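(* Let $m\ge3$ and let $\mathcal L_m$ be the $\mathcal O_{s_m}$-module generated by the representation vector fields $\xi_X$, $X\in\mathfrak g_m$, together with the vector fields $\eta_k$, $2\le k\le m-2$. Then $\mathcal L_m$ is a solvable holomorphic Lie algebra. In addition, it is a free $\mathcal O_{s_m}$-module of rank $s_m$, and it defines a free divisor on $\mathrm{Sk}_m(\mathbb C)$ given by the equation $$\prod_{k=1}^{m-2}\det\big(\hat{\hat A}^{(k)}\big)\cdot\prod_{k=2}^{m}\mathrm{Pf}_{\{\epsilon(k),\dots,k\}}(A)=0.$$
   Context: $\mathrm{Sk}_m(\mathbb C)$ is the space of complex skew-symmetric $m\times m$ matrices $A=(a_{ij})$, with coordinates $a_{ij}$, $i<j$; $s_m=\binom m2$, and $\mathcal O_{s_m}$ is the ring of germs at $0$ of holomorphic functions on $\mathrm{Sk}_m(\mathbb C)$. Let $G_m$ be the group of matrices $\begin{pmatrix}T&0\\0&B\end{pmatrix}$ with $T$ an invertible $2\times2$ diagonal matrix and $B$ an invertible lower triangular $(m-2)\times(m-2)$ matrix, acting on $\mathrm{Sk}_m(\mathbb C)$ by $M\cdot A=MAM^T$; its Lie algebra is $\mathfrak g_m$, and for $X\in\mathfrak g_m$ the representation vector field is $\xi_X(A)=XA+AX^T$. For $S\subseteq\{1,\dots,m\}$, $\mathrm{Pf}_S(A)$ is the Pfaffian of the submatrix of $A$ with rows and columns indexed by $S$. For $i\in\{2,\dots,m\}$, $\epsilon(i)\in\{1,2\}$ is chosen with parity opposite to $i$. $\bar e_{p,q}=E_{p,q}-E_{q,p}$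 ($E_{p,q}$ the elementary matrix), viewed as the constant vector field $\partial/\partial a_{pq}$. For $2\le k\le m-2$, $$\eta_k(A)=\sum_{k<p<q\le m}\mathrm{Pf}_{\{\epsilon(k),\dots,k,p,q\}}(A)\,\bar e_{p,q}.$$ $\hat{\hat A}$ is $A$ with its first two columns deleted and $\hat{\hat A}^{(k)}$ its upper left $k\times k$ submatrix. A holomorphic Lie algebra is a finitely generated $\mathcal O_{s_m}$-module of germs of holomorphic vector fields closed under Lie bracket. A free divisor is a reduced hypersurface germ whose module of logarithmic vector fields (holomorphic vector fields preserving its ideal) is a free module; "$\mathcal L_m$ defines a free divisor" means the hypersurface is a free divisor whose module of logarithmic vector fields is $\mathcal L_m$. *)

theory Defs
  imports Complex_Main "HOL-Analysis.Derivative" "HOL-Analysis.Infinite_Sum" "HOL-Combinatorics.Permutations"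
begin

text \<open>A point of Sk_m(C) is given by its coordinates a_ij, i<j; we represent it as a
  function on index pairs, only the pairs in coords m being relevant.\<close>

type_synonym pt = "nat \<times> nat \<Rightarrow> complex"
type_synonym vfield = "pt \<Rightarrow> pt"

definition coords :: "nat \<Rightarrow> (nat \<times> nat) set" where
  "coords m = {(i, j). 1 \<le> i \<and> i < j \<and> j \<le> m}"

definition matA :: "pt \<Rightarrow> nat \<Rightarrow> nat \<Rightarrow> complex" where
  "matA a i j = (if i < j then a (i, j) else if j < i then - a (j, i) else 0)"

definition near0 :: "nat \<Rightarrow> (pt \<Rightarrow> bool) \<Rightarrow> bool" where
  "near0 m P \<longleftrightarrow> (\<exists>r>0. \<forall>a. (\<forall>p\<in>coords m. norm (a p) < r) \<longrightarrow> P a)"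

definition holo_germ :: "nat \<Rightarrow> (pt \<Rightarrow> complex) \<Rightarrow> bool" where
  "holo_germ m f \<longleftrightarrow> (\<exists>c :: (nat \<times> nat \<Rightarrow> nat) \<Rightarrow> complex.
     near0 m (\<lambda>a. ((\<lambda>\<alpha>. c \<alpha> * (\<Prod>p\<in>coords m. a p ^ \<alpha> p)) has_sum f a)
                    {\<alpha>. \<forall>p. p \<notin> coords m \<longrightarrow> \<alpha> p = 0}))"

definition holo_field :: "nat \<Rightarrow> vfield \<Rightarrow> bool" where
  "holo_field m V \<longleftrightarrow> (\<forall>p\<in>coords m. holo_germ m (\<lambda>a. V a p))"

definition field_eq :: "nat \<Rightarrow> vfield \<Rightarrow> vfield \<Rightarrow> bool" where
  "field_eq m V W \<longleftrightarrow> near0 m (\<lambda>a. \<forall>p\<in>coords m. V a p = W a p)"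

definition pdiff :: "nat \<times> nat \<Rightarrow> (pt \<Rightarrow> complex) \<Rightarrow> pt \<Rightarrow> complex" where
  "pdiff p f a = deriv (\<lambda>t. f (a(p := t))) (a p)"

definition vf_app :: "nat \<Rightarrow> vfield \<Rightarrow> (pt \<Rightarrow> complex) \<Rightarrow> pt \<Rightarrow> complex" where
  "vf_app m V f a = (\<Sum>p\<in>coords m. V a p * pdiff p f a)"

definition lie_bracket :: "nat \<Rightarrow> vfield \<Rightarrow> vfield \<Rightarrow> vfield" where
  "lie_bracket m V W = (\<lambda>a q. vf_app m V (\<lambda>b. W b q) a - vf_app m W (\<lambda>b. V b q) a)"

definition gen_by :: "nat \<Rightarrow> vfield set \<Rightarrow> vfield set" where
  "gen_by m G = {v. \<exists>S h. finite S \<and> S \<subseteq> G \<and> (\<forall>\<zeta>\<in>S. holo_germ m (h \<zeta>)) \<and>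
       field_eq m v (\<lambda>a q. \<Sum>\<zeta>\<in>S. h \<zeta> a * \<zeta> a q)}"

definition holo_lie_alg :: "nat \<Rightarrow> vfield set \<Rightarrow> bool" where
  "holo_lie_alg m L \<longleftrightarrow>
     (\<exists>F. finite F \<and> (\<forall>v\<in>F. holo_field m v) \<and> L = gen_by m F) \<and>
     (\<forall>v\<in>L. \<forall>w\<in>L. lie_bracket m v w \<in> L)"

definition max_ideal_mult :: "nat \<Rightarrow> vfield set \<Rightarrow> vfield set" where
  "max_ideal_mult m L = {v. \<exists>S h. finite S \<and> S \<subseteq> L \<and>
       (\<forall>\<zeta>\<in>S. holo_germ m (h \<zeta>) \<and> h \<zeta> (\<lambda>_. 0) = 0) \<and>
       field_eq m v (\<lambda>a q. \<Sum>\<zeta>\<in>S. h \<zeta> a * \<zeta> a q)}"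

fun derived :: "nat \<Rightarrow> vfield set \<Rightarrow> nat \<Rightarrow> vfield set" where
  "derived m L 0 = L"
| "derived m L (Suc k) =
     gen_by m {lie_bracket m v w | v w. v \<in> derived m L k \<and> w \<in> derived m L k}"

definition solvable_hla :: "nat \<Rightarrow> vfield set \<Rightarrow> bool" where
  "solvable_hla m L \<longleftrightarrow> holo_lie_alg m L \<and> (\<exists>N. derived m L N \<subseteq> max_ideal_mult m L)"

definition free_of_rank :: "nat \<Rightarrow> vfield set \<Rightarrow> nat \<Rightarrow> bool" where
  "free_of_rank m L s \<longleftrightarrow> (\<exists>b :: nat \<Rightarrow> vfield.
     (\<forall>i<s. holo_field m (b i)) \<and> L = gen_by m (b ` {..<s}) \<and>
     (\<forall>h. (\<forall>i<s. holo_germ m (h i)) \<and>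
          field_eq m (\<lambda>a q. \<Sum>i<s. h i a * b i a q) (\<lambda>a q. 0)
          \<longrightarrow> (\<forall>i<s. near0 m (\<lambda>a. h i a = 0))))"

definition vanish_ideal :: "nat \<Rightarrow> (pt \<Rightarrow> complex) \<Rightarrow> (pt \<Rightarrow> complex) set" where
  "vanish_ideal m h = {g. holo_germ m g \<and> near0 m (\<lambda>a. h a = 0 \<longrightarrow> g a = 0)}"

definition principal_ideal :: "nat \<Rightarrow> (pt \<Rightarrow> complex) \<Rightarrow> (pt \<Rightarrow> complex) set" where
  "principal_ideal m h = {g. holo_germ m g \<and>
       (\<exists>u. holo_germ m u \<and> near0 m (\<lambda>a. g a = u a * h a))}"

definition derlog :: "nat \<Rightarrow> (pt \<Rightarrow> complex) \<Rightarrow> vfield set" where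
  "derlog m h = {v. holo_field m v \<and>
       (\<forall>g\<in>vanish_ideal m h. vf_app m v g \<in> vanish_ideal m h)}"

text \<open>The reduced hypersurface germ {h = 0} (h a non-zero, non-unit germ generating the
  ideal of its zero set) is a free divisor whose module of logarithmic vector fields is L.\<close>
definition defines_free_divisor :: "nat \<Rightarrow> vfield set \<Rightarrow> (pt \<Rightarrow> complex) \<Rightarrow> bool" where
  "defines_free_divisor m L h \<longleftrightarrow>
     holo_germ m h \<and> h (\<lambda>_. 0) = 0 \<and> \<not> near0 m (\<lambda>a. h a = 0) \<and>
     vanish_ideal m h = principal_ideal m h \<and>
     derlog m h = L \<and> (\<exists>s. free_of_rank m L s)"

text \<open>Pfaffian of the principal submatrix of M on the (sorted) index list, by expansion along
  the first row: Pf = sum_j (-1)^j a_{1j} Pf(removing 1, j).\<close>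
function pf :: "(nat \<Rightarrow> nat \<Rightarrow> complex) \<Rightarrow> nat list \<Rightarrow> complex" where
  "pf M [] = 1"
| "pf M (i # xs) =
     (\<Sum>t<length xs. (-1) ^ t * M i (xs ! t) * pf M (take t xs @ drop (Suc t) xs))"
  by pat_completeness auto
termination
  by (relation "measure (\<lambda>(M, xs). length xs)") auto

definition PfS :: "pt \<Rightarrow> nat set \<Rightarrow> complex" where
  "PfS a S = pf (matA a) (sorted_list_of_set S)"

definition detk :: "nat \<Rightarrow> (nat \<Rightarrow> nat \<Rightarrow> complex) \<Rightarrow> complex" where
  "detk k M = (\<Sum>p | p permutes {1..k}. of_int (sign p) * (\<Prod>i=1..k. M i (p i)))"

definition eps :: "nat \<Rightarrow> nat" where
  "eps i = (if even i then 1 else 2)"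

text \<open>Lie algebra g_m: diag 2x2 block plus lower triangular (m-2)x(m-2) block.\<close>
definition g_alg :: "nat \<Rightarrow> (nat \<Rightarrow> nat \<Rightarrow> complex) set" where
  "g_alg m = {X. \<forall>i j. X i j \<noteq> 0 \<longrightarrow> 1 \<le> j \<and> j \<le> i \<and> i \<le> m \<and> (j \<le> 2 \<longrightarrow> i = j)}"

text \<open>Representation vector field xi_X(A) = X A + A X^T.\<close>
definition xi :: "nat \<Rightarrow> (nat \<Rightarrow> nat \<Rightarrow> complex) \<Rightarrow> vfield" where
  "xi m X = (\<lambda>a pq. case pq of (p, q) \<Rightarrow>
      (\<Sum>k=1..m. X p k * matA a k q + matA a p k * X q k))"

definition eta :: "nat \<Rightarrow> nat \<Rightarrow> vfield" where
  "eta m k = (\<lambda>a pq. case pq of (p, q) \<Rightarrow>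
      (if k < p \<and> p < q \<and> q \<le> m then PfS a ({eps k..k} \<union> {p, q}) else 0))"

definition Lm :: "nat \<Rightarrow> vfield set" where
  "Lm m = gen_by m (xi m ` g_alg m \<union> eta m ` {2..m-2})"

definition hdiv :: "nat \<Rightarrow> pt \<Rightarrow> complex" where
  "hdiv m a = (\<Prod>k=1..m-2. detk k (\<lambda>i j. matA a i (j + 2))) *
              (\<Prod>k=2..m. PfS a {eps k..k})"

end

(* Restricting to lines through a generic direction e, division by the factors of the equation is a
   one-variable problem: every factor f is affine in some coordinate with leading coefficient another
   factor, and the factors are pairwise coprime. Hence a germ g vanishing on {f = 0} off the other
   factors has g / f bounded on circles around a, and a contour integral of (g / f)(a + t e) / t over
   such a circle gives a holomorphic quotient. So the vanishing ideal is principal, and a field is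
   logarithmic iff it is logarithmic along each factor. The 2 eta_k are representation fields of
   matrices with Pfaffian entries, so Pfaffian exchange identities show the generators to be
   logarithmic. Conversely, a logarithmic field is reduced to zero column by column: for columns
   2 and 3 by the diagonal fields, for column i >= 4 by the xi of E_ij (Cramer's rule with the
   determinant of size i - 2), leaving an entry divisible by the Pfaffian of {eps(i), ..., i} that
   eta_{i-2} removes. The same triangular structure gives independence, and logarithmic fields
   are closed under brackets. Solvability comes from a grading by dilations in which only the
   (commuting) diagonal fields have weight 0. *)
theory Submission
  imports Defs "HOL-Complex_Analysis.Complex_Analysis" "Jordan_Normal_Form.Determinant"
begin

section \<open>Germs of holomorphic functions\<close>

text \<open>The obstacle is where two components meet: there, vanishing of g on one of them says
  nothing about the quotient of g by its equation. Coprimality is therefore used quantitatively.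
  Lines avoiding such intersections inside a fixed disc are dense among the parallels to e; the
  quotient is bounded on each of them, and g = u f passes to all other points by continuity. So a
  division asks for zeros of g only off the other factors, and the same statement serves for the
  ideal, for a field along a single factor and for the elimination. Freeness and the equality with
  the logarithmic fields come from the elimination, not from a determinant of coefficients. The
  counts fit: columns 2 and 3 have three entries and three diagonal fields; column i >= 4 has i - 1
  entries, met by the i - 2 fields of E_ij with 3 <= j <= i and by eta_{i-2}. For solvability only
  the values at 0 of the structure functions matter. A nonzero value forces weights to add, and a
  bracket of two diagonal fields is zero, so each derived step raises by one the least weight of a
  generator whose coefficient may be nonzero at 0. The weights are finitely many, so this
  ends.\<close>

lemma difference_quotient_bound:
  assumes hol: "f holomorphic_on ball z r" and bd: "\<And>w. w \<in> ball z r \<Longrightarrow> norm (f w) \<le> M"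
    and h: "h \<noteq> 0" "norm h < r / 2"
  shows "norm ((f (z + h) - f z) / h - deriv f z) \<le> 32 * M / r ^ 2 * norm (h :: complex)"
proof -
  have r: "r > 0" using h norm_ge_zero[of h] by linarith
  have sub: "cball x (r/4) \<subseteq> ball z r" if "x \<in> ball z (r/2)" for x
  proof
    fix y assume "y \<in> cball x (r/4)"
    then have "dist z y \<le> dist z x + dist x y" "dist x y \<le> r/4" by (auto simp: dist_triangle)
    with that r show "y \<in> ball z r" by auto
  qed
  \<comment> \<open>First-order Taylor formula on the ball of radius r/2. Circles of radius r/4
    around its points stay inside the large ball, so Cauchy bounds the second derivative by 2 M /
    (r/4)^2 = 32 M / r^2.\<close>
  have "norm ((deriv ^^ 0) f (z+h) - (\<Sum>i\<le>1. (deriv ^^ i) f z * (z + h - z) ^ i / fact i))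
      \<le> (32 * M / r ^ 2) * norm (z + h - z) ^ Suc 1 / fact 1"
  proof (rule complex_Taylor[where S = "ball z (r/2)" and f = "\<lambda>i. (deriv ^^ i) f"])
    fix i x assume "x \<in> ball z (r/2)" "i \<le> (1::nat)"
    then have x: "x \<in> ball z r" using r by auto
    have "(deriv ^^ i) f holomorphic_on ball z r" using hol by (intro holomorphic_higher_deriv) auto
    then have "((deriv ^^ i) f has_field_derivative deriv ((deriv ^^ i) f) x) (at x)"
      using x holomorphic_derivI by blast
    then show "((deriv ^^ i) f has_field_derivative (deriv ^^ Suc i) f x) (at x within ball z (r/2))"
      by (auto intro: has_field_derivative_at_within)
  next
    fix x assume x: "x \<in> ball z (r/2)"
    have "norm ((deriv ^^ 2) f x) \<le> fact 2 * M / (r/4)^2"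
    proof (rule Cauchy_inequality)
      show "f holomorphic_on ball x (r/4)" "continuous_on (cball x (r/4)) f"
        using sub[OF x] hol holomorphic_on_subset ball_subset_cball
        by (blast intro: holomorphic_on_imp_continuous_on)+
      show "norm (f y) \<le> M" if "norm (x - y) = r/4" for y
        using sub[OF x] that by (intro bd) (auto simp: dist_norm)
    qed (use r in auto)
    then show "norm ((deriv ^^ Suc 1) f x) \<le> 32 * M / r ^ 2"
      by (simp add: numeral_2_eq_2 power2_eq_square)
  qed (use h r in \<open>auto simp: dist_norm\<close>)
  then have "norm (f (z+h) - f z - deriv f z * h) \<le> 32 * M / r ^ 2 * norm h ^ 2"
    by (simp add: numeral_2_eq_2 algebra_simps)
  moreover have "(f (z + h) - f z) / h - deriv f z = (f (z+h) - f z - deriv f z * h) / h"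
    using h by (simp add: field_simps)
  ultimately have "norm ((f (z + h) - f z) / h - deriv f z) \<le> 32 * M / r ^ 2 * norm h ^ 2 / norm h"
    by (simp only: norm_divide) (rule divide_right_mono, auto)
  then show ?thesis using h by (simp add: power2_eq_square)
qed

section \<open>Derivatives of functions that depend holomorphically on a parameter\<close>

lemma deriv_param:
  fixes \<phi> :: "complex \<Rightarrow> complex \<Rightarrow> complex"
  assumes S: "open S" and r: "r > 0"
    and h1: "\<And>s. s \<in> S \<Longrightarrow> \<phi> s holomorphic_on ball z r"
    and h2: "\<And>w. w \<in> ball z r \<Longrightarrow> (\<lambda>s. \<phi> s w) holomorphic_on S"
    and bd: "\<And>s w. s \<in> S \<Longrightarrow> w \<in> ball z r \<Longrightarrow> norm (\<phi> s w) \<le> M"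
  shows deriv_param_holomorphic: "(\<lambda>s. deriv (\<phi> s) z) holomorphic_on S"
    and deriv_param_limit: "s \<in> S \<Longrightarrow>
        (\<lambda>n. (deriv (\<lambda>s. \<phi> s (z + of_real (r / (2 * (real n + 2))))) s - deriv (\<lambda>s. \<phi> s z) s)
           / of_real (r / (2 * (real n + 2)))) \<longlonglongrightarrow> deriv (\<lambda>s. deriv (\<phi> s) z) s"
proof -
  \<comment> \<open>The shift by 2 keeps every step, also for n = 0, strictly below r/2, as the
    bound on difference quotients requires.\<close>
  define h where "h n = complex_of_real (r / (2 * (real n + 2)))" for n :: nat
  have hn0: "h n \<noteq> 0" for n using r unfolding h_def by (simp only: of_real_eq_0_iff) simp
  have nh: "norm (h n) = r / (2 * (real n + 2))" for n unfolding h_def norm_of_real using r by simp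
  have hn1: "norm (h n) < r / 2" for n unfolding nh by (rule divide_strict_left_mono) (use r in auto)
  have zin: "z + h n \<in> ball z r" for n using hn1[of n] r by (simp add: dist_norm)
  have z: "z \<in> ball z r" using r by simp
  define F where "F n s = (\<phi> s (z + h n) - \<phi> s z) / h n" for n s
  have Fh: "F n holomorphic_on S" for n unfolding F_def
    using hn0 by (intro holomorphic_intros h2 zin z) auto
  have lim0: "(\<lambda>n. 32 * M / r ^ 2 * norm (h n)) \<longlonglongrightarrow> 0"
  proof -
    have "(\<lambda>n. r / 2 * (1 / (real n + 2))) \<longlonglongrightarrow> r / 2 * 0"
      by (intro tendsto_mult tendsto_const) real_asymp
    then have "(\<lambda>n. 32 * M / r ^ 2 * (r / 2 * (1 / (real n + 2)))) \<longlonglongrightarrow> 32 * M / r ^ 2 * 0"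
      by (intro tendsto_mult tendsto_const) simp
    then show ?thesis unfolding nh by (simp add: algebra_simps)
  qed
  \<comment> \<open>The bound on difference quotients does not depend on s. So the limit is uniform
    on S, which gives holomorphy of the limit and convergence of the derivatives in s at
    once.\<close>
  have ul: "uniform_limit S F (\<lambda>s. deriv (\<phi> s) z) sequentially"
  proof (rule uniform_limitI)
    fix e :: real assume "e > 0"
    then have "\<forall>\<^sub>F n in sequentially. 32 * M / r ^ 2 * norm (h n) < e"
      using order_tendstoD(2)[OF lim0] by simp
    then show "\<forall>\<^sub>F n in sequentially. \<forall>s\<in>S. dist (F n s) (deriv (\<phi> s) z) < e"
    proof eventually_elim
      case (elim n)
      show ?case
      proof
        fix s assume "s \<in> S"
        then have "norm (F n s - deriv (\<phi> s) z) \<le> 32 * M / r ^ 2 * norm (h n)"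
          unfolding F_def by (intro difference_quotient_bound h1 bd hn0 hn1)
        then show "dist (F n s) (deriv (\<phi> s) z) < e" using elim by (simp add: dist_norm)
      qed
    qed
  qed
  have ul': "\<exists>d>0. cball x d \<subseteq> S \<and> uniform_limit (cball x d) F (\<lambda>s. deriv (\<phi> s) z) sequentially"
    if "x \<in> S" for x
    using ul S that by (meson open_contains_cball uniform_limit_on_subset)
  show hol: "(\<lambda>s. deriv (\<phi> s) z) holomorphic_on S"
    by (rule holomorphic_uniform_sequence[where f = F, OF S Fh]) (rule ul')
  show "(\<lambda>n. (deriv (\<lambda>s. \<phi> s (z + of_real (r / (2 * (real n + 2))))) s - deriv (\<lambda>s. \<phi> s z) s)
           / of_real (r / (2 * (real n + 2)))) \<longlonglongrightarrow> deriv (\<lambda>s. deriv (\<phi> s) z) s" if s: "s \<in> S"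
  proof -
    have Fd: "(F n has_field_derivative (deriv (\<lambda>s. \<phi> s (z + h n)) x - deriv (\<lambda>s. \<phi> s z) x) / h n) (at x)"
      if "x \<in> S" for n x
      unfolding F_def
      by (intro DERIV_cdivide DERIV_diff holomorphic_derivI[OF h2 S that] zin z)
    obtain g' where g': "\<forall>x\<in>S. ((\<lambda>s. deriv (\<phi> s) z) has_field_derivative g' x) (at x) \<and>
        (\<lambda>n. (deriv (\<lambda>s. \<phi> s (z + h n)) x - deriv (\<lambda>s. \<phi> s z) x) / h n) \<longlonglongrightarrow> g' x"
      using has_complex_derivative_uniform_sequence[where f = F and S = S and g = "\<lambda>s. deriv (\<phi> s) z"
          and f' = "\<lambda>n x. (deriv (\<lambda>s. \<phi> s (z + h n)) x - deriv (\<lambda>s. \<phi> s z) x) / h n", OF S] Fd ul'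
      by blast
    have "((\<lambda>s. deriv (\<phi> s) z) has_field_derivative g' s) (at s)" using g' s by blast
    then have eq: "deriv (\<lambda>s. deriv (\<phi> s) z) s = g' s" by (rule DERIV_imp_deriv)
    have "(\<lambda>n. (deriv (\<lambda>s. \<phi> s (z + h n)) s - deriv (\<lambda>s. \<phi> s z) s) / h n) \<longlonglongrightarrow> g' s"
      using g' s by blast
    then show ?thesis unfolding eq h_def .
  qed
qed

text \<open>Both iterated derivatives are limits of one sequence of difference quotients of w ->
  d/ds phi s w: by definition for one order, by \<open>deriv_param_limit\<close> for the
  other.\<close>

lemma deriv_param_commute:
  fixes \<phi> :: "complex \<Rightarrow> complex \<Rightarrow> complex"
  assumes r: "r > 0"
    and h1: "\<And>s. s \<in> ball x r \<Longrightarrow> \<phi> s holomorphic_on ball z r"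
    and h2: "\<And>w. w \<in> ball z r \<Longrightarrow> (\<lambda>s. \<phi> s w) holomorphic_on ball x r"
    and bd: "\<And>s w. s \<in> ball x r \<Longrightarrow> w \<in> ball z r \<Longrightarrow> norm (\<phi> s w) \<le> M"
  shows "deriv (\<lambda>s. deriv (\<phi> s) z) x = deriv (\<lambda>w. deriv (\<lambda>s. \<phi> s w) x) z"
proof -
  define D where "D w = deriv (\<lambda>s. \<phi> s w) x" for w
  have "D holomorphic_on ball z r" unfolding D_def
    by (rule deriv_param_holomorphic[where r = r and M = M and \<phi> = "\<lambda>w s. \<phi> s w"])
       (use assms in auto)
  then have "(D has_field_derivative deriv D z) (at z)" using r by (intro holomorphic_derivI) auto
  then have "((\<lambda>h. (D (z + h) - D z) / h) \<longlongrightarrow> deriv D z) (at 0)"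
    by (simp add: DERIV_def)
  moreover have "filterlim (\<lambda>n. complex_of_real (r / (2 * (real n + 2)))) (at 0) sequentially"
  proof -
    have *: "(\<lambda>n. r / (2 * (real n + 2))) \<longlonglongrightarrow> 0"
    proof -
      have "(\<lambda>n. r / 2 * (1 / (real n + 2))) \<longlonglongrightarrow> r / 2 * 0"
        by (intro tendsto_mult tendsto_const) real_asymp
      then show ?thesis by (simp add: algebra_simps)
    qed
    have hne: "complex_of_real (r / (2 * (real n + 2))) \<noteq> 0" for n
      using r by (simp only: of_real_eq_0_iff divide_eq_0_iff) auto
    show ?thesis unfolding filterlim_at
    proof
      show "\<forall>\<^sub>F n in sequentially. complex_of_real (r / (2 * (real n + 2))) \<in> UNIV \<and> complex_of_real (r / (2 * (real n + 2))) \<noteq> 0"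
        by (intro always_eventually allI) (use hne in blast)
      show "(\<lambda>n. complex_of_real (r / (2 * (real n + 2)))) \<longlonglongrightarrow> 0"
        using tendsto_of_real[OF *, where 'a=complex] by (simp only: of_real_0)
    qed
  qed
  ultimately have "(\<lambda>n. (D (z + of_real (r / (2 * (real n + 2)))) - D z) / of_real (r / (2 * (real n + 2)))) \<longlonglongrightarrow> deriv D z"
    by (rule filterlim_compose)
  moreover have "(\<lambda>n. (D (z + of_real (r / (2 * (real n + 2)))) - D z) / of_real (r / (2 * (real n + 2)))) \<longlonglongrightarrow> deriv (\<lambda>s. deriv (\<phi> s) z) x"
    unfolding D_def by (rule deriv_param_limit[where M = M and S = "ball x r"]) (use assms in auto)
  ultimately show ?thesis unfolding D_def by (rule LIMSEQ_unique[rotated])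
qed

text \<open>Induction on n with phi replaced by its derivative on the disc of half the radius, where
  Cauchy's inequality on circles of radius r/4 supplies the new bound 4 M / r.\<close>

lemma higher_deriv_param_holomorphic:
  fixes \<phi> :: "complex \<Rightarrow> complex \<Rightarrow> complex"
  assumes "open S" "r > 0"
    and "\<And>s. s \<in> S \<Longrightarrow> \<phi> s holomorphic_on ball z r"
    and "\<And>w. w \<in> ball z r \<Longrightarrow> (\<lambda>s. \<phi> s w) holomorphic_on S"
    and "\<And>s w. s \<in> S \<Longrightarrow> w \<in> ball z r \<Longrightarrow> norm (\<phi> s w) \<le> M"
  shows "(\<lambda>s. (deriv ^^ n) (\<phi> s) z) holomorphic_on S"
  using assms(2-)
proof (induction n arbitrary: \<phi> r M)
  case 0
  then show ?case by auto
next
  case (Suc n)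
  have sub: "ball w (r/2) \<subseteq> ball z r" "cball w (r/4) \<subseteq> ball z r" if "w \<in> ball z (r/2)" for w
    using that Suc.prems(1) by (auto simp: subset_eq intro: le_less_trans[OF dist_triangle[of z _ w]])
  have "(\<lambda>s. (deriv ^^ n) (deriv (\<phi> s)) z) holomorphic_on S"
  proof (rule Suc.IH[where r = "r/2" and M = "4 * M / r"])
    show "deriv (\<phi> s) holomorphic_on ball z (r/2)" if "s \<in> S" for s
    proof -
      have "deriv (\<phi> s) holomorphic_on ball z r" using Suc.prems(2)[OF that] by (intro holomorphic_deriv) auto
      then show ?thesis by (rule holomorphic_on_subset) (use Suc.prems(1) in auto)
    qed
    show "(\<lambda>s. deriv (\<phi> s) w) holomorphic_on S" if "w \<in> ball z (r/2)" for w
      by (rule deriv_param_holomorphic[where r = "r/2" and M = M])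
         (use Suc.prems sub[OF that] assms(1) in \<open>auto intro: holomorphic_on_subset\<close>)
    show "norm (deriv (\<phi> s) w) \<le> 4 * M / r" if "s \<in> S" "w \<in> ball z (r/2)" for s w
    proof -
      have "norm ((deriv ^^ 1) (\<phi> s) w) \<le> fact 1 * M / (r/4)^1"
      proof (rule Cauchy_inequality)
        have *: "\<phi> s holomorphic_on cball w (r/4)"
          using Suc.prems(2)[OF that(1)] sub[OF that(2)] by (blast intro: holomorphic_on_subset)
        then show "\<phi> s holomorphic_on ball w (r/4)" "continuous_on (cball w (r/4)) (\<phi> s)"
          using ball_subset_cball by (blast intro: holomorphic_on_imp_continuous_on holomorphic_on_subset)+
        show "norm (\<phi> s y) \<le> M" if "norm (w - y) = r/4" for y
          using sub[OF \<open>w \<in> _\<close>] that by (intro Suc.prems \<open>s \<in> S\<close>) (auto simp: dist_norm)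
      qed (use Suc.prems in auto)
      then show ?thesis by (simp add: mult.commute)
    qed
  qed (use Suc.prems in auto)
  then show ?case by (simp add: funpow_Suc_right del: funpow.simps)
qed

section \<open>Polydiscs and power series of separately holomorphic functions\<close>

definition polydisc :: "'i set \<Rightarrow> real \<Rightarrow> ('i \<Rightarrow> complex) set" where
  "polydisc C r = {a. \<forall>p\<in>C. norm (a p) < r}"

definition exponents :: "'i set \<Rightarrow> ('i \<Rightarrow> nat) set" where
  "exponents C = {\<alpha>. \<forall>p. p \<notin> C \<longrightarrow> \<alpha> p = 0}"

lemma polydisc_upd: "a \<in> polydisc C r \<Longrightarrow> norm t < r \<Longrightarrow> a(p := t) \<in> polydisc C r"
  by (auto simp: polydisc_def)

lemma polydisc_insert_upd:
  "a \<in> polydisc C r \<Longrightarrow> norm t < r \<Longrightarrow> a(p := t) \<in> polydisc (insert p C) r"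
  by (auto simp: polydisc_def)

lemma polydisc_mono: "a \<in> polydisc C r \<Longrightarrow> r \<le> s \<Longrightarrow> a \<in> polydisc C s"
  by (auto simp: polydisc_def intro: less_le_trans)

lemma exponents_insert_has_sum:
  assumes "p \<notin> C"
  shows "(f has_sum s) (exponents (insert p C)) \<longleftrightarrow>
    ((\<lambda>(n, \<alpha>). f (\<alpha>(p := n))) has_sum s) (UNIV \<times> exponents C)"
  by (rule has_sum_reindex_bij_witness[where i = "\<lambda>(n, \<alpha>). \<alpha>(p := n)" and j = "\<lambda>\<beta>. (\<beta> p, \<beta>(p := 0))"])
     (use assms in \<open>auto simp: exponents_def fun_eq_iff split: prod.splits if_splits\<close>)

lemma summable_monomials:
  fixes x :: "'i \<Rightarrow> real"
  assumes "finite C" "\<And>p. p \<in> C \<Longrightarrow> 0 \<le> x p \<and> x p < 1"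
  shows "(\<lambda>\<alpha>. \<Prod>p\<in>C. x p ^ \<alpha> p) summable_on exponents C"
  using assms
proof (induction C rule: finite_induct)
  case empty
  have "exponents {} = {\<lambda>_. 0 :: nat}" by (auto simp: exponents_def)
  then show ?case by (metis finite.emptyI finite_insert summable_on_finite)
next
  case (insert p C)
  then obtain S where S: "((\<lambda>\<alpha>. \<Prod>q\<in>C. x q ^ \<alpha> q) has_sum S) (exponents C)"
    by (auto simp: summable_on_def)
  have g: "(\<lambda>n. S * x p ^ n) summable_on (UNIV :: nat set)"
    using insert.prems by (intro summable_on_cmult_right summable_nonneg_imp_summable_on summable_geometric) auto
  have "(\<lambda>(n, \<alpha>). x p ^ n * (\<Prod>q\<in>C. x q ^ \<alpha> q)) summable_on (UNIV \<times> exponents C)"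
  proof (rule summable_on_SigmaI)
    show "((\<lambda>y. case (n, y) of (n, \<alpha>) \<Rightarrow> x p ^ n * (\<Prod>q\<in>C. x q ^ \<alpha> q)) has_sum S * x p ^ n) (exponents C)" for n
      using has_sum_cmult_right[OF S, of "x p ^ n"] by (simp add: mult.commute)
  qed (use insert.prems g in \<open>auto intro!: mult_nonneg_nonneg prod_nonneg\<close>)
  moreover have "(\<Prod>q\<in>insert p C. x q ^ (\<alpha>(p := n)) q) = x p ^ n * (\<Prod>q\<in>C. x q ^ \<alpha> q)" for n \<alpha>
  proof -
    have "(\<Prod>q\<in>C. x q ^ (\<alpha>(p := n)) q) = (\<Prod>q\<in>C. x q ^ \<alpha> q)"
      using insert.hyps(2) by (intro prod.cong refl) (metis fun_upd_other)
    then show ?thesis using insert.hyps by simp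
  qed
  ultimately show ?case
    unfolding summable_on_def exponents_insert_has_sum[OF insert.hyps(2)] by simp
qed

text \<open>The bound M is explicit because the coefficient estimates are carried through an
  induction on C. The middle clause is there because a point is a function on all indices, while
  only those in C are coordinates.\<close>

definition sep_holo :: "'i set \<Rightarrow> real \<Rightarrow> real \<Rightarrow> (('i \<Rightarrow> complex) \<Rightarrow> complex) \<Rightarrow> bool" where
  "sep_holo C r M f \<longleftrightarrow> (\<forall>a\<in>polydisc C r. norm (f a) \<le> M) \<and>
     (\<forall>a\<in>polydisc C r. \<forall>b. (\<forall>p\<in>C. b p = a p) \<longrightarrow> f b = f a) \<and>
     (\<forall>a\<in>polydisc C r. \<forall>p\<in>C. (\<lambda>t. f (a(p := t))) holomorphic_on ball 0 r)"

lemma sep_holoD: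
  assumes "sep_holo C r M f" "a \<in> polydisc C r"
  shows "norm (f a) \<le> M" "(\<And>p. p \<in> C \<Longrightarrow> b p = a p) \<Longrightarrow> f b = f a"
    "p \<in> C \<Longrightarrow> (\<lambda>t. f (a(p := t))) holomorphic_on ball 0 r"
  using assms unfolding sep_holo_def by blast+

text \<open>The induction step of the power series theorem: the Taylor coefficients in one variable
  are functions of the same kind in the others, and Cauchy's inequality on the circle of radius r/2
  gives their bound.\<close>

lemma sep_holo_coefficient:
  assumes f: "sep_holo (insert p C) r M f" and r: "r > 0" and p: "p \<notin> C"
  shows "sep_holo C r (M * (2 / r) ^ n) (\<lambda>a. (deriv ^^ n) (\<lambda>t. f (a(p := t))) 0 / fact n)"
proof -
  have bd: "norm (f a) \<le> M" if "a \<in> polydisc (insert p C) r" for a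
    using sep_holoD(1)[OF f that] .
  have slice: "(\<lambda>t. f (a(p := t))) holomorphic_on ball 0 r" if "a \<in> polydisc C r" for a
  proof -
    have "(\<lambda>t. f ((a(p := 0))(p := t))) holomorphic_on ball 0 r"
      by (rule sep_holoD(3)[OF f polydisc_insert_upd[OF that]]) (use r in auto)
    then show ?thesis by simp
  qed
  show ?thesis
    unfolding sep_holo_def
  proof (intro conjI ballI allI impI)
    fix a :: "'a \<Rightarrow> complex" assume a: "a \<in> polydisc C r"
    have "norm ((deriv ^^ n) (\<lambda>t. f (a(p := t))) 0) \<le> fact n * M / (r/2) ^ n"
    proof (rule Cauchy_inequality)
      show "(\<lambda>t. f (a(p := t))) holomorphic_on ball 0 (r/2)"
        by (rule holomorphic_on_subset[OF slice[OF a]]) (use r in auto)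
      show "continuous_on (cball 0 (r/2)) (\<lambda>t. f (a(p := t)))"
        by (rule holomorphic_on_imp_continuous_on, rule holomorphic_on_subset[OF slice[OF a]]) (use r in auto)
      show "norm (f (a(p := x))) \<le> M" if "norm (0 - x) = r/2" for x
        using that r by (intro bd polydisc_insert_upd a) auto
    qed (use r in auto)
    then have "norm ((deriv ^^ n) (\<lambda>t. f (a(p := t))) 0) / fact n \<le> M / (r/2) ^ n"
      by (simp add: field_simps)
    then show "norm ((deriv ^^ n) (\<lambda>t. f (a(p := t))) 0 / fact n) \<le> M * (2 / r) ^ n"
      using r by (simp add: norm_divide power_divide field_simps)
  next
    fix a b :: "'a \<Rightarrow> complex" assume a: "a \<in> polydisc C r" and b: "\<forall>q\<in>C. b q = a q"
    have "f (b(p := t)) = f (a(p := t))" if "t \<in> ball 0 r" for t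
    proof -
      have "a(p := t) \<in> polydisc (insert p C) r" using that by (intro polydisc_insert_upd a) auto
      moreover have "\<forall>q\<in>insert p C. (b(p := t)) q = (a(p := t)) q" using b by auto
      ultimately show ?thesis using f unfolding sep_holo_def by blast
    qed
    moreover have "\<forall>\<^sub>F t in nhds 0. t \<in> ball (0 :: complex) r" using r by (intro eventually_nhds_in_open) auto
    ultimately have "\<forall>\<^sub>F t in nhds 0. f (b(p := t)) = f (a(p := t))" by (auto elim: eventually_mono)
    then show "(deriv ^^ n) (\<lambda>t. f (b(p := t))) 0 / fact n = (deriv ^^ n) (\<lambda>t. f (a(p := t))) 0 / fact n"
      by (subst higher_deriv_cong_ev) auto
  next
    fix a :: "'a \<Rightarrow> complex" and q assume a: "a \<in> polydisc C r" and q: "q \<in> C"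
    then have pq: "p \<noteq> q" using p by auto
    have "(\<lambda>s. (deriv ^^ n) (\<lambda>t. f (a(q := s, p := t))) 0) holomorphic_on ball 0 r"
    proof (rule higher_deriv_param_holomorphic[where r = r and M = M])
      show "(\<lambda>t. f (a(q := s, p := t))) holomorphic_on ball 0 r" if "s \<in> ball 0 r" for s
        using that slice[OF polydisc_upd[OF a]] by auto
      show "(\<lambda>s. f (a(q := s, p := t))) holomorphic_on ball 0 r" if "t \<in> ball 0 r" for t
      proof -
        have "(\<lambda>s. f ((a(p := t))(q := s))) holomorphic_on ball 0 r"
          by (rule sep_holoD(3)[OF f polydisc_insert_upd[OF a]]) (use q that in auto)
        then show ?thesis by (subst fun_upd_twist[OF pq[symmetric]])
      qed
      show "norm (f (a(q := s, p := t))) \<le> M" if "s \<in> ball 0 r" "t \<in> ball 0 r" for s t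
        using that by (intro sep_holoD(1)[OF f] polydisc_insert_upd polydisc_upd a) auto
    qed (use r in auto)
    then show "(\<lambda>s. (deriv ^^ n) (\<lambda>t. f ((a(q := s))(p := t))) 0 / fact n) holomorphic_on ball 0 r"
      by (intro holomorphic_intros) auto
  qed
qed

text \<open>The bounded case of Hartogs' theorem (Osgood's lemma). One variable is expanded at a
  time; Cauchy's estimates make the family of all monomials absolutely summable on the half
  polydisc, so the iterated sums merge into one unordered sum.\<close>

theorem separately_holomorphic_power_series:
  assumes "finite C" "r > 0" "sep_holo C r M f"
  shows "\<exists>c. (\<forall>\<alpha>. norm (c \<alpha>) \<le> M * (\<Prod>p\<in>C. (2 / r) ^ \<alpha> p)) \<and>
     (\<forall>a\<in>polydisc C (r/2). ((\<lambda>\<alpha>. c \<alpha> * (\<Prod>p\<in>C. a p ^ \<alpha> p)) has_sum f a) (exponents C))"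
  using assms
proof (induction C arbitrary: M f rule: finite_induct)
  case empty
  have eq1: "exponents {} = {\<lambda>_. 0 :: nat}" by (auto simp: exponents_def)
  have eq2: "f a = f (\<lambda>_. 0)" and le: "norm (f a) \<le> M" for a
    using sep_holoD(1)[OF empty.prems(2), of a] sep_holoD(2)[OF empty.prems(2), of "\<lambda>_. 0" a]
    by (auto simp: polydisc_def)
  have hs: "((\<lambda>\<alpha>. f (\<lambda>_. 0) * (\<Prod>p\<in>{}. a p ^ \<alpha> p)) has_sum f (\<lambda>_. 0)) {\<lambda>_. 0}" for a
    by (rule has_sum_finiteI) auto
  show ?case
  proof (intro exI conjI allI ballI)
    show "norm (f (\<lambda>_. 0)) \<le> M * (\<Prod>p\<in>{}. (2 / r) ^ \<alpha> p)" for \<alpha> :: "'a \<Rightarrow> nat"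
      using le by simp
    show "((\<lambda>\<alpha>. f (\<lambda>_. 0) * (\<Prod>p\<in>{}. a p ^ \<alpha> p)) has_sum f a) (exponents {})" for a
      unfolding eq1 eq2[of a] by (rule hs)
  qed
next
  case (insert p C)
  define g where "g n a = (deriv ^^ n) (\<lambda>t. f (a(p := t))) 0 / fact n" for n a
  have "\<forall>n. \<exists>c. (\<forall>\<alpha>. norm (c \<alpha>) \<le> M * (2 / r) ^ n * (\<Prod>p\<in>C. (2 / r) ^ \<alpha> p)) \<and>
     (\<forall>a\<in>polydisc C (r/2). ((\<lambda>\<alpha>. c \<alpha> * (\<Prod>p\<in>C. a p ^ \<alpha> p)) has_sum g n a) (exponents C))"
    using insert.IH[OF insert.prems(1) sep_holo_coefficient[OF insert.prems(2,1) insert.hyps(2)]]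
    unfolding g_def by blast
  from choice[OF this] obtain c where c1: "\<And>n \<alpha>. norm (c n \<alpha>) \<le> M * (2 / r) ^ n * (\<Prod>p\<in>C. (2 / r) ^ \<alpha> p)"
    and c2: "\<And>n a. a \<in> polydisc C (r/2) \<Longrightarrow>
        ((\<lambda>\<alpha>. c n \<alpha> * (\<Prod>p\<in>C. a p ^ \<alpha> p)) has_sum g n a) (exponents C)"
    by blast
  define d where "d \<beta> = c (\<beta> p) (\<beta>(p := 0))" for \<beta>
  have M: "M \<ge> 0"
  proof -
    have "norm (f (\<lambda>_. 0)) \<le> M"
      using insert.prems by (intro sep_holoD(1)[OF insert.prems(2)]) (auto simp: polydisc_def)
    then show ?thesis using norm_ge_zero order_trans by blast
  qed
  have bound: "norm (d \<beta>) \<le> M * (\<Prod>q\<in>insert p C. (2 / r) ^ \<beta> q)" for \<beta>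
  proof -
    have "(\<Prod>q\<in>C. (2 / r) ^ (\<beta>(p := 0)) q) = (\<Prod>q\<in>C. (2 / r) ^ \<beta> q)"
      using insert.hyps(2) by (intro prod.cong refl) (metis fun_upd_other)
    then show ?thesis using c1[of "\<beta> p" "\<beta>(p := 0)"] insert.hyps by (simp add: d_def mult.assoc)
  qed
  have "((\<lambda>\<beta>. d \<beta> * (\<Prod>q\<in>insert p C. a q ^ \<beta> q)) has_sum f a) (exponents (insert p C))"
    if a: "a \<in> polydisc (insert p C) (r/2)" for a
  proof -
    have aC: "a \<in> polydisc C (r/2)" "norm (a p) < r/2" using a by (auto simp: polydisc_def)
    then have aC': "a \<in> polydisc C r" using insert.prems(1) by (auto intro: polydisc_mono)
    \<comment> \<open>The majorant is a product of geometric series, whose ratios 2 |a q| / r are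
      below 1 on the half polydisc.\<close>
    have "(\<lambda>\<beta>. \<Prod>q\<in>insert p C. (2 / r * norm (a q)) ^ \<beta> q) summable_on exponents (insert p C)"
      using insert.hyps insert.prems(1) a by (intro summable_monomials) (auto simp: polydisc_def field_simps)
    then have "(\<lambda>\<beta>. M * (\<Prod>q\<in>insert p C. (2 / r * norm (a q)) ^ \<beta> q)) summable_on exponents (insert p C)"
      by (rule summable_on_cmult_right)
    moreover have "norm (d \<beta> * (\<Prod>q\<in>insert p C. a q ^ \<beta> q)) \<le> M * (\<Prod>q\<in>insert p C. (2 / r * norm (a q)) ^ \<beta> q)" for \<beta>
    proof -
      have "norm (d \<beta> * (\<Prod>q\<in>insert p C. a q ^ \<beta> q)) = norm (d \<beta>) * (\<Prod>q\<in>insert p C. norm (a q) ^ \<beta> q)"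
        by (simp add: norm_mult prod_norm[symmetric] norm_power del: prod.insert_remove)
      also have "\<dots> \<le> M * (\<Prod>q\<in>insert p C. (2 / r) ^ \<beta> q) * (\<Prod>q\<in>insert p C. norm (a q) ^ \<beta> q)"
        by (intro mult_right_mono bound prod_nonneg) auto
      also have "\<dots> = M * (\<Prod>q\<in>insert p C. (2 / r * norm (a q)) ^ \<beta> q)"
        by (simp only: power_mult_distrib prod.distrib mult.assoc)
      finally show ?thesis .
    qed
    ultimately have "(\<lambda>\<beta>. norm (d \<beta> * (\<Prod>q\<in>insert p C. a q ^ \<beta> q))) summable_on exponents (insert p C)"
      by (rule Infinite_Sum.abs_summable_on_comparison_test')
    then have "(\<lambda>\<beta>. d \<beta> * (\<Prod>q\<in>insert p C. a q ^ \<beta> q)) summable_on exponents (insert p C)"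
      by (rule Infinite_Sum.abs_summable_summable)
    then have summ: "(\<lambda>(n, \<alpha>). d (\<alpha>(p := n)) * (\<Prod>q\<in>insert p C. a q ^ (\<alpha>(p := n)) q)) summable_on UNIV \<times> exponents C"
      unfolding summable_on_def exponents_insert_has_sum[OF insert.hyps(2)] .
    have gs: "(\<lambda>n. g n a * a p ^ n) sums f a"
    proof -
      have "(\<lambda>t. f ((a(p := 0))(p := t))) holomorphic_on ball 0 r"
        by (rule sep_holoD(3)[OF insert.prems(2) polydisc_insert_upd[OF aC']]) (use insert.prems(1) in auto)
      then have hol: "(\<lambda>t. f (a(p := t))) holomorphic_on ball 0 r" by simp
      show ?thesis
        using holomorphic_power_series[OF hol, of "a p"] aC insert.prems(1) unfolding g_def by simp
    qed
    have "((\<lambda>(n, \<alpha>). d (\<alpha>(p := n)) * (\<Prod>q\<in>insert p C. a q ^ (\<alpha>(p := n)) q)) has_sum f a) (UNIV \<times> exponents C)"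
    proof (rule has_sum_SigmaI)
      fix n :: nat
      have eq: "d (\<alpha>(p := n)) * (\<Prod>q\<in>insert p C. a q ^ (\<alpha>(p := n)) q)
          = c n \<alpha> * (\<Prod>q\<in>C. a q ^ \<alpha> q) * a p ^ n" if "\<alpha> \<in> exponents C" for \<alpha>
      proof -
        have "\<alpha>(p := 0) = \<alpha>" using that insert.hyps by (auto simp: exponents_def)
        moreover have "(\<Prod>q\<in>C. a q ^ (\<alpha>(p := n)) q) = (\<Prod>q\<in>C. a q ^ \<alpha> q)"
          using insert.hyps(2) by (intro prod.cong refl) (metis fun_upd_other)
        ultimately show ?thesis using insert.hyps by (simp add: d_def)
      qed
      show "((\<lambda>y. case (n, y) of (n, \<alpha>) \<Rightarrow> d (\<alpha>(p := n)) * (\<Prod>q\<in>insert p C. a q ^ (\<alpha>(p := n)) q))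
          has_sum g n a * a p ^ n) (exponents C)"
        using has_sum_cmult_left[OF c2[OF aC(1)], of n "a p ^ n"]
        by (rule has_sum_cong[THEN iffD1, rotated]) (simp only: prod.case eq)
    next
      have "(\<lambda>n. norm (g n a * a p ^ n)) summable_on UNIV"
      proof (rule summable_nonneg_imp_summable_on)
        have bg: "norm (g n a) \<le> M * (2 / r) ^ n" for n
          using sep_holoD(1)[OF sep_holo_coefficient[OF insert.prems(2,1) insert.hyps(2)] aC']
          unfolding g_def .
        have "norm (g n a * a p ^ n) \<le> M * (2 / r * norm (a p)) ^ n" for n
          using mult_right_mono[OF bg[of n], of "norm (a p) ^ n", OF zero_le_power[OF norm_ge_zero]]
          by (simp only: norm_mult norm_power power_mult_distrib mult.assoc)
        note le = this
        have "norm (2 / r * norm (a p)) < 1"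
          using aC(2) insert.prems(1) by (simp add: field_simps)
        then have sm: "summable (\<lambda>n. M * (2 / r * norm (a p)) ^ n)"
          by (intro summable_mult summable_geometric)
        show "summable (\<lambda>n. norm (g n a * a p ^ n))"
          by (rule summable_comparison_test'[OF sm, of 0]) (simp only: real_norm_def abs_norm_cancel le)
      qed auto
      then have "(\<lambda>n. g n a * a p ^ n) summable_on UNIV" by (rule Infinite_Sum.abs_summable_summable)
      then have "((\<lambda>n. g n a * a p ^ n) has_sum (\<Sum>\<^sub>\<infinity>n. g n a * a p ^ n)) UNIV" by simp
      with gs show "((\<lambda>n. g n a * a p ^ n) has_sum f a) UNIV"
        using has_sum_imp_sums sums_unique2 by metis
    qed (use summ in auto)
    then show ?thesis unfolding exponents_insert_has_sum[OF insert.hyps(2)] .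
  qed
  with bound show ?case by (intro exI[of _ d]) auto
qed

text \<open>Holomorphy is required along arbitrary holomorphic curves, rather than along the coordinate axes
  only, because closure under sums, products and composition is then immediate.\<close>

definition holo_disc :: "'i set \<Rightarrow> real \<Rightarrow> (('i \<Rightarrow> complex) \<Rightarrow> complex) \<Rightarrow> bool" where
  "holo_disc C r f \<longleftrightarrow> (\<exists>M. \<forall>a\<in>polydisc C r. norm (f a) \<le> M) \<and>
     (\<forall>a\<in>polydisc C r. \<forall>b. (\<forall>p\<in>C. b p = a p) \<longrightarrow> f b = f a) \<and>
     (\<forall>U \<gamma>. open U \<longrightarrow> (\<forall>p\<in>C. (\<lambda>t. \<gamma> t p) holomorphic_on U) \<longrightarrow> \<gamma> ` U \<subseteq> polydisc C r \<longrightarrow>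
        (\<lambda>t :: complex. f (\<gamma> t)) holomorphic_on U)"

lemma holo_discI:
  assumes "\<And>a. a \<in> polydisc C r \<Longrightarrow> norm (f a) \<le> M"
    and "\<And>a b. a \<in> polydisc C r \<Longrightarrow> (\<And>p. p \<in> C \<Longrightarrow> b p = a p) \<Longrightarrow> f b = f a"
    and "\<And>U \<gamma>. open U \<Longrightarrow> (\<And>p. p \<in> C \<Longrightarrow> (\<lambda>t. \<gamma> t p) holomorphic_on U) \<Longrightarrow>
       (\<And>t. t \<in> U \<Longrightarrow> \<gamma> t \<in> polydisc C r) \<Longrightarrow> (\<lambda>t :: complex. f (\<gamma> t)) holomorphic_on U"
  shows "holo_disc C r f"
  unfolding holo_disc_def
proof (intro conjI)
  show "\<exists>M. \<forall>a\<in>polydisc C r. norm (f a) \<le> M" using assms(1) by blast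
  show "\<forall>a\<in>polydisc C r. \<forall>b. (\<forall>p\<in>C. b p = a p) \<longrightarrow> f b = f a" using assms(2) by blast
  show "\<forall>U \<gamma>. open U \<longrightarrow> (\<forall>p\<in>C. (\<lambda>t. \<gamma> t p) holomorphic_on U) \<longrightarrow> \<gamma> ` U \<subseteq> polydisc C r \<longrightarrow>
        (\<lambda>t. f (\<gamma> t)) holomorphic_on U"
    by (intro allI impI assms(3)) blast+
qed

lemma holo_disc_bound:
  assumes "holo_disc C r f"
  obtains M where "M > 0" "\<And>a. a \<in> polydisc C r \<Longrightarrow> norm (f a) \<le> M"
proof -
  obtain M where "\<forall>a\<in>polydisc C r. norm (f a) \<le> M" using assms unfolding holo_disc_def by blast
  then show ?thesis by (intro that[of "max M 1"]) (auto simp: le_max_iff_disj)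
qed

lemma holo_disc_cong:
  assumes "holo_disc C r f" "a \<in> polydisc C r" "\<And>p. p \<in> C \<Longrightarrow> b p = a p"
  shows "f b = f a"
  using assms unfolding holo_disc_def by blast

lemma holo_disc_curve:
  assumes "holo_disc C r f" "open U" "\<And>p. p \<in> C \<Longrightarrow> (\<lambda>t. \<gamma> t p) holomorphic_on U"
    "\<And>t. t \<in> U \<Longrightarrow> \<gamma> t \<in> polydisc C r"
  shows "(\<lambda>t :: complex. f (\<gamma> t)) holomorphic_on U"
proof -
  have "\<gamma> ` U \<subseteq> polydisc C r" using assms(4) by blast
  then show ?thesis using assms(1-3) unfolding holo_disc_def by blast
qed

lemma holo_disc_mono:
  assumes f: "holo_disc C r f" and "s \<le> r"
  shows "holo_disc C s f"
proof -
  obtain M where M: "\<And>a. a \<in> polydisc C r \<Longrightarrow> norm (f a) \<le> M" using holo_disc_bound[OF f] by blast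
  show ?thesis
    using polydisc_mono[OF _ assms(2)] M
    by (intro holo_discI[where M = M]) (blast, blast intro: holo_disc_cong[OF f], blast intro: holo_disc_curve[OF f])
qed

lemma holo_disc_slice:
  assumes "holo_disc C r f" "a \<in> polydisc C r"
  shows "(\<lambda>t. f (a(p := t))) holomorphic_on ball 0 r"
proof (rule holo_disc_curve[OF assms(1)])
  show "(\<lambda>t. (a(p := t)) q) holomorphic_on ball 0 r" for q
    by (cases "q = p") (auto intro: holomorphic_intros)
qed (use assms polydisc_upd in auto)

lemma holo_disc_const: "holo_disc C r (\<lambda>_. c)"
  by (rule holo_discI[where M = "norm c"]) auto

lemma holo_disc_coord: "p \<in> C \<Longrightarrow> holo_disc C r (\<lambda>a. a p)"
  by (rule holo_discI[where M = r]) (auto simp: polydisc_def less_imp_le)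

lemma holo_disc_add:
  assumes f: "holo_disc C r f" and g: "holo_disc C r g"
  shows "holo_disc C r (\<lambda>a. f a + g a)"
proof -
  obtain M where M: "\<And>a. a \<in> polydisc C r \<Longrightarrow> norm (f a) \<le> M" using holo_disc_bound[OF f] by blast
  obtain N where N: "\<And>a. a \<in> polydisc C r \<Longrightarrow> norm (g a) \<le> N" using holo_disc_bound[OF g] by blast
  show ?thesis
  proof (rule holo_discI[where M = "M + N"])
    show "norm (f a + g a) \<le> M + N" if "a \<in> polydisc C r" for a
      using M[OF that] N[OF that] norm_triangle_mono by blast
    show "f b + g b = f a + g a" if "a \<in> polydisc C r" "\<And>p. p \<in> C \<Longrightarrow> b p = a p" for a b
      using holo_disc_cong[OF f that] holo_disc_cong[OF g that] by simp
  qed (intro holomorphic_intros holo_disc_curve[OF f] holo_disc_curve[OF g]; simp)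
qed

lemma holo_disc_mult:
  assumes f: "holo_disc C r f" and g: "holo_disc C r g"
  shows "holo_disc C r (\<lambda>a. f a * g a)"
proof -
  obtain M where M: "M > 0" "\<And>a. a \<in> polydisc C r \<Longrightarrow> norm (f a) \<le> M" using holo_disc_bound[OF f] by blast
  obtain N where N: "N > 0" "\<And>a. a \<in> polydisc C r \<Longrightarrow> norm (g a) \<le> N" using holo_disc_bound[OF g] by blast
  show ?thesis
  proof (rule holo_discI[where M = "M * N"])
    show "norm (f a * g a) \<le> M * N" if "a \<in> polydisc C r" for a
      using M(1) M(2)[OF that] N(2)[OF that] unfolding norm_mult by (intro mult_mono) auto
    show "f b * g b = f a * g a" if "a \<in> polydisc C r" "\<And>p. p \<in> C \<Longrightarrow> b p = a p" for a b
      using holo_disc_cong[OF f that] holo_disc_cong[OF g that] by simp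
  qed (intro holomorphic_intros holo_disc_curve[OF f] holo_disc_curve[OF g]; simp)
qed

lemma holo_disc_comp:
  assumes f: "holo_disc C r f" and T: "\<And>p. p \<in> C \<Longrightarrow> holo_disc C s (\<lambda>a. T a p)"
    and TT: "\<And>a. a \<in> polydisc C s \<Longrightarrow> T a \<in> polydisc C r"
  shows "holo_disc C s (\<lambda>a. f (T a))"
proof -
  obtain M where M: "\<And>a. a \<in> polydisc C r \<Longrightarrow> norm (f a) \<le> M" using holo_disc_bound[OF f] by blast
  show ?thesis
  proof (rule holo_discI[where M = M])
    show "norm (f (T a)) \<le> M" if "a \<in> polydisc C s" for a using M TT that by blast
    show "f (T b) = f (T a)" if "a \<in> polydisc C s" "\<And>p. p \<in> C \<Longrightarrow> b p = a p" for a b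
      by (rule holo_disc_cong[OF f TT[OF that(1)]]) (rule holo_disc_cong[OF T that])
    show "(\<lambda>t. f (T (\<gamma> t))) holomorphic_on U"
      if "open U" "\<And>p. p \<in> C \<Longrightarrow> (\<lambda>t. \<gamma> t p) holomorphic_on U" "\<And>t. t \<in> U \<Longrightarrow> \<gamma> t \<in> polydisc C s" for U \<gamma>
    proof (rule holo_disc_curve[OF f that(1)])
      show "(\<lambda>t. T (\<gamma> t) p) holomorphic_on U" if "p \<in> C" for p
        by (rule holo_disc_curve[OF T[OF that] \<open>open U\<close>]) fact+
    qed (use that TT in blast)
  qed
qed

text \<open>The point with all coordinates r lies in the larger polydisc, so the series converges
  absolutely there. Its terms majorise those at every point of the smaller polydisc, and the M-test
  gives uniform convergence along any holomorphic curve.\<close>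

lemma power_series_holo_disc:
  assumes r: "r > 0"
    and c: "\<And>a. a \<in> polydisc C (2 * r) \<Longrightarrow>
      ((\<lambda>\<alpha>. c \<alpha> * (\<Prod>p\<in>C. a p ^ \<alpha> p)) has_sum f a) (exponents C)"
  shows "holo_disc C r f"
proof -
  define B where "B \<alpha> = norm (c \<alpha> * (\<Prod>p\<in>C. of_real r ^ \<alpha> p))" for \<alpha>
  have "((\<lambda>\<alpha>. c \<alpha> * (\<Prod>p\<in>C. of_real r ^ \<alpha> p)) has_sum f (\<lambda>_. of_real r)) (exponents C)"
    using c[of "\<lambda>_. of_real r"] r by (simp add: polydisc_def)
  then have "(\<lambda>\<alpha>. c \<alpha> * (\<Prod>p\<in>C. of_real r ^ \<alpha> p)) summable_on (exponents C)"
    by (auto simp: summable_on_def)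
  then have B: "B summable_on exponents C"
    unfolding B_def by (rule summable_on_iff_abs_summable_on_complex[THEN iffD1])
  have le: "norm (c \<alpha> * (\<Prod>p\<in>C. a p ^ \<alpha> p)) \<le> B \<alpha>" if "a \<in> polydisc C r" for a \<alpha>
  proof -
    have "norm (\<Prod>p\<in>C. a p ^ \<alpha> p) \<le> (\<Prod>p\<in>C. r ^ \<alpha> p)"
      unfolding prod_norm[symmetric] norm_power using that
      by (intro prod_mono) (auto simp: polydisc_def intro!: power_mono intro: less_imp_le)
    also have "\<dots> = norm (\<Prod>p\<in>C. complex_of_real r ^ \<alpha> p)"
      unfolding prod_norm[symmetric] norm_power using r by simp
    finally show ?thesis unfolding B_def norm_mult by (intro mult_left_mono) auto
  qed
  have c': "((\<lambda>\<alpha>. c \<alpha> * (\<Prod>p\<in>C. a p ^ \<alpha> p)) has_sum f a) (exponents C)" if "a \<in> polydisc C r" for a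
    using that r by (intro c) (auto elim!: polydisc_mono)
  show ?thesis
  proof (rule holo_discI[where M = "infsum B (exponents C)"])
    show "norm (f a) \<le> infsum B (exponents C)" if "a \<in> polydisc C r" for a
      using norm_infsum_le[OF c'[OF that] _ le[OF that]] B has_sum_infsum by blast
    show "f b = f a" if "a \<in> polydisc C r" "\<And>p. p \<in> C \<Longrightarrow> b p = a p" for a b
    proof -
      have "b \<in> polydisc C r" using that by (auto simp: polydisc_def)
      moreover have "(\<Prod>p\<in>C. b p ^ \<alpha> p) = (\<Prod>p\<in>C. a p ^ \<alpha> p)" for \<alpha>
        using that(2) by (intro prod.cong) auto
      ultimately show ?thesis using c'[of a] c'[of b] that has_sum_unique by fastforce
    qed
    show "(\<lambda>t. f (\<gamma> t)) holomorphic_on U"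
      if U: "open U" and hol: "\<And>p. p \<in> C \<Longrightarrow> (\<lambda>t. \<gamma> t p) holomorphic_on U"
        and \<gamma>: "\<And>t. t \<in> U \<Longrightarrow> \<gamma> t \<in> polydisc C r" for U \<gamma>
    proof -
      define g where "g t = (\<Sum>\<^sub>\<infinity>\<alpha>\<in>exponents C. c \<alpha> * (\<Prod>p\<in>C. \<gamma> t p ^ \<alpha> p))" for t
      have gf: "g t = f (\<gamma> t)" if "t \<in> U" for t
        unfolding g_def using c'[OF \<gamma>[OF that]] by (rule infsumI)
      have ul: "uniform_limit U (\<lambda>X t. \<Sum>\<alpha>\<in>X. c \<alpha> * (\<Prod>p\<in>C. \<gamma> t p ^ \<alpha> p)) g (finite_subsets_at_top (exponents C))"
        unfolding g_def by (rule Weierstrass_m_test_general[OF _ B]) (use le \<gamma> in blast)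
      have "g holomorphic_on U"
        unfolding holomorphic_on_open[OF U]
      proof
        fix z assume "z \<in> U"
        then obtain d where d: "d > 0" "cball z d \<subseteq> U" using U open_contains_cball by blast
        have hs: "(\<lambda>t. \<Sum>\<alpha>\<in>X. c \<alpha> * (\<Prod>p\<in>C. \<gamma> t p ^ \<alpha> p)) holomorphic_on cball z d" for X
          using holomorphic_on_subset[OF hol d(2)] by (intro holomorphic_intros)
        have "g holomorphic_on ball z d"
        proof (rule holomorphic_uniform_limit)
          show "\<forall>\<^sub>F X in finite_subsets_at_top (exponents C).
            continuous_on (cball z d) (\<lambda>t. \<Sum>\<alpha>\<in>X. c \<alpha> * (\<Prod>p\<in>C. \<gamma> t p ^ \<alpha> p)) \<and>
            (\<lambda>t. \<Sum>\<alpha>\<in>X. c \<alpha> * (\<Prod>p\<in>C. \<gamma> t p ^ \<alpha> p)) holomorphic_on ball z d"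
            by (intro always_eventually allI conjI holomorphic_on_imp_continuous_on hs
                holomorphic_on_subset[OF hs ball_subset_cball])
          show "uniform_limit (cball z d) (\<lambda>X t. \<Sum>\<alpha>\<in>X. c \<alpha> * (\<Prod>p\<in>C. \<gamma> t p ^ \<alpha> p)) g
            (finite_subsets_at_top (exponents C))"
            by (rule uniform_limit_on_subset[OF ul d(2)])
        qed auto
        then show "\<exists>f'. (g has_field_derivative f') (at z)"
          using d(1) holomorphic_on_open[of "ball z d" g] by auto
      qed
      then show ?thesis using gf holomorphic_cong by metis
    qed
  qed
qed

lemma holo_disc_power_series:
  assumes "finite C" "r > 0" "holo_disc C r f"
  shows "\<exists>c. \<forall>a\<in>polydisc C (r/2). ((\<lambda>\<alpha>. c \<alpha> * (\<Prod>p\<in>C. a p ^ \<alpha> p)) has_sum f a) (exponents C)"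
proof -
  obtain M where M: "\<And>a. a \<in> polydisc C r \<Longrightarrow> norm (f a) \<le> M" using holo_disc_bound[OF assms(3)] by blast
  have "sep_holo C r M f"
    unfolding sep_holo_def using M holo_disc_cong[OF assms(3)] holo_disc_slice[OF assms(3)] by blast
  then show ?thesis using separately_holomorphic_power_series[OF assms(1,2)] by blast
qed

text \<open>Points at coordinatewise distance at most r/4 lie on a complex line on which Cauchy's
  inequality bounds the derivative. For more distant points the bound on f suffices, since 2 M = (8
  M / r) (r/4).\<close>

lemma holo_disc_lipschitz:
  assumes f: "holo_disc C r f" and r: "r > 0"
  obtains K where "K > 0" "\<And>a b d. a \<in> polydisc C (r/2) \<Longrightarrow> b \<in> polydisc C (r/2) \<Longrightarrow>
    (\<And>p. p \<in> C \<Longrightarrow> norm (b p - a p) \<le> d) \<Longrightarrow> d \<ge> 0 \<Longrightarrow> norm (f b - f a) \<le> K * d"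
proof -
  obtain M where M: "M > 0" "\<And>a. a \<in> polydisc C r \<Longrightarrow> norm (f a) \<le> M" using holo_disc_bound[OF f] by blast
  have small: "norm (f b - f a) \<le> 8 * M / r * d"
    if a: "a \<in> polydisc C (r/2)" and d: "\<And>p. p \<in> C \<Longrightarrow> norm (b p - a p) \<le> d" "d > 0" "d \<le> r/4" for a b d
  proof -
    \<comment> \<open>Dividing by d makes the direction have coordinates of norm at most 1 on C, and
      b is reached at the parameter t = d.\<close>
    define \<gamma> where "\<gamma> t p = a p + t * ((b p - a p) / of_real d)" for t p
    have sub: "\<gamma> t \<in> polydisc C r" if "t \<in> ball 0 (r/2)" for t
      unfolding polydisc_def
    proof safe
      fix p assume p: "p \<in> C"
      have "norm (\<gamma> t p) \<le> norm (a p) + norm t * (norm (b p - a p) / d)"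
        unfolding \<gamma>_def using d(2) norm_triangle_ineq[of "a p" "t * ((b p - a p) / of_real d)"]
        by (simp add: norm_mult norm_divide)
      also have "norm t * (norm (b p - a p) / d) \<le> norm t * 1"
        using d(1)[OF p] d(2) by (intro mult_left_mono) auto
      also have "norm (a p) + norm t * 1 < r" using a p that by (auto simp: polydisc_def)
      finally show "norm (\<gamma> t p) < r" by simp
    qed
    define F where "F t = f (\<gamma> t)" for t
    have hol: "F holomorphic_on ball 0 (r/2)"
      unfolding F_def by (rule holo_disc_curve[OF f]) (auto simp: \<gamma>_def sub intro!: holomorphic_intros)
    have F1: "F (of_real d) = f b"
    proof -
      have "\<gamma> (of_real d) = b" using d(2) by (auto simp: \<gamma>_def fun_eq_iff)
      then show ?thesis by (simp add: F_def)
    qed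
    have "\<gamma> 0 = a" by (simp add: \<gamma>_def fun_eq_iff)
    then have F0: "F 0 = f a" by (simp add: F_def)
    have der: "norm (deriv F t) \<le> 8 * M / r" if t: "t \<in> cball 0 (r/4)" for t
    proof -
      have s: "cball t (r/8) \<subseteq> ball 0 (r/2)"
      proof
        fix x assume "x \<in> cball t (r/8)"
        then show "x \<in> ball 0 (r/2)"
          using t r norm_triangle_sub[of x t] by (simp add: dist_norm norm_minus_commute)
      qed
      have "norm ((deriv ^^ 1) F t) \<le> fact 1 * M / (r/8) ^ 1"
      proof (rule Cauchy_inequality)
        show "F holomorphic_on ball t (r/8)" "continuous_on (cball t (r/8)) F"
          using hol s ball_subset_cball holomorphic_on_subset
          by (blast intro: holomorphic_on_imp_continuous_on)+
        show "norm (F x) \<le> M" if "norm (t - x) = r/8" for x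
          unfolding F_def using s that by (intro M sub) (auto simp: dist_norm)
      qed (use r in auto)
      then show ?thesis by (simp add: mult.commute)
    qed
    have "norm (F (of_real d) - F 0) \<le> 8 * M / r * norm (complex_of_real d - 0)"
    proof (rule field_differentiable_bound[where S = "cball 0 (r/4)"])
      show "(F has_field_derivative deriv F t) (at t within cball 0 (r/4))" if "t \<in> cball 0 (r/4)" for t
        using holomorphic_derivI[OF hol open_ball, of t] that r by (auto intro: has_field_derivative_at_within)
    qed (use der d r in auto)
    then show ?thesis using d(2) by (simp add: F0 F1)
  qed
  show ?thesis
  proof (rule that[of "8 * M / r"])
    fix a b d
    assume a: "a \<in> polydisc C (r/2)" and b: "b \<in> polydisc C (r/2)"
      and d: "\<And>p. p \<in> C \<Longrightarrow> norm (b p - a p) \<le> d" "d \<ge> 0"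
    consider "d = 0" | "0 < d" "d \<le> r/4" | "d > r/4" using d(2) by linarith
    then show "norm (f b - f a) \<le> 8 * M / r * d"
    proof cases
      case 1
      then have "f b = f a"
        using d by (intro holo_disc_cong[OF f]) (auto intro: polydisc_mono[OF a] simp: r less_imp_le)
      then show ?thesis using 1 by simp
    next
      case 2
      then show ?thesis using small[OF a d(1)] by blast
    next
      case 3
      have "norm (f b - f a) \<le> norm (f b) + norm (f a)" by (rule norm_triangle_ineq4)
      also have "\<dots> \<le> M + M" using r a b by (intro add_mono M) (auto elim!: polydisc_mono)
      also have "\<dots> = 8 * M / r * (r/4)" using r by simp
      also have "\<dots> \<le> 8 * M / r * d" using 3 M(1) r by (intro mult_left_mono) auto
      finally show ?thesis .
    qed
  qed (use M r in auto)
qed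

section \<open>Germs at the origin\<close>

lemma finite_coords [simp]: "finite (coords m)"
  by (rule finite_subset[of _ "{1..m} \<times> {1..m}"]) (auto simp: coords_def)

lemma near0_iff: "near0 m P \<longleftrightarrow> (\<exists>r>0. \<forall>a\<in>polydisc (coords m) r. P a)"
  by (simp add: near0_def polydisc_def)

lemma near0I: "r > 0 \<Longrightarrow> (\<And>a. a \<in> polydisc (coords m) r \<Longrightarrow> P a) \<Longrightarrow> near0 m P"
  unfolding near0_iff by blast

lemma near0_mono: "near0 m P \<Longrightarrow> (\<And>a. P a \<Longrightarrow> Q a) \<Longrightarrow> near0 m Q"
  unfolding near0_iff by blast

lemma near0_conj: "near0 m (\<lambda>a. P a \<and> Q a) \<longleftrightarrow> near0 m P \<and> near0 m Q"
proof
  assume "near0 m P \<and> near0 m Q"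
  then obtain r s where "r > 0" "s > 0" "\<forall>a\<in>polydisc (coords m) r. P a" "\<forall>a\<in>polydisc (coords m) s. Q a"
    unfolding near0_iff by blast
  then show "near0 m (\<lambda>a. P a \<and> Q a)"
    by (intro near0I[of "min r s"]) (auto dest: polydisc_mono[of _ _ "min r s" r] polydisc_mono[of _ _ "min r s" s])
qed (auto elim: near0_mono)

lemma near0_mp: "near0 m P \<Longrightarrow> near0 m Q \<Longrightarrow> (\<And>a. P a \<Longrightarrow> Q a \<Longrightarrow> R a) \<Longrightarrow> near0 m R"
  using near0_conj[of m P Q] by (auto elim: near0_mono)

lemma near0_all: "(\<And>a. P a) \<Longrightarrow> near0 m P"
  by (rule near0I[of 1]) auto

lemma near0_ball_finite:
  assumes "finite I" "\<And>i. i \<in> I \<Longrightarrow> near0 m (P i)"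
  shows "near0 m (\<lambda>a. \<forall>i\<in>I. P i a)"
  using assms by (induction rule: finite_induct) (auto simp: near0_conj near0_all)

lemma near0_at_0: "near0 m P \<Longrightarrow> P (\<lambda>_. 0)"
  unfolding near0_iff polydisc_def by force

text \<open>The bridge from convergent power series to holomorphy along curves; each direction costs
  half of the radius.\<close>

lemma holo_germ_iff: "holo_germ m f \<longleftrightarrow> (\<exists>r>0. holo_disc (coords m) r f)"
proof
  assume "holo_germ m f"
  then obtain c r where "r > 0" "\<And>a. a \<in> polydisc (coords m) r \<Longrightarrow>
      ((\<lambda>\<alpha>. c \<alpha> * (\<Prod>p\<in>coords m. a p ^ \<alpha> p)) has_sum f a) (exponents (coords m))"
    unfolding holo_germ_def near0_iff exponents_def by blast
  then have "holo_disc (coords m) (r/2) f" by (intro power_series_holo_disc[where c = c]) auto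
  with \<open>r > 0\<close> show "\<exists>r>0. holo_disc (coords m) r f" by (intro exI[of _ "r/2"]) auto
next
  assume "\<exists>r>0. holo_disc (coords m) r f"
  then obtain r where "r > 0" "holo_disc (coords m) r f" by blast
  then show "holo_germ m f"
    using holo_disc_power_series[of "coords m" r f]
    unfolding holo_germ_def near0_iff exponents_def by (meson finite_coords half_gt_zero)
qed

lemma holo_germ_disc2:
  assumes "holo_germ m f" "holo_germ m g"
  obtains r where "r > 0" "holo_disc (coords m) r f" "holo_disc (coords m) r g"
proof -
  obtain r s where "r > 0" "s > 0" "holo_disc (coords m) r f" "holo_disc (coords m) s g"
    using assms unfolding holo_germ_iff by blast
  then show ?thesis by (intro that[of "min r s"]) (auto elim: holo_disc_mono)
qed

lemma holo_germ_const [simp]: "holo_germ m (\<lambda>_. c)"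
  unfolding holo_germ_iff by (intro exI[of _ 1] conjI holo_disc_const) simp

lemma holo_germ_add: "holo_germ m f \<Longrightarrow> holo_germ m g \<Longrightarrow> holo_germ m (\<lambda>a. f a + g a)"
  by (erule holo_germ_disc2, assumption) (unfold holo_germ_iff, blast intro: holo_disc_add)

lemma holo_germ_mult: "holo_germ m f \<Longrightarrow> holo_germ m g \<Longrightarrow> holo_germ m (\<lambda>a. f a * g a)"
  by (erule holo_germ_disc2, assumption) (unfold holo_germ_iff, blast intro: holo_disc_mult)

lemma holo_germ_minus: "holo_germ m f \<Longrightarrow> holo_germ m (\<lambda>a. - f a)"
  using holo_germ_mult[of m "\<lambda>_. -1" f] by simp

lemma holo_germ_diff: "holo_germ m f \<Longrightarrow> holo_germ m g \<Longrightarrow> holo_germ m (\<lambda>a. f a - g a)"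
  using holo_germ_add[OF _ holo_germ_minus, of m f g] by simp

lemma holo_germ_sum: "(\<And>i. i \<in> I \<Longrightarrow> holo_germ m (f i)) \<Longrightarrow> holo_germ m (\<lambda>a. \<Sum>i\<in>I. f i a)"
  by (induction I rule: infinite_finite_induct) (auto intro: holo_germ_add)

lemma holo_germ_cong:
  assumes "holo_germ m f" "near0 m (\<lambda>a. f a = g a)"
  shows "holo_germ m g"
proof -
  obtain c where "near0 m (\<lambda>a. ((\<lambda>\<alpha>. c \<alpha> * (\<Prod>p\<in>coords m. a p ^ \<alpha> p)) has_sum f a) {\<alpha>. \<forall>p. p \<notin> coords m \<longrightarrow> \<alpha> p = 0})"
    using assms(1) unfolding holo_germ_def by blast
  from near0_mp[OF this assms(2)]
  have "near0 m (\<lambda>a. ((\<lambda>\<alpha>. c \<alpha> * (\<Prod>p\<in>coords m. a p ^ \<alpha> p)) has_sum g a) {\<alpha>. \<forall>p. p \<notin> coords m \<longrightarrow> \<alpha> p = 0})"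
    by simp
  then show ?thesis unfolding holo_germ_def by (intro exI[of _ c])
qed

text \<open>Factors of norm at most 1 map every polydisc into itself. This is how the dilations of
  the weight argument act on germs.\<close>

lemma holo_germ_scale:
  assumes f: "holo_germ m f" and c: "\<And>p. p \<in> coords m \<Longrightarrow> norm (c p) \<le> 1"
  shows "holo_germ m (\<lambda>a. f (\<lambda>p. c p * a p))"
proof -
  obtain r where r: "r > 0" "holo_disc (coords m) r f" using f unfolding holo_germ_iff by blast
  have "holo_disc (coords m) r (\<lambda>a. f (\<lambda>p. c p * a p))"
  proof (rule holo_disc_comp[OF r(2)])
    show "holo_disc (coords m) r (\<lambda>a. c p * a p)" if "p \<in> coords m" for p
      by (intro holo_disc_mult holo_disc_const holo_disc_coord that)
    show "(\<lambda>p. c p * a p) \<in> polydisc (coords m) r" if a: "a \<in> polydisc (coords m) r" for a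
      unfolding polydisc_def
    proof safe
      fix i j assume p: "(i, j) \<in> coords m"
      then have "norm (c (i,j) * a (i,j)) \<le> 1 * norm (a (i,j))" unfolding norm_mult by (intro mult_right_mono c) auto
      also have "\<dots> < r" using a p by (auto simp: polydisc_def)
      finally show "norm (c (i,j) * a (i,j)) < r" .
    qed
  qed
  with r show ?thesis unfolding holo_germ_iff by blast
qed

subsection \<open>Partial derivatives\<close>

lemma holo_disc_has_derivative:
  assumes "holo_disc C r f" "a \<in> polydisc C r" "p \<in> C"
  shows "((\<lambda>t. f (a(p := t))) has_field_derivative pdiff p f a) (at (a p))"
proof -
  have "a p \<in> ball 0 r" using assms by (auto simp: polydisc_def)
  then show ?thesis unfolding pdiff_def by (rule holomorphic_derivI[OF holo_disc_slice[OF assms(1,2)] open_ball])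
qed

lemma pdiff_eqI: "((\<lambda>t. f (a(p := t))) has_field_derivative D) (at (a p)) \<Longrightarrow> pdiff p f a = D"
  unfolding pdiff_def by (rule DERIV_imp_deriv)

lemma pdiff_add:
  assumes "holo_disc C r f" "holo_disc C r g" "a \<in> polydisc C r" "p \<in> C"
  shows "pdiff p (\<lambda>a. f a + g a) a = pdiff p f a + pdiff p g a"
  by (intro pdiff_eqI DERIV_add holo_disc_has_derivative) (use assms in auto)

lemma pdiff_mult:
  assumes "holo_disc C r f" "holo_disc C r g" "a \<in> polydisc C r" "p \<in> C"
  shows "pdiff p (\<lambda>a. f a * g a) a = f a * pdiff p g a + g a * pdiff p f a"
  using DERIV_mult[OF holo_disc_has_derivative[OF assms(1,3,4)] holo_disc_has_derivative[OF assms(2,3,4)]]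
  by (intro pdiff_eqI) (simp add: algebra_simps)

lemma pdiff_const: "pdiff p (\<lambda>_. c) a = 0"
  by (intro pdiff_eqI) auto

lemma pdiff_coord: "pdiff p (\<lambda>a. a q) a = (if p = q then 1 else 0)"
  by (intro pdiff_eqI) (auto intro!: derivative_eq_intros)

lemma pdiff_independent: "(\<And>t. f (a(p := t)) = f a) \<Longrightarrow> pdiff p f a = 0"
  by (intro pdiff_eqI) simp

text \<open>Written with the increment h as variable, the derivative is taken at the fixed centre 0
  however the base point moves along a curve, so the results on derivatives with a parameter
  apply.\<close>

lemma holo_disc_pdiff:
  assumes f: "holo_disc C r f" and r: "r > 0" and p: "p \<in> C"
  shows "holo_disc C (r/2) (pdiff p f)"
proof -
  obtain M where M: "M > 0" "\<And>a. a \<in> polydisc C r \<Longrightarrow> norm (f a) \<le> M" using holo_disc_bound[OF f] by blast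
  have sh: "a(p := a p + h) \<in> polydisc C r" if "a \<in> polydisc C (r/2)" "norm h < r/2" for a h
  proof -
    have "norm (a p + h) \<le> norm (a p) + norm h" by (rule norm_triangle_ineq)
    also have "\<dots> < r" using that p by (auto simp: polydisc_def)
    finally show ?thesis using that r by (intro polydisc_upd polydisc_mono[OF that(1)]) auto
  qed
  have eq: "pdiff p f a = deriv (\<lambda>h. f (a(p := a p + h))) 0" for a
    unfolding pdiff_def by (subst deriv_shift_0) (simp add: o_def)
  have hol: "(\<lambda>h. f (a(p := a p + h))) holomorphic_on ball 0 (r/2)" if "a \<in> polydisc C (r/2)" for a
  proof (rule holo_disc_curve[OF f])
    show "(\<lambda>t. (a(p := a p + t)) q) holomorphic_on ball 0 (r/2)" for q
      by (cases "q = p") (auto intro: holomorphic_intros)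
  qed (use sh that in auto)
  show ?thesis
  proof (rule holo_discI[where M = "fact 1 * M / (r/4) ^ 1"])
    fix a assume a: "a \<in> polydisc C (r/2)"
    have "norm ((deriv ^^ 1) (\<lambda>h. f (a(p := a p + h))) 0) \<le> fact 1 * M / (r/4) ^ 1"
    proof (rule Cauchy_inequality)
      have *: "(\<lambda>h. f (a(p := a p + h))) holomorphic_on cball 0 (r/4)"
        by (rule holomorphic_on_subset[OF hol[OF a]]) (use r in auto)
      then show "continuous_on (cball 0 (r/4)) (\<lambda>h. f (a(p := a p + h)))"
        by (rule holomorphic_on_imp_continuous_on)
      show "(\<lambda>h. f (a(p := a p + h))) holomorphic_on ball 0 (r/4)"
        by (rule holomorphic_on_subset[OF *]) auto
      show "norm (f (a(p := a p + x))) \<le> M" if "norm (0 - x) = r/4" for x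
        using that r by (intro M sh a) auto
    qed (use r in auto)
    then show "norm (pdiff p f a) \<le> fact 1 * M / (r/4) ^ 1" by (simp add: eq)
  next
    fix a b assume a: "a \<in> polydisc C (r/2)" and b: "\<And>q. q \<in> C \<Longrightarrow> b q = a q"
    have "f (b(p := b p + h)) = f (a(p := a p + h))" if "norm h < r/2" for h
      using b p by (intro holo_disc_cong[OF f sh[OF a that]]) auto
    then have "\<forall>\<^sub>F h in nhds 0. f (b(p := b p + h)) = f (a(p := a p + h))"
      using eventually_nhds_in_open[of "ball (0::complex) (r/2)" 0] r by (auto elim!: eventually_mono)
    then show "pdiff p f b = pdiff p f a" unfolding eq by (intro deriv_cong_ev) auto
  next
    fix U and \<gamma> :: "complex \<Rightarrow> pt"
    assume U: "open U" and g: "\<And>q. q \<in> C \<Longrightarrow> (\<lambda>t. \<gamma> t q) holomorphic_on U"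
      and gU: "\<And>t. t \<in> U \<Longrightarrow> \<gamma> t \<in> polydisc C (r/2)"
    show "(\<lambda>t. pdiff p f (\<gamma> t)) holomorphic_on U"
      unfolding eq
    proof (rule deriv_param_holomorphic[where r = "r/2" and M = M, OF U])
      show "(\<lambda>s. f ((\<gamma> s)(p := \<gamma> s p + h))) holomorphic_on U" if "h \<in> ball 0 (r/2)" for h
      proof (rule holo_disc_curve[OF f U])
        show "(\<lambda>t. ((\<gamma> t)(p := \<gamma> t p + h)) q) holomorphic_on U" if "q \<in> C" for q
          using g[OF that] g[OF p] by (cases "q = p") (auto intro!: holomorphic_intros)
      qed (use sh gU that in auto)
    qed (use hol gU M sh r in auto)
  qed
qed

lemma pdiff_commute:
  assumes f: "holo_disc C r f" and a: "a \<in> polydisc C (r/2)" and pq: "p \<in> C" "q \<in> C" and r: "r > 0"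
  shows "pdiff p (pdiff q f) a = pdiff q (pdiff p f) a"
proof (cases "p = q")
  case False
  obtain M where M: "M > 0" "\<And>a. a \<in> polydisc C r \<Longrightarrow> norm (f a) \<le> M" using holo_disc_bound[OF f] by blast
  have ball: "norm s < r" if "s \<in> ball (a u) (r/2)" "u \<in> C" for s u
  proof -
    have "norm s \<le> norm (a u) + norm (s - a u)" by (rule norm_triangle_sub)
    also have "\<dots> < r" using that a by (auto simp: polydisc_def dist_norm norm_minus_commute)
    finally show ?thesis .
  qed
  have aa: "a \<in> polydisc C r" using polydisc_mono[OF a] r by auto
  have mem: "a(p := s, q := t) \<in> polydisc C r" if "s \<in> ball (a p) (r/2)" "t \<in> ball (a q) (r/2)" for s t
    using ball that pq by (intro polydisc_upd aa) auto
  have "deriv (\<lambda>s. deriv (\<lambda>t. f (a(p := s, q := t))) (a q)) (a p)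
      = deriv (\<lambda>t. deriv (\<lambda>s. f (a(p := s, q := t))) (a p)) (a q)"
  proof (rule deriv_param_commute[where r = "r/2" and M = M])
    show "(\<lambda>t. f (a(p := s, q := t))) holomorphic_on ball (a q) (r/2)" if "s \<in> ball (a p) (r/2)" for s
    proof (rule holo_disc_curve[OF f])
      show "(\<lambda>t. (a(p := s, q := t)) u) holomorphic_on ball (a q) (r/2)" for u
        by (cases "u = q") (auto intro: holomorphic_intros)
    qed (use mem that in auto)
    show "(\<lambda>s. f (a(p := s, q := t))) holomorphic_on ball (a p) (r/2)" if "t \<in> ball (a q) (r/2)" for t
    proof (rule holo_disc_curve[OF f])
      show "(\<lambda>s. (a(p := s, q := t)) u) holomorphic_on ball (a p) (r/2)" for u
        by (cases "u = q"; cases "u = p") (auto intro: holomorphic_intros)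
    qed (use mem that in auto)
  qed (use mem M r in auto)
  then show ?thesis
    using False unfolding pdiff_def by (simp add: fun_upd_twist[of p q])
qed simp

lemma holo_germ_pdiff: "holo_germ m f \<Longrightarrow> p \<in> coords m \<Longrightarrow> holo_germ m (pdiff p f)"
  unfolding holo_germ_iff by (meson half_gt_zero holo_disc_pdiff)

lemma near0_pdiff_cong:
  assumes "near0 m (\<lambda>a. f a = g a)"
  shows "near0 m (\<lambda>a. \<forall>p\<in>coords m. pdiff p f a = pdiff p g a)"
proof -
  obtain r where r: "r > 0" "\<And>a. a \<in> polydisc (coords m) r \<Longrightarrow> f a = g a" using assms unfolding near0_iff by blast
  show ?thesis
  proof (rule near0I[OF r(1)], rule ballI)
    fix a p assume a: "a \<in> polydisc (coords m) r" and p: "p \<in> coords m"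
    have "\<forall>\<^sub>F t in nhds (a p). t \<in> ball 0 r"
      using a p by (intro eventually_nhds_in_open) (auto simp: polydisc_def)
    then have "\<forall>\<^sub>F t in nhds (a p). f (a(p := t)) = g (a(p := t))"
      by eventually_elim (auto intro!: r(2) polydisc_upd a)
    then show "pdiff p f a = pdiff p g a" unfolding pdiff_def by (intro deriv_cong_ev) auto
  qed
qed

subsection \<open>Vector fields\<close>

lemma holo_germ_vf_app: "holo_field m V \<Longrightarrow> holo_germ m f \<Longrightarrow> holo_germ m (vf_app m V f)"
  unfolding vf_app_def holo_field_def by (intro holo_germ_sum holo_germ_mult holo_germ_pdiff) auto

lemma vf_app_cong:
  assumes "near0 m (\<lambda>a. f a = g a)"
  shows "near0 m (\<lambda>a. vf_app m V f a = vf_app m V g a)"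
  using near0_pdiff_cong[OF assms] by (rule near0_mono) (simp add: vf_app_def)

lemma vf_app_field_cong:
  assumes "field_eq m V W"
  shows "near0 m (\<lambda>a. \<forall>f. vf_app m V f a = vf_app m W f a)"
  using assms unfolding field_eq_def by (rule near0_mono) (simp add: vf_app_def)

lemma vf_app_mult:
  assumes "holo_germ m f" "holo_germ m g"
  shows "near0 m (\<lambda>a. vf_app m V (\<lambda>a. f a * g a) a = f a * vf_app m V g a + g a * vf_app m V f a)"
proof -
  obtain r where r: "r > 0" "holo_disc (coords m) r f" "holo_disc (coords m) r g"
    using holo_germ_disc2[OF assms] by blast
  show ?thesis
    by (rule near0I[OF r(1)])
      (simp add: vf_app_def pdiff_mult[OF r(2,3)] sum.distrib[symmetric] sum_distrib_left algebra_simps)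
qed

lemma vf_app_add:
  assumes "holo_germ m f" "holo_germ m g"
  shows "near0 m (\<lambda>a. vf_app m V (\<lambda>a. f a + g a) a = vf_app m V f a + vf_app m V g a)"
proof -
  obtain r where r: "r > 0" "holo_disc (coords m) r f" "holo_disc (coords m) r g"
    using holo_germ_disc2[OF assms] by blast
  show ?thesis
    by (rule near0I[OF r(1)])
      (simp add: vf_app_def pdiff_add[OF r(2,3)] sum.distrib[symmetric] sum_distrib_left algebra_simps)
qed

lemma vf_app_sum:
  assumes "finite I" "\<And>i. i \<in> I \<Longrightarrow> holo_germ m (f i)"
  shows "near0 m (\<lambda>a. vf_app m V (\<lambda>a. \<Sum>i\<in>I. f i a) a = (\<Sum>i\<in>I. vf_app m V (f i) a))"
  using assms
proof (induction I rule: finite_induct)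
  case empty
  then show ?case by (intro near0_all) (simp add: vf_app_def pdiff_const)
next
  case (insert i I)
  have "near0 m (\<lambda>a. vf_app m V (\<lambda>a. f i a + (\<Sum>i\<in>I. f i a)) a = vf_app m V (f i) a + vf_app m V (\<lambda>a. \<Sum>i\<in>I. f i a) a)"
    using insert.prems by (intro vf_app_add holo_germ_sum) auto
  from near0_mp[OF this insert.IH] insert show ?case by simp
qed

lemma vf_app_comb:
  "vf_app m (\<lambda>a q. \<Sum>i\<in>I. h i a * b i a q) f a = (\<Sum>i\<in>I. h i a * vf_app m (b i) f a)"
  unfolding vf_app_def sum_distrib_right sum_distrib_left by (subst sum.swap) (simp add: mult.assoc)

lemma holo_field_bracket:
  assumes "holo_field m V" "holo_field m W"
  shows "holo_field m (lie_bracket m V W)"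
  unfolding holo_field_def lie_bracket_def
  using assms by (intro ballI holo_germ_diff holo_germ_vf_app) (auto simp: holo_field_def)

text \<open>The splitting isolates a second-order part that is symmetric in V and W up to the order
  of two partial derivatives; it cancels in the commutator.\<close>

lemma vf_app_vf_app:
  assumes W: "holo_field m W" and f: "holo_germ m f"
  shows "near0 m (\<lambda>a. vf_app m V (vf_app m W f) a =
     (\<Sum>q\<in>coords m. vf_app m V (\<lambda>a. W a q) a * pdiff q f a) +
     (\<Sum>q\<in>coords m. \<Sum>p\<in>coords m. V a p * W a q * pdiff p (pdiff q f) a))"
proof -
  have "near0 m (\<lambda>a. vf_app m V (vf_app m W f) a = (\<Sum>q\<in>coords m. vf_app m V (\<lambda>a. W a q * pdiff q f a) a))"
    unfolding vf_app_def[of m W]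
    by (rule vf_app_sum) (use W f in \<open>auto simp: holo_field_def intro!: holo_germ_mult holo_germ_pdiff\<close>)
  moreover have "near0 m (\<lambda>a. \<forall>q\<in>coords m. vf_app m V (\<lambda>a. W a q * pdiff q f a) a =
      W a q * vf_app m V (pdiff q f) a + pdiff q f a * vf_app m V (\<lambda>a. W a q) a)"
    by (intro near0_ball_finite vf_app_mult) (use W f in \<open>auto simp: holo_field_def intro!: holo_germ_pdiff\<close>)
  ultimately show ?thesis
    by (rule near0_mp) (simp add: vf_app_def[of m V "pdiff _ f"] sum.distrib sum_distrib_left algebra_simps)
qed

lemma vf_app_bracket:
  assumes V: "holo_field m V" and W: "holo_field m W" and f: "holo_germ m f"
  shows "near0 m (\<lambda>a. vf_app m (lie_bracket m V W) f a =
    vf_app m V (vf_app m W f) a - vf_app m W (vf_app m V f) a)"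
proof -
  obtain r where r: "r > 0" "holo_disc (coords m) r f" using f unfolding holo_germ_iff by blast
  have "near0 m (\<lambda>a. \<forall>p\<in>coords m. \<forall>q\<in>coords m. pdiff p (pdiff q f) a = pdiff q (pdiff p f) a)"
    by (rule near0I[of "r/2"]) (use r pdiff_commute in auto)
  note near0_conj[THEN iffD2, OF conjI, OF vf_app_vf_app[OF W f, of V]
      near0_conj[THEN iffD2, OF conjI, OF vf_app_vf_app[OF V f, of W] this]]
  then show ?thesis
  proof (rule near0_mono)
    fix a
    assume *: "vf_app m V (vf_app m W f) a =
        (\<Sum>q\<in>coords m. vf_app m V (\<lambda>a. W a q) a * pdiff q f a) +
        (\<Sum>q\<in>coords m. \<Sum>p\<in>coords m. V a p * W a q * pdiff p (pdiff q f) a) \<and>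
      vf_app m W (vf_app m V f) a =
        (\<Sum>q\<in>coords m. vf_app m W (\<lambda>a. V a q) a * pdiff q f a) +
        (\<Sum>q\<in>coords m. \<Sum>p\<in>coords m. W a p * V a q * pdiff p (pdiff q f) a) \<and>
      (\<forall>p\<in>coords m. \<forall>q\<in>coords m. pdiff p (pdiff q f) a = pdiff q (pdiff p f) a)"
    have "(\<Sum>q\<in>coords m. \<Sum>p\<in>coords m. V a p * W a q * pdiff p (pdiff q f) a)
        = (\<Sum>q\<in>coords m. \<Sum>p\<in>coords m. W a p * V a q * pdiff p (pdiff q f) a)"
      by (subst sum.swap) (use * in \<open>auto intro!: sum.cong\<close>)
    moreover have "vf_app m (lie_bracket m V W) f a =
        (\<Sum>q\<in>coords m. vf_app m V (\<lambda>a. W a q) a * pdiff q f a) -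
        (\<Sum>q\<in>coords m. vf_app m W (\<lambda>a. V a q) a * pdiff q f a)"
    proof -
      have "lie_bracket m V W a q = vf_app m V (\<lambda>a. W a q) a - vf_app m W (\<lambda>a. V a q) a" for q
        by (simp add: lie_bracket_def)
      then show ?thesis
        by (simp only: vf_app_def[of m "lie_bracket m V W"] left_diff_distrib sum_subtractf)
    qed
    ultimately show "vf_app m (lie_bracket m V W) f a =
        vf_app m V (vf_app m W f) a - vf_app m W (vf_app m V f) a"
      using * by simp
  qed
qed

section \<open>Polynomial functions and coprimality along lines\<close>

text \<open>Polynomials are kept as functions closed under the ring operations, so that continuity,
  holomorphy along curves and the chain rule are each one induction, without coefficients.\<close>

inductive pfun :: "'i set \<Rightarrow> (('i \<Rightarrow> complex) \<Rightarrow> complex) \<Rightarrow> bool" for C where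
  pfun_const: "pfun C (\<lambda>_. c)"
| pfun_coord: "p \<in> C \<Longrightarrow> pfun C (\<lambda>a. a p)"
| pfun_add: "pfun C f \<Longrightarrow> pfun C g \<Longrightarrow> pfun C (\<lambda>a. f a + g a)"
| pfun_mult: "pfun C f \<Longrightarrow> pfun C g \<Longrightarrow> pfun C (\<lambda>a. f a * g a)"

lemma pfun_minus: "pfun C f \<Longrightarrow> pfun C (\<lambda>a. - f a)"
  using pfun_mult[OF pfun_const[of C "-1"], of f] by simp

lemma pfun_diff: "pfun C f \<Longrightarrow> pfun C g \<Longrightarrow> pfun C (\<lambda>a. f a - g a)"
  using pfun_add[OF _ pfun_minus, of C f g] by simp

lemma pfun_sum: "(\<And>i. i \<in> I \<Longrightarrow> pfun C (f i)) \<Longrightarrow> pfun C (\<lambda>a. \<Sum>i\<in>I. f i a)"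
  by (induction I rule: infinite_finite_induct) (auto intro: pfun_const pfun_add)

lemma pfun_prod: "(\<And>i. i \<in> I \<Longrightarrow> pfun C (f i)) \<Longrightarrow> pfun C (\<lambda>a. \<Prod>i\<in>I. f i a)"
  by (induction I rule: infinite_finite_induct) (auto intro: pfun_const pfun_mult)

lemma pfun_holo_disc: "pfun C f \<Longrightarrow> holo_disc C r f"
  by (induction rule: pfun.induct) (auto intro: holo_disc_const holo_disc_coord holo_disc_add holo_disc_mult)

lemma pfun_holo_germ: "pfun (coords m) f \<Longrightarrow> holo_germ m f"
  unfolding holo_germ_iff by (intro exI[of _ 1] conjI pfun_holo_disc) simp_all

lemma pfun_tendsto:
  "pfun C f \<Longrightarrow> (\<And>p. p \<in> C \<Longrightarrow> ((\<lambda>t. \<gamma> t p) \<longlongrightarrow> L p) F) \<Longrightarrow> ((\<lambda>t. f (\<gamma> t)) \<longlongrightarrow> f L) F"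
  by (induction rule: pfun.induct) (auto intro!: tendsto_intros)

lemma pfun_curve:
  "pfun C f \<Longrightarrow> (\<And>p. p \<in> C \<Longrightarrow> (\<lambda>t. \<gamma> t p) holomorphic_on U) \<Longrightarrow> (\<lambda>t. f (\<gamma> t)) holomorphic_on U"
  by (induction rule: pfun.induct) (auto intro!: holomorphic_intros)

lemma pfun_has_derivative:
  assumes "pfun C f" "p \<in> C"
  shows "((\<lambda>t. f (a(p := t))) has_field_derivative pdiff p f a) (at (a p))"
proof -
  have "(\<lambda>t. f (a(p := t))) holomorphic_on UNIV"
  proof (rule pfun_curve[OF assms(1)])
    show "(\<lambda>t. (a(p := t)) q) holomorphic_on UNIV" for q
      by (cases "q = p") (auto intro: holomorphic_intros)
  qed
  then show ?thesis unfolding pdiff_def by (rule holomorphic_derivI) auto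
qed

definition dfun :: "(nat \<times> nat) set \<Rightarrow> (pt \<Rightarrow> complex) \<Rightarrow> pt \<Rightarrow> pt \<Rightarrow> complex" where
  "dfun C f a v = (\<Sum>p\<in>C. v p * pdiff p f a)"

text \<open>This identifies the coordinate expression for a derivation with a one-variable
  derivative, so that the derivative of a determinant or Pfaffian can be read off from its values on
  a line.\<close>

lemma pfun_chain_rule:
  assumes "finite C" "pfun C f"
  shows "((\<lambda>t. f (\<lambda>p. a p + t * v p)) has_field_derivative dfun C f a v) (at 0)"
  using assms(2)
proof (induction rule: pfun.induct)
  case (pfun_const c)
  then show ?case by (simp add: dfun_def pdiff_const)
next
  case (pfun_coord p)
  have "dfun C (\<lambda>a. a p) a v = v p"
    using assms(1) pfun_coord by (simp add: dfun_def pdiff_coord sum.delta if_distrib cong: if_cong)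
  then show ?case by (auto intro!: derivative_eq_intros)
next
  case (pfun_add f g)
  have "dfun C (\<lambda>a. f a + g a) a v = dfun C f a v + dfun C g a v"
  proof -
    have "pdiff p (\<lambda>a. f a + g a) a = pdiff p f a + pdiff p g a" if "p \<in> C" for p
      by (intro pdiff_eqI DERIV_add pfun_has_derivative[OF pfun_add.hyps(1) that] pfun_has_derivative[OF pfun_add.hyps(2) that])
    then show ?thesis by (simp add: dfun_def sum.distrib[symmetric] distrib_left)
  qed
  with pfun_add.IH show ?case by (auto intro!: DERIV_add)
next
  case (pfun_mult f g)
  have "dfun C (\<lambda>a. f a * g a) a v = dfun C f a v * g a + dfun C g a v * f a"
  proof -
    have "pdiff p (\<lambda>a. f a * g a) a = pdiff p f a * g a + pdiff p g a * f a" if "p \<in> C" for p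
      using DERIV_mult[OF pfun_has_derivative[OF pfun_mult.hyps(1) that, of a] pfun_has_derivative[OF pfun_mult.hyps(2) that, of a]]
      by (intro pdiff_eqI) simp
    then show ?thesis by (simp add: dfun_def sum.distrib[symmetric] sum_distrib_right distrib_left mult.assoc)
  qed
  with DERIV_mult[OF pfun_mult.IH] show ?case by simp
qed

section \<open>Homogeneous polynomials on lines and coprimality\<close>

definition homogeneous :: "nat \<Rightarrow> (('i \<Rightarrow> complex) \<Rightarrow> complex) \<Rightarrow> bool" where
  "homogeneous d f \<longleftrightarrow> (\<forall>a t. f (\<lambda>p. t * a p) = t ^ d * f a)"

definition on_line :: "('i \<Rightarrow> complex) \<Rightarrow> ('i \<Rightarrow> complex) \<Rightarrow> complex \<Rightarrow> 'i \<Rightarrow> complex" where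
  "on_line e a t = (\<lambda>p. a p + t * e p)"

lemma pfun_on_line: "pfun C f \<Longrightarrow> (\<lambda>t. f (on_line e a t)) holomorphic_on U"
  unfolding on_line_def by (rule pfun_curve[where \<gamma> = "\<lambda>t p. a p + t * e p"]) (auto intro!: holomorphic_intros)

lemma finite_zeros_cball:
  assumes "F holomorphic_on UNIV" "F t0 \<noteq> 0"
  shows "finite {t \<in> cball 0 R. F t = (0 :: complex)}"
proof (cases "F constant_on UNIV")
  case True
  then obtain y where "\<And>t. F t = y" unfolding constant_on_def by blast
  then show ?thesis using assms(2) by simp
next
  case False
  then show ?thesis by (intro holomorphic_compact_finite_zeros[OF assms(1)]) auto
qed

text \<open>Far out on the line the direction dominates: f (a + t e) = t^d f (a / t + e), and the
  second factor tends to f e. The proof uses s = 1 / t.\<close>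

lemma homogeneous_on_line_nonzero:
  assumes f: "pfun C f" and d: "homogeneous d f" and e: "f e \<noteq> 0"
  shows "\<exists>t. f (on_line e a t) \<noteq> 0"
proof -
  have "((\<lambda>s. f (\<lambda>p. s * a p + e p)) \<longlongrightarrow> f (\<lambda>p. 0 * a p + e p)) (at 0)"
    by (rule pfun_tendsto[OF f]) (intro tendsto_intros)
  then have "\<forall>\<^sub>F s in at 0. f (\<lambda>p. s * a p + e p) \<noteq> 0"
    using e by (intro tendsto_imp_eventually_ne) auto
  moreover have "\<forall>\<^sub>F s in at (0::complex). s \<noteq> 0" by (simp add: eventually_at_filter)
  ultimately have "\<forall>\<^sub>F s in at (0::complex). s \<noteq> 0 \<and> f (\<lambda>p. s * a p + e p) \<noteq> 0" by eventually_elim simp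
  then obtain s where s: "s \<noteq> 0" "f (\<lambda>p. s * a p + e p) \<noteq> 0"
    using eventually_happens trivial_limit_at by blast
  have "(\<lambda>p. s * a p + e p) = (\<lambda>p. s * on_line e a (1/s) p)" using s by (auto simp: on_line_def field_simps)
  with s d have "f (on_line e a (1/s)) \<noteq> 0" unfolding homogeneous_def by auto
  then show ?thesis ..
qed

lemma homogeneous_finite_zeros:
  assumes "pfun C f" "homogeneous d f" "f e \<noteq> 0"
  shows "finite {t \<in> cball 0 R. f (on_line e a t) = 0}"
  using homogeneous_on_line_nonzero[OF assms] finite_zeros_cball[OF pfun_on_line[OF assms(1)]] by blast

text \<open>Arbitrarily small translates of every line in direction \<open>e\<close> avoid the common zeros of
  \<open>f\<close> and \<open>g\<close> inside any given disc; for polynomials that are regular in the direction \<open>e\<close>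
  this says that they have no common factor.\<close>

definition coprime_lines :: "('i \<Rightarrow> complex) \<Rightarrow> (('i \<Rightarrow> complex) \<Rightarrow> complex) \<Rightarrow> (('i \<Rightarrow> complex) \<Rightarrow> complex) \<Rightarrow> bool" where
  "coprime_lines e f g \<longleftrightarrow> (\<forall>R a \<epsilon>. \<epsilon> > 0 \<longrightarrow> (\<exists>b. (\<forall>p. norm (b p - a p) < \<epsilon>) \<and>
     (\<forall>t\<in>cball 0 R. \<not> (f (on_line e b t) = 0 \<and> g (on_line e b t) = 0))))"

lemma coprime_lines_sym: "coprime_lines e f g \<Longrightarrow> coprime_lines e g f"
  unfolding coprime_lines_def by (simp add: conj_commute)

lemma coprime_lines_nonzero: "(\<And>a. g a \<noteq> 0) \<Longrightarrow> coprime_lines e f g"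
  unfolding coprime_lines_def by (metis diff_self norm_zero)

text \<open>Moving the coordinate z changes neither f nor its finitely many zeros on a line, but
  shifts F at each of them by s times the nonzero value of G. So only finitely many shifts s are
  bad. Every coprimality statement about the factors is obtained by iterating this step.\<close>

lemma coprime_lines_affine:
  assumes f: "pfun C f" "homogeneous d f" "f e \<noteq> 0"
    and fz: "\<And>a s. f (a(z := s)) = f a"
    and Fz: "\<And>a s. F (a(z := s)) = F a + (s - a z) * G a"
    and cop: "coprime_lines e f G"
  shows "coprime_lines e f F"
  unfolding coprime_lines_def
proof (intro allI impI)
  fix R :: real and a :: "'a \<Rightarrow> complex" and \<epsilon> :: real assume \<epsilon>: "\<epsilon> > 0"
  then have "\<epsilon>/2 > 0" by simp
  with cop obtain b where b: "\<And>p. norm (b p - a p) < \<epsilon>/2"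
    and bz: "\<And>t. t \<in> cball 0 R \<Longrightarrow> \<not> (f (on_line e b t) = 0 \<and> G (on_line e b t) = 0)"
    unfolding coprime_lines_def by blast
  define T where "T = {t \<in> cball 0 R. f (on_line e b t) = 0}"
  have "finite T" unfolding T_def by (rule homogeneous_finite_zeros[OF f])
  then have fin: "finite ((\<lambda>t. - F (on_line e b t) / G (on_line e b t)) ` T)" by simp
  have "infinite (ball (0::complex) (\<epsilon>/2))" using \<epsilon> by (intro uncountable_infinite uncountable_ball) simp
  then obtain s where s: "norm s < \<epsilon>/2" "s \<notin> (\<lambda>t. - F (on_line e b t) / G (on_line e b t)) ` T"
    using fin by (metis (no_types, lifting) finite_subset mem_ball_0 subsetI)
  define b' where "b' = b(z := b z + s)"
  have eq: "on_line e b' t = (on_line e b t)(z := on_line e b t z + s)" for t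
    by (auto simp: on_line_def b'_def fun_eq_iff)
  show "\<exists>b. (\<forall>p. norm (b p - a p) < \<epsilon>) \<and>
     (\<forall>t\<in>cball 0 R. \<not> (f (on_line e b t) = 0 \<and> F (on_line e b t) = 0))"
  proof (intro exI[of _ b'] conjI allI ballI notI)
    fix p
    have "norm (b' p - a p) \<le> norm (b p - a p) + norm s"
      using norm_triangle_ineq[of "b p - a p" s] by (auto simp: b'_def algebra_simps)
    then show "norm (b' p - a p) < \<epsilon>" using b[of p] s by linarith
  next
    fix t assume t: "t \<in> cball 0 R" and z: "f (on_line e b' t) = 0 \<and> F (on_line e b' t) = 0"
    then have "t \<in> T" "F (on_line e b t) + s * G (on_line e b t) = 0"
      unfolding eq fz Fz T_def by auto
    moreover have "G (on_line e b t) \<noteq> 0" using bz[OF t] \<open>t \<in> T\<close> by (auto simp: T_def)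
    ultimately have "s = - F (on_line e b t) / G (on_line e b t)"
      by (simp add: field_simps add_eq_0_iff)
    with s \<open>t \<in> T\<close> show False by blast
  qed
qed

text \<open>By compactness |f| + |g| has a positive minimum on the disc, and by the Lipschitz
  estimates a small translation of the line cannot lower it to 0.\<close>

lemma no_common_zeros_open:
  assumes C: "finite C" and f: "pfun C f" and g: "pfun C g"
    and nz: "\<And>t. t \<in> cball 0 R \<Longrightarrow> \<not> (f (on_line e b t) = 0 \<and> g (on_line e b t) = 0)"
  shows "\<exists>\<eta>>0. \<forall>b'. (\<forall>p\<in>C. norm (b' p - b p) < \<eta>) \<longrightarrow>
    (\<forall>t\<in>cball 0 R. \<not> (f (on_line e b' t) = 0 \<and> g (on_line e b' t) = 0))"
proof (cases "R \<ge> 0")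
  case False
  then show ?thesis by (intro exI[of _ 1]) auto
next
  case True
  define h where "h t = norm (f (on_line e b t)) + norm (g (on_line e b t))" for t
  have "continuous_on (cball 0 R) h"
    unfolding h_def by (intro continuous_intros holomorphic_on_imp_continuous_on pfun_on_line[OF f] pfun_on_line[OF g])
  then obtain t0 where t0: "t0 \<in> cball 0 R" "\<And>t. t \<in> cball 0 R \<Longrightarrow> h t0 \<le> h t"
    using continuous_attains_inf[of "cball 0 R" h] True by auto
  define \<mu> where "\<mu> = h t0"
  have \<mu>: "\<mu> > 0" using nz[OF t0(1)] unfolding \<mu>_def h_def
    by (auto simp: add_pos_nonneg add_nonneg_pos)
  define B where "B = (\<Sum>p\<in>C. norm (b p) + R * norm (e p)) + 2"
  have B: "norm (b p) + R * norm (e p) + 1 < B" if "p \<in> C" for p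
    using member_le_sum[OF that, of "\<lambda>p. norm (b p) + R * norm (e p)"] C True unfolding B_def by auto
  have "B > 0" unfolding B_def using True by (intro add_nonneg_pos sum_nonneg) auto
  then have B2: "2 * B > 0" by simp
  obtain K where K: "K > 0" "\<And>x y d. x \<in> polydisc C (2*B/2) \<Longrightarrow> y \<in> polydisc C (2*B/2) \<Longrightarrow>
    (\<And>p. p \<in> C \<Longrightarrow> norm (y p - x p) \<le> d) \<Longrightarrow> d \<ge> 0 \<Longrightarrow> norm (f y - f x) \<le> K * d"
    using holo_disc_lipschitz[OF pfun_holo_disc[OF f] B2] by metis
  obtain L where L: "L > 0" "\<And>x y d. x \<in> polydisc C (2*B/2) \<Longrightarrow> y \<in> polydisc C (2*B/2) \<Longrightarrow>
    (\<And>p. p \<in> C \<Longrightarrow> norm (y p - x p) \<le> d) \<Longrightarrow> d \<ge> 0 \<Longrightarrow> norm (g y - g x) \<le> L * d"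
    using holo_disc_lipschitz[OF pfun_holo_disc[OF g] B2] by metis
  define \<eta> where "\<eta> = min 1 (\<mu> / (2 * (K + L)))"
  have \<eta>: "\<eta> > 0" "\<eta> \<le> 1" unfolding \<eta>_def using \<mu> K L by auto
  have "(K + L) * \<eta> \<le> (K + L) * (\<mu> / (2 * (K + L)))" unfolding \<eta>_def using K L by (intro mult_left_mono) auto
  also have "\<dots> = \<mu> / 2" using K L by (simp add: field_simps)
  finally have KL: "(K + L) * \<eta> < \<mu>" using \<mu> by simp
  have mem: "on_line e b' t \<in> polydisc C (2*B/2)"
    if "\<forall>p\<in>C. norm (b' p - b p) \<le> 1" "t \<in> cball 0 R" for b' t
    unfolding polydisc_def
  proof safe
    fix p assume p: "p \<in> C"
    have "norm (on_line e b' t p) \<le> norm (b' p) + norm t * norm (e p)"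
      unfolding on_line_def using norm_triangle_ineq[of "b' p" "t * e p"] by (simp add: norm_mult)
    also have "\<dots> \<le> norm (b p) + 1 + R * norm (e p)"
      using that p norm_triangle_sub[of "b' p" "b p"] by (intro add_mono mult_right_mono) force+
    finally show "norm (on_line e b' t p) < 2*B/2" using B[OF p] by simp
  qed
  show ?thesis
  proof (intro exI[of _ \<eta>] conjI allI impI ballI notI)
    fix b' t assume b': "\<forall>p\<in>C. norm (b' p - b p) < \<eta>" and t: "t \<in> cball 0 R"
      and z: "f (on_line e b' t) = 0 \<and> g (on_line e b' t) = 0"
    have m1: "on_line e b' t \<in> polydisc C (2*B/2)" and m2: "on_line e b t \<in> polydisc C (2*B/2)"
    proof -
      have "\<forall>p\<in>C. norm (b' p - b p) \<le> 1" using b' \<eta> by fastforce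
      then show "on_line e b' t \<in> polydisc C (2*B/2)" by (rule mem[OF _ t])
      show "on_line e b t \<in> polydisc C (2*B/2)" by (rule mem[OF _ t]) simp
    qed
    have d: "norm (on_line e b t p - on_line e b' t p) \<le> \<eta>" if "p \<in> C" for p
      using b' that by (simp add: on_line_def norm_minus_commute less_imp_le)
    have "norm (f (on_line e b t)) \<le> K * \<eta>" "norm (g (on_line e b t)) \<le> L * \<eta>"
      using K(2)[OF m1 m2 d] L(2)[OF m1 m2 d] z \<eta>(1) by auto
    then have "h t \<le> (K + L) * \<eta>" unfolding h_def by (simp add: distrib_right)
    with t0(2)[OF t] KL show False unfolding \<mu>_def by simp
  qed (rule \<eta>)
qed

text \<open>The translates for the single members are performed in succession, each so small that
  what has been achieved before survives; the radius \<open>\<eta>\<close> is part of the statement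
  to make this induction possible.\<close>

lemma coprime_lines_family:
  assumes C: "finite C" and f: "pfun C f" and "finite \<Phi>"
    and "\<And>\<phi>. \<phi> \<in> \<Phi> \<Longrightarrow> pfun C \<phi>" "\<And>\<phi>. \<phi> \<in> \<Phi> \<Longrightarrow> coprime_lines e f \<phi>" and "\<epsilon> > 0"
  shows "\<exists>b \<eta>. \<eta> > 0 \<and> (\<forall>p. norm (b p - a p) < \<epsilon>) \<and>
    (\<forall>b'. (\<forall>p\<in>C. norm (b' p - b p) < \<eta>) \<longrightarrow>
      (\<forall>\<phi>\<in>\<Phi>. \<forall>t\<in>cball 0 R. \<not> (f (on_line e b' t) = 0 \<and> \<phi> (on_line e b' t) = 0)))"
  using assms(3-6)
proof (induction \<Phi> arbitrary: \<epsilon> rule: finite_induct)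
  case empty
  then show ?case by (intro exI[of _ a] exI[of _ 1]) auto
next
  case (insert \<phi> \<Phi>)
  then obtain b \<eta> where b: "\<eta> > 0" "\<And>p. norm (b p - a p) < \<epsilon>/2"
    "\<And>b'. (\<forall>p\<in>C. norm (b' p - b p) < \<eta>) \<Longrightarrow>
      (\<forall>\<phi>\<in>\<Phi>. \<forall>t\<in>cball 0 R. \<not> (f (on_line e b' t) = 0 \<and> \<phi> (on_line e b' t) = 0))"
    using insert.IH[of "\<epsilon>/2"] by (auto simp: half_gt_zero)
  have "min (\<eta>/2) (\<epsilon>/2) > 0" using b insert.prems by simp
  moreover have "coprime_lines e f \<phi>" using insert.prems by simp
  ultimately obtain c where c: "\<And>p. norm (c p - b p) < min (\<eta>/2) (\<epsilon>/2)"
    "\<And>t. t \<in> cball 0 R \<Longrightarrow> \<not> (f (on_line e c t) = 0 \<and> \<phi> (on_line e c t) = 0)"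
    unfolding coprime_lines_def by blast
  from no_common_zeros_open[OF C f _ c(2)] insert.prems obtain \<eta>' where \<eta>': "\<eta>' > 0"
    "\<And>b'. (\<forall>p\<in>C. norm (b' p - c p) < \<eta>') \<Longrightarrow>
      (\<forall>t\<in>cball 0 R. \<not> (f (on_line e b' t) = 0 \<and> \<phi> (on_line e b' t) = 0))" by blast
  show ?case
  proof (intro exI[of _ c] exI[of _ "min \<eta>' (\<eta>/2)"] conjI allI impI)
    show "norm (c p - a p) < \<epsilon>" for p
      using c(1)[of p] b(2)[of p] norm_triangle_ineq[of "c p - b p" "b p - a p"] by simp
    fix b' assume b': "\<forall>p\<in>C. norm (b' p - c p) < min \<eta>' (\<eta>/2)"
    have "\<forall>p\<in>C. norm (b' p - b p) < \<eta>"
    proof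
      fix p assume "p \<in> C"
      then show "norm (b' p - b p) < \<eta>"
        using b' c(1)[of p] norm_triangle_ineq[of "b' p - c p" "c p - b p"] by fastforce
    qed
    with b(3) \<eta>'(2) b' show "\<forall>\<phi>\<in>insert \<phi> \<Phi>. \<forall>t\<in>cball 0 R. \<not> (f (on_line e b' t) = 0 \<and> \<phi> (on_line e b' t) = 0)"
      by simp
  qed (use b \<eta>' in auto)
qed

section \<open>Division by an affine polynomial\<close>

text \<open>Riemann sums of a function holomorphic in a parameter are visibly holomorphic; an error
  bound governed by L alone lets this property pass to the integral by uniform convergence.\<close>

lemma riemann_sum_error:
  fixes F :: "real \<Rightarrow> complex" and N :: nat
  assumes lip: "\<And>x y. x \<in> {0..1} \<Longrightarrow> y \<in> {0..1} \<Longrightarrow> norm (F x - F y) \<le> L * \<bar>x - y\<bar>" and N: "N > 0"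
  shows "norm (integral {0..1} F - (\<Sum>j<N. F (real j / real N)) / of_nat N) \<le> L / real N"
proof -
  have L: "L \<ge> 0" using order_trans[OF norm_ge_zero lip[of 1 0]] by simp
  have cont: "continuous_on {0..1} F"
  proof (rule lipschitz_on_continuous_on[of L])
    show "L-lipschitz_on {0..1} F"
      using lip L by (intro lipschitz_onI) (auto simp: dist_norm)
  qed
  have sub: "{x..y} \<subseteq> {0..1}" if "0 \<le> x" "y \<le> 1" for x y :: real using that by auto
  have int: "F integrable_on {x..y}" if "0 \<le> x" "y \<le> 1" for x y
    by (rule integrable_continuous_real, rule continuous_on_subset[OF cont sub[OF that]])
  have step: "norm (integral {real k / real N .. real (Suc k) / real N} F - F (real k / real N) / of_nat N) \<le> L / real N * (1 / real N)" if k: "k < N" for k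
  proof -
    have le: "real k / real N \<le> real (Suc k) / real N" "real (Suc k) / real N \<le> 1" "0 \<le> real k / real N" using k N by (auto simp: field_simps)
    have w: "real (Suc k) / real N - real k / real N = 1 / real N" using N by (simp add: field_simps)
    have "integral {real k / real N .. real (Suc k) / real N} F - F (real k / real N) / of_nat N
        = integral {real k / real N .. real (Suc k) / real N} (\<lambda>x. F x - F (real k / real N))"
    proof -
      have "integral {real k / real N .. real (Suc k) / real N} (\<lambda>x. F (real k / real N)) = F (real k / real N) / of_nat N"
        using w le(1) by (simp add: scaleR_conv_of_real field_simps)
      then show ?thesis by (subst integral_diff) (simp_all only: int[OF le(3,2)] integrable_const_ivl)
    qed
    also have "norm \<dots> \<le> L / real N * (real (Suc k) / real N - real k / real N)"
    proof (rule integral_bound)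
      show "continuous_on {real k / real N .. real (Suc k) / real N} (\<lambda>x. F x - F (real k / real N))"
        by (intro continuous_intros continuous_on_subset[OF cont sub] le)
      fix x assume x: "x \<in> {real k / real N .. real (Suc k) / real N}"
      then have "0 \<le> x" "x \<le> 1" using le by (meson atLeastAtMost_iff order_trans)+
      then have "norm (F x - F (real k / real N)) \<le> L * \<bar>x - real k / real N\<bar>" using le by (intro lip) auto
      also have "\<dots> \<le> L * (1 / real N)" using x w L by (intro mult_left_mono) (auto simp: abs_le_iff)
      finally show "norm (F x - F (real k / real N)) \<le> L / real N" by simp
    qed (rule le)
    finally show ?thesis using w by simp
  qed
  have "norm (integral {0..real k / real N} F - (\<Sum>j<k. F (real j / real N)) / of_nat N) \<le> real k * (L / real N * (1 / real N))" if "k \<le> N" for k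
    using that
  proof (induction k)
    case 0
    then show ?case by simp
  next
    case (Suc k)
    have "integral {0..real k / real N} F + integral {real k / real N..real (Suc k) / real N} F = integral {0..real (Suc k) / real N} F"
      using Suc.prems N by (intro Henstock_Kurzweil_Integration.integral_combine int) (auto simp: field_simps)
    then have "integral {0..real (Suc k) / real N} F - (\<Sum>j<Suc k. F (real j / real N)) / N
      = (integral {0..real k / real N} F - (\<Sum>j<k. F (real j / real N)) / of_nat N)
        + (integral {real k / real N..real (Suc k) / real N} F - F (real k / real N) / of_nat N)"
      by (simp add: add_divide_distrib algebra_simps)
    also have "norm \<dots> \<le> real k * (L / real N * (1 / real N)) + L / real N * (1 / real N)"
      using Suc.IH Suc.prems step[of k] by (intro norm_triangle_mono) auto
    finally show ?case by (simp add: distrib_right add_divide_distrib)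
  qed
  from this[of N] show ?thesis using N by simp
qed

lemma mean_value_circle:
  assumes hol: "F holomorphic_on ball 0 r" and R: "0 < R" "R < r"
  shows "integral {0..1} (\<lambda>x. F (of_real R * exp (2 * of_real pi * \<i> * of_real x))) = F 0"
proof -
  have "F holomorphic_on cball 0 R" by (rule holomorphic_on_subset[OF hol]) (use R in auto)
  then have "((\<lambda>u. F u / (u - 0)) has_contour_integral (2 * of_real pi * \<i> * F 0)) (circlepath 0 R)"
    using R by (intro Cauchy_integral_circlepath_simple) auto
  then have "((\<lambda>x. F (circlepath 0 R x) / circlepath 0 R x * vector_derivative (circlepath 0 R) (at x))
     has_integral 2 * of_real pi * \<i> * F 0) {0..1}"
    unfolding has_contour_integral by simp
  also have "(\<lambda>x. F (circlepath 0 R x) / circlepath 0 R x * vector_derivative (circlepath 0 R) (at x))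
      = (\<lambda>x. 2 * of_real pi * \<i> * F (of_real R * exp (2 * of_real pi * \<i> * of_real x)))"
    using R by (simp only: vector_derivative_circlepath) (auto simp: circlepath fun_eq_iff)
  finally have "((\<lambda>x. 2 * of_real pi * \<i> * F (of_real R * exp (2 * of_real pi * \<i> * of_real x)))
     has_integral 2 * of_real pi * \<i> * F 0) {0..1}" .
  then have "((\<lambda>x. 1 / (2 * of_real pi * \<i>) * (2 * of_real pi * \<i> * F (of_real R * exp (2 * of_real pi * \<i> * of_real x))))
     has_integral 1 / (2 * of_real pi * \<i>) * (2 * of_real pi * \<i> * F 0)) {0..1}"
    by (rule has_integral_mult_right)
  then show ?thesis by (simp add: integral_unique)
qed

text \<open>Riemann's removable singularity theorem, applied to one point of K at a time.\<close>

lemma holomorphic_extend_finite: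
  assumes "finite K" "open S" "\<phi> holomorphic_on S - K"
    and "\<And>z. z \<in> K \<Longrightarrow> z \<in> S \<Longrightarrow> \<exists>B. \<forall>\<^sub>F t in at z. norm (\<phi> t) \<le> B"
  shows "\<exists>F. F holomorphic_on S \<and> (\<forall>t\<in>S - K. F t = \<phi> t)"
  using assms(1,3,4)
proof (induction K arbitrary: \<phi> rule: finite_induct)
  case empty
  then show ?case by auto
next
  case (insert k K)
  show ?case
  proof (cases "k \<in> S")
    case False
    then have "S - insert k K = S - K" by auto
    with insert.IH[of \<phi>] insert.prems show ?thesis by auto
  next
    case True
    have op: "open (S - K)" using assms(2) insert.hyps(1) by (intro open_Diff finite_imp_closed)
    have k: "k \<in> interior (S - K)" using True insert.hyps(2) interior_open[OF op] by auto
    have "S - insert k K = S - K - {k}" by auto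
    then have "\<phi> holomorphic_on (S - K) - {k}" using insert.prems by simp
    from holomorphic_on_extend_bounded[OF this k] insert.prems(2)[of k] True
    obtain \<psi> where \<psi>: "\<psi> holomorphic_on S - K" "\<And>z. z \<in> S - K - {k} \<Longrightarrow> \<psi> z = \<phi> z" by auto
    have "\<exists>B. \<forall>\<^sub>F t in at z. norm (\<psi> t) \<le> B" if z: "z \<in> K" "z \<in> S" for z
    proof -
      from insert.prems(2)[of z] z obtain B where B: "\<forall>\<^sub>F t in at z. norm (\<phi> t) \<le> B" by auto
      have "open (S - {k} - (K - {z}))" "z \<in> S - {k} - (K - {z})"
        using assms(2) insert.hyps z by (auto intro!: open_Diff finite_imp_closed)
      then have "\<forall>\<^sub>F t in at z. t \<in> S - {k} - (K - {z}) - {z}"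
        using eventually_at_in_open by blast
      with B have "\<forall>\<^sub>F t in at z. norm (\<psi> t) \<le> B"
        by eventually_elim (use \<psi>(2) in auto)
      then show ?thesis ..
    qed
    from insert.IH[OF \<psi>(1) this] obtain F where "F holomorphic_on S" "\<forall>t\<in>S - K. F t = \<psi> t" by blast
    then show ?thesis using \<psi>(2) by (intro exI[of _ F]) auto
  qed
qed

section \<open>Means over circles and the division theorem\<close>

definition unit_circle_point :: "real \<Rightarrow> complex" where
  "unit_circle_point x = exp (2 * of_real pi * \<i> * of_real x)"

lemma norm_unit_circle_point [simp]: "norm (unit_circle_point x) = 1"
  by (simp add: unit_circle_point_def)

lemma unit_circle_point_lipschitz: "norm (unit_circle_point x - unit_circle_point y) \<le> 2 * pi * \<bar>x - y\<bar>"
proof -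
  have "unit_circle_point x - unit_circle_point y = unit_circle_point y * (exp (\<i> * of_real (2 * pi * (x - y))) - 1)"
    unfolding unit_circle_point_def right_diff_distrib exp_add[symmetric] by (simp add: algebra_simps)
  then have "norm (unit_circle_point x - unit_circle_point y) = norm (exp (\<i> * of_real (2 * pi * (x - y))) - 1)"
    by (simp add: norm_mult)
  also have "\<dots> = 2 * \<bar>sin (2 * pi * (x - y) / 2)\<bar>" by (rule dist_exp_i_1)
  also have "\<dots> \<le> 2 * \<bar>2 * pi * (x - y) / 2\<bar>" by (intro mult_left_mono abs_sin_x_le_abs_x) auto
  also have "\<dots> = 2 * pi * \<bar>x - y\<bar>" by (simp add: abs_mult)
  finally show ?thesis .
qed

text \<open>For h = g / f this is the Cauchy integral that yields the quotient: with t = R exp (2 pi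
  i x) one has dt / t = 2 pi i dx, so the kernel disappears and a mean over x remains.\<close>

definition circle_mean :: "('i \<Rightarrow> complex) \<Rightarrow> real \<Rightarrow> (('i \<Rightarrow> complex) \<Rightarrow> complex) \<Rightarrow> ('i \<Rightarrow> complex) \<Rightarrow> complex" where
  "circle_mean e R h a = integral {0..1} (\<lambda>x. h (on_line e a (of_real R * unit_circle_point x)))"

lemma on_line_polydisc:
  assumes "a \<in> polydisc C \<delta>" "\<And>p. p \<in> C \<Longrightarrow> norm (e p) \<le> 1" "norm t \<le> R"
  shows "on_line e a t \<in> polydisc C (\<delta> + R)"
  unfolding polydisc_def
proof safe
  fix p assume p: "p \<in> C"
  have "norm (on_line e a t p) \<le> norm (a p) + norm t * norm (e p)"
    unfolding on_line_def using norm_triangle_ineq[of "a p" "t * e p"] by (simp add: norm_mult)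
  also have "norm t * norm (e p) \<le> R * 1" using assms(2)[OF p] assms(3) order_trans[OF norm_ge_zero assms(3)] by (intro mult_mono) auto
  also have "norm (a p) < \<delta>" using assms p by (auto simp: polydisc_def)
  finally show "norm (on_line e a t p) < \<delta> + R" by simp
qed

text \<open>The lower bound c for f on the circles makes the integrand Lipschitz in the angle with
  one constant for all base points. Hence the Riemann sums converge uniformly, and the limit is
  holomorphic along every curve.\<close>

lemma circle_mean_holo_disc:
  assumes f: "holo_disc C r f" and g: "holo_disc C r g" and r: "r > 0"
    and e: "\<And>p. p \<in> C \<Longrightarrow> norm (e p) \<le> 1" and R: "R > 0" "\<delta> + R \<le> r/2"
    and c: "c > 0" "\<And>a t. a \<in> polydisc C \<delta> \<Longrightarrow> norm t = R \<Longrightarrow> norm (f (on_line e a t)) \<ge> c"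
  shows "holo_disc C \<delta> (circle_mean e R (\<lambda>a. g a / f a))"
proof -
  obtain Mf where Mf: "Mf > 0" "\<And>a. a \<in> polydisc C r \<Longrightarrow> norm (f a) \<le> Mf" using holo_disc_bound[OF f] by blast
  obtain Mg where Mg: "Mg > 0" "\<And>a. a \<in> polydisc C r \<Longrightarrow> norm (g a) \<le> Mg" using holo_disc_bound[OF g] by blast
  obtain K where K: "K > 0" "\<And>x y d. x \<in> polydisc C (r/2) \<Longrightarrow> y \<in> polydisc C (r/2) \<Longrightarrow>
    (\<And>p. p \<in> C \<Longrightarrow> norm (y p - x p) \<le> d) \<Longrightarrow> d \<ge> 0 \<Longrightarrow> norm (f y - f x) \<le> K * d"
    using holo_disc_lipschitz[OF f r] by metis
  obtain H where H: "H > 0" "\<And>x y d. x \<in> polydisc C (r/2) \<Longrightarrow> y \<in> polydisc C (r/2) \<Longrightarrow>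
    (\<And>p. p \<in> C \<Longrightarrow> norm (y p - x p) \<le> d) \<Longrightarrow> d \<ge> 0 \<Longrightarrow> norm (g y - g x) \<le> H * d"
    using holo_disc_lipschitz[OF g r] by metis
  have mem: "on_line e a t \<in> polydisc C (r/2)" if "a \<in> polydisc C \<delta>" "norm t = R" for a t
    by (rule polydisc_mono[OF on_line_polydisc[OF that(1) e] R(2)]) (use that in auto)
  have mem': "on_line e a t \<in> polydisc C r" if "a \<in> polydisc C \<delta>" "norm t = R" for a t
    using mem[OF that] r by (auto elim: polydisc_mono)
  define z where "z x = of_real R * unit_circle_point x" for x
  have nz: "norm (z x) = R" for x using R by (simp add: z_def norm_mult)
  define F where "F a x = g (on_line e a (z x)) / f (on_line e a (z x))" for a x
  define L where "L = (H * Mf + Mg * K) / c ^ 2 * (R * (2 * pi))"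
  have quot: "norm (g1 / f1 - g2 / f2) \<le> (H * Mf + Mg * K) / c ^ 2 * d"
    if "norm (g1 - g2) \<le> H * d" "norm (f1 - f2) \<le> K * d" "norm f2 \<le> Mf" "norm g2 \<le> Mg"
      "c \<le> norm f1" "c \<le> norm f2" "d \<ge> 0" for f1 f2 g1 g2 :: complex and d
  proof -
    have n: "f1 \<noteq> 0" "f2 \<noteq> 0" using that c by auto
    then have "g1 / f1 - g2 / f2 = ((g1 - g2) * f2 - g2 * (f1 - f2)) / (f1 * f2)" by (simp add: field_simps)
    also have "norm \<dots> = norm ((g1 - g2) * f2 - g2 * (f1 - f2)) / (norm f1 * norm f2)"
      by (simp add: norm_divide norm_mult)
    also have "\<dots> \<le> ((H * d) * Mf + Mg * (K * d)) / (c * c)"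
    proof (rule frac_le)
      have "norm ((g1 - g2) * f2 - g2 * (f1 - f2)) \<le> norm (g1 - g2) * norm f2 + norm g2 * norm (f1 - f2)"
        unfolding norm_mult[symmetric] by (rule norm_triangle_ineq4)
      also have "\<dots> \<le> (H * d) * Mf + Mg * (K * d)"
        using that H K Mf Mg by (intro add_mono mult_mono) auto
      finally show "norm ((g1 - g2) * f2 - g2 * (f1 - f2)) \<le> (H * d) * Mf + Mg * (K * d)" .
      show "c * c \<le> norm f1 * norm f2" using that c by (intro mult_mono) auto
    qed (use that c H K Mf Mg in auto)
    finally show ?thesis by (simp add: power2_eq_square algebra_simps add_divide_distrib)
  qed
  have lip: "norm (F a x - F a y) \<le> L * \<bar>x - y\<bar>" if a: "a \<in> polydisc C \<delta>" for a x y
  proof -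
    define d where "d = norm (z x - z y)"
    have d: "norm (on_line e a (z x) p - on_line e a (z y) p) \<le> d" if "p \<in> C" for p
    proof -
      have "on_line e a (z x) p - on_line e a (z y) p = (z x - z y) * e p" by (simp add: on_line_def algebra_simps)
      then show ?thesis using mult_left_mono[OF e[OF that], of d] by (simp add: norm_mult d_def)
    qed
    have F_le: "norm (F a x - F a y) \<le> (H * Mf + Mg * K) / c ^ 2 * d"
      unfolding F_def by (intro quot H K Mf Mg mem mem' a nz c d) (auto simp: d_def)
    have "d \<le> R * (2 * pi * \<bar>x - y\<bar>)"
    proof -
      have "d = R * norm (unit_circle_point x - unit_circle_point y)"
        unfolding d_def z_def right_diff_distrib[symmetric] norm_mult using R by simp
      then show ?thesis using mult_left_mono[OF unit_circle_point_lipschitz[of x y], of R] R by simp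
    qed
    then have "(H * Mf + Mg * K) / c ^ 2 * d \<le> (H * Mf + Mg * K) / c ^ 2 * (R * (2 * pi * \<bar>x - y\<bar>))"
      using H(1) K(1) Mf(1) Mg(1) by (intro mult_left_mono) auto
    with F_le show ?thesis unfolding L_def by (simp only: mult.assoc)
  qed
  have cm: "circle_mean e R (\<lambda>a. g a / f a) a = integral {0..1} (F a)" for a
    by (simp add: circle_mean_def F_def[abs_def] z_def)
  have bF: "norm (F a x) \<le> Mg / c" if "a \<in> polydisc C \<delta>" for a x
    unfolding F_def norm_divide using c Mg mem'[OF that nz] that nz
    by (intro frac_le) (auto simp: less_imp_le)
  have err: "norm (integral {0..1} (F a) - (\<Sum>j<Suc n. F a (real j / real (Suc n))) / of_nat (Suc n)) \<le> L / real (Suc n)"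
    if "a \<in> polydisc C \<delta>" for a n
    by (rule riemann_sum_error) (use lip[OF that] in auto)
  show ?thesis
    unfolding cm
  proof (rule holo_discI[where M = "Mg / c"])
    fix a assume a: "a \<in> polydisc C \<delta>"
    have "continuous_on {0..1} (F a)"
    proof (rule lipschitz_on_continuous_on[of "\<bar>L\<bar>"])
      show "\<bar>L\<bar>-lipschitz_on {0..1} (F a)"
        using order_trans[OF lip[OF a] mult_right_mono[OF abs_ge_self abs_ge_zero]]
        by (intro lipschitz_onI) (auto simp: dist_norm)
    qed
    from integral_bound[OF _ this, of "Mg / c"] bF[OF a] show "norm (integral {0..1} (F a)) \<le> Mg / c" by auto
  next
    fix a b assume a: "a \<in> polydisc C \<delta>" and b: "\<And>p. p \<in> C \<Longrightarrow> b p = a p"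
    have "F b x = F a x" for x
    proof -
      have eq: "on_line e b (z x) p = on_line e a (z x) p" if "p \<in> C" for p using b[OF that] by (simp add: on_line_def)
      show ?thesis unfolding F_def
        using holo_disc_cong[OF f mem'[OF a nz] eq] holo_disc_cong[OF g mem'[OF a nz] eq] by simp
    qed
    then have "F b = F a" by auto
    then show "integral {0..1} (F b) = integral {0..1} (F a)" by simp
  next
    fix U and \<gamma> :: "complex \<Rightarrow> 'a \<Rightarrow> complex"
    assume U: "open U" and hol: "\<And>p. p \<in> C \<Longrightarrow> (\<lambda>t. \<gamma> t p) holomorphic_on U"
      and \<gamma>: "\<And>t. t \<in> U \<Longrightarrow> \<gamma> t \<in> polydisc C \<delta>"
    have Fh: "(\<lambda>s. F (\<gamma> s) x) holomorphic_on U" for x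
      unfolding F_def
    proof (intro holomorphic_on_divide)
      have "(\<lambda>s. on_line e (\<gamma> s) (z x) p) holomorphic_on U" if "p \<in> C" for p
        unfolding on_line_def using hol[OF that] by (intro holomorphic_intros)
      then show "(\<lambda>s. g (on_line e (\<gamma> s) (z x))) holomorphic_on U" "(\<lambda>s. f (on_line e (\<gamma> s) (z x))) holomorphic_on U"
        using mem' \<gamma> nz by (auto intro!: holo_disc_curve[OF g U] holo_disc_curve[OF f U])
      show "f (on_line e (\<gamma> s) (z x)) \<noteq> 0" if "s \<in> U" for s
        using c(2)[OF \<gamma>[OF that] nz, of x] c(1) by auto
    qed
    have ul: "uniform_limit U (\<lambda>n s. (\<Sum>j<Suc n. F (\<gamma> s) (real j / real (Suc n))) / of_nat (Suc n))
      (\<lambda>s. integral {0..1} (F (\<gamma> s))) sequentially"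
    proof (rule uniform_limitI)
      fix \<epsilon> :: real assume "\<epsilon> > 0"
      moreover have "(\<lambda>n. L / real (Suc n)) \<longlonglongrightarrow> 0" by real_asymp
      ultimately have "\<forall>\<^sub>F n in sequentially. L / real (Suc n) < \<epsilon>" by (simp add: order_tendstoD)
      then show "\<forall>\<^sub>F n in sequentially. \<forall>s\<in>U. dist ((\<Sum>j<Suc n. F (\<gamma> s) (real j / real (Suc n))) / of_nat (Suc n))
          (integral {0..1} (F (\<gamma> s))) < \<epsilon>"
        by eventually_elim (use err \<gamma> in \<open>auto simp: dist_norm norm_minus_commute intro: le_less_trans simp del: of_nat_Suc sum.lessThan_Suc\<close>)
    qed
    show "(\<lambda>t. integral {0..1} (F (\<gamma> t))) holomorphic_on U"
    proof (rule holomorphic_uniform_sequence[OF U])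
      show "(\<lambda>s. (\<Sum>j<Suc n. F (\<gamma> s) (real j / real (Suc n))) / of_nat (Suc n)) holomorphic_on U" for n
        by (intro holomorphic_intros Fh) (simp del: of_nat_Suc)
      show "\<exists>d>0. cball x d \<subseteq> U \<and> uniform_limit (cball x d)
          (\<lambda>n s. (\<Sum>j<Suc n. F (\<gamma> s) (real j / real (Suc n))) / of_nat (Suc n)) (\<lambda>s. integral {0..1} (F (\<gamma> s))) sequentially"
        if "x \<in> U" for x
        using ul U that by (meson open_contains_cball uniform_limit_on_subset)
    qed
  qed
qed

text \<open>By homogeneity f has the constant norm R^d |f e| = 2 c on the circle through the
  multiples of e, and a base point of size below \<open>\<delta>\<close> changes this by at most
  c.\<close>

lemma pfun_norm_circle_bound:
  assumes C: "finite C" and f: "pfun C f" and d: "homogeneous d f" and fe: "f e \<noteq> 0"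
    and e: "\<And>p. p \<in> C \<Longrightarrow> norm (e p) \<le> 1" and R: "R > 0"
  shows "\<exists>\<delta> c. \<delta> > 0 \<and> \<delta> \<le> R \<and> c > 0 \<and>
    (\<forall>a\<in>polydisc C \<delta>. \<forall>t. norm t = R \<longrightarrow> norm (f (on_line e a t)) \<ge> c)"
proof -
  have R4: "4 * R > 0" using R by simp
  obtain K where K: "K > 0" "\<And>x y d. x \<in> polydisc C (4*R/2) \<Longrightarrow> y \<in> polydisc C (4*R/2) \<Longrightarrow>
    (\<And>p. p \<in> C \<Longrightarrow> norm (y p - x p) \<le> d) \<Longrightarrow> d \<ge> 0 \<Longrightarrow> norm (f y - f x) \<le> K * d"
    using holo_disc_lipschitz[OF pfun_holo_disc[OF f] R4] by metis
  define c where "c = R ^ d * norm (f e) / 2"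
  have c: "c > 0" unfolding c_def using fe R by simp
  define \<delta> where "\<delta> = min R (c / K)"
  have \<delta>: "\<delta> > 0" "\<delta> \<le> R" "K * \<delta> \<le> c"
    unfolding \<delta>_def using R K(1) c mult_left_mono[of "min R (c/K)" "c/K" K] by auto
  have "norm (f (on_line e a t)) \<ge> c" if a: "a \<in> polydisc C \<delta>" and t: "norm t = R" for a t
  proof -
    have z: "(\<lambda>_. 0) \<in> polydisc C \<delta>" using \<delta> by (simp add: polydisc_def)
    have "on_line e a t \<in> polydisc C (\<delta> + R)" "on_line e (\<lambda>_. 0) t \<in> polydisc C (\<delta> + R)"
      using t by (intro on_line_polydisc[where e = e, OF a e] on_line_polydisc[where e = e, OF z e]; simp)+
    then have m: "on_line e a t \<in> polydisc C (4*R/2)" "on_line e (\<lambda>_. 0) t \<in> polydisc C (4*R/2)"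
      using \<delta> by (auto elim!: polydisc_mono)
    have "norm (f (on_line e a t) - f (on_line e (\<lambda>_. 0) t)) \<le> K * \<delta>"
      by (rule K(2)[OF m(2,1)]) (use a \<delta> in \<open>auto simp: on_line_def polydisc_def less_imp_le\<close>)
    moreover have "norm (f (on_line e (\<lambda>_. 0) t)) = 2 * c"
      using d t unfolding homogeneous_def on_line_def c_def by (simp add: norm_mult norm_power)
    moreover have "norm (f (on_line e (\<lambda>_. 0) t)) \<le> norm (f (on_line e a t)) + norm (f (on_line e a t) - f (on_line e (\<lambda>_. 0) t))"
      by (rule norm_triangle_sub[of "f (on_line e (\<lambda>_. 0) t)" "f (on_line e a t)", unfolded norm_minus_commute[of "f (on_line e (\<lambda>_. 0) t)"]])
    ultimately show ?thesis using \<delta>(3) by linarith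
  qed
  with \<delta> c show ?thesis by blast
qed

text \<open>Near a zero \<open>z\<close> on the line, moving the affine variable \<open>x\<close> by \<open>f / \<alpha>\<close> lands on the
  zero set of \<open>f\<close>, where \<open>g\<close> vanishes; the Lipschitz bound for \<open>g\<close> then bounds \<open>g / f\<close>.\<close>

lemma quotient_bounded_on_line:
  assumes f: "pfun C f" and \<alpha>: "pfun C \<alpha>" and \<Phi>: "finite \<Phi>" "\<And>\<phi>. \<phi> \<in> \<Phi> \<Longrightarrow> pfun C \<phi>"
    and aff: "\<And>a s. f (a(x := s)) = f a + (s - a x) * \<alpha> a"
    and \<alpha>nz: "\<And>a. (\<And>\<phi>. \<phi> \<in> \<Phi> \<Longrightarrow> \<phi> a \<noteq> 0) \<Longrightarrow> \<alpha> a \<noteq> 0"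
    and g: "holo_disc C r g" and r: "r > 0" and C: "finite C"
    and van: "\<And>a. a \<in> polydisc C r \<Longrightarrow> f a = 0 \<Longrightarrow> (\<And>\<phi>. \<phi> \<in> \<Phi> \<Longrightarrow> \<phi> a \<noteq> 0) \<Longrightarrow> g a = 0"
    and z: "f (on_line e b z) = 0" "\<And>\<phi>. \<phi> \<in> \<Phi> \<Longrightarrow> \<phi> (on_line e b z) \<noteq> 0"
    and zin: "on_line e b z \<in> polydisc C (r/2)"
  shows "\<exists>B. \<forall>\<^sub>F t in at z. norm (g (on_line e b t) / f (on_line e b t)) \<le> B"
proof -
  obtain K where K: "K > 0" "\<And>x y d. x \<in> polydisc C (r/2) \<Longrightarrow> y \<in> polydisc C (r/2) \<Longrightarrow>
    (\<And>p. p \<in> C \<Longrightarrow> norm (y p - x p) \<le> d) \<Longrightarrow> d \<ge> 0 \<Longrightarrow> norm (g y - g x) \<le> K * d"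
    using holo_disc_lipschitz[OF g r] by metis
  define \<alpha>0 where "\<alpha>0 = \<alpha> (on_line e b z)"
  have \<alpha>0: "\<alpha>0 \<noteq> 0" unfolding \<alpha>0_def using \<alpha>nz z(2) by blast
  define c where "c t = (on_line e b t)(x := on_line e b t x - f (on_line e b t) / \<alpha> (on_line e b t))" for t
  have lline: "((\<lambda>t. on_line e b t p) \<longlongrightarrow> on_line e b z p) (at z)" for p
    unfolding on_line_def by (intro tendsto_intros)
  have l\<alpha>: "((\<lambda>t. \<alpha> (on_line e b t)) \<longlongrightarrow> \<alpha>0) (at z)"
    unfolding \<alpha>0_def by (rule pfun_tendsto[where \<gamma> = "on_line e b", OF \<alpha> lline])
  have lf: "((\<lambda>t. f (on_line e b t)) \<longlongrightarrow> 0) (at z)"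
    using pfun_tendsto[where \<gamma> = "on_line e b" and L = "on_line e b z", OF f lline] z(1) by simp
  have lc: "((\<lambda>t. c t p) \<longlongrightarrow> on_line e b z p) (at z)" for p
  proof (cases "p = x")
    case True
    have "((\<lambda>t. on_line e b t x - f (on_line e b t) / \<alpha> (on_line e b t)) \<longlongrightarrow> on_line e b z x - 0 / \<alpha>0) (at z)"
      by (intro tendsto_diff tendsto_divide lline lf l\<alpha> \<alpha>0)
    then show ?thesis using True by (simp add: c_def)
  qed (use lline in \<open>simp add: c_def\<close>)
  have ev_mem: "\<forall>\<^sub>F t in at z. \<gamma> t \<in> polydisc C (r/2)"
    if "\<And>p. p \<in> C \<Longrightarrow> ((\<lambda>t. \<gamma> t p) \<longlongrightarrow> on_line e b z p) (at z)" for \<gamma>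
  proof -
    have "\<forall>\<^sub>F t in at z. \<forall>p\<in>C. norm (\<gamma> t p) < r/2"
      using zin C
      by (intro eventually_ball_finite ballI order_tendstoD(2)[OF tendsto_norm[OF that]]) (auto simp: polydisc_def)
    then show ?thesis by (simp add: polydisc_def)
  qed
  have ev\<Phi>: "\<forall>\<^sub>F t in at z. \<forall>\<phi>\<in>\<Phi>. \<phi> (c t) \<noteq> 0"
    using \<Phi> z(2) by (intro eventually_ball_finite ballI) (auto intro!: tendsto_imp_eventually_ne[OF pfun_tendsto[OF _ lc]])
  have ev\<alpha>: "\<forall>\<^sub>F t in at z. norm \<alpha>0 / 2 < norm (\<alpha> (on_line e b t))"
    using \<alpha>0 by (intro order_tendstoD(1)[OF tendsto_norm[OF l\<alpha>]]) simp
  have "\<forall>\<^sub>F t in at z. norm (g (on_line e b t) / f (on_line e b t)) \<le> 2 * K / norm \<alpha>0"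
    using ev_mem[of c, OF lc] ev_mem[of "on_line e b", OF lline] ev\<Phi> ev\<alpha>
  proof eventually_elim
    case (elim t)
    define w where "w = on_line e b t"
    have \<alpha>w: "\<alpha> w \<noteq> 0" using elim(4) \<alpha>0 unfolding w_def by auto
    have fc: "f (c t) = 0" unfolding c_def w_def[symmetric] aff using \<alpha>w by (simp add: field_simps)
    have "c t \<in> polydisc C r" using elim(1) r by (auto elim: polydisc_mono)
    then have gc: "g (c t) = 0" using van fc elim(3) by blast
    have "norm (g w - g (c t)) \<le> K * norm (f w / \<alpha> w)"
      by (rule K(2)[OF elim(1)]) (use elim(2) in \<open>auto simp: c_def w_def[symmetric]\<close>)
    also have "\<dots> = K / norm (\<alpha> w) * norm (f w)" by (simp add: norm_divide)
    also have "\<dots> \<le> K / (norm \<alpha>0 / 2) * norm (f w)"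
      using elim(4) K(1) \<alpha>0 \<alpha>w unfolding w_def by (intro mult_right_mono divide_left_mono mult_pos_pos) auto
    finally have le: "norm (g w) \<le> 2 * K / norm \<alpha>0 * norm (f w)" by (simp add: gc field_simps)
    show "norm (g (on_line e b t) / f (on_line e b t)) \<le> 2 * K / norm \<alpha>0"
    proof (cases "f w = 0")
      case True
      then show ?thesis using K(1) by (simp add: w_def[symmetric])
    next
      case False
      then show ?thesis using le unfolding w_def[symmetric] norm_divide by (simp add: divide_le_eq)
    qed
  qed
  then show ?thesis ..
qed

text \<open>The candidate u is the circle mean of g / f. If the line through b avoids the common
  zeros of f with the members of \<open>\<Phi>\<close>, the quotient extends over the zeros of f on
  the line, and the mean value property identifies u b with the extended quotient at b. Such b are
  dense and g - u f is Lipschitz, so g = u f holds on a whole polydisc.\<close>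

theorem affine_division:
  assumes C: "finite C" and f: "pfun C f" and d: "homogeneous d f" and fe: "f e \<noteq> 0"
    and e: "\<And>p. p \<in> C \<Longrightarrow> norm (e p) \<le> 1"
    and \<alpha>: "pfun C \<alpha>" and \<Phi>: "finite \<Phi>" "\<And>\<phi>. \<phi> \<in> \<Phi> \<Longrightarrow> pfun C \<phi>"
    and aff: "\<And>a s. f (a(x := s)) = f a + (s - a x) * \<alpha> a"
    and \<alpha>nz: "\<And>a. (\<And>\<phi>. \<phi> \<in> \<Phi> \<Longrightarrow> \<phi> a \<noteq> 0) \<Longrightarrow> \<alpha> a \<noteq> 0"
    and cop: "\<And>\<phi>. \<phi> \<in> \<Phi> \<Longrightarrow> coprime_lines e f \<phi>"
    and g: "holo_disc C r g" and r: "r > 0"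
    and van: "\<And>a. a \<in> polydisc C r \<Longrightarrow> f a = 0 \<Longrightarrow> (\<And>\<phi>. \<phi> \<in> \<Phi> \<Longrightarrow> \<phi> a \<noteq> 0) \<Longrightarrow> g a = 0"
  shows "\<exists>\<delta> u. \<delta> > 0 \<and> holo_disc C \<delta> u \<and> (\<forall>a\<in>polydisc C \<delta>. g a = u a * f a)"
proof -
  \<comment> \<open>Discs of radius 2 R on lines with base point in the \<open>\<delta>\<close>
    polydisc stay within 3 R < r/2, where the Lipschitz estimates for g hold.\<close>
  define R where "R = r / 8"
  have R: "R > 0" using r by (simp add: R_def)
  obtain \<delta> c where \<delta>: "\<delta> > 0" "\<delta> \<le> R" and c: "c > 0"
    "\<And>a t. a \<in> polydisc C \<delta> \<Longrightarrow> norm t = R \<Longrightarrow> norm (f (on_line e a t)) \<ge> c"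
    using pfun_norm_circle_bound[OF C f d fe e R] by blast
  define u where "u = circle_mean e R (\<lambda>a. g a / f a)"
  have uh: "holo_disc C \<delta> u"
    unfolding u_def by (rule circle_mean_holo_disc[OF pfun_holo_disc[OF f] g r e R _ c]) (use \<delta> in \<open>auto simp: R_def\<close>)
  have generic: "g b = u b * f b"
    if b: "b \<in> polydisc C \<delta>"
      and bz: "\<And>\<phi> t. \<phi> \<in> \<Phi> \<Longrightarrow> norm t \<le> 2 * R \<Longrightarrow> \<not> (f (on_line e b t) = 0 \<and> \<phi> (on_line e b t) = 0)" for b
  proof -
    define Z where "Z = {t \<in> cball 0 (2 * R). f (on_line e b t) = 0}"
    have finZ: "finite Z" unfolding Z_def by (rule homogeneous_finite_zeros[OF f d fe])
    have mem: "on_line e b t \<in> polydisc C (r/2)" if "norm t \<le> 2 * R" for t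
      by (rule polydisc_mono[OF on_line_polydisc[where e = e, OF b e that]]) (use \<delta> in \<open>auto simp: R_def\<close>)
    have mem': "on_line e b t \<in> polydisc C r" if "norm t \<le> 2 * R" for t
      using mem[OF that] r by (auto elim: polydisc_mono)
    have gh: "(\<lambda>t. g (on_line e b t)) holomorphic_on ball 0 (2 * R)"
      by (rule holo_disc_curve[OF g]) (use mem' in \<open>auto simp: on_line_def intro!: holomorphic_intros\<close>)
    have h1: "(\<lambda>t. g (on_line e b t) / f (on_line e b t)) holomorphic_on ball 0 (2 * R) - Z"
      by (intro holomorphic_on_divide pfun_on_line[OF f] holomorphic_on_subset[OF gh]) (auto simp: Z_def)
    have h2: "\<exists>B. \<forall>\<^sub>F t in at z. norm (g (on_line e b t) / f (on_line e b t)) \<le> B" if z: "z \<in> Z" for z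
      by (rule quotient_bounded_on_line[OF f \<alpha> \<Phi> aff \<alpha>nz g r C van])
         (use z bz mem in \<open>auto simp: Z_def\<close>)
    obtain F where F: "F holomorphic_on ball 0 (2 * R)"
      "\<And>t. t \<in> ball 0 (2 * R) - Z \<Longrightarrow> F t = g (on_line e b t) / f (on_line e b t)"
      using holomorphic_extend_finite[OF finZ open_ball h1 h2] by blast
    have "u b = integral {0..1} (\<lambda>x. F (of_real R * exp (2 * of_real pi * \<i> * of_real x)))"
      unfolding u_def circle_mean_def unit_circle_point_def[symmetric]
    proof (rule integral_cong)
      fix x
      have n: "norm (of_real R * unit_circle_point x) = R" using R by (simp add: norm_mult)
      have "of_real R * unit_circle_point x \<in> ball 0 (2 * R) - Z"
        using c(2)[OF b n] c(1) n R by (auto simp: Z_def)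
      from F(2)[OF this]
      show "g (on_line e b (of_real R * unit_circle_point x)) / f (on_line e b (of_real R * unit_circle_point x))
          = F (of_real R * unit_circle_point x)" by simp
    qed
    also have "\<dots> = F 0" by (rule mean_value_circle[OF F(1)]) (use R in auto)
    finally have uF: "u b = F 0" .
    \<comment> \<open>D vanishes at all t near 0 other than 0, whether or not f b = 0; continuity
      then gives the identity at t = 0 also when b is a zero of f.\<close>
    define D where "D t = F t * f (on_line e b t) - g (on_line e b t)" for t
    have "D holomorphic_on ball 0 (2 * R)"
      unfolding D_def by (intro holomorphic_intros F gh pfun_on_line[OF f])
    then have "isCont D 0"
      using R continuous_on_eq_continuous_at[OF open_ball] holomorphic_on_imp_continuous_on by (metis centre_in_ball mult_pos_pos zero_less_numeral)
    then have "(D \<longlongrightarrow> D 0) (at 0)" by (simp add: isCont_def)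
    moreover have "\<forall>\<^sub>F t in at 0. D t = 0"
    proof -
      have "open (ball 0 (2 * R) - (Z - {0}))" "0 \<in> ball 0 (2 * R) - (Z - {0})"
        using finZ R by (auto intro!: open_Diff finite_imp_closed)
      then have "\<forall>\<^sub>F t in at 0. t \<in> ball 0 (2 * R) - (Z - {0}) - {0}" by (rule eventually_at_in_open)
      then show ?thesis
      proof eventually_elim
        case (elim t)
        then have "t \<in> ball 0 (2 * R) - Z" by auto
        moreover from this have "f (on_line e b t) \<noteq> 0" by (auto simp: Z_def)
        ultimately show "D t = 0" unfolding D_def by (simp add: F(2))
      qed
    qed
    ultimately have "((\<lambda>_. 0) \<longlongrightarrow> D 0) (at (0::complex))" by (rule Lim_transform_eventually)
    then have "D 0 = 0" by (simp add: tendsto_const_iff)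
    moreover have "on_line e b 0 = b" by (simp add: on_line_def)
    ultimately show ?thesis using uF by (simp add: D_def)
  qed
  define w where "w a = g a - u a * f a" for a
  have "holo_disc C \<delta> (\<lambda>a. g a + (-1) * (u a * f a))"
    using \<delta> by (intro holo_disc_add holo_disc_mult holo_disc_const uh pfun_holo_disc[OF f] holo_disc_mono[OF g]) (auto simp: R_def)
  then have wh: "holo_disc C \<delta> w" unfolding w_def by simp
  obtain K where K: "K > 0" "\<And>x y d. x \<in> polydisc C (\<delta>/2) \<Longrightarrow> y \<in> polydisc C (\<delta>/2) \<Longrightarrow>
    (\<And>p. p \<in> C \<Longrightarrow> norm (y p - x p) \<le> d) \<Longrightarrow> d \<ge> 0 \<Longrightarrow> norm (w y - w x) \<le> K * d"
    using holo_disc_lipschitz[OF wh \<delta>(1)] by metis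
  have "w a = 0" if a: "a \<in> polydisc C (\<delta>/2)" for a
  proof (rule ccontr)
    assume "w a \<noteq> 0"
    \<comment> \<open>\<open>\<mu>\<close> keeps the perturbed point inside the polydisc; the second
      bound in \<open>\<epsilon>\<close> makes the Lipschitz estimate yield |w a| <= |w a| /
      2.\<close>
    define \<mu> where "\<mu> = Min (insert (\<delta>/2) ((\<lambda>p. \<delta>/2 - norm (a p)) ` C))"
    have \<mu>: "\<mu> > 0" unfolding \<mu>_def using C a \<delta>(1) by (subst Min_gr_iff) (auto simp: polydisc_def)
    have \<mu>le: "\<mu> \<le> \<delta>/2 - norm (a p)" if "p \<in> C" for p unfolding \<mu>_def using C that by (intro Min_le) auto
    define \<epsilon> where "\<epsilon> = min \<mu> (norm (w a) / (2 * K))"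
    have \<epsilon>: "\<epsilon> > 0" unfolding \<epsilon>_def using \<mu> K(1) \<open>w a \<noteq> 0\<close> by simp
    from coprime_lines_family[OF C f \<Phi>(1) \<Phi>(2) cop \<epsilon>, of a "2 * R"]
    obtain b \<eta> where b: "\<eta> > 0" "\<And>p. norm (b p - a p) < \<epsilon>"
      "\<And>b'. (\<forall>p\<in>C. norm (b' p - b p) < \<eta>) \<Longrightarrow>
      (\<forall>\<phi>\<in>\<Phi>. \<forall>t\<in>cball 0 (2 * R). \<not> (f (on_line e b' t) = 0 \<and> \<phi> (on_line e b' t) = 0))" by blast
    have bin: "b \<in> polydisc C (\<delta>/2)"
      unfolding polydisc_def
    proof safe
      fix p assume p: "p \<in> C"
      have "norm (b p) \<le> norm (a p) + norm (b p - a p)" by (rule norm_triangle_sub)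
      also have "\<dots> < norm (a p) + \<mu>" using b(2)[of p] by (simp add: \<epsilon>_def)
      finally show "norm (b p) < \<delta>/2" using \<mu>le[OF p] by simp
    qed
    have "g b = u b * f b"
    proof (rule generic)
      show "b \<in> polydisc C \<delta>" using bin \<delta>(1) by (auto elim: polydisc_mono)
    qed (use b(3)[of b] b(1) in auto)
    then have "w b = 0" by (simp add: w_def)
    then have "norm (w a) \<le> K * \<epsilon>"
      using K(2)[OF bin a, of \<epsilon>] b(2) \<epsilon> by (simp add: norm_minus_commute less_imp_le)
    also have "\<dots> \<le> K * (norm (w a) / (2 * K))" unfolding \<epsilon>_def using K(1) by (intro mult_left_mono) auto
    also have "\<dots> = norm (w a) / 2" using K(1) by simp
    finally show False using \<open>w a \<noteq> 0\<close> by simp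
  qed
  then have "g a = u a * f a" if "a \<in> polydisc C (\<delta>/2)" for a using that by (simp add: w_def)
  moreover have "holo_disc C (\<delta>/2) u" using uh \<delta>(1) by (auto elim: holo_disc_mono)
  ultimately show ?thesis using \<delta>(1) by (intro exI[of _ "\<delta>/2"] exI[of _ u]) auto
qed

section \<open>Pfaffians\<close>

definition del :: "nat \<Rightarrow> 'a list \<Rightarrow> 'a list" where
  "del t xs = take t xs @ drop (Suc t) xs"

lemma length_del: "t < length xs \<Longrightarrow> length (del t xs) = length xs - 1"
  by (auto simp: del_def)

lemma nth_del: "t < length xs \<Longrightarrow> s < length xs - 1 \<Longrightarrow> del t xs ! s = (if s < t then xs ! s else xs ! Suc s)"
  by (auto simp: del_def nth_append min_def)

lemma del_del:
  assumes "s < t" "t < length xs"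
  shows "del s (del t xs) = del (t - 1) (del s xs)"
proof (rule nth_equalityI)
  show "length (del s (del t xs)) = length (del (t - 1) (del s xs))"
    using assms by (simp add: length_del)
  fix i assume "i < length (del s (del t xs))"
  then have "i < length xs - 2" using assms by (simp add: length_del)
  then show "del s (del t xs) ! i = del (t - 1) (del s xs) ! i"
    using assms by (auto simp: nth_del length_del)
qed

lemma del_Cons_Suc [simp]: "del (Suc t) (x # xs) = x # del t xs"
  and del_Cons_0 [simp]: "del 0 (x # xs) = xs"
  by (auto simp: del_def)

lemma del_append1: "t < length us \<Longrightarrow> del t (us @ xs) = del t us @ xs"
  and del_append2: "t \<ge> length us \<Longrightarrow> del t (us @ xs) = us @ del (t - length us) xs"
  by (auto simp: del_def Suc_diff_le)

lemma set_del_subset: "set (del t xs) \<subseteq> set xs"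
  by (auto simp: del_def dest: in_set_takeD in_set_dropD)

lemma pf_Cons: "pf M (i # xs) = (\<Sum>t<length xs. (-1) ^ t * M i (xs ! t) * pf M (del t xs))"
  by (simp add: del_def)

declare pf.simps(2) [simp del]

lemma pf_cong:
  "(\<And>x y. x \<in> set xs \<Longrightarrow> y \<in> set xs \<Longrightarrow> M x y = N x y) \<Longrightarrow> pf M xs = pf N xs"
proof (induction "length xs" arbitrary: xs rule: less_induct)
  case less
  show ?case
  proof (cases xs)
    case (Cons i ys)
    have "pf M (del t ys) = pf N (del t ys)" if "t < length ys" for t
      using less that Cons set_del_subset[of t ys] by (intro less.hyps) (auto simp: length_del)
    then show ?thesis unfolding Cons pf_Cons using less.prems Cons by (intro sum.cong) auto
  qed simp
qed

lemma pf_smult: "pf (\<lambda>i j. c * M i j) xs = c ^ (length xs div 2) * pf M xs"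
proof (induction "length xs" arbitrary: xs rule: less_induct)
  case less
  show ?case
  proof (cases xs)
    case (Cons i ys)
    have "(-1) ^ t * (c * M i (ys ! t)) * pf (\<lambda>i j. c * M i j) (del t ys) =
        c ^ (length xs div 2) * ((-1) ^ t * M i (ys ! t) * pf M (del t ys))" if t: "t < length ys" for t
    proof -
      have "length xs div 2 = Suc (length (del t ys) div 2)" using t Cons by (simp add: length_del)
      moreover have "pf (\<lambda>i j. c * M i j) (del t ys) = c ^ (length (del t ys) div 2) * pf M (del t ys)"
        using t Cons by (intro less.hyps) (simp add: length_del)
      ultimately show ?thesis by simp
    qed
    then show ?thesis unfolding Cons pf_Cons sum_distrib_left using Cons by (intro sum.cong) auto
  qed simp
qed

text \<open>Every index of the list occurs exactly once in each product of the expansion.\<close>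

lemma pf_scale: "distinct xs \<Longrightarrow> pf (\<lambda>i j. s i * s j * M i j) xs = (\<Prod>x\<in>set xs. s x) * pf M xs"
proof (induction "length xs" arbitrary: xs rule: less_induct)
  case less
  show ?case
  proof (cases xs)
    case (Cons i ys)
    have "(-1) ^ t * (s i * s (ys ! t) * M i (ys ! t)) * pf (\<lambda>i j. s i * s j * M i j) (del t ys) =
        (\<Prod>x\<in>set xs. s x) * ((-1) ^ t * M i (ys ! t) * pf M (del t ys))" if t: "t < length ys" for t
    proof -
      have d: "distinct ys" "i \<notin> set ys" using less.prems Cons by auto
      have ys: "ys = take t ys @ ys ! t # drop (Suc t) ys" using t by (rule id_take_nth_drop)
      then have "set ys = insert (ys ! t) (set (del t ys))" unfolding del_def by (metis list.simps(15) set_append Un_insert_right)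
      moreover have "ys ! t \<notin> set (del t ys)" "distinct (del t ys)"
        using d(1) ys unfolding del_def by (metis distinct_append not_distinct_conv_prefix set_append distinct.simps(2) Un_iff disjoint_insert(1) list.simps(15) inf_commute,
            metis distinct_append distinct.simps(2) set_ConsD disjoint_iff list.set_intros(2))
      ultimately have "(\<Prod>x\<in>set xs. s x) = s i * (s (ys ! t) * (\<Prod>x\<in>set (del t ys). s x))" using Cons d by simp
      moreover have "pf (\<lambda>i j. s i * s j * M i j) (del t ys) = (\<Prod>x\<in>set (del t ys). s x) * pf M (del t ys)"
        using t Cons \<open>distinct (del t ys)\<close> by (intro less.hyps) (simp_all add: length_del)
      ultimately show ?thesis by simp
    qed
    then show ?thesis unfolding Cons pf_Cons sum_distrib_left using Cons by (intro sum.cong) auto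
  qed simp
qed

section \<open>Antisymmetry of Pfaffians and its consequences\<close>

locale skew =
  fixes M :: "nat \<Rightarrow> nat \<Rightarrow> complex"
  assumes skew: "M i j = - M j i"
begin

text \<open>Expanding along both leading rows leaves M i j times the rest and a double sum over the
  two further indices that are removed. Interchanging the order of removal changes the sign of that
  sum.\<close>

lemma pf_swap_first: "pf M (i # j # xs) = - pf M (j # i # xs)"
proof -
  define n where "n = length xs"
  define T where "T i j = (\<Sum>t<n. \<Sum>s<n - 1. (-1) ^ (t + s) * M i (xs ! t) * M j (del t xs ! s) * pf M (del s (del t xs)))" for i j
  have exp: "pf M (i # j # xs) = M i j * pf M xs - T i j" for i j
  proof -
    have "pf M (i # j # xs) = M i j * pf M xs + (\<Sum>t<n. (-1) ^ Suc t * M i (xs ! t) * pf M (j # del t xs))"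
      unfolding pf_Cons[of M i] n_def by (simp add: sum.lessThan_Suc_shift del: sum.lessThan_Suc)
    also have "(\<Sum>t<n. (-1) ^ Suc t * M i (xs ! t) * pf M (j # del t xs)) = - T i j"
      unfolding T_def sum_negf[symmetric] pf_Cons[of M j]
      by (intro sum.cong) (auto simp: length_del n_def sum_distrib_left power_add algebra_simps simp flip: sum_negf intro!: sum.cong)
    finally show ?thesis by simp
  qed
  have "T i j = - T j i"
  proof -
    let ?A = "{..<n} \<times> {..<n - 1}"
    \<comment> \<open>Removing position t and then position s of the shortened list removes the same
      two entries as removing them in the other order; the map rewrites the positions accordingly
      and is an involution.\<close>
    let ?\<phi> = "\<lambda>(t, s). if s < t then (s, t - 1) else (Suc s, t)"
    let ?h = "\<lambda>i j (t, s). (-1) ^ (t + s) * M i (xs ! t) * M j (del t xs ! s) * pf M (del s (del t xs))"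
    have T': "T i j = sum (?h i j) ?A" for i j unfolding T_def by (rule sum.cartesian_product)
    have "sum (?h i j) ?A = (\<Sum>x\<in>?A. - ?h j i x)"
    proof (rule sum.reindex_bij_witness[where i = ?\<phi> and j = ?\<phi>])
      fix x assume x: "x \<in> ?A"
      obtain t s where ts: "x = (t, s)" by (cases x)
      show "?\<phi> (?\<phi> x) = x" "?\<phi> x \<in> ?A" using x ts by (auto split: if_splits)
      show "- ?h j i (?\<phi> x) = ?h i j x"
      proof (cases "s < t")
        case True
        then have "(-1::complex) ^ (t + s) = - ((-1) ^ (s + (t - 1)))" by (cases t) (auto simp: add.commute)
        moreover have "del s xs ! (t - 1) = xs ! t" "del t xs ! s = xs ! s"
          using True x ts by (auto simp: nth_del n_def)
        ultimately show ?thesis using True x ts by (simp add: n_def del_del[of s t])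
      next
        case False
        moreover have "del (Suc s) xs ! t = xs ! t" "del t xs ! s = xs ! Suc s"
          using False x ts by (auto simp: nth_del n_def)
        moreover have "del t (del (Suc s) xs) = del s (del t xs)"
          using False x ts del_del[of t "Suc s" xs] by (auto simp: n_def)
        ultimately show ?thesis using x ts by (simp add: add.commute)
      qed
    next
      fix x assume x: "x \<in> ?A"
      then show "?\<phi> (?\<phi> x) = x" "?\<phi> x \<in> ?A" by (auto split: if_splits)
    qed
    then show ?thesis unfolding T' by (simp only: sum_negf)
  qed
  then show ?thesis unfolding exp using skew[of i j] by simp
qed

lemma pf_swap: "pf M (us @ i # j # xs) = - pf M (us @ j # i # xs)"
proof (induction "length us" arbitrary: us xs rule: less_induct)
  case less
  show ?case
  proof (cases us)
    case Nil
    then show ?thesis using pf_swap_first[of i j xs] by simp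
  next
    case (Cons u vs)
    define k where "k = length vs"
    define ys where "ys = vs @ i # j # xs"
    define zs where "zs = vs @ j # i # xs"
    \<comment> \<open>The transposition of the positions of i and j. A term that pairs u with i or j
      changes only the sign (-1)^t; in the other terms both entries remain adjacent in a shorter
      list, and the induction applies.\<close>
    define \<sigma> where "\<sigma> t = (if t = k then Suc k else if t = Suc k then k else t)" for t
    have len: "length ys = k + 2 + length xs" "length zs = k + 2 + length xs"
      by (auto simp: ys_def zs_def k_def)
    have "(\<Sum>t<length ys. (-1) ^ t * M u (ys ! t) * pf M (del t ys))
        = (\<Sum>t<length zs. - ((-1) ^ t * M u (zs ! t) * pf M (del t zs)))"
    proof (rule sum.reindex_bij_witness[where i = \<sigma> and j = \<sigma>])
      fix t assume "t \<in> {..<length ys}"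
      then have t: "t < k + 2 + length xs" by (simp add: len)
      show "- ((-1) ^ \<sigma> t * M u (zs ! \<sigma> t) * pf M (del (\<sigma> t) zs)) = (-1) ^ t * M u (ys ! t) * pf M (del t ys)"
      proof -
        consider "t < k" | "t = k" | "t = Suc k" | "t > Suc k" by linarith
        then show ?thesis
        proof cases
          case 1
          then have "length (del t vs) < length us" by (simp add: length_del k_def Cons)
          from less.hyps[OF this, of xs] 1 show ?thesis
            by (simp add: \<sigma>_def ys_def zs_def del_append1 k_def nth_append)
        next
          case 2
          then show ?thesis by (simp add: \<sigma>_def ys_def zs_def del_append2 k_def nth_append)
        next
          case 3
          then show ?thesis by (simp add: \<sigma>_def ys_def zs_def del_append2 k_def nth_append)
        next
          case 4
          then obtain r where r: "t = k + Suc (Suc r)" by (auto simp: less_iff_Suc_add)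
          have "length vs < length us" by (simp add: Cons)
          from less.hyps[OF this, of "del r xs"] show ?thesis
            unfolding r by (simp add: \<sigma>_def ys_def zs_def del_append2 k_def nth_append)
        qed
      qed
    qed (auto simp: \<sigma>_def len)
    then show ?thesis unfolding Cons ys_def zs_def by (simp add: pf_Cons sum_negf)
  qed
qed

lemma pf_move: "pf M (us @ x # xs) = (-1) ^ length us * pf M (x # us @ xs)"
proof (induction us arbitrary: xs rule: rev_induct)
  case (snoc u us)
  show ?case using pf_swap[of us u x xs] snoc[of "u # xs"] by simp
qed simp

lemma pf_repeat: "pf M (us @ x # vs @ x # ws) = 0"
proof -
  have 0: "pf M (x # x # ys) = 0" for ys using pf_swap_first[of x x ys] by simp
  have "pf M ((us @ x # vs) @ x # ws) = (-1) ^ length (us @ x # vs) * pf M (x # (us @ x # vs) @ ws)"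
    by (rule pf_move)
  also have "pf M (x # (us @ x # vs) @ ws) = pf M ((x # us) @ x # (vs @ ws))" by simp
  also have "\<dots> = (-1) ^ length (x # us) * pf M (x # (x # us) @ (vs @ ws))" by (rule pf_move)
  also have "pf M (x # (x # us) @ (vs @ ws)) = 0" using 0 by simp
  finally show ?thesis by simp
qed

lemma pf_not_distinct: "\<not> distinct xs \<Longrightarrow> pf M xs = 0"
  using not_distinct_decomp[of xs] pf_repeat by force

lemma pf_update: "t < length xs \<Longrightarrow> pf M (xs[t := x]) = (-1) ^ t * pf M (x # del t xs)"
  using pf_move[of "take t xs" x "drop (Suc t) xs"] by (simp add: upd_conv_take_nth_drop del_def)

lemma pf_update_linear:
  assumes "t < length xs"
  shows "pf M (xs[t := x]) = (\<Sum>s<length xs - 1. (-1) ^ (t + s) * pf M (del s (del t xs)) * M x (del t xs ! s))"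
  unfolding pf_update[OF assms] pf_Cons length_del[OF assms] sum_distrib_left
  by (intro sum.cong) (auto simp: power_add)

text \<open>Stated with replacements instead of deletions: this exhibits the Pfaffian of p, q and S
  as a fixed combination of rows of M, paired with p. The matrix of the eta fields and the exchange
  identities both arise from this form.\<close>

lemma pf_expand_two: "pf M (p # q # xs) = M p q * pf M xs - (\<Sum>t<length xs. M p (xs ! t) * pf M (xs[t := q]))"
proof -
  have "pf M (p # q # xs) = M p q * pf M xs + (\<Sum>t<length xs. (-1) ^ Suc t * M p (xs ! t) * pf M (q # del t xs))"
    unfolding pf_Cons[of M p] by (simp add: sum.lessThan_Suc_shift del: sum.lessThan_Suc)
  also have "(\<Sum>t<length xs. (-1) ^ Suc t * M p (xs ! t) * pf M (q # del t xs)) = - (\<Sum>t<length xs. M p (xs ! t) * pf M (xs[t := q]))"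
    unfolding sum_negf[symmetric] by (intro sum.cong) (auto simp: pf_update)
  finally show ?thesis by simp
qed

lemma pf_append_two: "pf M (xs @ [p, q]) = pf M (p # q # xs)"
proof -
  have "pf M (xs @ [p, q]) = (-1) ^ length xs * pf M (p # xs @ [q])" using pf_move[of xs p "[q]"] by simp
  also have "pf M (p # xs @ [q]) = (-1) ^ Suc (length xs) * pf M (q # p # xs)" using pf_move[of "p # xs" q "[]"] by simp
  also have "pf M (q # p # xs) = - pf M (p # q # xs)" by (rule pf_swap_first)
  finally show ?thesis by (simp add: power_add[symmetric] mult.assoc[symmetric])
qed

end

text \<open>Each product in the Pfaffian contains exactly one entry with index i, so the
  simultaneous row and column operation acts affinely in \<open>\<tau>\<close>, with the index i
  replaced by n in the linear term.\<close>

lemma pf_row_operation: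
  assumes M: "skew M" and M': "skew M'" and t: "t < length xs" "xs ! t = i" and xs: "distinct xs"
    and other: "\<And>p q. p \<noteq> i \<Longrightarrow> q \<noteq> i \<Longrightarrow> M' p q = M p q"
    and row: "\<And>q. q \<noteq> i \<Longrightarrow> M' i q = M i q + \<tau> * M n q"
  shows "pf M' xs = pf M xs + \<tau> * pf M (xs[t := n])"
proof -
  interpret M: skew M by (rule M)
  interpret M': skew M' by (rule M')
  have i: "i \<notin> set (del t xs)"
    using xs t id_take_nth_drop[OF t(1)] unfolding del_def
    by (metis Un_iff disjoint_iff distinct.simps(2) distinct_append list.set_intros(1) set_append)
  have mem: "del t xs ! s \<noteq> i" if "s < length (del t xs)" for s using i that nth_mem by metis
  have eq: "xs[t := i] = xs" using t list_update_id by metis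
  have "pf M' (xs[t := i]) = (-1) ^ t * pf M' (i # del t xs)" by (rule M'.pf_update[OF t(1)])
  also have "pf M' (i # del t xs) = pf M (i # del t xs) + \<tau> * pf M (n # del t xs)"
  proof -
    have c: "pf M' (del s (del t xs)) = pf M (del s (del t xs))" for s
      using i set_del_subset[of s "del t xs"] by (intro pf_cong other) auto
    show ?thesis
      unfolding pf_Cons sum_distrib_left sum.distrib[symmetric]
      by (intro sum.cong) (auto simp: c row mem algebra_simps)
  qed
  finally show ?thesis using M.pf_update[OF t(1), of i] M.pf_update[OF t(1), of n]
    by (simp add: eq algebra_simps)
qed

section \<open>Determinants and cofactors\<close>

definition detmat :: "nat \<Rightarrow> (nat \<Rightarrow> nat \<Rightarrow> complex) \<Rightarrow> complex Matrix.mat" where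
  "detmat k M = Matrix.mat k k (\<lambda>(i, j). M (Suc i) (Suc j))"

lemma detmat_carrier [simp]: "detmat k M \<in> carrier_mat k k"
  by (simp add: detmat_def)

text \<open>Conjugation by the shift between {0..<k} and {1..k} preserves signs. It makes the
  adjugate identities available for \<open>detk\<close>.\<close>

lemma detk_eq_det: "detk k M = Determinant.det (detmat k M)"
proof -
  have bij: "bij_betw Suc {0..<k} {1..k}"
    by (rule bij_betwI[where g = "\<lambda>x. x - 1"]) auto
  have inj: "inj_on Suc {0..<k}" by simp
  have bij': "bij_betw (\<lambda>x. x - 1) {1..k} {0..<k}"
    by (rule bij_betwI[where g = Suc]) auto
  have inj': "inj_on (\<lambda>x. x - 1 :: nat) {1..k}" by (rule inj_onI) auto
  have "(\<Sum>p | p permutes {0..<k}. of_int (sign p) * (\<Prod>i = 0..<k. M (Suc i) (Suc (p i)))) = detk k M"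
    unfolding detk_def
  proof (rule sum.reindex_bij_witness[where i = "map_permutation {1..k} (\<lambda>x. x - 1)" and j = "map_permutation {0..<k} Suc"])
    fix p assume "p \<in> {p. p permutes {0..<k}}"
    then have p: "p permutes {0..<k}" by simp
    have "map_permutation {1..k} (\<lambda>x. x - 1) (map_permutation {0..<k} Suc p) = map_permutation {0..<k} ((\<lambda>x. x - 1) \<circ> Suc) p"
      by (rule map_permutation_compose[OF bij inj'])
    then show "map_permutation {1..k} (\<lambda>x. x - 1) (map_permutation {0..<k} Suc p) = p"
      using p by (simp add: o_def map_permutation_ident)
    show "map_permutation {0..<k} Suc p \<in> {p. p permutes {1..k}}"
      using map_permutation_permutes[OF bij p] by simp
    have "(\<Prod>i = 1..k. M i (map_permutation {0..<k} Suc p i)) = (\<Prod>i = 0..<k. M (Suc i) (Suc (p i)))"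
      using prod.reindex_bij_betw[OF bij, of "\<lambda>i. M i (map_permutation {0..<k} Suc p i)"]
      by (simp add: map_permutation_apply[OF inj])
    moreover have "sign (map_permutation {0..<k} Suc p) = sign p"
      by (rule sign_map_permutation) (use p in auto)
    ultimately show "of_int (sign (map_permutation {0..<k} Suc p)) * (\<Prod>i = 1..k. M i (map_permutation {0..<k} Suc p i))
        = of_int (sign p) * (\<Prod>i = 0..<k. M (Suc i) (Suc (p i)))" by simp
  next
    fix p assume "p \<in> {p. p permutes {1..k}}"
    then have p: "p permutes {1..k}" by simp
    have "map_permutation {0..<k} Suc (map_permutation {1..k} (\<lambda>x. x - 1) p) = map_permutation {1..k} (Suc \<circ> (\<lambda>x. x - 1)) p"
      by (rule map_permutation_compose[OF bij' inj])
    also have "\<dots> = map_permutation {1..k} (\<lambda>x. x) p"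
      by (rule map_permutation_cong) (use p in \<open>auto simp: inj_on_def\<close>)
    finally show "map_permutation {0..<k} Suc (map_permutation {1..k} (\<lambda>x. x - 1) p) = p"
      using p by (simp add: map_permutation_ident)
    show "map_permutation {1..k} (\<lambda>x. x - 1) p \<in> {p. p permutes {0..<k}}"
      using map_permutation_permutes[OF bij' p] by simp
  qed
  moreover have "Determinant.det (detmat k M) = (\<Sum>p | p permutes {0..<k}. of_int (sign p) * (\<Prod>i = 0..<k. M (Suc i) (Suc (p i))))"
    unfolding det_def'[OF detmat_carrier]
  proof (intro sum.cong refl arg_cong2[where f = "(*)"] prod.cong)
    fix p i assume "p \<in> {p. p permutes {0..<k}}" "i \<in> {0..<k}"
    then have "p i < k" "i < k" using permutes_in_image[of p "{0..<k}" i] by auto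
    then show "detmat k M $$ (i, p i) = M (Suc i) (Suc (p i))" by (simp add: detmat_def)
  qed
  ultimately show ?thesis by simp
qed

definition cofk :: "nat \<Rightarrow> (nat \<Rightarrow> nat \<Rightarrow> complex) \<Rightarrow> nat \<Rightarrow> nat \<Rightarrow> complex" where
  "cofk k M r c = cofactor (detmat k M) (r - 1) (c - 1)"

lemma sum_shift_Suc: "(\<Sum>c = 1..k. f c) = (\<Sum>c<k. f (Suc c))" for f :: "nat \<Rightarrow> complex"
  by (rule sum.reindex_bij_witness[where i = Suc and j = "\<lambda>x. x - 1"]) auto

lemma cofk_row:
  assumes "r \<in> {1..k}" "r' \<in> {1..k}"
  shows "(\<Sum>c = 1..k. M r c * cofk k M r' c) = (if r = r' then detk k M else 0)"
proof -
  have i: "r - 1 < k" "r' - 1 < k" "r - 1 = r' - 1 \<longleftrightarrow> r = r'" using assms by auto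
  have "(detmat k M * adj_mat (detmat k M)) $$ (r - 1, r' - 1) = (\<Sum>c<k. M r (Suc c) * cofactor (detmat k M) (r' - 1) c)"
    using i assms unfolding times_mat_def scalar_prod_def adj_mat_def detmat_def
    by (auto intro!: sum.cong)
  moreover have "(detmat k M * adj_mat (detmat k M)) $$ (r - 1, r' - 1) = (if r = r' then detk k M else 0)"
    using adj_mat(2)[OF detmat_carrier, of k M] i by (simp add: detk_eq_det)
  ultimately show ?thesis unfolding sum_shift_Suc cofk_def by simp
qed

lemma cofk_col:
  assumes "c \<in> {1..k}" "c' \<in> {1..k}"
  shows "(\<Sum>r = 1..k. M r c * cofk k M r c') = (if c = c' then detk k M else 0)"
proof -
  have i: "c - 1 < k" "c' - 1 < k" "c' - 1 = c - 1 \<longleftrightarrow> c = c'" using assms by auto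
  have "(adj_mat (detmat k M) * detmat k M) $$ (c' - 1, c - 1) = (\<Sum>r<k. M (Suc r) c * cofactor (detmat k M) r (c' - 1))"
    using i assms unfolding times_mat_def scalar_prod_def adj_mat_def detmat_def
    by (auto intro!: sum.cong)
  moreover have "(adj_mat (detmat k M) * detmat k M) $$ (c' - 1, c - 1) = (if c = c' then detk k M else 0)"
    using adj_mat(3)[OF detmat_carrier, of k M] i by (simp add: detk_eq_det)
  ultimately show ?thesis unfolding sum_shift_Suc cofk_def by simp
qed

lemma cofk_cong:
  assumes "r \<in> {1..k}" "c \<in> {1..k}"
    "\<And>r' c'. r' \<in> {1..k} \<Longrightarrow> c' \<in> {1..k} \<Longrightarrow> r' \<noteq> r \<Longrightarrow> c' \<noteq> c \<Longrightarrow> M r' c' = N r' c'"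
  shows "cofk k M r c = cofk k N r c"
proof -
  have "mat_delete (detmat k M) (r - 1) (c - 1) = mat_delete (detmat k N) (r - 1) (c - 1)"
    using assms by (intro eq_matI) (auto simp: mat_delete_def detmat_def)
  then show ?thesis by (simp add: cofk_def cofactor_def)
qed

lemma detk_cong: "(\<And>r c. r \<in> {1..k} \<Longrightarrow> c \<in> {1..k} \<Longrightarrow> M r c = N r c) \<Longrightarrow> detk k M = detk k N"
  unfolding detk_eq_det detmat_def by (intro arg_cong[of _ _ Determinant.det] cong_mat) auto

text \<open>The cofactors of a column do not involve its entries, so the Laplace expansions of both
  determinants share them.\<close>

lemma detk_change_col:
  assumes c: "c \<in> {1..k}"
    and other: "\<And>r' c'. r' \<in> {1..k} \<Longrightarrow> c' \<in> {1..k} \<Longrightarrow> c' \<noteq> c \<Longrightarrow> N r' c' = M r' c'"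
  shows "detk k N = detk k M + (\<Sum>r = 1..k. (N r c - M r c) * cofk k M r c)"
proof -
  have "detk k N = (\<Sum>r = 1..k. N r c * cofk k N r c)" using cofk_col[OF c c] by simp
  also have "\<dots> = (\<Sum>r = 1..k. N r c * cofk k M r c)"
    using cofk_cong[of _ k c N M] c other by (intro sum.cong) auto
  also have "\<dots> = (\<Sum>r = 1..k. M r c * cofk k M r c) + (\<Sum>r = 1..k. (N r c - M r c) * cofk k M r c)"
    by (simp add: sum.distrib[symmetric] algebra_simps)
  finally show ?thesis using cofk_col[OF c c] by simp
qed

lemma detk_change_entry:
  assumes rc: "r \<in> {1..k}" "c \<in> {1..k}"
    and other: "\<And>r' c'. r' \<in> {1..k} \<Longrightarrow> c' \<in> {1..k} \<Longrightarrow> (r', c') \<noteq> (r, c) \<Longrightarrow> N r' c' = M r' c'"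
  shows "detk k N = detk k M + (N r c - M r c) * cofk k M r c"
proof -
  have "detk k N = detk k M + (\<Sum>r' = 1..k. (N r' c - M r' c) * cofk k M r' c)"
    by (rule detk_change_col[OF rc(2)]) (use other in auto)
  also have "(\<Sum>r' = 1..k. (N r' c - M r' c) * cofk k M r' c)
      = (\<Sum>r' = 1..k. if r' = r then (N r c - M r c) * cofk k M r c else 0)"
    using other rc by (intro sum.cong) auto
  finally show ?thesis using rc by simp
qed

text \<open>Row n is orthogonal to the cofactors of row i unless i = n, in which case the operation
  scales that row.\<close>

lemma detk_add_row:
  assumes "i \<in> {1..k}" "n \<in> {1..k}"
    and other: "\<And>r c. r \<in> {1..k} \<Longrightarrow> c \<in> {1..k} \<Longrightarrow> r \<noteq> i \<Longrightarrow> N r c = M r c"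
    and row: "\<And>c. c \<in> {1..k} \<Longrightarrow> N i c = M i c + \<tau> * M n c"
  shows "detk k N = (if i = n then 1 + \<tau> else 1) * detk k M"
proof -
  have "detk k N = (\<Sum>c = 1..k. N i c * cofk k N i c)" using cofk_row[OF assms(1,1)] by simp
  also have "\<dots> = (\<Sum>c = 1..k. (M i c + \<tau> * M n c) * cofk k M i c)"
    using cofk_cong[of i k _ N M] assms by (intro sum.cong) auto
  also have "\<dots> = (\<Sum>c = 1..k. M i c * cofk k M i c) + \<tau> * (\<Sum>c = 1..k. M n c * cofk k M i c)"
    by (simp add: sum.distrib[symmetric] sum_distrib_left algebra_simps)
  finally show ?thesis using cofk_row[OF assms(1,1), of M] cofk_row[OF assms(2,1), of M]
    by (auto simp: distrib_right)
qed

lemma cofk_last: "cofk (Suc k) M (Suc k) (Suc k) = detk k M"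
proof -
  have "mat_delete (detmat (Suc k) M) k k = detmat k M"
    by (intro eq_matI) (auto simp: mat_delete_def detmat_def)
  then show ?thesis by (simp add: cofk_def cofactor_def detk_eq_det)
qed

lemma cofk_above_last:
  "cofk (Suc (Suc k)) M (Suc k) (Suc (Suc k)) = - detk (Suc k) (\<lambda>r c. M (if r = Suc k then Suc (Suc k) else r) c)"
proof -
  have "mat_delete (detmat (Suc (Suc k)) M) k (Suc k) = detmat (Suc k) (\<lambda>r c. M (if r = Suc k then Suc (Suc k) else r) c)"
    by (intro eq_matI) (auto simp: mat_delete_def detmat_def)
  then show ?thesis by (simp add: cofk_def cofactor_def detk_eq_det)
qed

text \<open>Pairing the relation with the cofactors of row i leaves \<open>l i\<close> times the
  determinant.\<close>

lemma detk_eq_0_left_kernel: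
  assumes i: "i \<in> {1..k}" and l: "l i \<noteq> 0"
    and ker: "\<And>c. c \<in> {1..k} \<Longrightarrow> (\<Sum>r = 1..k. l r * M r c) = 0"
  shows "detk k M = 0"
proof -
  have "0 = (\<Sum>c = 1..k. (\<Sum>r = 1..k. l r * M r c) * cofk k M i c)" using ker by simp
  also have "\<dots> = (\<Sum>r = 1..k. l r * (\<Sum>c = 1..k. M r c * cofk k M i c))"
    unfolding sum_distrib_right sum_distrib_left by (subst sum.swap) (simp add: mult.assoc)
  also have "\<dots> = (\<Sum>r = 1..k. if r = i then l i * detk k M else 0)"
    using cofk_row[OF _ i, of _ M] by (intro sum.cong) auto
  also have "\<dots> = l i * detk k M" using i by simp
  finally show ?thesis using l by simp
qed

lemma detk_pfun: "(\<And>i j. i \<in> {1..k} \<Longrightarrow> j \<in> {1..k} \<Longrightarrow> pfun C (\<lambda>a. M a i j)) \<Longrightarrow> pfun C (\<lambda>a. detk k (M a))"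
  unfolding detk_def
  by (intro pfun_sum pfun_mult pfun_const pfun_prod) (use permutes_in_image in fastforce)

lemma detk_smult: "detk k (\<lambda>i j. t * M i j) = t ^ k * detk k M"
  unfolding detk_def by (simp add: prod.distrib sum_distrib_left algebra_simps)

section \<open>The factors of the equation\<close>

lemma skew_matA: "skew (matA a)"
  by unfold_locales (auto simp: matA_def)

lemma matA_upd:
  assumes "u < v"
  shows "matA (a((u, v) := s)) i j = (if i = u \<and> j = v then s else if i = v \<and> j = u then - s else matA a i j)"
  using assms by (auto simp: matA_def)

lemma matA_smult: "matA (\<lambda>p. t * a p) = (\<lambda>i j. t * matA a i j)"
  by (auto simp: matA_def fun_eq_iff)

lemma matA_add_smult: "matA (\<lambda>p. a p + t * b p) i j = matA a i j + t * matA b i j"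
  by (auto simp: matA_def)

lemma matA_pfun: "i \<in> {1..m} \<Longrightarrow> j \<in> {1..m} \<Longrightarrow> pfun (coords m) (\<lambda>a. matA a i j)"
  unfolding matA_def
  by (cases i j rule: linorder_cases) (auto intro!: pfun_const pfun_minus pfun_coord simp: coords_def)

lemma pf_pfun: "set xs \<subseteq> {1..m} \<Longrightarrow> pfun (coords m) (\<lambda>a. pf (matA a) xs)"
proof (induction "length xs" arbitrary: xs rule: less_induct)
  case less
  show ?case
  proof (cases xs)
    case Nil
    then show ?thesis by (simp add: pfun_const)
  next
    case (Cons i ys)
    have "pfun (coords m) (\<lambda>a. pf (matA a) (del t ys))" if "t < length ys" for t
      using less that Cons set_del_subset[of t ys] by (intro less.hyps) (auto simp: length_del)
    then show ?thesis
      unfolding Cons pf_Cons using less.prems Cons nth_mem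
      by (intro pfun_sum pfun_mult pfun_const matA_pfun) fastforce+
  qed
qed

text \<open>With u and v in front, the expansion contains the entry at (u, v) once, with coefficient
  the Pfaffian of \<open>ws\<close>; every other term lacks u or v.\<close>

lemma pf_change_entry:
  assumes uv: "u < v" and d: "distinct (ws @ [u, v])"
  shows "pf (matA (a((u, v) := s))) (ws @ [u, v]) = pf (matA a) (ws @ [u, v]) + (s - a (u, v)) * pf (matA a) ws"
proof -
  interpret skew "matA a" by (rule skew_matA)
  interpret S: skew "matA (a((u, v) := s))" by (rule skew_matA)
  have 1: "pf (matA (a((u, v) := s))) ws = pf (matA a) ws"
    using d uv by (intro pf_cong) (auto simp: matA_upd)
  have 2: "pf (matA (a((u, v) := s))) (ws[t := v]) = pf (matA a) (ws[t := v])" for t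
    using d uv set_update_subset_insert[of ws t v] by (intro pf_cong) (auto simp: matA_upd)
  have 3: "matA (a((u, v) := s)) u (ws ! t) = matA a u (ws ! t)" if "t < length ws" for t
    using d uv nth_mem[OF that] by (auto simp: matA_upd)
  have "matA a u v = a (u, v)" "matA (a((u, v) := s)) u v = s" using uv by (auto simp: matA_def)
  then show ?thesis
    unfolding pf_append_two S.pf_append_two pf_expand_two S.pf_expand_two 1 2
    by (simp add: 3 algebra_simps)
qed

lemma pf_independent:
  assumes "u < v" "v \<notin> set xs \<or> u \<notin> set xs"
  shows "pf (matA (a((u, v) := s))) xs = pf (matA a) xs"
  using assms by (intro pf_cong) (auto simp: matA_upd)

definition Dfac :: "nat \<Rightarrow> pt \<Rightarrow> complex" where
  "Dfac k a = detk k (\<lambda>i j. matA a i (j + 2))"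

definition Slist :: "nat \<Rightarrow> nat list" where
  "Slist k = [eps k..<Suc k]"

definition Pfac :: "nat \<Rightarrow> pt \<Rightarrow> complex" where
  "Pfac k a = pf (matA a) (Slist k)"

text \<open>Both families share one index type, so that products, coprimality and division can be
  treated for all factors at once.\<close>

definition fac :: "nat + nat \<Rightarrow> pt \<Rightarrow> complex" where
  "fac x = (case x of Inl k \<Rightarrow> Dfac k | Inr k \<Rightarrow> Pfac k)"

definition facs :: "nat \<Rightarrow> (nat + nat) set" where
  "facs m = Inl ` {1..m - 2} \<union> Inr ` {2..m}"

lemma fac_simps [simp]: "fac (Inl k) = Dfac k" "fac (Inr k) = Pfac k"
  by (auto simp: fac_def)

lemma finite_facs [simp]: "finite (facs m)"
  by (simp add: facs_def)

lemma eps_bounds: "1 \<le> eps k" "eps k \<le> 2" by (auto simp: eps_def)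

lemma set_Slist [simp]: "set (Slist k) = {eps k..k}"
  by (auto simp: Slist_def)

lemma distinct_Slist [simp]: "distinct (Slist k)"
  by (simp add: Slist_def)

text \<open>\<open>eps\<close> depends only on the parity, so lowering k by 2 drops exactly the last
  two indices. This is the origin of the recursion from \<open>Pfac (k - 2)\<close> to
  \<open>Pfac k\<close>.\<close>

lemma Slist_split:
  assumes "k \<ge> 2"
  shows "Slist k = Slist (k - 2) @ [k - 1, k]"
proof -
  obtain j where k: "k = Suc (Suc j)" using assms by (metis add_2_eq_Suc le_Suc_ex)
  have "eps k = eps j" unfolding k eps_def by simp
  moreover have "eps j \<le> Suc j" by (auto simp: eps_def elim: oddE)
  ultimately show ?thesis by (simp add: Slist_def k)
qed

lemma hdiv_eq: "hdiv m a = (\<Prod>x\<in>facs m. fac x a)"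
proof -
  have "(\<Prod>x\<in>facs m. fac x a) = (\<Prod>x\<in>Inl ` {1..m - 2}. fac x a) * (\<Prod>x\<in>Inr ` {2..m}. fac x a)"
    unfolding facs_def by (rule prod.union_disjoint) auto
  also have "\<dots> = (\<Prod>k=1..m - 2. Dfac k a) * (\<Prod>k=2..m. Pfac k a)"
    by (simp add: prod.reindex)
  finally have prod: "(\<Prod>x\<in>facs m. fac x a) = (\<Prod>k=1..m - 2. Dfac k a) * (\<Prod>k=2..m. Pfac k a)" .
  have "Pfac k a = PfS a {eps k..k}" for k
    by (simp add: Pfac_def PfS_def Slist_def atLeastLessThanSuc_atLeastAtMost[symmetric])
  then show ?thesis unfolding prod by (simp add: hdiv_def Dfac_def)
qed

lemma Dfac_pfun: "k + 2 \<le> m \<Longrightarrow> pfun (coords m) (Dfac k)"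
  unfolding Dfac_def[abs_def] by (intro detk_pfun matA_pfun) auto

lemma Pfac_pfun: "k \<le> m \<Longrightarrow> pfun (coords m) (Pfac k)"
  unfolding Pfac_def[abs_def] using eps_bounds[of k] by (intro pf_pfun) auto

lemma fac_pfun: "x \<in> facs m \<Longrightarrow> pfun (coords m) (fac x)"
  by (auto simp: facs_def intro!: Dfac_pfun Pfac_pfun)

lemma fac_homogeneous: "\<exists>d. homogeneous d (fac x)"
proof (cases x)
  case (Inl k)
  then have "homogeneous k (fac x)"
    by (simp add: homogeneous_def Dfac_def[abs_def] matA_smult detk_smult)
  then show ?thesis ..
next
  case (Inr k)
  then have "homogeneous (length (Slist k) div 2) (fac x)"
    by (simp add: homogeneous_def Pfac_def[abs_def] matA_smult pf_smult)
  then show ?thesis ..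
qed

lemma Dfac_0 [simp]: "Dfac 0 a = 1"
  by (simp add: Dfac_def detk_def)

text \<open>For k = 0 and k = 1 the lower end is k + 1 and the index list is empty; the recursion
  starts from the constant 1.\<close>

lemma Pfac_less_2: "k < 2 \<Longrightarrow> Pfac k a = 1"
  by (auto simp: Pfac_def Slist_def eps_def less_2_cases_iff)

lemma Dfac_independent: "u < v \<Longrightarrow> k < u \<or> k + 2 < v \<Longrightarrow> Dfac k (a((u, v) := s)) = Dfac k a"
  unfolding Dfac_def by (intro detk_cong) (auto simp: matA_upd)

lemma Pfac_independent: "u < v \<Longrightarrow> k < v \<Longrightarrow> Pfac k (a((u, v) := s)) = Pfac k a"
  unfolding Pfac_def by (intro pf_independent) auto

text \<open>The coordinate is the bottom right corner of the matrix; its mirror image under skew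
  symmetry would be in row k + 3, outside the block.\<close>

lemma Dfac_affine:
  "Dfac (Suc k) (a((Suc k, k + 3) := s)) = Dfac (Suc k) a + (s - a (Suc k, k + 3)) * Dfac k a"
proof -
  have "Dfac (Suc k) (a((Suc k, k + 3) := s)) = Dfac (Suc k) a +
    (matA (a((Suc k, k + 3) := s)) (Suc k) (Suc k + 2) - matA a (Suc k) (Suc k + 2)) * cofk (Suc k) (\<lambda>i j. matA a i (j + 2)) (Suc k) (Suc k)"
    unfolding Dfac_def by (rule detk_change_entry) (auto simp: matA_upd)
  then show ?thesis by (simp add: cofk_last Dfac_def matA_def numeral_3_eq_3)
qed

lemma Pfac_affine:
  assumes "k \<ge> 2"
  shows "Pfac k (a((k - 1, k) := s)) = Pfac k a + (s - a (k - 1, k)) * Pfac (k - 2) a"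
  unfolding Pfac_def Slist_split[OF assms]
  by (rule pf_change_entry) (use assms in \<open>auto simp: Slist_split[OF assms, symmetric]\<close>)

text \<open>The coefficient of the coordinate \<open>(k, k + 3)\<close> in \<open>Dfac (k + 1)\<close>.\<close>

definition Dminor :: "nat \<Rightarrow> pt \<Rightarrow> complex" where
  "Dminor k a = - detk k (\<lambda>r c. matA a (if r = k then Suc k else r) (c + 2))"

lemma Dfac_affine2:
  assumes "k \<ge> 1"
  shows "Dfac (Suc k) (a((k, k + 3) := s)) = Dfac (Suc k) a + (s - a (k, k + 3)) * Dminor k a"
proof -
  obtain j where k: "k = Suc j" using assms by (cases k) auto
  have "Dfac (Suc k) (a((k, k + 3) := s)) = Dfac (Suc k) a +
    (matA (a((k, k + 3) := s)) k (Suc k + 2) - matA a k (Suc k + 2)) * cofk (Suc k) (\<lambda>i j. matA a i (j + 2)) k (Suc k)"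
    unfolding Dfac_def by (rule detk_change_entry) (use assms in \<open>auto simp: matA_upd\<close>)
  then show ?thesis by (simp add: cofk_above_last Dminor_def matA_def numeral_3_eq_3 k)
qed

lemma Dminor_affine:
  "Dminor (Suc k) (a((k + 2, k + 3) := s)) = Dminor (Suc k) a + (s - a (k + 2, k + 3)) * (- Dfac k a)"
proof -
  let ?N = "\<lambda>a r c. matA a (if r = Suc k then Suc (Suc k) else r) (c + 2)"
  have "detk (Suc k) (?N (a((k + 2, k + 3) := s))) = detk (Suc k) (?N a) +
    (?N (a((k + 2, k + 3) := s)) (Suc k) (Suc k) - ?N a (Suc k) (Suc k)) * cofk (Suc k) (?N a) (Suc k) (Suc k)"
    by (rule detk_change_entry) (auto simp: matA_upd)
  moreover have "detk k (?N a) = Dfac k a" unfolding Dfac_def by (rule detk_cong) auto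
  ultimately show ?thesis by (simp add: cofk_last Dminor_def matA_def numeral_3_eq_3)
qed

text \<open>The coefficient of the coordinate \<open>(k - 2, k)\<close> in \<open>Pfac k\<close>.\<close>

definition Pminor :: "nat \<Rightarrow> pt \<Rightarrow> complex" where
  "Pminor k a = - pf (matA a) (Slist (k - 4) @ [k - 3, k - 1])"

lemma Pfac_affine2:
  assumes "k \<ge> 4"
  shows "Pfac k (a((k - 2, k) := s)) = Pfac k a + (s - a (k - 2, k)) * Pminor k a"
proof -
  define ws where "ws = Slist (k - 4) @ [k - 3, k - 1]"
  have sp: "Slist k = (Slist (k - 4) @ [k - 3]) @ (k - 2) # (k - 1) # [k]"
  proof -
    obtain j where k: "k = j + 4" using assms by (metis add.commute le_Suc_ex)
    have "Slist k = Slist (j + 2) @ [j + 3, j + 4]" using Slist_split[of k] by (simp add: k)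
    also have "Slist (j + 2) = Slist j @ [j + 1, j + 2]" using Slist_split[of "j + 2"] by simp
    finally show ?thesis by (simp add: k)
  qed
  have eq: "Pfac k b = - pf (matA b) (ws @ [k - 2, k])" for b
  proof -
    interpret skew "matA b" by (rule skew_matA)
    show ?thesis unfolding Pfac_def sp using pf_swap[of "Slist (k - 4) @ [k - 3]" "k - 2" "k - 1" "[k]"] by (simp add: ws_def)
  qed
  have "pf (matA (a((k - 2, k) := s))) (ws @ [k - 2, k]) = pf (matA a) (ws @ [k - 2, k]) + (s - a (k - 2, k)) * pf (matA a) ws"
    by (rule pf_change_entry) (use assms in \<open>auto simp: ws_def\<close>)
  then show ?thesis unfolding eq Pminor_def ws_def[symmetric] by simp
qed

lemma Pminor_affine:
  assumes "k \<ge> 4"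
  shows "Pminor k (a((k - 3, k - 1) := s)) = Pminor k a + (s - a (k - 3, k - 1)) * (- Pfac (k - 4) a)"
proof -
  have "pf (matA (a((k - 3, k - 1) := s))) (Slist (k - 4) @ [k - 3, k - 1])
     = pf (matA a) (Slist (k - 4) @ [k - 3, k - 1]) + (s - a (k - 3, k - 1)) * pf (matA a) (Slist (k - 4))"
    by (rule pf_change_entry) (use assms in auto)
  then show ?thesis by (simp add: Pminor_def Pfac_def)
qed

subsection \<open>The factors are pairwise coprime\<close>

lemma Dfac_nonzero: "\<exists>a. Dfac k a \<noteq> 0"
proof (induction k)
  case (Suc k)
  then obtain a where a: "Dfac k a \<noteq> 0" by blast
  define s where "s = a (Suc k, k + 3) + (1 - Dfac (Suc k) a) / Dfac k a"
  have "Dfac (Suc k) (a((Suc k, k + 3) := s)) = 1" unfolding Dfac_affine s_def using a by simp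
  then show ?case by (metis one_neq_zero)
qed simp

lemma Pfac_nonzero: "\<exists>a. Pfac k a \<noteq> 0"
proof (induction k rule: less_induct)
  case (less k)
  show ?case
  proof (cases "k < 2")
    case True
    then show ?thesis using Pfac_less_2 by simp
  next
    case False
    then obtain a where a: "Pfac (k - 2) a \<noteq> 0" using less[of "k - 2"] by auto
    define s where "s = a (k - 1, k) + (1 - Pfac k a) / Pfac (k - 2) a"
    have "Pfac k (a((k - 1, k) := s)) = 1" using Pfac_affine[of k a s] a False unfolding s_def by simp
    then show ?thesis by (metis one_neq_zero)
  qed
qed

text \<open>On the line joining a good point for I to a good point for i, every function has
  finitely many zeros in the unit disc.\<close>

lemma common_nonzero:
  assumes "finite I" "\<And>i. i \<in> I \<Longrightarrow> pfun C (f i)" "\<And>i. i \<in> I \<Longrightarrow> \<exists>a. f i a \<noteq> 0"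
  shows "\<exists>a. \<forall>i\<in>I. f i a \<noteq> 0"
  using assms
proof (induction I rule: finite_induct)
  case (insert i I)
  have "\<exists>a. \<forall>j\<in>I. f j a \<noteq> 0" using insert.prems by (intro insert.IH) auto
  then obtain a where a: "\<forall>j\<in>I. f j a \<noteq> 0" by blast
  obtain b where b: "f i b \<noteq> 0" using insert.prems(2)[of i] by blast
  define e where "e p = b p - a p" for p
  have l: "on_line e a 0 = a" "on_line e a 1 = b" by (auto simp: on_line_def e_def)
  have "finite {t \<in> cball 0 1. f j (on_line e a t) = 0}" if j: "j \<in> insert i I" for j
  proof (rule finite_zeros_cball)
    show "(\<lambda>t. f j (on_line e a t)) holomorphic_on UNIV" by (rule pfun_on_line) (use insert.prems j in blast)
    show "f j (on_line e a (if j = i then 1 else 0)) \<noteq> 0" using j a b l by auto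
  qed
  then have fin: "finite (\<Union>j\<in>insert i I. {t \<in> cball 0 1. f j (on_line e a t) = 0})"
    using insert.hyps by blast
  have "infinite (cball (0::complex) 1)" by (intro uncountable_infinite uncountable_cball) simp
  then obtain t where "t \<in> cball 0 1" "t \<notin> (\<Union>j\<in>insert i I. {t \<in> cball 0 1. f j (on_line e a t) = 0})"
    using fin by (meson finite_subset subsetI)
  then show ?case by (intro exI[of _ "on_line e a t"]) auto
qed simp

text \<open>The normalisation makes a step of length |t| along e enlarge a polydisc by at most |t|.
  It is reached by rescaling, as the factors are homogeneous.\<close>

lemma regular_direction:
  "\<exists>e. (\<forall>x\<in>facs m. fac x e \<noteq> 0) \<and> (\<forall>p\<in>coords m. norm (e p) \<le> 1)"
proof -
  have "\<exists>a. fac x a \<noteq> 0" for x by (cases x) (auto simp: Dfac_nonzero Pfac_nonzero)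
  then obtain a where a: "\<forall>x\<in>facs m. fac x a \<noteq> 0"
    using common_nonzero[where f = fac and I = "facs m" and C = "coords m", OF finite_facs fac_pfun] by blast
  define B where "B = (\<Sum>p\<in>coords m. norm (a p)) + 1"
  have B: "norm (a p) \<le> B" if "p \<in> coords m" for p
    using member_le_sum[OF that, of "\<lambda>p. norm (a p)"] unfolding B_def by simp
  have B0: "B > 0" unfolding B_def by (intro add_nonneg_pos sum_nonneg) auto
  show ?thesis
  proof (intro exI[of _ "\<lambda>p. of_real (1 / B) * a p"] conjI ballI)
    fix x assume x: "x \<in> facs m"
    obtain d where "homogeneous d (fac x)" using fac_homogeneous by blast
    then have "fac x (\<lambda>p. of_real (1 / B) * a p) = of_real (1 / B) ^ d * fac x a"
      unfolding homogeneous_def by blast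
    then show "fac x (\<lambda>p. of_real (1 / B) * a p) \<noteq> 0" using a x B0 by simp
  next
    fix p assume "p \<in> coords m"
    then show "norm (of_real (1 / B) * a p) \<le> 1" using B B0 by (simp add: norm_mult norm_divide)
  qed
qed

lemma coprime_lines_minus: "coprime_lines e f g \<Longrightarrow> coprime_lines e f (\<lambda>a. - g a)"
  by (simp add: coprime_lines_def)

context
  fixes m e
  assumes e: "\<And>x. x \<in> facs m \<Longrightarrow> fac x e \<noteq> 0"
begin

lemma Dfac_regular:
  assumes "k + 2 \<le> m"
  obtains d where "pfun (coords m) (Dfac k)" "homogeneous d (Dfac k)" "Dfac k e \<noteq> 0"
proof -
  have "Dfac k e \<noteq> 0" using e[of "Inl k"] assms by (cases "k = 0") (auto simp: facs_def)
  then show ?thesis using that Dfac_pfun[OF assms] fac_homogeneous[of "Inl k"] by auto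
qed

lemma Pfac_regular:
  assumes "k \<le> m"
  obtains d where "pfun (coords m) (Pfac k)" "homogeneous d (Pfac k)" "Pfac k e \<noteq> 0"
proof -
  have "Pfac k e \<noteq> 0" using e[of "Inr k"] assms by (cases "k < 2") (auto simp: facs_def Pfac_less_2)
  then show ?thesis using that Pfac_pfun[OF assms] fac_homogeneous[of "Inr k"] by auto
qed

lemma Dfac_step:
  assumes "k + 2 \<le> m" "u < v" "k < u \<or> k + 2 < v"
    and "\<And>a s. F (a((u, v) := s)) = F a + (s - a (u, v)) * G a" "coprime_lines e (Dfac k) G"
  shows "coprime_lines e (Dfac k) F"
proof -
  obtain d where d: "pfun (coords m) (Dfac k)" "homogeneous d (Dfac k)" "Dfac k e \<noteq> 0"
    using Dfac_regular[OF assms(1)] by blast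
  show ?thesis
  proof (rule coprime_lines_affine[where z = "(u, v)" and G = G, OF d])
    show "Dfac k (a((u, v) := s)) = Dfac k a" for a s by (rule Dfac_independent) (use assms in auto)
  qed (use assms in auto)
qed

lemma Pfac_step:
  assumes "k \<le> m" "u < v" "k < v"
    and "\<And>a s. F (a((u, v) := s)) = F a + (s - a (u, v)) * G a" "coprime_lines e (Pfac k) G"
  shows "coprime_lines e (Pfac k) F"
proof -
  obtain d where d: "pfun (coords m) (Pfac k)" "homogeneous d (Pfac k)" "Pfac k e \<noteq> 0"
    using Pfac_regular[OF assms(1)] by blast
  show ?thesis
  proof (rule coprime_lines_affine[where z = "(u, v)" and G = G, OF d])
    show "Pfac k (a((u, v) := s)) = Pfac k a" for a s by (rule Pfac_independent) (use assms in auto)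
  qed (use assms in auto)
qed

text \<open>The corner coordinate of \<open>Dfac j\<close> reduces j by one. For neighbours i = j -
  1 this is useless, the coefficient being \<open>Dfac i\<close> itself. Then the entry above the
  corner is used, and in its coefficient \<open>Dminor i\<close> again the corner, whose coefficient
  is \<open>Dfac (i - 1)\<close> up to sign.\<close>

lemma coprime_Dfac_Dfac: "i < j \<Longrightarrow> j + 2 \<le> m \<Longrightarrow> coprime_lines e (Dfac i) (Dfac j)"
proof (induction j arbitrary: i rule: less_induct)
  case (less j)
  obtain k where j: "j = Suc k" using less.prems by (cases j) auto
  show ?case
  proof (cases "i = 0")
    case True
    then show ?thesis by (intro coprime_lines_sym[OF coprime_lines_nonzero]) simp
  next
    case False
    show ?thesis
    proof (cases "i < k")
      case True
      show ?thesis unfolding j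
        by (rule Dfac_step[OF _ _ _ Dfac_affine]) (use less.IH[of k i] less.prems True j in auto)
    next
      case False
      then have ik: "i = k" using less.prems j by simp
      obtain l where l: "k = Suc l" using \<open>i \<noteq> 0\<close> ik by (cases k) auto
      have "coprime_lines e (Dfac k) (\<lambda>a. - Dfac l a)"
        by (rule coprime_lines_minus, rule coprime_lines_sym) (use less.IH[of k l] less.prems j l in auto)
      note c = this
      have "coprime_lines e (Dfac k) (Dminor k)"
        unfolding l by (rule Dfac_step[OF _ _ _ Dminor_affine]) (use c less.prems j l in auto)
      note c = this
      show ?thesis unfolding ik j
        by (rule Dfac_step[OF _ _ _ Dfac_affine2]) (use c less.prems j l in auto)
    qed
  qed
qed

text \<open>The coordinate (j - 1, j) reduces j by 2 and fails only for i = j - 2, where its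
  coefficient is \<open>Pfac i\<close>. There the coordinates (j - 2, j) and (j - 3, j - 1) lead to
  \<open>Pfac (j - 4)\<close>; neither occurs in \<open>Pfac i\<close>.\<close>

lemma coprime_Pfac_Pfac: "i < j \<Longrightarrow> j \<le> m \<Longrightarrow> coprime_lines e (Pfac i) (Pfac j)"
proof (induction j arbitrary: i rule: less_induct)
  case (less j)
  show ?case
  proof (cases "i < 2")
    case True
    then show ?thesis by (intro coprime_lines_sym[OF coprime_lines_nonzero]) (simp add: Pfac_less_2)
  next
    case False
    consider "i < j - 2" | "i = j - 1" | "i = j - 2" "j \<ge> 4" using less.prems False by linarith
    then show ?thesis
    proof cases
      case 1
      show ?thesis
        by (rule Pfac_step[OF _ _ _ Pfac_affine]) (use less.IH[of "j - 2" i] less.prems 1 False in auto)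
    next
      case 2
      have "coprime_lines e (Pfac i) (Pfac (j - 2))"
        by (rule coprime_lines_sym) (use less.IH[of i "j - 2"] less.prems 2 False in auto)
      note c = this
      show ?thesis
        by (rule Pfac_step[OF _ _ _ Pfac_affine]) (use c less.prems 2 False in auto)
    next
      case 3
      have "coprime_lines e (Pfac i) (\<lambda>a. - Pfac (j - 4) a)"
      proof (rule coprime_lines_minus, rule coprime_lines_sym, rule less.IH)
        show "i < j" "j - 4 < i" "i \<le> m" using less.prems 3 by linarith+
      qed
      note c = this
      have "coprime_lines e (Pfac i) (Pminor j)"
        by (rule Pfac_step[OF _ _ _ Pminor_affine[OF 3(2)]]) (use c less.prems 3 False in auto)
      note c = this
      show ?thesis
        by (rule Pfac_step[OF _ _ _ Pfac_affine2[OF 3(2)]]) (use c less.prems 3 False in auto)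
    qed
  qed
qed

text \<open>The factor that reaches further is lowered: for j >= i + 2 the coordinate (j - 1, j)
  does not occur in \<open>Dfac i\<close>, and for j < i + 2 the corner (i, i + 2) does not occur in
  \<open>Pfac j\<close>.\<close>

lemma coprime_Dfac_Pfac: "i + 2 \<le> m \<Longrightarrow> j \<le> m \<Longrightarrow> coprime_lines e (Dfac i) (Pfac j)"
proof (induction "i + j" arbitrary: i j rule: less_induct)
  case less
  consider "i = 0" | "j < 2" | "i > 0" "j \<ge> 2" "j \<ge> i + 2" | "i > 0" "j \<ge> 2" "j < i + 2" by linarith
  then show ?case
  proof cases
    case 1
    then show ?thesis by (intro coprime_lines_sym[OF coprime_lines_nonzero]) simp
  next
    case 2
    then show ?thesis by (intro coprime_lines_nonzero) (simp add: Pfac_less_2)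
  next
    case 3
    show ?thesis
      by (rule Dfac_step[OF _ _ _ Pfac_affine[OF 3(2)]]) (use less.hyps[of i "j - 2"] less.prems 3 in auto)
  next
    case 4
    then obtain k where i: "i = Suc k" by (cases i) auto
    have "coprime_lines e (Pfac j) (Dfac k)"
      by (rule coprime_lines_sym) (use less.hyps[of k j] less.prems i in auto)
    note c = this
    have "coprime_lines e (Pfac j) (Dfac i)"
      unfolding i by (rule Pfac_step[OF _ _ _ Dfac_affine]) (use c less.prems 4 i in auto)
    then show ?thesis by (rule coprime_lines_sym)
  qed
qed

lemma coprime_fac_fac:
  assumes "x \<in> facs m" "y \<in> facs m" "x \<noteq> y"
  shows "coprime_lines e (fac x) (fac y)"
proof -
  have DD: "coprime_lines e (Dfac i) (Dfac j)" if "i \<noteq> j" "i \<in> {1..m-2}" "j \<in> {1..m-2}" for i j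
    using that coprime_Dfac_Dfac[of i j] coprime_lines_sym[OF coprime_Dfac_Dfac[of j i]]
    by (cases "i < j") auto
  have PP: "coprime_lines e (Pfac i) (Pfac j)" if "i \<noteq> j" "i \<in> {2..m}" "j \<in> {2..m}" for i j
    using that coprime_Pfac_Pfac[of i j] coprime_lines_sym[OF coprime_Pfac_Pfac[of j i]]
    by (cases "i < j") auto
  have DP: "coprime_lines e (Dfac i) (Pfac j)" if "i \<in> {1..m-2}" "j \<in> {2..m}" for i j
    using that coprime_Dfac_Pfac[of i j] by auto
  from assms(1,2) consider i j where "x = Inl i" "y = Inl j" "i \<in> {1..m-2}" "j \<in> {1..m-2}"
    | i j where "x = Inl i" "y = Inr j" "i \<in> {1..m-2}" "j \<in> {2..m}"
    | i j where "x = Inr j" "y = Inl i" "i \<in> {1..m-2}" "j \<in> {2..m}"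
    | i j where "x = Inr i" "y = Inr j" "i \<in> {2..m}" "j \<in> {2..m}"
    unfolding facs_def by blast
  then show ?thesis
  proof cases
    case 1
    then show ?thesis using DD[of i j] assms(3) by simp
  next
    case 2
    then show ?thesis using DP[of i j] by simp
  next
    case 3
    then show ?thesis using coprime_lines_sym[OF DP[of i j]] by simp
  next
    case 4
    then show ?thesis using PP[of i j] assms(3) by simp
  qed
qed

end

text \<open>Zeros of g are required only on the part of {fac x = 0} off the other factors. There the
  leading coefficient of the affine coordinate is nonzero, being another factor or the constant
  1.\<close>

theorem fac_division:
  assumes x: "x \<in> facs m" and g: "holo_germ m g"
    and van: "near0 m (\<lambda>a. fac x a = 0 \<longrightarrow> (\<forall>y\<in>facs m - {x}. fac y a \<noteq> 0) \<longrightarrow> g a = 0)"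
  shows "\<exists>u. holo_germ m u \<and> near0 m (\<lambda>a. g a = u a * fac x a)"
proof -
  obtain e where e: "\<And>x. x \<in> facs m \<Longrightarrow> fac x e \<noteq> 0" "\<And>p. p \<in> coords m \<Longrightarrow> norm (e p) \<le> 1"
    using regular_direction by blast
  obtain r1 where r1: "r1 > 0" "holo_disc (coords m) r1 g" using g unfolding holo_germ_iff by blast
  obtain r2 where r2: "r2 > 0" "\<And>a. a \<in> polydisc (coords m) r2 \<Longrightarrow>
      fac x a = 0 \<Longrightarrow> (\<forall>y\<in>facs m - {x}. fac y a \<noteq> 0) \<Longrightarrow> g a = 0"
    using van unfolding near0_iff by blast
  define r where "r = min r1 r2"
  have r: "r > 0" "holo_disc (coords m) r g" using r1 r2 unfolding r_def by (auto elim: holo_disc_mono)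
  obtain d where d: "homogeneous d (fac x)" using fac_homogeneous by blast
  have "\<exists>p \<alpha>. pfun (coords m) \<alpha> \<and> (\<forall>a s. fac x (a(p := s)) = fac x a + (s - a p) * \<alpha> a) \<and>
      (\<forall>a. (\<forall>y\<in>facs m - {x}. fac y a \<noteq> 0) \<longrightarrow> \<alpha> a \<noteq> 0)"
  proof (cases x)
    case (Inl k)
    then obtain j where j: "k = Suc j" "j + 3 \<le> m" using x by (cases k) (auto simp: facs_def)
    have "Dfac j a \<noteq> 0" if "\<forall>y\<in>facs m - {x}. fac y a \<noteq> 0" for a
      using that[rule_format, of "Inl j"] j Inl by (cases "j = 0") (auto simp: facs_def)
    then show ?thesis
      using Dfac_pfun[of j m] j Inl Dfac_affine[of j]
      by (intro exI[of _ "(Suc j, j + 3)"] exI[of _ "Dfac j"]) simp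
  next
    case (Inr k)
    then have k: "k \<ge> 2" "k \<le> m" using x by (auto simp: facs_def)
    have "Pfac (k - 2) a \<noteq> 0" if "\<forall>y\<in>facs m - {x}. fac y a \<noteq> 0" for a
      using that[rule_format, of "Inr (k - 2)"] k Inr by (cases "k - 2 < 2") (auto simp: facs_def Pfac_less_2)
    then show ?thesis
      using Pfac_pfun[of "k - 2" m] k Inr Pfac_affine[of k]
      by (intro exI[of _ "(k - 1, k)"] exI[of _ "Pfac (k - 2)"]) simp
  qed
  then obtain p \<alpha> where \<alpha>: "pfun (coords m) \<alpha>" "\<And>a s. fac x (a(p := s)) = fac x a + (s - a p) * \<alpha> a"
      "\<And>a. (\<forall>y\<in>facs m - {x}. fac y a \<noteq> 0) \<Longrightarrow> \<alpha> a \<noteq> 0" by blast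
  have "\<exists>\<delta> u. \<delta> > 0 \<and> holo_disc (coords m) \<delta> u \<and> (\<forall>a\<in>polydisc (coords m) \<delta>. g a = u a * fac x a)"
  proof (rule affine_division[where \<Phi> = "fac ` (facs m - {x})" and e = e and d = d and \<alpha> = \<alpha> and x = p and r = r])
    show "g a = 0" if "a \<in> polydisc (coords m) r" "fac x a = 0" "\<And>\<phi>. \<phi> \<in> fac ` (facs m - {x}) \<Longrightarrow> \<phi> a \<noteq> 0" for a
      using that r2(2)[of a] polydisc_mono[OF that(1), of r2] by (auto simp: r_def)
    show "coprime_lines e (fac x) \<phi>" if "\<phi> \<in> fac ` (facs m - {x})" for \<phi>
      using that coprime_fac_fac[OF e(1) x] by auto
  qed (use e x d \<alpha> r fac_pfun in auto)
  then show ?thesis unfolding holo_germ_iff near0_iff by blast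
qed

section \<open>The generating vector fields are logarithmic\<close>

definition E_mat :: "nat \<Rightarrow> nat \<Rightarrow> nat \<Rightarrow> nat \<Rightarrow> complex" where
  "E_mat i n p q = (if p = i \<and> q = n then 1 else 0)"

lemma xi_elem:
  assumes "n \<in> {1..m}"
  shows "xi m (E_mat i n) a (u, v) = (if u = i then matA a n v else 0) + (if v = i then matA a u n else 0)"
proof -
  have "xi m (E_mat i n) a (u, v) = (\<Sum>k=1..m. (if k = n then (if u = i then matA a n v else 0) + (if v = i then matA a u n else 0) else 0))"
    unfolding xi_def prod.case by (rule sum.cong) (auto simp: E_mat_def)
  then show ?thesis using assms by simp
qed

lemma xi_sum_elem:
  assumes "u \<in> {1..m}" "v \<in> {1..m}"
  shows "xi m X a (u, v) = (\<Sum>i=1..m. \<Sum>n=1..m. X i n * xi m (E_mat i n) a (u, v))"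
proof -
  have "(\<Sum>i=1..m. \<Sum>n=1..m. X i n * xi m (E_mat i n) a (u, v))
      = (\<Sum>n=1..m. \<Sum>i=1..m. (if i = u then X u n * matA a n v else 0) + (if i = v then X v n * matA a u n else 0))"
    by (subst sum.swap) (auto simp: xi_elem algebra_simps intro!: sum.cong)
  also have "\<dots> = (\<Sum>n=1..m. X u n * matA a n v + X v n * matA a u n)"
    using assms by (simp add: sum.distrib)
  finally show ?thesis by (simp add: xi_def algebra_simps)
qed

lemma matA_xi: "matA (xi m X a) p q = (\<Sum>k=1..m. X p k * matA a k q) - (\<Sum>k=1..m. X q k * matA a k p)"
proof -
  have s: "matA a i j = - matA a j i" for i j by (auto simp: matA_def)
  have x: "xi m X a (p, q) = (\<Sum>k=1..m. X p k * matA a k q) - (\<Sum>k=1..m. X q k * matA a k p)" for p q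
    unfolding xi_def prod.case sum_subtractf[symmetric] by (rule sum.cong) (auto simp: s[of p] mult.commute)
  show ?thesis unfolding matA_def[of "xi m X a"] x by auto
qed

lemma matA_xi_elem:
  assumes "n \<in> {1..m}"
  shows "matA (xi m (E_mat i n) a) p q = (if p = i then matA a n q else 0) + (if q = i then matA a p n else 0)"
proof -
  have "(\<Sum>k=1..m. E_mat i n p k * matA a k q) = (if p = i then matA a n q else 0)" for p q
  proof -
    have "(\<Sum>k=1..m. E_mat i n p k * matA a k q) = (\<Sum>k=1..m. if k = n then (if p = i then matA a n q else 0) else 0)"
      by (rule sum.cong) (auto simp: E_mat_def)
    then show ?thesis using assms by simp
  qed
  then show ?thesis unfolding matA_xi by (auto simp: matA_def)
qed

section \<open>Derivatives of the factors along elementary representation fields\<close>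

lemma vf_app_dfun: "vf_app m V f a = dfun (coords m) f a (V a)"
  by (simp add: vf_app_def dfun_def)

lemma dfun_cong: "(\<And>p. p \<in> C \<Longrightarrow> v p = w p) \<Longrightarrow> dfun C f a v = dfun C f a w"
  by (simp add: dfun_def)

lemma dfun_sum: "dfun C f a (\<lambda>p. \<Sum>i\<in>I. c i * v i p) = (\<Sum>i\<in>I. c i * dfun C f a (v i))"
  unfolding dfun_def sum_distrib_left sum_distrib_right by (subst sum.swap) (simp add: mult.assoc)

lemma dfun_cmult: "dfun C f a (\<lambda>p. c * v p) = c * dfun C f a v"
  by (simp add: dfun_def sum_distrib_left mult.assoc)

lemma dfun_xi:
  "dfun (coords m) f a (xi m X a) = (\<Sum>i=1..m. \<Sum>n=1..m. X i n * dfun (coords m) f a (xi m (E_mat i n) a))"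
proof -
  have "dfun (coords m) f a (xi m X a) = dfun (coords m) f a
      (\<lambda>p. \<Sum>i=1..m. 1 * (\<Sum>n=1..m. X i n * xi m (E_mat i n) a p))"
    by (rule dfun_cong) (auto simp: coords_def xi_sum_elem)
  also have "\<dots> = (\<Sum>i=1..m. 1 * (\<Sum>n=1..m. X i n * dfun (coords m) f a (xi m (E_mat i n) a)))"
    unfolding dfun_sum ..
  finally show ?thesis by simp
qed

text \<open>The product form fits the flow of an elementary field on a determinant: a row operation
  contributes the factor, a column operation the affine term.\<close>

lemma dfunI:
  assumes "pfun (coords m) f" "\<And>t. f (\<lambda>p. a p + t * v p) = (1 + t * c) * (f a + t * y)"
  shows "dfun (coords m) f a v = c * f a + y"
proof -
  have "((\<lambda>t. (1 + t * c) * (f a + t * y)) has_field_derivative (c * f a + y)) (at 0)"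
    by (auto intro!: derivative_eq_intros)
  then have "((\<lambda>t. f (\<lambda>p. a p + t * v p)) has_field_derivative (c * f a + y)) (at 0)"
    unfolding assms(2) .
  then show ?thesis using pfun_chain_rule[OF finite_coords assms(1)] DERIV_unique by blast
qed

text \<open>To first order, row and column n are added to row and column i, which replaces the index
  i by n in the Pfaffian. The position of i in the list is \<open>i - eps k\<close>.\<close>

lemma dfun_Pfac_xi:
  assumes k: "k \<le> m" and n: "n \<in> {1..m}"
  shows "dfun (coords m) (Pfac k) a (xi m (E_mat i n) a) =
    (if eps k \<le> i \<and> i \<le> k then pf (matA a) ((Slist k)[i - eps k := n]) else 0)"
proof -
  let ?M = "\<lambda>t. matA (\<lambda>p. a p + t * xi m (E_mat i n) a p)"
  have M: "?M t p q = matA a p q + t * ((if p = i then matA a n q else 0) + (if q = i then matA a p n else 0))" for t p q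
    unfolding matA_add_smult matA_xi_elem[OF n] ..
  show ?thesis
  proof (cases "eps k \<le> i \<and> i \<le> k")
    case True
    have "dfun (coords m) (Pfac k) a (xi m (E_mat i n) a) = 0 * Pfac k a + pf (matA a) ((Slist k)[i - eps k := n])"
    proof (rule dfunI[OF Pfac_pfun[OF k]])
      fix t
      have "pf (?M t) (Slist k) = pf (matA a) (Slist k) + t * pf (matA a) ((Slist k)[i - eps k := n])"
        by (rule pf_row_operation[where i = i]) (use True in \<open>auto simp: skew_matA M Slist_def simp del: upt_Suc\<close>)
      then show "Pfac k (\<lambda>p. a p + t * xi m (E_mat i n) a p) =
        (1 + t * 0) * (Pfac k a + t * pf (matA a) ((Slist k)[i - eps k := n]))" by (simp add: Pfac_def)
    qed
    then show ?thesis using True by simp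
  next
    case False
    have "dfun (coords m) (Pfac k) a (xi m (E_mat i n) a) = 0 * Pfac k a + 0"
    proof (rule dfunI[OF Pfac_pfun[OF k]])
      fix t
      have "pf (?M t) (Slist k) = pf (matA a) (Slist k)" by (rule pf_cong) (use False in \<open>auto simp: M\<close>)
      then show "Pfac k (\<lambda>p. a p + t * xi m (E_mat i n) a p) = (1 + t * 0) * (Pfac k a + t * 0)" by (simp add: Pfac_def)
    qed
    then show ?thesis using False by auto
  qed
qed

abbreviation Ahat :: "pt \<Rightarrow> nat \<Rightarrow> nat \<Rightarrow> complex" where
  "Ahat a \<equiv> \<lambda>i j. matA a i (j + 2)"

text \<open>The field acts on the truncated matrix twice: as a row operation, and as a column
  operation on its column i - 2. The condition on n and i ensures that an added row belongs to the
  block, so that only i = n contributes there.\<close>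

lemma dfun_Dfac_xi:
  assumes k: "k + 2 \<le> m" and n: "n \<in> {1..m}" and ni: "n \<le> k \<or> k < i" and i: "i \<ge> 1"
  shows "dfun (coords m) (Dfac k) a (xi m (E_mat i n) a) =
    (if i \<le> k \<and> i = n then Dfac k a else 0) +
    (if 3 \<le> i \<and> i \<le> k + 2 then \<Sum>r=1..k. matA a r n * cofk k (Ahat a) r (i - 2) else 0)"
proof -
  define Y where "Y = (if 3 \<le> i \<and> i \<le> k + 2 then \<Sum>r=1..k. matA a r n * cofk k (Ahat a) r (i - 2) else 0)"
  let ?M = "\<lambda>t. matA (\<lambda>p. a p + t * xi m (E_mat i n) a p)"
  have M: "?M t p q = matA a p q + t * ((if p = i then matA a n q else 0) + (if q = i then matA a p n else 0))" for t p q
    unfolding matA_add_smult matA_xi_elem[OF n] ..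
  have "dfun (coords m) (Dfac k) a (xi m (E_mat i n) a) = (if i \<le> k \<and> i = n then 1 else 0) * Dfac k a + Y"
  proof (rule dfunI[OF Dfac_pfun[OF k]])
    fix t
    define B where "B r c = Ahat a r c + (if c + 2 = i then t * matA a r n else 0)" for r c
    have B: "detk k B = Dfac k a + t * Y"
    proof (cases "3 \<le> i \<and> i \<le> k + 2")
      case True
      have "detk k B = detk k (Ahat a) + (\<Sum>r=1..k. (B r (i - 2) - Ahat a r (i - 2)) * cofk k (Ahat a) r (i - 2))"
        by (rule detk_change_col) (use True in \<open>auto simp: B_def\<close>)
      also have "(\<Sum>r=1..k. (B r (i - 2) - Ahat a r (i - 2)) * cofk k (Ahat a) r (i - 2)) = t * Y"
      proof -
        have "i - 2 + 2 = i" using True by arith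
        then have "B r (i - 2) - Ahat a r (i - 2) = t * matA a r n" for r unfolding B_def by simp
        then show ?thesis using True by (simp add: Y_def sum_distrib_left mult.assoc)
      qed
      finally show ?thesis by (simp add: Dfac_def)
    next
      case False
      have "detk k B = detk k (Ahat a)" by (rule detk_cong) (use False in \<open>auto simp: B_def\<close>)
      then show ?thesis using False by (auto simp: Dfac_def Y_def)
    qed
    have "detk k (\<lambda>r c. ?M t r (c + 2)) = (if i \<le> k \<and> i = n then 1 + t else 1) * detk k B"
    proof (cases "i \<le> k")
      case True
      have "detk k (\<lambda>r c. ?M t r (c + 2)) = (if i = n then 1 + t else 1) * detk k B"
      proof (rule detk_add_row)
        show "i \<in> {1..k}" "n \<in> {1..k}" using True ni n i by auto
        show "?M t r (c + 2) = B r c" if "r \<noteq> i" for r c using that by (simp only: M B_def) auto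
        \<comment> \<open>The quadratic term would be t^2 times the diagonal entry at n, which is
          zero by skew symmetry.\<close>
        show "?M t i (c + 2) = B i c + t * B n c" for c
          by (simp only: M B_def) (auto simp: matA_def algebra_simps)
      qed
      then show ?thesis using True by simp
    next
      case False
      have "detk k (\<lambda>r c. ?M t r (c + 2)) = detk k B"
        by (rule detk_cong) (use False in \<open>auto simp: M B_def\<close>)
      then show ?thesis using False by simp
    qed
    then show "Dfac k (\<lambda>p. a p + t * xi m (E_mat i n) a p) =
        (1 + t * (if i \<le> k \<and> i = n then 1 else 0)) * (Dfac k a + t * Y)"
      unfolding B by (simp add: Dfac_def)
  qed
  then show ?thesis unfolding Y_def by simp
qed

text \<open>\<open>2 \<eta>\<^sub>l\<close> is the representation field of the matrix whose
  row \<open>i\<close> is \<open>eta_sign l i\<close> times \<open>Pf\<^sub>S e\<^sub>i - \<Sum>\<^sub>t Pf(S[t := i]) e\<^bsub>S\<^sub>t\<^esub>\<close>, with \<open>S = {\<epsilon>(l),\<dots>,l}\<close>.\<close>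

definition eta_sign :: "nat \<Rightarrow> nat \<Rightarrow> complex" where
  "eta_sign l i = (if i > l then 1 else if i < eps l then - 1 else 0)"

definition eta_matrix :: "nat \<Rightarrow> pt \<Rightarrow> nat \<Rightarrow> nat \<Rightarrow> complex" where
  "eta_matrix l a i n = eta_sign l i * ((if n = i then Pfac l a else 0) -
     (\<Sum>t<length (Slist l). if n = Slist l ! t then pf (matA a) ((Slist l)[t := i]) else 0))"

lemma sum_eta_matrix:
  assumes "i \<in> {1..m}" "l \<le> m"
  shows "(\<Sum>n=1..m. eta_matrix l a i n * Z n) = eta_sign l i *
    (Pfac l a * Z i - (\<Sum>t<length (Slist l). pf (matA a) ((Slist l)[t := i]) * Z (Slist l ! t)))"
proof -
  have S: "Slist l ! t \<in> {1..m}" if "t < length (Slist l)" for t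
    using nth_mem[OF that] assms eps_bounds[of l] by auto
  have "(\<Sum>n=1..m. eta_matrix l a i n * Z n) = eta_sign l i * ((\<Sum>n=1..m. if n = i then Pfac l a * Z i else 0)
     - (\<Sum>n=1..m. \<Sum>t<length (Slist l). if n = Slist l ! t then pf (matA a) ((Slist l)[t := i]) * Z (Slist l ! t) else 0))"
    unfolding eta_matrix_def sum_subtractf[symmetric] sum_distrib_left
    by (intro sum.cong) (auto simp: algebra_simps sum_distrib_left sum_distrib_right intro!: sum.cong)
  also have "(\<Sum>n=1..m. \<Sum>t<length (Slist l). if n = Slist l ! t then pf (matA a) ((Slist l)[t := i]) * Z (Slist l ! t) else 0)
    = (\<Sum>t<length (Slist l). pf (matA a) ((Slist l)[t := i]) * Z (Slist l ! t))"
    by (subst sum.swap) (use S in \<open>auto intro!: sum.cong\<close>)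
  finally show ?thesis using assms by simp
qed

text \<open>p and q are last in the sorted list; moving a pair of indices to the front does not
  change the sign.\<close>

lemma PfS_insert_two:
  assumes "l < p" "p < q"
  shows "PfS a ({eps l..l} \<union> {p, q}) = pf (matA a) (p # q # Slist l)"
proof -
  interpret skew "matA a" by (rule skew_matA)
  have "sorted_list_of_set ({eps l..l} \<union> {p, q}) = Slist l @ [p, q]"
  proof -
    have "sorted (Slist l @ [p, q])" "distinct (Slist l @ [p, q])"
      using assms by (auto simp: sorted_append Slist_def simp del: upt_Suc)
    moreover have "set (Slist l @ [p, q]) = {eps l..l} \<union> {p, q}" by auto
    ultimately show ?thesis using sorted_list_of_set.idem_if_sorted_distinct[of "Slist l @ [p, q]"] by simp
  qed
  then show ?thesis by (simp add: PfS_def pf_append_two)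
qed

text \<open>Row p of the matrix against column q of A gives \<open>eta_sign l p\<close> times the
  Pfaffian of p, q and S, so the representation field has the sum of two signs as factor. The sum is
  2 if both indices exceed l. If one lies in S, the Pfaffian repeats an index. In the remaining case
  p = 1 < eps l and q > l, the choice of -1 below \<open>eps l\<close> makes the signs
  cancel.\<close>

lemma eta_eq_xi:
  assumes pq: "(p, q) \<in> coords m" and l: "2 \<le> l" "l \<le> m"
  shows "eta m l a (p, q) = 1 / 2 * xi m (eta_matrix l a) a (p, q)"
proof -
  interpret skew "matA a" by (rule skew_matA)
  let ?B = "\<lambda>p q. pf (matA a) (p # q # Slist l)"
  have B: "(\<Sum>n=1..m. eta_matrix l a i n * matA a n j) = eta_sign l i * ?B i j" if "i \<in> {1..m}" for i j
  proof -
    have "?B i j = - ?B j i" by (rule pf_swap_first)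
    also have "\<dots> = Pfac l a * matA a i j - (\<Sum>t<length (Slist l). pf (matA a) ((Slist l)[t := i]) * matA a (Slist l ! t) j)"
      unfolding pf_expand_two Pfac_def using skew[of j]
      by (simp add: sum_negf[symmetric] mult.commute)
    finally show ?thesis unfolding sum_eta_matrix[OF that l(2)] by simp
  qed
  have r: "p \<in> {1..m}" "q \<in> {1..m}" "p < q" using pq by (auto simp: coords_def)
  have "xi m (eta_matrix l a) a (p, q) = matA (xi m (eta_matrix l a) a) p q" using r by (simp add: matA_def)
  also have "\<dots> = eta_sign l p * ?B p q - eta_sign l q * ?B q p"
    unfolding matA_xi B[OF r(1)] B[OF r(2)] ..
  also have "\<dots> = (eta_sign l p + eta_sign l q) * ?B p q"
    using pf_swap_first[of q p "Slist l"] by (simp add: algebra_simps)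
  finally have x: "xi m (eta_matrix l a) a (p, q) = (eta_sign l p + eta_sign l q) * ?B p q" .
  have rep: "?B p q = 0" if "p \<in> set (Slist l) \<or> q \<in> set (Slist l)"
    by (rule pf_not_distinct) (use that in auto)
  show ?thesis
  proof (cases "l < p")
    case True
    then show ?thesis unfolding x using r PfS_insert_two[OF True r(3), of a] by (simp add: eta_def eta_sign_def)
  next
    case False
    have "(eta_sign l p + eta_sign l q) * ?B p q = 0"
      using rep r False eps_bounds[of l] by (auto simp: eta_sign_def not_less)
    then show ?thesis unfolding x using False by (simp add: eta_def)
  qed
qed

section \<open>Exchange identities and the derivatives along the eta fields\<close>

lemma dfun_eta:
  fixes f :: "pt \<Rightarrow> complex" and a :: pt
  assumes l: "2 \<le> l" "l \<le> m"
  defines "Z \<equiv> \<lambda>i n. dfun (coords m) f a (xi m (E_mat i n) a)"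
  shows "dfun (coords m) f a (eta m l a) = 1 / 2 * ((\<Sum>i=1..m. eta_sign l i * Pfac l a * Z i i) -
    (\<Sum>t<length (Slist l). \<Sum>i=1..m. eta_sign l i * pf (matA a) ((Slist l)[t := i]) * Z i (Slist l ! t)))"
proof -
  have "dfun (coords m) f a (eta m l a) = dfun (coords m) f a (\<lambda>p. 1 / 2 * xi m (eta_matrix l a) a p)"
    by (rule dfun_cong) (use eta_eq_xi l in auto)
  also have "\<dots> = 1 / 2 * (\<Sum>i=1..m. \<Sum>n=1..m. eta_matrix l a i n * Z i n)"
    unfolding dfun_cmult dfun_xi[of m f a "eta_matrix l a"] Z_def ..
  also have "(\<Sum>i=1..m. \<Sum>n=1..m. eta_matrix l a i n * Z i n) =
      (\<Sum>i=1..m. eta_sign l i * (Pfac l a * Z i i - (\<Sum>t<length (Slist l). pf (matA a) ((Slist l)[t := i]) * Z i (Slist l ! t))))"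
    using sum_eta_matrix[OF _ l(2)] by (intro sum.cong) auto
  also have "\<dots> = (\<Sum>i=1..m. eta_sign l i * Pfac l a * Z i i) -
    (\<Sum>i=1..m. \<Sum>t<length (Slist l). eta_sign l i * pf (matA a) ((Slist l)[t := i]) * Z i (Slist l ! t))"
    by (simp only: right_diff_distrib sum_subtractf sum_distrib_left mult.assoc)
  also have "(\<Sum>i=1..m. \<Sum>t<length (Slist l). eta_sign l i * pf (matA a) ((Slist l)[t := i]) * Z i (Slist l ! t))
    = (\<Sum>t<length (Slist l). \<Sum>i=1..m. eta_sign l i * pf (matA a) ((Slist l)[t := i]) * Z i (Slist l ! t))"
    by (rule sum.swap)
  finally show ?thesis .
qed

text \<open>A Pfaffian analogue of the Pluecker relations. The first factor is expanded along the
  replaced index. For each remaining index w, which lies in \<open>ys\<close>, the Pfaffian of w, n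
  and \<open>ys\<close> vanishes by repetition, and its expansion is the linear relation that
  evaluates the sum.\<close>

lemma pfaffian_exchange:
  assumes M: "skew M" and t: "t < length xs" and sub: "set (del t xs) \<subseteq> set ys"
  shows "(\<Sum>j<length ys. pf M (xs[t := ys ! j]) * pf M (ys[j := n])) = pf M (xs[t := n]) * pf M ys"
proof -
  interpret skew M by (rule M)
  define c where "c s = (-1) ^ (t + s) * pf M (del s (del t xs))" for s
  define w where "w s = del t xs ! s" for s
  have lin: "pf M (xs[t := x]) = (\<Sum>s<length xs - 1. c s * M x (w s))" for x
    unfolding pf_update_linear[OF t] c_def w_def ..
  have cramer: "(\<Sum>j<length ys. M (ys ! j) (w s) * pf M (ys[j := n])) = M n (w s) * pf M ys" if "s < length xs - 1" for s
  proof -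
    have "w s \<in> set ys" using sub that t unfolding w_def by (metis length_del nth_mem subsetD)
    then have "pf M (w s # n # ys) = 0" by (intro pf_not_distinct) auto
    then have "(\<Sum>j<length ys. M (w s) (ys ! j) * pf M (ys[j := n])) = M (w s) n * pf M ys"
      unfolding pf_expand_two by simp
    then show ?thesis unfolding skew[of "w s"] by (simp add: sum_negf)
  qed
  have "(\<Sum>j<length ys. pf M (xs[t := ys ! j]) * pf M (ys[j := n]))
      = (\<Sum>s<length xs - 1. c s * (\<Sum>j<length ys. M (ys ! j) (w s) * pf M (ys[j := n])))"
    unfolding lin sum_distrib_right sum_distrib_left by (subst sum.swap) (simp add: mult.assoc)
  also have "\<dots> = (\<Sum>s<length xs - 1. c s * (M n (w s) * pf M ys))" using cramer by (intro sum.cong) auto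
  finally show ?thesis unfolding lin sum_distrib_right by (simp add: mult.assoc)
qed

text \<open>The same argument with the determinant as second factor: the linear relation is now
  Cramer's rule for the rows w <= k of the truncated matrix, whose columns are those of A from 3 to
  k + 2.\<close>

lemma pfaffian_determinant_exchange:
  assumes t: "t < length xs" and sub: "set (del t xs) \<subseteq> {1..k}"
  shows "(\<Sum>i=3..k+2. pf (matA a) (xs[t := i]) * (\<Sum>r=1..k. matA a r n * cofk k (Ahat a) r (i - 2)))
    = pf (matA a) (xs[t := n]) * Dfac k a"
proof -
  interpret skew "matA a" by (rule skew_matA)
  define c where "c s = (-1) ^ (t + s) * pf (matA a) (del s (del t xs))" for s
  define w where "w s = del t xs ! s" for s
  have lin: "pf (matA a) (xs[t := x]) = (\<Sum>s<length xs - 1. c s * matA a x (w s))" for x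
    unfolding pf_update_linear[OF t] c_def w_def ..
  have cramer: "(\<Sum>i=3..k+2. matA a i (w s) * (\<Sum>r=1..k. matA a r n * cofk k (Ahat a) r (i - 2)))
      = matA a n (w s) * Dfac k a" if "s < length xs - 1" for s
  proof -
    have ws: "w s \<in> {1..k}" using sub that t unfolding w_def by (metis length_del nth_mem subsetD)
    have "(\<Sum>i=3..k+2. matA a i (w s) * (\<Sum>r=1..k. matA a r n * cofk k (Ahat a) r (i - 2)))
        = (\<Sum>c=1..k. - Ahat a (w s) c * (\<Sum>r=1..k. matA a r n * cofk k (Ahat a) r c))"
    proof (rule sum.reindex_bij_witness[where i = "\<lambda>c. c + 2" and j = "\<lambda>i. i - 2"])
      fix i assume "i \<in> {3..k+2}"
      then show i2: "i - 2 + 2 = i" and "i - 2 \<in> {1..k}" by auto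
      show "- Ahat a (w s) (i - 2) * (\<Sum>r=1..k. matA a r n * cofk k (Ahat a) r (i - 2)) =
          matA a i (w s) * (\<Sum>r=1..k. matA a r n * cofk k (Ahat a) r (i - 2))"
        unfolding i2 using skew[of i "w s"] by simp
    qed auto
    also have "\<dots> = (\<Sum>r=1..k. - matA a r n * (\<Sum>c=1..k. Ahat a (w s) c * cofk k (Ahat a) r c))"
      unfolding sum_distrib_left by (subst sum.swap) (simp add: mult.assoc mult.left_commute)
    also have "\<dots> = (\<Sum>r=1..k. if r = w s then - matA a r n * Dfac k a else 0)"
      using cofk_row[OF ws, of _ "Ahat a"] by (intro sum.cong) (auto simp: Dfac_def)
    also have "\<dots> = matA a n (w s) * Dfac k a" using ws skew[of n "w s"] by simp
    finally show ?thesis .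
  qed
  have "(\<Sum>i=3..k+2. pf (matA a) (xs[t := i]) * (\<Sum>r=1..k. matA a r n * cofk k (Ahat a) r (i - 2)))
      = (\<Sum>s<length xs - 1. c s * (\<Sum>i=3..k+2. matA a i (w s) * (\<Sum>r=1..k. matA a r n * cofk k (Ahat a) r (i - 2))))"
    unfolding lin sum_distrib_right sum_distrib_left[of "c _"] by (subst sum.swap) (simp add: mult.assoc)
  also have "\<dots> = (\<Sum>s<length xs - 1. c s * (matA a n (w s) * Dfac k a))" using cramer by (intro sum.cong) auto
  finally show ?thesis unfolding lin sum_distrib_right by (simp add: mult.assoc)
qed

lemma nth_Slist: "t < length (Slist l) \<Longrightarrow> Slist l ! t = eps l + t"
  by (simp add: Slist_def del: upt_Suc)

lemma length_Slist: "length (Slist l) = Suc l - eps l"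
  by (simp add: Slist_def del: upt_Suc)

lemma pf_update_repeat:
  assumes "t < length xs" "x \<in> set xs" "x \<noteq> xs ! t"
  shows "pf (matA a) (xs[t := x]) = 0"
proof -
  interpret skew "matA a" by (rule skew_matA)
  obtain s where s: "s < length xs" "xs ! s = x" using assms(2) by (auto simp: in_set_conv_nth)
  then have "s \<noteq> t" using assms(3) by auto
  moreover have "xs[t := x] ! s = xs[t := x] ! t" using s assms(1) \<open>s \<noteq> t\<close> by simp
  ultimately have "\<not> distinct (xs[t := x])"
    using s(1) assms(1) nth_eq_iff_index_eq[of "xs[t := x]" s t] by auto
  then show ?thesis by (rule pf_not_distinct)
qed

lemma dfun_Pfac_xi_diag:
  assumes "k \<le> m" "i \<in> {1..m}"
  shows "dfun (coords m) (Pfac k) a (xi m (E_mat i i) a) = (if i \<in> {eps k..k} then Pfac k a else 0)"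
proof -
  have "(Slist k)[i - eps k := i] = Slist k" if "i \<in> {eps k..k}"
    using that by (intro list_update_same_conv[THEN iffD2]) (auto simp: nth_Slist length_Slist)
  then show ?thesis using dfun_Pfac_xi[OF assms, of a i] by (auto simp: Pfac_def)
qed

lemma dfun_Pfac_xi_repeat:
  assumes "k \<le> m" "n \<in> {1..m}" "n \<in> {eps k..k}" "i \<noteq> n"
  shows "dfun (coords m) (Pfac k) a (xi m (E_mat i n) a) = 0"
proof -
  have "pf (matA a) ((Slist k)[i - eps k := n]) = 0" if "i \<in> {eps k..k}"
    using that assms by (intro pf_update_repeat) (auto simp: nth_Slist length_Slist)
  then show ?thesis using dfun_Pfac_xi[OF assms(1,2), of a i] by auto
qed

lemma sum_cofk_Ahat:
  assumes "3 \<le> i" "i \<le> k + 2" "3 \<le> n" "n \<le> k + 2"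
  shows "(\<Sum>r=1..k. matA a r n * cofk k (Ahat a) r (i - 2)) = (if i = n then Dfac k a else 0)"
proof -
  have n: "n - 2 + 2 = n" "n - 2 \<in> {1..k}" "i - 2 \<in> {1..k}" "n - 2 = i - 2 \<longleftrightarrow> i = n" using assms by auto
  have "(\<Sum>r=1..k. Ahat a r (n - 2) * cofk k (Ahat a) r (i - 2)) = (if i = n then Dfac k a else 0)"
    using cofk_col[OF n(2,3), of "Ahat a"] n(4) by (simp add: Dfac_def)
  then show ?thesis unfolding n(1) .
qed

lemma dfun_eta_independent:
  assumes "\<And>p q s. l < p \<Longrightarrow> p < q \<Longrightarrow> f (a((p, q) := s)) = f a"
  shows "dfun (coords m) f a (eta m l a) = 0"
proof -
  have "eta m l a (p, q) * pdiff (p, q) f a = 0" for p q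
    using pdiff_independent[of f a "(p, q)"] assms[of p q] by (auto simp: eta_def)
  then show ?thesis unfolding dfun_def by (intro sum.neutral) auto
qed

lemma eta_sign_Slist: "x \<in> {eps l..l} \<Longrightarrow> eta_sign l x = 0"
  by (auto simp: eta_sign_def)

text \<open>For k <= l the field moves no coordinate of \<open>Pfac k\<close>. Otherwise the
  diagonal part of the matrix acts by scalars, and a member of S inside {eps k..k} contributes
  nothing, by repetition. The only possible other member is 1, for which the exchange identity
  returns the product of the two Pfaffians.\<close>

lemma dfun_eta_Pfac:
  assumes l: "2 \<le> l" "l \<le> m" and k: "k \<le> m"
  shows "\<exists>\<kappa>. \<forall>a. dfun (coords m) (Pfac k) a (eta m l a) = \<kappa> * Pfac l a * Pfac k a"
proof (cases "k \<le> l")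
  case True
  then have "dfun (coords m) (Pfac k) a (eta m l a) = 0" for a
    by (intro dfun_eta_independent Pfac_independent) auto
  then show ?thesis by (intro exI[of _ 0]) auto
next
  case False
  define Z where "Z a i n = dfun (coords m) (Pfac k) a (xi m (E_mat i n) a)" for a i n
  define n where "n t = Slist l ! t" for t
  have nt: "n t \<in> {eps l..l}" "n t \<in> {1..m}" if "t < length (Slist l)" for t
    using nth_mem[OF that] l eps_bounds[of l] unfolding n_def by auto
  have s1: "(\<Sum>i=1..m. eta_sign l i * Pfac l a * Z a i i) = (\<Sum>i=1..m. if i \<in> {eps k..k} then eta_sign l i else 0) * Pfac l a * Pfac k a" for a
    unfolding sum_distrib_right Z_def using dfun_Pfac_xi_diag[OF k] by (intro sum.cong) auto
  have s2: "(\<Sum>i=1..m. eta_sign l i * pf (matA a) ((Slist l)[t := i]) * Z a i (n t)) =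
      (if n t \<in> {eps k..k} then 0 else 1) * Pfac l a * Pfac k a" if t: "t < length (Slist l)" for a t
  proof (cases "n t \<in> {eps k..k}")
    case True
    have "eta_sign l i * pf (matA a) ((Slist l)[t := i]) * Z a i (n t) = 0" for i
      using dfun_Pfac_xi_repeat[OF k nt(2)[OF t] True, of i a] eta_sign_Slist[OF nt(1)[OF t]]
      unfolding Z_def by (cases "i = n t") auto
    then have "(\<Sum>i=1..m. eta_sign l i * pf (matA a) ((Slist l)[t := i]) * Z a i (n t)) = 0"
      by (intro sum.neutral ballI)
    then show ?thesis using True by simp
  next
    case F: False
    then have ne: "n t < eps k" using nt[OF t] \<open>\<not> k \<le> l\<close> by auto
    \<comment> \<open>The sign may be dropped: it is 1 above l, and for eps k <= i <= l the index i
      is a second member of S, so the Pfaffian is zero.\<close>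
    have drop: "eta_sign l i * pf (matA a) ((Slist l)[t := i]) = pf (matA a) ((Slist l)[t := i])"
      if "eps k \<le> i" for i
    proof (cases "l < i")
      case True
      then show ?thesis by (simp add: eta_sign_def)
    next
      case False
      then have "i \<in> set (Slist l)" "i \<noteq> Slist l ! t" using that ne nt[OF t] unfolding n_def by auto
      then show ?thesis using pf_update_repeat[OF t] by simp
    qed
    have "(\<Sum>i=1..m. eta_sign l i * pf (matA a) ((Slist l)[t := i]) * Z a i (n t))
        = (\<Sum>i\<in>{eps k..k}. eta_sign l i * pf (matA a) ((Slist l)[t := i]) * Z a i (n t))"
      by (rule sum.mono_neutral_right)
         (use k eps_bounds[of k] in \<open>auto simp: Z_def dfun_Pfac_xi[OF k nt(2)[OF t]]\<close>)
    also have "\<dots> = (\<Sum>i\<in>{eps k..k}. pf (matA a) ((Slist l)[t := i]) * pf (matA a) ((Slist k)[i - eps k := n t]))"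
      by (rule sum.cong) (auto simp: drop Z_def dfun_Pfac_xi[OF k nt(2)[OF t]])
    also have "\<dots> = (\<Sum>j<length (Slist k). pf (matA a) ((Slist l)[t := Slist k ! j]) * pf (matA a) ((Slist k)[j := n t]))"
      by (rule sum.reindex_bij_witness[where i = "\<lambda>j. eps k + j" and j = "\<lambda>i. i - eps k"])
         (auto simp: length_Slist nth_Slist)
    also have "\<dots> = pf (matA a) ((Slist l)[t := n t]) * pf (matA a) (Slist k)"
    proof (rule pfaffian_exchange[OF skew_matA t])
      show "set (del t (Slist l)) \<subseteq> set (Slist k)"
      proof
        fix x assume x: "x \<in> set (del t (Slist l))"
        then have x1: "x \<in> {eps l..l}" using set_del_subset[of t "Slist l"] by auto
        have "x \<noteq> n t"
        proof -
          have "Slist l = take t (Slist l) @ n t # drop (Suc t) (Slist l)" unfolding n_def by (rule id_take_nth_drop[OF t])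
          then have "distinct (take t (Slist l) @ n t # drop (Suc t) (Slist l))" by (metis distinct_Slist)
          then show ?thesis using x unfolding del_def by auto
        qed
        then have "eps k \<le> x" using x1 nt[OF t] ne eps_bounds[of k] eps_bounds[of l] by auto
        then show "x \<in> set (Slist k)" using x1 \<open>\<not> k \<le> l\<close> by auto
      qed
    qed
    also have "(Slist l)[t := n t] = Slist l" by (simp add: n_def)
    finally show ?thesis using F by (auto simp: Pfac_def)
  qed
  have "dfun (coords m) (Pfac k) a (eta m l a) = 1/2 * ((\<Sum>i=1..m. if i \<in> {eps k..k} then eta_sign l i else 0)
      - (\<Sum>t<length (Slist l). if n t \<in> {eps k..k} then 0 else 1)) * Pfac l a * Pfac k a" for a
  proof -
    have "(\<Sum>t<length (Slist l). \<Sum>i=1..m. eta_sign l i * pf (matA a) ((Slist l)[t := i]) * Z a i (n t))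
      = (\<Sum>t<length (Slist l). (if n t \<in> {eps k..k} then 0 else 1) * Pfac l a * Pfac k a)"
      by (intro sum.cong refl s2) auto
    then show ?thesis
      unfolding dfun_eta[OF l] Z_def[symmetric] n_def[symmetric] s1 sum_distrib_right[symmetric]
      by (simp only: left_diff_distrib right_diff_distrib mult.assoc)
  qed
  then show ?thesis by blast
qed

text \<open>The members of S that are at least 3 are column indices of the truncated matrix and drop
  out by orthogonality of columns and cofactors. The members 1 and 2 are treated by the mixed
  exchange identity.\<close>

lemma dfun_eta_Dfac:
  assumes l: "2 \<le> l" "l \<le> m" and k: "k + 2 \<le> m"
  shows "\<exists>\<kappa>. \<forall>a. dfun (coords m) (Dfac k) a (eta m l a) = \<kappa> * Pfac l a * Dfac k a"
proof (cases "k \<le> l")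
  case True
  then have "dfun (coords m) (Dfac k) a (eta m l a) = 0" for a
    by (intro dfun_eta_independent Dfac_independent) auto
  then show ?thesis by (intro exI[of _ 0]) auto
next
  case False
  define Z where "Z a i n = dfun (coords m) (Dfac k) a (xi m (E_mat i n) a)" for a i n
  define n where "n t = Slist l ! t" for t
  have nt: "n t \<in> {eps l..l}" "n t \<in> {1..m}" "n t \<le> k" if "t < length (Slist l)" for t
    using nth_mem[OF that] l eps_bounds[of l] False unfolding n_def by auto
  \<comment> \<open>The number of times i occurs among the row indices 1..k and the column indices
    3..k+2, that is, the weight of the determinant under the diagonal field of i.\<close>
  define d where "d i = (if i \<le> k then 1 else 0) + (if 3 \<le> i \<and> i \<le> k + 2 then 1 else 0 :: complex)" for i
  have s1: "(\<Sum>i=1..m. eta_sign l i * Pfac l a * Z a i i) = (\<Sum>i=1..m. eta_sign l i * d i) * Pfac l a * Dfac k a" for a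
    unfolding sum_distrib_right
  proof (rule sum.cong)
    fix i assume i: "i \<in> {1..m}"
    have "Z a i i = d i * Dfac k a"
      unfolding Z_def using dfun_Dfac_xi[OF k i, of i a] i sum_cofk_Ahat[of i k i a] by (auto simp: d_def)
    then show "eta_sign l i * Pfac l a * Z a i i = eta_sign l i * d i * Pfac l a * Dfac k a" by simp
  qed simp
  have s2: "(\<Sum>i=1..m. eta_sign l i * pf (matA a) ((Slist l)[t := i]) * Z a i (n t)) =
      (if 3 \<le> n t then 0 else 1) * Pfac l a * Dfac k a" if t: "t < length (Slist l)" for a t
  proof -
    \<comment> \<open>This removes the row contribution of \<open>dfun_Dfac_xi\<close>, which occurs
      only at i = n t.\<close>
    have sn: "eta_sign l (n t) = 0" by (rule eta_sign_Slist[OF nt(1)[OF t]])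
    define y where "y i = (\<Sum>r=1..k. matA a r (n t) * cofk k (Ahat a) r (i - 2))" for i
    have Z: "eta_sign l i * pf (matA a) ((Slist l)[t := i]) * Z a i (n t) =
      (if 3 \<le> i \<and> i \<le> k + 2 then eta_sign l i * pf (matA a) ((Slist l)[t := i]) * y i else 0)" if "i \<in> {1..m}" for i
    proof -
      have "Z a i (n t) = (if i \<le> k \<and> i = n t then Dfac k a else 0) + (if 3 \<le> i \<and> i \<le> k + 2 then y i else 0)"
        unfolding Z_def y_def by (rule dfun_Dfac_xi[OF k nt(2)[OF t]]) (use nt[OF t] that in auto)
      then show ?thesis using sn by (cases "i = n t") auto
    qed
    have "(\<Sum>i=1..m. eta_sign l i * pf (matA a) ((Slist l)[t := i]) * Z a i (n t))
        = (\<Sum>i=3..k+2. eta_sign l i * pf (matA a) ((Slist l)[t := i]) * y i)"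
      by (rule sum.mono_neutral_cong_right) (use k Z in auto)
    also have "\<dots> = (if 3 \<le> n t then 0 else 1) * Pfac l a * Dfac k a"
    proof (cases "3 \<le> n t")
      case True
      have "eta_sign l i * pf (matA a) ((Slist l)[t := i]) * y i = 0" if "i \<in> {3..k+2}" for i
        using sum_cofk_Ahat[of i k "n t" a] True that nt[OF t] sn unfolding y_def by auto
      then have "(\<Sum>i=3..k+2. eta_sign l i * pf (matA a) ((Slist l)[t := i]) * y i) = 0"
        by (intro sum.neutral ballI)
      then show ?thesis using True by simp
    next
      case F: False
      have "eta_sign l i * pf (matA a) ((Slist l)[t := i]) = pf (matA a) ((Slist l)[t := i])" if "3 \<le> i" for i
      proof (cases "l < i")
        case True
        then show ?thesis by (simp add: eta_sign_def)
      next
        case False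
        then have "i \<in> set (Slist l)" "i \<noteq> Slist l ! t" using that F eps_bounds[of l] unfolding n_def by auto
        then show ?thesis using pf_update_repeat[OF t] by simp
      qed
      then have "(\<Sum>i=3..k+2. eta_sign l i * pf (matA a) ((Slist l)[t := i]) * y i) = (\<Sum>i=3..k+2. pf (matA a) ((Slist l)[t := i]) * y i)"
        by (intro sum.cong) auto
      also have "\<dots> = pf (matA a) ((Slist l)[t := n t]) * Dfac k a"
        unfolding y_def
      proof (rule pfaffian_determinant_exchange[OF t])
        show "set (del t (Slist l)) \<subseteq> {1..k}" using set_del_subset[of t "Slist l"] False eps_bounds[of l] by force
      qed
      also have "(Slist l)[t := n t] = Slist l" by (simp add: n_def)
      finally show ?thesis using F by (simp add: Pfac_def)
    qed
    finally show ?thesis .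
  qed
  have "dfun (coords m) (Dfac k) a (eta m l a) = 1/2 * ((\<Sum>i=1..m. eta_sign l i * d i)
      - (\<Sum>t<length (Slist l). if 3 \<le> n t then 0 else 1)) * Pfac l a * Dfac k a" for a
  proof -
    have "(\<Sum>t<length (Slist l). \<Sum>i=1..m. eta_sign l i * pf (matA a) ((Slist l)[t := i]) * Z a i (n t))
      = (\<Sum>t<length (Slist l). (if 3 \<le> n t then 0 else 1) * Pfac l a * Dfac k a)"
      by (intro sum.cong refl s2) auto
    then show ?thesis
      unfolding dfun_eta[OF l] Z_def[symmetric] n_def[symmetric] s1 sum_distrib_right[symmetric]
      by (simp only: left_diff_distrib right_diff_distrib mult.assoc)
  qed
  then show ?thesis by blast
qed

text \<open>A first component 0, which is no matrix row, marks the field eta_j; the other pairs are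
  the positions of the free entries of g_m.\<close>

definition basis_index :: "nat \<Rightarrow> (nat \<times> nat) set" where
  "basis_index m = {(i, j). 1 \<le> j \<and> j \<le> i \<and> i \<le> m \<and> (i \<noteq> j \<longrightarrow> 3 \<le> j)} \<union> {0} \<times> {2..m - 2}"

definition basis_field :: "nat \<Rightarrow> nat \<times> nat \<Rightarrow> vfield" where
  "basis_field m b = (case b of (i, j) \<Rightarrow> if i = 0 then eta m j else xi m (E_mat i j))"

lemma finite_basis_index [simp]: "finite (basis_index m)"
  by (rule finite_subset[of _ "{0..m} \<times> {0..m}"]) (auto simp: basis_index_def)

lemma basis_field_logarithmic_fac:
  assumes b: "b \<in> basis_index m" and x: "x \<in> facs m"
  shows "\<exists>\<mu>. pfun (coords m) \<mu> \<and> (\<forall>a. vf_app m (basis_field m b) (fac x) a = \<mu> a * fac x a)"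
proof -
  have "(\<exists>i j. b = (i, j) \<and> 1 \<le> j \<and> j \<le> i \<and> i \<le> m \<and> (i \<noteq> j \<longrightarrow> 3 \<le> j)) \<or> (\<exists>l\<in>{2..m-2}. b = (0, l))"
    using b unfolding basis_index_def by auto
  then show ?thesis
  proof
    assume "\<exists>i j. b = (i, j) \<and> 1 \<le> j \<and> j \<le> i \<and> i \<le> m \<and> (i \<noteq> j \<longrightarrow> 3 \<le> j)"
    then obtain i j where ij: "b = (i, j)" "1 \<le> j" "j \<le> i" "i \<le> m" "i \<noteq> j \<longrightarrow> 3 \<le> j" by blast
    have bf: "vf_app m (basis_field m b) (fac x) a = dfun (coords m) (fac x) a (xi m (E_mat i j) a)" for a
      using ij by (simp add: basis_field_def vf_app_dfun)
    have "\<exists>c. \<forall>a. dfun (coords m) (fac x) a (xi m (E_mat i j) a) = c * fac x a"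
    proof (cases x)
      case (Inl k)
      then have k: "k + 2 \<le> m" using x by (auto simp: facs_def)
      have d: "dfun (coords m) (Dfac k) a (xi m (E_mat i j) a) = (if i \<le> k \<and> i = j then Dfac k a else 0) +
        (if 3 \<le> i \<and> i \<le> k + 2 then if i = j then Dfac k a else 0 else 0)" for a
      proof -
        have "3 \<le> i \<Longrightarrow> i \<le> k + 2 \<Longrightarrow> (\<Sum>r=1..k. matA a r j * cofk k (Ahat a) r (i - 2)) = (if i = j then Dfac k a else 0)"
          by (rule sum_cofk_Ahat) (use ij in auto)
        moreover have "j \<in> {1..m}" "j \<le> k \<or> k < i" "i \<ge> 1" using ij by auto
        ultimately show ?thesis using dfun_Dfac_xi[OF k, of j i a] by simp
      qed
      show ?thesis
        by (intro exI[of _ "(if i \<le> k \<and> i = j then 1 else 0) + (if 3 \<le> i \<and> i \<le> k + 2 \<and> i = j then 1 else 0)"])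
           (auto simp: Inl d)
    next
      case (Inr k)
      then have k: "k \<le> m" using x by (auto simp: facs_def)
      have j: "j \<in> {1..m}" using ij by auto
      show ?thesis
      proof (cases "i = j")
        case True
        then show ?thesis
          using dfun_Pfac_xi_diag[OF k j] by (intro exI[of _ "if i \<in> {eps k..k} then 1 else 0"]) (auto simp: Inr)
      next
        case False
        have "dfun (coords m) (Pfac k) a (xi m (E_mat i j) a) = 0" for a
        proof (cases "j \<in> {eps k..k}")
          case True
          then show ?thesis using dfun_Pfac_xi_repeat[OF k j True False] by blast
        next
          case jn: False
          \<comment> \<open>Off the diagonal j is at least 3 and so above \<open>eps k\<close>;
            lying outside the interval it exceeds k, and i with it.\<close>
          then have "\<not> (eps k \<le> i \<and> i \<le> k)" using ij False eps_bounds[of k] by auto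
          then show ?thesis using dfun_Pfac_xi[OF k j, of a i] by auto
        qed
        then show ?thesis by (intro exI[of _ 0]) (simp add: Inr)
      qed
    qed
    then obtain c where "\<forall>a. dfun (coords m) (fac x) a (xi m (E_mat i j) a) = c * fac x a" ..
    then show ?thesis unfolding bf by (intro exI[of _ "\<lambda>_. c"]) (simp add: pfun_const)
  next
    assume "\<exists>l\<in>{2..m-2}. b = (0, l)"
    then obtain l where l: "b = (0, l)" "2 \<le> l" "l \<le> m" by auto
    have "\<exists>\<kappa>. \<forall>a. dfun (coords m) (fac x) a (eta m l a) = \<kappa> * Pfac l a * fac x a"
      using dfun_eta_Pfac[OF l(2,3)] dfun_eta_Dfac[OF l(2,3)] x by (auto simp: facs_def)
    then obtain \<kappa> where "\<forall>a. dfun (coords m) (fac x) a (eta m l a) = \<kappa> * Pfac l a * fac x a" ..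
    then show ?thesis
      using l by (intro exI[of _ "\<lambda>a. \<kappa> * Pfac l a"])
        (simp add: basis_field_def vf_app_dfun pfun_mult pfun_const Pfac_pfun)
  qed
qed

lemma dfun_mult:
  assumes "finite C" "pfun C f" "pfun C g"
  shows "dfun C (\<lambda>a. f a * g a) a v = f a * dfun C g a v + g a * dfun C f a v"
  using DERIV_unique[OF pfun_chain_rule[OF assms(1) pfun_mult[OF assms(2,3)], of a v]
    DERIV_mult[OF pfun_chain_rule[OF assms(1,2), of a v] pfun_chain_rule[OF assms(1,3), of a v]]]
  by (simp add: algebra_simps)

lemma logarithmic_prod:
  assumes "finite I" "\<And>x. x \<in> I \<Longrightarrow> pfun (coords m) (f x)"
    "\<And>x. x \<in> I \<Longrightarrow> \<exists>\<mu>. pfun (coords m) \<mu> \<and> (\<forall>a. vf_app m v (f x) a = \<mu> a * f x a)"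
  shows "\<exists>\<mu>. pfun (coords m) \<mu> \<and> (\<forall>a. vf_app m v (\<lambda>a. \<Prod>x\<in>I. f x a) a = \<mu> a * (\<Prod>x\<in>I. f x a))"
  using assms
proof (induction I rule: finite_induct)
  case empty
  then show ?case by (intro exI[of _ "\<lambda>_. 0"]) (simp add: pfun_const vf_app_def pdiff_const)
next
  case (insert x I)
  obtain \<mu> where \<mu>: "pfun (coords m) \<mu>" "\<And>a. vf_app m v (\<lambda>a. \<Prod>x\<in>I. f x a) a = \<mu> a * (\<Prod>x\<in>I. f x a)"
    using insert.IH insert.prems by auto
  obtain \<nu> where \<nu>: "pfun (coords m) \<nu>" "\<And>a. vf_app m v (f x) a = \<nu> a * f x a"
    using insert.prems(2)[of x] by auto
  have p: "pfun (coords m) (f x)" "pfun (coords m) (\<lambda>a. \<Prod>x\<in>I. f x a)"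
    using insert.prems(1) by (auto intro: pfun_prod)
  have "vf_app m v (\<lambda>a. \<Prod>x\<in>insert x I. f x a) a = (\<nu> a + \<mu> a) * (\<Prod>x\<in>insert x I. f x a)" for a
    using insert.hyps dfun_mult[OF finite_coords p, of a "v a"] \<mu>(2)[of a] \<nu>(2)[of a]
    by (simp add: vf_app_dfun algebra_simps)
  then show ?case using pfun_add[OF \<nu>(1) \<mu>(1)] by blast
qed

lemma basis_field_logarithmic:
  assumes "b \<in> basis_index m"
  shows "\<exists>\<mu>. pfun (coords m) \<mu> \<and> (\<forall>a. vf_app m (basis_field m b) (hdiv m) a = \<mu> a * hdiv m a)"
  using logarithmic_prod[where f = fac, OF finite_facs fac_pfun basis_field_logarithmic_fac[OF assms]]
  unfolding hdiv_eq[abs_def] by simp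

lemma xi_pfun: "p \<in> coords m \<Longrightarrow> pfun (coords m) (\<lambda>a. xi m X a p)"
proof (cases p)
  case (Pair u v)
  assume "p \<in> coords m"
  then have uv: "u \<in> {1..m}" "v \<in> {1..m}" using Pair by (auto simp: coords_def)
  show ?thesis
    unfolding xi_def Pair prod.case
    by (intro pfun_sum pfun_add pfun_mult pfun_const matA_pfun uv) auto
qed

lemma eta_pfun:
  assumes "p \<in> coords m"
  shows "pfun (coords m) (\<lambda>a. eta m k a p)"
proof (cases p)
  case (Pair u v)
  then have uv: "u \<in> {1..m}" "v \<in> {1..m}" "u < v" using assms by (auto simp: coords_def)
  show ?thesis
  proof (cases "k < u")
    case True
    have "pfun (coords m) (\<lambda>a. pf (matA a) (u # v # Slist k))"
      by (rule pf_pfun) (use uv True eps_bounds[of k] in auto)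
    then show ?thesis using uv True by (simp add: Pair eta_def PfS_insert_two[simplified])
  next
    case False
    then show ?thesis by (simp add: Pair eta_def pfun_const)
  qed
qed

lemma basis_field_pfun: "p \<in> coords m \<Longrightarrow> pfun (coords m) (\<lambda>a. basis_field m b a p)"
  unfolding basis_field_def by (cases b) (auto intro: xi_pfun eta_pfun)

lemma basis_field_holo: "holo_field m (basis_field m b)"
  unfolding holo_field_def using basis_field_pfun pfun_holo_germ by blast

section \<open>The module of logarithmic vector fields\<close>

definition combination :: "nat \<Rightarrow> (nat \<times> nat \<Rightarrow> pt \<Rightarrow> complex) \<Rightarrow> vfield" where
  "combination m c = (\<lambda>a q. \<Sum>b\<in>basis_index m. c b a * basis_field m b a q)"

definition basis_span :: "nat \<Rightarrow> vfield set" where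
  "basis_span m = {v. \<exists>c. (\<forall>b\<in>basis_index m. holo_germ m (c b)) \<and> field_eq m v (combination m c)}"

lemma field_eq_refl [simp]: "field_eq m v v"
  unfolding field_eq_def by (rule near0_all) simp

lemma field_eq_trans: "field_eq m u v \<Longrightarrow> field_eq m v w \<Longrightarrow> field_eq m u w"
  unfolding field_eq_def by (erule near0_mp) auto

section \<open>Generated modules and spans with vanishing coefficients\<close>

lemma sum_image_fibers:
  fixes b :: "'i \<Rightarrow> vfield"
  assumes I: "finite I"
  shows "(\<Sum>\<zeta>\<in>b ` I. (\<Sum>i | i \<in> I \<and> b i = \<zeta>. c i a) * \<zeta> a q) = (\<Sum>i\<in>I. c i a * b i a q)"
proof -
  have "(\<Sum>\<zeta>\<in>b ` I. (\<Sum>i | i \<in> I \<and> b i = \<zeta>. c i a) * \<zeta> a q) = (\<Sum>\<zeta>\<in>b ` I. \<Sum>i | i \<in> I \<and> b i = \<zeta>. c i a * b i a q)"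
    unfolding sum_distrib_right by (intro sum.cong) auto
  also have "\<dots> = (\<Sum>i\<in>I. c i a * b i a q)"
    by (rule sum.image_gen[symmetric, OF I])
  finally show ?thesis .
qed

text \<open>The definition generates by a set of fields, the arguments below use indexed families.
  As b need not be injective, coefficients of equal fields are added up in one direction, and an
  index is chosen for each field in the other.\<close>

lemma gen_by_image:
  assumes I: "finite I"
  shows "gen_by m (b ` I) = {v. \<exists>c. (\<forall>i\<in>I. holo_germ m (c i)) \<and> field_eq m v (\<lambda>a q. \<Sum>i\<in>I. c i a * b i a q)}"
proof (intro equalityI subsetI)
  fix v assume "v \<in> gen_by m (b ` I)"
  then obtain S h where S: "finite S" "S \<subseteq> b ` I" "\<forall>\<zeta>\<in>S. holo_germ m (h \<zeta>)"
    "field_eq m v (\<lambda>a q. \<Sum>\<zeta>\<in>S. h \<zeta> a * \<zeta> a q)"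
    unfolding gen_by_def by blast
  from S(2) have "\<forall>\<zeta>\<in>S. \<exists>i\<in>I. b i = \<zeta>" by blast
  then have "\<forall>\<zeta>\<in>S. \<exists>i. i \<in> I \<and> b i = \<zeta>" by blast
  from bchoice[OF this] obtain g where g: "\<And>\<zeta>. \<zeta> \<in> S \<Longrightarrow> g \<zeta> \<in> I \<and> b (g \<zeta>) = \<zeta>" by blast
  define c where "c i a = (\<Sum>\<zeta> | \<zeta> \<in> S \<and> g \<zeta> = i. h \<zeta> a)" for i a
  have "(\<Sum>i\<in>I. c i a * b i a q) = (\<Sum>\<zeta>\<in>S. h \<zeta> a * \<zeta> a q)" for a q
  proof -
    have "(\<Sum>i\<in>I. c i a * b i a q) = (\<Sum>i\<in>I. \<Sum>\<zeta> | \<zeta> \<in> S \<and> g \<zeta> = i. h \<zeta> a * \<zeta> a q)"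
      unfolding c_def sum_distrib_right by (intro sum.cong) (use g in auto)
    also have "\<dots> = (\<Sum>\<zeta>\<in>S. h \<zeta> a * \<zeta> a q)"
      using sum.group[OF S(1) I, of g "\<lambda>\<zeta>. h \<zeta> a * \<zeta> a q"] g by auto
    finally show ?thesis .
  qed
  moreover have "\<forall>i\<in>I. holo_germ m (c i)"
    unfolding c_def[abs_def] using S(3) by (intro ballI holo_germ_sum) auto
  ultimately show "v \<in> {v. \<exists>c. (\<forall>i\<in>I. holo_germ m (c i)) \<and> field_eq m v (\<lambda>a q. \<Sum>i\<in>I. c i a * b i a q)}"
    using S(4) by (intro CollectI exI[of _ c]) simp
next
  fix v assume "v \<in> {v. \<exists>c. (\<forall>i\<in>I. holo_germ m (c i)) \<and> field_eq m v (\<lambda>a q. \<Sum>i\<in>I. c i a * b i a q)}"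
  then obtain c where c: "\<forall>i\<in>I. holo_germ m (c i)" "field_eq m v (\<lambda>a q. \<Sum>i\<in>I. c i a * b i a q)" by blast
  define h where "h \<zeta> a = (\<Sum>i | i \<in> I \<and> b i = \<zeta>. c i a)" for \<zeta> a
  have "(\<Sum>\<zeta>\<in>b ` I. h \<zeta> a * \<zeta> a q) = (\<Sum>i\<in>I. c i a * b i a q)" for a q
    unfolding h_def by (rule sum_image_fibers[OF I])
  moreover have "\<forall>\<zeta>\<in>b ` I. holo_germ m (h \<zeta>)"
    unfolding h_def[abs_def] using c(1) by (intro ballI holo_germ_sum) auto
  ultimately show "v \<in> gen_by m (b ` I)"
    unfolding gen_by_def using c(2) I by (intro CollectI exI[of _ "b ` I"] exI[of _ h]) simp
qed

lemma gen_by_mono: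
  assumes "G \<subseteq> H"
  shows "gen_by m G \<subseteq> gen_by m H"
proof
  fix v assume "v \<in> gen_by m G"
  then obtain S h where "finite S" "S \<subseteq> G" "\<forall>\<zeta>\<in>S. holo_germ m (h \<zeta>)"
    "field_eq m v (\<lambda>a q. \<Sum>\<zeta>\<in>S. h \<zeta> a * \<zeta> a q)" unfolding gen_by_def by blast
  then show "v \<in> gen_by m H"
    unfolding gen_by_def using assms by (intro CollectI exI[of _ S] exI[of _ h]) simp
qed

lemma gen_by_basis: "gen_by m (basis_field m ` basis_index m) = basis_span m"
  unfolding gen_by_image[OF finite_basis_index] basis_span_def combination_def ..

text \<open>Z interpolates between the module itself (Z empty) and its product with the maximal
  ideal (Z everything); the weight filtration consists of such spans.\<close>

definition basis_span_vanishing :: "nat \<Rightarrow> (nat \<times> nat) set \<Rightarrow> vfield set" where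
  "basis_span_vanishing m Z = {v. \<exists>c. (\<forall>b\<in>basis_index m. holo_germ m (c b) \<and> (b \<in> Z \<longrightarrow> c b (\<lambda>_. 0) = 0)) \<and>
     field_eq m v (combination m c)}"

lemma basis_span_vanishing_empty: "basis_span_vanishing m {} = basis_span m"
  by (simp add: basis_span_vanishing_def basis_span_def)

lemma basis_span_vanishing_subset: "basis_span_vanishing m Z \<subseteq> basis_span m"
  unfolding basis_span_vanishing_def basis_span_def by blast

lemma basis_span_vanishing_cong:
  "v \<in> basis_span_vanishing m Z \<Longrightarrow> field_eq m w v \<Longrightarrow> w \<in> basis_span_vanishing m Z"
  unfolding basis_span_vanishing_def using field_eq_trans by blast

lemma combination_single:
  assumes "b \<in> basis_index m"
  shows "combination m (\<lambda>b' a. if b' = b then f a else 0) = (\<lambda>a q. f a * basis_field m b a q)"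
proof -
  have "(\<Sum>b'\<in>basis_index m. (if b' = b then f a else 0) * basis_field m b' a q)
      = (\<Sum>b'\<in>basis_index m. if b' = b then f a * basis_field m b a q else 0)" for a q
    by (rule sum.cong) auto
  then show ?thesis using assms by (simp add: combination_def)
qed

lemma basis_span_basis: "b \<in> basis_index m \<Longrightarrow> basis_field m b \<in> basis_span m"
  unfolding basis_span_def
  using combination_single[of b m "\<lambda>_. 1"]
  by (intro CollectI exI[of _ "\<lambda>b' a. if b' = b then 1 else 0"]) auto

lemma basis_span_vanishing_sum:
  assumes S: "finite S" and h: "\<And>\<zeta>. \<zeta> \<in> S \<Longrightarrow> holo_germ m (h \<zeta>)" and v: "\<And>\<zeta>. \<zeta> \<in> S \<Longrightarrow> f \<zeta> \<in> basis_span_vanishing m Z"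
  shows "(\<lambda>a q. \<Sum>\<zeta>\<in>S. h \<zeta> a * f \<zeta> a q) \<in> basis_span_vanishing m Z"
proof -
  from v have "\<forall>\<zeta>\<in>S. \<exists>c. (\<forall>b\<in>basis_index m. holo_germ m (c b) \<and> (b \<in> Z \<longrightarrow> c b (\<lambda>_. 0) = 0)) \<and> field_eq m (f \<zeta>) (combination m c)"
    unfolding basis_span_vanishing_def by blast
  from bchoice[OF this] obtain c where c: "\<And>\<zeta> b. \<zeta> \<in> S \<Longrightarrow> b \<in> basis_index m \<Longrightarrow> holo_germ m (c \<zeta> b)"
    "\<And>\<zeta> b. \<zeta> \<in> S \<Longrightarrow> b \<in> basis_index m \<Longrightarrow> b \<in> Z \<Longrightarrow> c \<zeta> b (\<lambda>_. 0) = 0"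
    "\<And>\<zeta>. \<zeta> \<in> S \<Longrightarrow> field_eq m (f \<zeta>) (combination m (c \<zeta>))" by blast
  have "near0 m (\<lambda>a. \<forall>\<zeta>\<in>S. \<forall>q\<in>coords m. f \<zeta> a q = combination m (c \<zeta>) a q)"
    by (rule near0_ball_finite[OF S]) (use c(3) in \<open>simp add: field_eq_def\<close>)
  then have "field_eq m (\<lambda>a q. \<Sum>\<zeta>\<in>S. h \<zeta> a * f \<zeta> a q) (combination m (\<lambda>b a. \<Sum>\<zeta>\<in>S. h \<zeta> a * c \<zeta> b a))"
    unfolding field_eq_def
  proof (rule near0_mono, intro ballI)
    fix a q assume "\<forall>\<zeta>\<in>S. \<forall>q\<in>coords m. f \<zeta> a q = combination m (c \<zeta>) a q" "q \<in> coords m"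
    then have "(\<Sum>\<zeta>\<in>S. h \<zeta> a * f \<zeta> a q) = (\<Sum>\<zeta>\<in>S. \<Sum>b\<in>basis_index m. h \<zeta> a * (c \<zeta> b a * basis_field m b a q))"
      by (simp add: combination_def sum_distrib_left)
    also have "\<dots> = combination m (\<lambda>b a. \<Sum>\<zeta>\<in>S. h \<zeta> a * c \<zeta> b a) a q"
      unfolding combination_def sum_distrib_right by (subst sum.swap) (simp add: mult.assoc)
    finally show "(\<Sum>\<zeta>\<in>S. h \<zeta> a * f \<zeta> a q) = combination m (\<lambda>b a. \<Sum>\<zeta>\<in>S. h \<zeta> a * c \<zeta> b a) a q" .
  qed
  moreover have "holo_germ m (\<lambda>a. \<Sum>\<zeta>\<in>S. h \<zeta> a * c \<zeta> b a)" if "b \<in> basis_index m" for b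
    using h c(1) that by (intro holo_germ_sum holo_germ_mult) auto
  ultimately show ?thesis unfolding basis_span_vanishing_def using c(2)
    by (intro CollectI exI[of _ "\<lambda>b a. \<Sum>\<zeta>\<in>S. h \<zeta> a * c \<zeta> b a"] conjI ballI impI) auto
qed

lemmas basis_span_sum = basis_span_vanishing_sum[of _ _ _ _ "{}", unfolded basis_span_vanishing_empty]

lemma gen_by_subset_span_vanishing:
  assumes "G \<subseteq> basis_span_vanishing m Z"
  shows "gen_by m G \<subseteq> basis_span_vanishing m Z"
proof
  fix v assume "v \<in> gen_by m G"
  then obtain S h where S: "finite S" "S \<subseteq> G" "\<forall>\<zeta>\<in>S. holo_germ m (h \<zeta>)"
    "field_eq m v (\<lambda>a q. \<Sum>\<zeta>\<in>S. h \<zeta> a * \<zeta> a q)" unfolding gen_by_def by blast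
  have "(\<lambda>a q. \<Sum>\<zeta>\<in>S. h \<zeta> a * \<zeta> a q) \<in> basis_span_vanishing m Z"
    by (rule basis_span_vanishing_sum[where f = "\<lambda>\<zeta>. \<zeta>"]) (use S assms in auto)
  then show "v \<in> basis_span_vanishing m Z" using S(4) by (rule basis_span_vanishing_cong)
qed

lemmas gen_by_subset_span = gen_by_subset_span_vanishing[of _ _ "{}", unfolded basis_span_vanishing_empty]

lemma xi_in_basis_span:
  assumes X: "X \<in> g_alg m"
  shows "xi m X \<in> basis_span m"
proof -
  define c :: "nat \<times> nat \<Rightarrow> pt \<Rightarrow> complex" where "c b a = (if fst b = 0 then 0 else X (fst b) (snd b))" for b a
  have "xi m X a p = combination m c a p" if "p \<in> coords m" for a p
  proof -
    obtain u v where p: "p = (u, v)" "u \<in> {1..m}" "v \<in> {1..m}" using \<open>p \<in> coords m\<close> by (auto simp: coords_def)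
    define I where "I = {(i, j). 1 \<le> j \<and> j \<le> i \<and> i \<le> m \<and> (i \<noteq> j \<longrightarrow> 3 \<le> j)}"
    have "xi m X a p = (\<Sum>x\<in>{1..m} \<times> {1..m}. X (fst x) (snd x) * xi m (E_mat (fst x) (snd x)) a p)"
      unfolding p(1) xi_sum_elem[OF p(2,3), of X a] by (simp add: sum.cartesian_product case_prod_unfold)
    also have "\<dots> = (\<Sum>x\<in>I. X (fst x) (snd x) * xi m (E_mat (fst x) (snd x)) a p)"
    proof (rule sum.mono_neutral_right)
      show "\<forall>x\<in>{1..m} \<times> {1..m} - I. X (fst x) (snd x) * xi m (E_mat (fst x) (snd x)) a p = 0"
      proof
        fix x assume x: "x \<in> {1..m} \<times> {1..m} - I"
        have "X (fst x) (snd x) = 0"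
        proof (rule ccontr)
          assume "X (fst x) (snd x) \<noteq> 0"
          then have "1 \<le> snd x \<and> snd x \<le> fst x \<and> fst x \<le> m \<and> (snd x \<le> 2 \<longrightarrow> fst x = snd x)"
            using X unfolding g_alg_def by blast
          then have "x \<in> I" unfolding I_def by (cases x) auto
          then show False using x by blast
        qed
        then show "X (fst x) (snd x) * xi m (E_mat (fst x) (snd x)) a p = 0" by simp
      qed
    qed (auto simp: I_def)
    also have "\<dots> = (\<Sum>b\<in>I. c b a * basis_field m b a p)"
      by (rule sum.cong) (auto simp: c_def basis_field_def I_def)
    also have "\<dots> = combination m c a p"
      unfolding combination_def
    proof (rule sum.mono_neutral_left)
      show "I \<subseteq> basis_index m" by (auto simp: I_def basis_index_def)
      show "\<forall>b\<in>basis_index m - I. c b a * basis_field m b a p = 0"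
        by (auto simp: basis_index_def I_def c_def)
    qed simp
    finally show ?thesis .
  qed
  then have "field_eq m (xi m X) (combination m c)" unfolding field_eq_def by (intro near0_all) auto
  then show ?thesis unfolding basis_span_def c_def[abs_def] by (intro CollectI exI conjI) auto
qed

lemma Lm_eq_basis_span: "Lm m = basis_span m"
proof
  have "eta m k \<in> basis_span m" if "k \<in> {2..m-2}" for k
    using basis_span_basis[of "(0, k)" m] that by (simp add: basis_index_def basis_field_def)
  then show "Lm m \<subseteq> basis_span m"
    unfolding Lm_def using xi_in_basis_span by (intro gen_by_subset_span) auto
  have "basis_field m ` basis_index m \<subseteq> xi m ` g_alg m \<union> eta m ` {2..m-2}"
  proof
    fix v assume "v \<in> basis_field m ` basis_index m"
    then obtain i j where b: "(i, j) \<in> basis_index m" "v = basis_field m (i, j)" by auto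
    show "v \<in> xi m ` g_alg m \<union> eta m ` {2..m-2}"
    proof (cases "i = 0")
      case True
      then show ?thesis using b by (auto simp: basis_index_def basis_field_def)
    next
      case False
      then have "E_mat i j \<in> g_alg m" using b unfolding g_alg_def basis_index_def E_mat_def by auto
      then show ?thesis using b False by (auto simp: basis_field_def)
    qed
  qed
  then have "gen_by m (basis_field m ` basis_index m) \<subseteq> Lm m"
    unfolding Lm_def by (rule gen_by_mono)
  then show "basis_span m \<subseteq> Lm m" unfolding gen_by_basis .
qed

subsection \<open>The vanishing ideal\<close>

lemma hdiv_pfun: "pfun (coords m) (hdiv m)"
  unfolding hdiv_eq[abs_def] by (intro pfun_prod fac_pfun)

lemma hdiv_holo: "holo_germ m (hdiv m)"
  by (rule pfun_holo_germ[OF hdiv_pfun])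

lemma hdiv_zero_iff: "hdiv m a = 0 \<longleftrightarrow> (\<exists>x\<in>facs m. fac x a = 0)"
  by (simp add: hdiv_eq)

text \<open>The factors are divided out one at a time. After each division the quotient still
  vanishes on the next component off the others, because the divisors already removed are nonzero
  there.\<close>

lemma vanish_ideal_hdiv:
  assumes g: "holo_germ m g" and van: "near0 m (\<lambda>a. hdiv m a = 0 \<longrightarrow> g a = 0)"
  shows "\<exists>u. holo_germ m u \<and> near0 m (\<lambda>a. g a = u a * hdiv m a)"
proof -
  have "\<exists>u. holo_germ m u \<and> near0 m (\<lambda>a. g a = u a * (\<Prod>x\<in>I. fac x a))" if "finite I" "I \<subseteq> facs m" for I
    using that
  proof (induction I rule: finite_induct)
    case empty
    show ?case by (intro exI[of _ g]) (use g in \<open>auto intro: near0_all\<close>)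
  next
    case (insert x I)
    then obtain u where u: "holo_germ m u" "near0 m (\<lambda>a. g a = u a * (\<Prod>x\<in>I. fac x a))" by auto
    have x: "x \<in> facs m" using insert.prems by simp
    have "near0 m (\<lambda>a. fac x a = 0 \<longrightarrow> (\<forall>y\<in>facs m - {x}. fac y a \<noteq> 0) \<longrightarrow> u a = 0)"
      using u(2) van
    proof (rule near0_mp, intro impI)
      fix a assume ga: "g a = u a * (\<Prod>x\<in>I. fac x a)" and h0: "hdiv m a = 0 \<longrightarrow> g a = 0"
        and f0: "fac x a = 0" and nz: "\<forall>y\<in>facs m - {x}. fac y a \<noteq> 0"
      have "hdiv m a = 0" using f0 x by (auto simp: hdiv_zero_iff)
      moreover have "(\<Prod>x\<in>I. fac x a) \<noteq> 0" using nz insert.hyps insert.prems by (subst prod_zero_iff) auto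
      ultimately show "u a = 0" using ga h0 by simp
    qed
    from fac_division[OF x u(1) this] obtain w where w: "holo_germ m w" "near0 m (\<lambda>a. u a = w a * fac x a)" by blast
    have "near0 m (\<lambda>a. g a = w a * (\<Prod>x\<in>insert x I. fac x a))"
      using u(2) w(2) by (rule near0_mp) (use insert.hyps in \<open>simp add: mult.assoc\<close>)
    with w(1) show ?case by blast
  qed
  from this[OF finite_facs subset_refl] show ?thesis unfolding hdiv_eq .
qed

lemma vanish_ideal_eq: "vanish_ideal m (hdiv m) = principal_ideal m (hdiv m)"
proof
  show "vanish_ideal m (hdiv m) \<subseteq> principal_ideal m (hdiv m)"
    unfolding vanish_ideal_def principal_ideal_def using vanish_ideal_hdiv by blast
  show "principal_ideal m (hdiv m) \<subseteq> vanish_ideal m (hdiv m)"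
    unfolding vanish_ideal_def principal_ideal_def by (auto elim: near0_mono)
qed

text \<open>Once the ideal is known to be principal, the product rule reduces the condition on all
  its members to its generator.\<close>

lemma derlog_iff:
  "v \<in> derlog m (hdiv m) \<longleftrightarrow> holo_field m v \<and>
    (\<exists>\<mu>. holo_germ m \<mu> \<and> near0 m (\<lambda>a. vf_app m v (hdiv m) a = \<mu> a * hdiv m a))"
proof
  assume v: "v \<in> derlog m (hdiv m)"
  have "hdiv m \<in> vanish_ideal m (hdiv m)" using hdiv_holo by (auto simp: vanish_ideal_def intro: near0_all)
  then have "vf_app m v (hdiv m) \<in> vanish_ideal m (hdiv m)" using v by (auto simp: derlog_def)
  then show "holo_field m v \<and> (\<exists>\<mu>. holo_germ m \<mu> \<and> near0 m (\<lambda>a. vf_app m v (hdiv m) a = \<mu> a * hdiv m a))"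
    using v unfolding vanish_ideal_eq principal_ideal_def derlog_def by blast
next
  assume "holo_field m v \<and> (\<exists>\<mu>. holo_germ m \<mu> \<and> near0 m (\<lambda>a. vf_app m v (hdiv m) a = \<mu> a * hdiv m a))"
  then obtain \<mu> where v: "holo_field m v" and \<mu>: "holo_germ m \<mu>" "near0 m (\<lambda>a. vf_app m v (hdiv m) a = \<mu> a * hdiv m a)"
    by blast
  have "vf_app m v g \<in> vanish_ideal m (hdiv m)" if "g \<in> vanish_ideal m (hdiv m)" for g
  proof -
    from that obtain u where g: "holo_germ m g" and u: "holo_germ m u" "near0 m (\<lambda>a. g a = u a * hdiv m a)"
      unfolding vanish_ideal_eq principal_ideal_def by blast
    have "near0 m (\<lambda>a. vf_app m v g a = u a * vf_app m v (hdiv m) a + hdiv m a * vf_app m v u a)"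
      using vf_app_cong[OF u(2), of v] vf_app_mult[OF u(1) hdiv_holo, of v] by (rule near0_mp) simp
    then have "near0 m (\<lambda>a. hdiv m a = 0 \<longrightarrow> vf_app m v g a = 0)" using \<mu>(2) by (rule near0_mp) simp
    then show ?thesis using holo_germ_vf_app[OF v g] by (simp add: vanish_ideal_def)
  qed
  with v show "v \<in> derlog m (hdiv m)" by (auto simp: derlog_def)
qed

lemma derlog_cong:
  assumes "v \<in> derlog m (hdiv m)" "field_eq m w v"
  shows "w \<in> derlog m (hdiv m)"
proof -
  from assms(1) obtain \<mu> where v: "holo_field m v" and \<mu>: "holo_germ m \<mu>" "near0 m (\<lambda>a. vf_app m v (hdiv m) a = \<mu> a * hdiv m a)"
    unfolding derlog_iff by blast
  have "holo_field m w" unfolding holo_field_def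
  proof
    fix p assume p: "p \<in> coords m"
    have "near0 m (\<lambda>a. v a p = w a p)" using assms(2) p unfolding field_eq_def by (auto elim: near0_mono)
    moreover have "holo_germ m (\<lambda>a. v a p)" using v p unfolding holo_field_def by blast
    ultimately show "holo_germ m (\<lambda>a. w a p)"
      using holo_germ_cong[of m "\<lambda>a. v a p" "\<lambda>a. w a p"] by blast
  qed
  moreover have "near0 m (\<lambda>a. vf_app m w (hdiv m) a = \<mu> a * hdiv m a)"
    using vf_app_field_cong[OF assms(2)] \<mu>(2) by (rule near0_mp) simp
  ultimately show ?thesis using \<mu>(1) unfolding derlog_iff by blast
qed

lemma derlog_diff:
  assumes v: "v \<in> derlog m (hdiv m)" and c: "\<And>b. b \<in> J \<Longrightarrow> holo_germ m (c b)" and J: "J \<subseteq> basis_index m"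
  shows "(\<lambda>a q. v a q - (\<Sum>b\<in>J. c b a * basis_field m b a q)) \<in> derlog m (hdiv m)"
proof -
  from v obtain \<mu> where vh: "holo_field m v" and \<mu>: "holo_germ m \<mu>" "near0 m (\<lambda>a. vf_app m v (hdiv m) a = \<mu> a * hdiv m a)"
    unfolding derlog_iff by blast
  have "\<forall>b\<in>J. \<exists>\<nu>. pfun (coords m) \<nu> \<and> (\<forall>a. vf_app m (basis_field m b) (hdiv m) a = \<nu> a * hdiv m a)"
    using basis_field_logarithmic J by blast
  from bchoice[OF this] obtain \<nu> where \<nu>: "\<And>b. b \<in> J \<Longrightarrow> pfun (coords m) (\<nu> b)"
    "\<And>b a. b \<in> J \<Longrightarrow> vf_app m (basis_field m b) (hdiv m) a = \<nu> b a * hdiv m a" by blast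
  have app: "vf_app m (\<lambda>a q. v a q - (\<Sum>b\<in>J. c b a * basis_field m b a q)) (hdiv m) a
     = vf_app m v (hdiv m) a - (\<Sum>b\<in>J. c b a * \<nu> b a) * hdiv m a" for a
  proof -
    have "vf_app m (\<lambda>a q. v a q - (\<Sum>b\<in>J. c b a * basis_field m b a q)) (hdiv m) a
       = vf_app m v (hdiv m) a - vf_app m (\<lambda>a q. \<Sum>b\<in>J. c b a * basis_field m b a q) (hdiv m) a"
      by (simp add: vf_app_def left_diff_distrib sum_subtractf)
    also have "vf_app m (\<lambda>a q. \<Sum>b\<in>J. c b a * basis_field m b a q) (hdiv m) a = (\<Sum>b\<in>J. c b a * \<nu> b a) * hdiv m a"
      unfolding vf_app_comb sum_distrib_right by (intro sum.cong) (auto simp: \<nu>(2))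
    finally show ?thesis .
  qed
  show ?thesis
    unfolding derlog_iff app
  proof (intro conjI exI)
    show "holo_field m (\<lambda>a q. v a q - (\<Sum>b\<in>J. c b a * basis_field m b a q))"
      using vh basis_field_holo c unfolding holo_field_def
      by (intro ballI holo_germ_diff holo_germ_sum holo_germ_mult) auto
    show "holo_germ m (\<lambda>a. \<mu> a - (\<Sum>b\<in>J. c b a * \<nu> b a))"
      by (intro holo_germ_diff \<mu> holo_germ_sum holo_germ_mult c pfun_holo_germ \<nu>)
    show "near0 m (\<lambda>a. vf_app m v (hdiv m) a - (\<Sum>b\<in>J. c b a * \<nu> b a) * hdiv m a = (\<mu> a - (\<Sum>b\<in>J. c b a * \<nu> b a)) * hdiv m a)"
      using \<mu>(2) by (rule near0_mono) (simp add: left_diff_distrib)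
  qed
qed

lemma zero_derlog: "(\<lambda>a q. 0) \<in> derlog m (hdiv m)"
  unfolding derlog_iff
  by (intro conjI exI[of _ "\<lambda>_. 0"]) (auto simp: holo_field_def vf_app_def intro: near0_all)

lemma basis_span_subset_derlog: "basis_span m \<subseteq> derlog m (hdiv m)"
proof
  fix v assume "v \<in> basis_span m"
  then obtain c where c: "\<And>b. b \<in> basis_index m \<Longrightarrow> holo_germ m (c b)" "field_eq m v (combination m c)"
    unfolding basis_span_def by blast
  have "(\<lambda>a q. 0 - (\<Sum>b\<in>basis_index m. - c b a * basis_field m b a q)) \<in> derlog m (hdiv m)"
    by (rule derlog_diff[OF zero_derlog]) (auto intro: holo_germ_minus c)
  also have "(\<lambda>a q. 0 - (\<Sum>b\<in>basis_index m. - c b a * basis_field m b a q)) = combination m c"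
    by (simp add: combination_def sum_negf)
  finally show "v \<in> derlog m (hdiv m)" using c(2) by (rule derlog_cong)
qed

lemma basis_span_of_diff:
  assumes d: "(\<lambda>a q. v a q - (\<Sum>b\<in>J. c b a * basis_field m b a q)) \<in> basis_span m"
    and c: "\<And>b. b \<in> J \<Longrightarrow> holo_germ m (c b)" and J: "J \<subseteq> basis_index m"
  shows "v \<in> basis_span m"
proof -
  let ?w = "\<lambda>a q. v a q - (\<Sum>b\<in>J. c b a * basis_field m b a q)"
  \<comment> \<open>\<open>None\<close> stands for the remainder, so that it and the subtracted
    generators form one finite family.\<close>
  define h where "h x = (case x of None \<Rightarrow> (\<lambda>_. 1) | Some b \<Rightarrow> c b)" for x
  define f where "f x = (case x of None \<Rightarrow> ?w | Some b \<Rightarrow> basis_field m b)" for x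
  have fin: "finite J" using J finite_basis_index finite_subset by blast
  have "(\<lambda>a q. \<Sum>x\<in>insert None (Some ` J). h x a * f x a q) \<in> basis_span m"
  proof (rule basis_span_sum)
    show "holo_germ m (h x)" if "x \<in> insert None (Some ` J)" for x
      using that c by (auto simp: h_def)
    show "f x \<in> basis_span m" if "x \<in> insert None (Some ` J)" for x
      using that d J basis_span_basis by (auto simp: f_def)
  qed (use fin in auto)
  also have "(\<lambda>a q. \<Sum>x\<in>insert None (Some ` J). h x a * f x a q) = v"
    using fin by (auto simp: fun_eq_iff sum.reindex h_def f_def)
  finally show ?thesis .
qed

text \<open>With hdiv = f H the product rule gives H v(f) = 0 at zeros of hdiv where f = 0. So v(f)
  vanishes on {f = 0} wherever the other factors do not, which is all that the division theorem asks
  for.\<close>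

lemma derlog_fac:
  assumes v: "v \<in> derlog m (hdiv m)" and x: "x \<in> facs m"
  shows "\<exists>\<mu>. holo_germ m \<mu> \<and> near0 m (\<lambda>a. vf_app m v (fac x) a = \<mu> a * fac x a)"
proof -
  from v obtain \<mu> where vh: "holo_field m v" and \<mu>: "holo_germ m \<mu>" "near0 m (\<lambda>a. vf_app m v (hdiv m) a = \<mu> a * hdiv m a)"
    unfolding derlog_iff by blast
  define H where "H a = (\<Prod>y\<in>facs m - {x}. fac y a)" for a
  have hH: "hdiv m = (\<lambda>a. fac x a * H a)"
    unfolding hdiv_eq[abs_def] H_def using prod.remove[OF finite_facs x] by auto
  have Hh: "holo_germ m H" unfolding H_def[abs_def] by (intro pfun_holo_germ pfun_prod fac_pfun) auto
  have fh: "holo_germ m (fac x)" by (intro pfun_holo_germ fac_pfun x)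
  show ?thesis
  proof (rule fac_division[OF x holo_germ_vf_app[OF vh fh]])
    show "near0 m (\<lambda>a. fac x a = 0 \<longrightarrow> (\<forall>y\<in>facs m - {x}. fac y a \<noteq> 0) \<longrightarrow> vf_app m v (fac x) a = 0)"
      using \<mu>(2) vf_app_mult[OF fh Hh, of v]
    proof (rule near0_mp, intro impI)
      fix a assume 1: "vf_app m v (hdiv m) a = \<mu> a * hdiv m a"
        and 2: "vf_app m v (\<lambda>a. fac x a * H a) a = fac x a * vf_app m v H a + H a * vf_app m v (fac x) a"
        and 3: "fac x a = 0" "\<forall>y\<in>facs m - {x}. fac y a \<noteq> 0"
      have "H a \<noteq> 0" using 3(2) by (simp add: H_def)
      then show "vf_app m v (fac x) a = 0" using 1 2 3(1) unfolding hH by simp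
    qed
  qed
qed

text \<open>Along a regular line a factor has isolated zeros, so g vanishes on a punctured
  neighbourhood of the base point and, by continuity, at the base point.\<close>

lemma fac_cancel:
  assumes x: "x \<in> facs m" and g: "holo_germ m g" and z: "near0 m (\<lambda>a. fac x a * g a = 0)"
  shows "near0 m (\<lambda>a. g a = 0)"
proof -
  obtain e where e: "\<And>x. x \<in> facs m \<Longrightarrow> fac x e \<noteq> 0" "\<And>p. p \<in> coords m \<Longrightarrow> norm (e p) \<le> 1"
    using regular_direction by blast
  obtain r1 where r1: "r1 > 0" "holo_disc (coords m) r1 g" using g unfolding holo_germ_iff by blast
  obtain r2 where r2: "r2 > 0" "\<And>a. a \<in> polydisc (coords m) r2 \<Longrightarrow> fac x a * g a = 0"
    using z unfolding near0_iff by blast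
  define r where "r = min r1 r2"
  have r: "r > 0" "holo_disc (coords m) r g"
    using r1 r2 unfolding r_def by (auto elim: holo_disc_mono)
  have r3: "fac x a * g a = 0" if "a \<in> polydisc (coords m) r" for a
    by (rule r2(2), rule polydisc_mono[OF that]) (simp add: r_def)
  obtain d where d: "homogeneous d (fac x)" using fac_homogeneous by blast
  show ?thesis
  proof (rule near0I[of "r/2"])
    fix a assume a: "a \<in> polydisc (coords m) (r/2)"
    have mem: "on_line e a t \<in> polydisc (coords m) r" if "norm t < r/2" for t
      using on_line_polydisc[where e = e and R = "r/2" and t = t, OF a e(2)] that by simp
    define G where "G t = g (on_line e a t)" for t
    have "G holomorphic_on ball 0 (r/2)"
      unfolding G_def by (rule holo_disc_curve[OF r(2)]) (use mem in \<open>auto simp: on_line_def intro!: holomorphic_intros\<close>)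
    then have "isCont G 0"
      using r continuous_on_eq_continuous_at[OF open_ball] holomorphic_on_imp_continuous_on by (metis centre_in_ball half_gt_zero)
    then have "(G \<longlongrightarrow> G 0) (at 0)" by (simp add: isCont_def)
    moreover have "\<forall>\<^sub>F t in at 0. G t = 0"
    proof -
      define K where "K = {t \<in> cball 0 (r/2). fac x (on_line e a t) = 0}"
      have "finite K" unfolding K_def by (rule homogeneous_finite_zeros[where f = "fac x", OF fac_pfun[OF x] d e(1)[OF x]])
      then have "open (ball 0 (r/2) - (K - {0}))" "0 \<in> ball 0 (r/2) - (K - {0})"
        using r(1) by (auto intro!: open_Diff finite_imp_closed)
      then have "\<forall>\<^sub>F t in at 0. t \<in> ball 0 (r/2) - (K - {0}) - {0}" by (rule eventually_at_in_open)
      then show ?thesis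
      proof eventually_elim
        case (elim t)
        then have "fac x (on_line e a t) \<noteq> 0" by (auto simp: K_def)
        moreover have "fac x (on_line e a t) * G t = 0" unfolding G_def using elim by (intro r3 mem) auto
        ultimately show "G t = 0" by simp
      qed
    qed
    ultimately have "((\<lambda>_. 0) \<longlongrightarrow> G 0) (at (0::complex))" by (rule Lim_transform_eventually)
    then have "G 0 = 0" by (simp add: tendsto_const_iff)
    then show "g a = 0" by (simp add: G_def on_line_def)
  qed (use r in auto)
qed

section \<open>Elimination of logarithmic fields column by column\<close>

lemma cofk_Ahat_pfun:
  assumes k: "k + 2 \<le> m" and rc: "r \<in> {1..k}" "c \<in> {1..k}"
  shows "pfun (coords m) (\<lambda>a. cofk k (Ahat a) r c)"
proof -
  let ?N = "\<lambda>a i j. Ahat a i j + (if i = r \<and> j = c then 1 else 0)"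
  \<comment> \<open>Raising one entry by 1 changes the determinant by its cofactor; this shows the
    cofactor to be a polynomial.\<close>
  have "cofk k (Ahat a) r c = detk k (?N a) - Dfac k a" for a
  proof -
    have "detk k (?N a) = detk k (Ahat a) + (?N a r c - Ahat a r c) * cofk k (Ahat a) r c"
      by (rule detk_change_entry[OF rc]) auto
    then show ?thesis by (simp add: Dfac_def)
  qed
  moreover have "pfun (coords m) (\<lambda>a. detk k (?N a) - Dfac k a)"
    by (intro pfun_diff detk_pfun pfun_add matA_pfun pfun_const Dfac_pfun k) (use k in auto)
  ultimately show ?thesis by simp
qed

lemma dfun_Dfac_column:
  assumes k: "k + 2 \<le> m" "k \<ge> 1" and v: "\<And>p. p \<in> coords m \<Longrightarrow> snd p < k + 2 \<Longrightarrow> v p = 0"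
  shows "dfun (coords m) (Dfac k) a v = (\<Sum>r=1..k. v (r, k + 2) * cofk k (Ahat a) r k)"
proof -
  have "dfun (coords m) (Dfac k) a v = 0 * Dfac k a + (\<Sum>r=1..k. v (r, k + 2) * cofk k (Ahat a) r k)"
  proof (rule dfunI[OF Dfac_pfun[OF k(1)]])
    fix t
    let ?N = "\<lambda>r c. matA (\<lambda>p. a p + t * v p) r (c + 2)"
    have "detk k ?N = detk k (Ahat a) + (\<Sum>r=1..k. (?N r k - Ahat a r k) * cofk k (Ahat a) r k)"
    proof (rule detk_change_col)
      fix r c assume rc: "r \<in> {1..k}" "c \<in> {1..k}" "c \<noteq> k"
      have "matA v r (c + 2) = 0"
        using rc k v[of "(r, c + 2)"] v[of "(c + 2, r)"] by (auto simp: matA_def coords_def)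
      then show "?N r c = Ahat a r c" by (simp add: matA_add_smult)
    qed (use k in auto)
    also have "(\<Sum>r=1..k. (?N r k - Ahat a r k) * cofk k (Ahat a) r k) = t * (\<Sum>r=1..k. v (r, k + 2) * cofk k (Ahat a) r k)"
      unfolding sum_distrib_left matA_add_smult by (rule sum.cong) (auto simp: matA_def)
    finally show "Dfac k (\<lambda>p. a p + t * v p) = (1 + t * 0) * (Dfac k a + t * (\<Sum>r=1..k. v (r, k + 2) * cofk k (Ahat a) r k))"
      by (simp add: Dfac_def)
  qed
  then show ?thesis by simp
qed

lemma dfun_Pfac_column:
  assumes k: "k \<le> m" "k \<ge> 2" and v: "\<And>p. p \<in> coords m \<Longrightarrow> snd p < k \<Longrightarrow> v p = 0"
    and v': "\<And>r. 1 \<le> r \<Longrightarrow> r < k - 1 \<Longrightarrow> v (r, k) = 0"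
  shows "dfun (coords m) (Pfac k) a v = v (k - 1, k) * Pfac (k - 2) a"
proof -
  have "dfun (coords m) (Pfac k) a v = 0 * Pfac k a + v (k - 1, k) * Pfac (k - 2) a"
  proof (rule dfunI[OF Pfac_pfun[OF k(1)]])
    fix t
    have z: "v (x, y) = 0" if "1 \<le> x" "x < y" "y \<le> k" "(x, y) \<noteq> (k - 1, k)" for x y
    proof (cases "y < k")
      case True
      then show ?thesis using v[of "(x, y)"] that k by (auto simp: coords_def)
    next
      case False
      then show ?thesis using v'[of x] that by auto
    qed
    have "pf (matA (\<lambda>p. a p + t * v p)) (Slist k) = pf (matA (a((k - 1, k) := a (k - 1, k) + t * v (k - 1, k)))) (Slist k)"
    proof (rule pf_cong)
      fix x y assume "x \<in> set (Slist k)" "y \<in> set (Slist k)"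
      then have "1 \<le> x" "x \<le> k" "1 \<le> y" "y \<le> k" using eps_bounds[of k] by auto
      then show "matA (\<lambda>p. a p + t * v p) x y = matA (a((k - 1, k) := a (k - 1, k) + t * v (k - 1, k))) x y"
        using z[of x y] z[of y x] by (cases x y rule: linorder_cases) (auto simp: matA_def)
    qed
    then have "Pfac k (\<lambda>p. a p + t * v p) = Pfac k (a((k - 1, k) := a (k - 1, k) + t * v (k - 1, k)))"
      by (simp add: Pfac_def)
    then show "Pfac k (\<lambda>p. a p + t * v p) = (1 + t * 0) * (Pfac k a + t * (v (k - 1, k) * Pfac (k - 2) a))"
      unfolding Pfac_affine[OF k(2)] by simp
  qed
  then show ?thesis by simp
qed

text \<open>Where \<open>Dfac k\<close> vanishes but \<open>Dfac (k - 1)\<close> does not, the cofactors of the last column span the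
  left kernel, so being logarithmic along \<open>Dfac k\<close> puts column \<open>k + 2\<close> of \<open>v\<close> into the column space; hence all
  determinants in Cramer's rule are divisible by \<open>Dfac k\<close>.\<close>

lemma derlog_column_solution:
  assumes v: "v \<in> derlog m (hdiv m)" and k: "k + 2 \<le> m" "k \<ge> 2"
    and z: "near0 m (\<lambda>a. \<forall>p\<in>coords m. snd p < k + 2 \<longrightarrow> v a p = 0)"
  shows "\<exists>c. (\<forall>j\<in>{1..k}. holo_germ m (c j)) \<and>
    near0 m (\<lambda>a. \<forall>r\<in>{1..k}. v a (r, k + 2) = (\<Sum>j=1..k. c j a * Ahat a r j))"
proof -
  define N where "N j a = (\<Sum>r=1..k. v a (r, k + 2) * cofk k (Ahat a) r j)" for j a
  have x: "Inl k \<in> facs m" using k by (auto simp: facs_def)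
  have vh: "holo_germ m (\<lambda>a. v a (r, k + 2))" if "r \<in> {1..k}" for r
    using v that k unfolding derlog_iff holo_field_def by (auto simp: coords_def)
  have Nh: "holo_germ m (N j)" if "j \<in> {1..k}" for j
    unfolding N_def[abs_def]
    by (intro holo_germ_sum holo_germ_mult vh pfun_holo_germ cofk_Ahat_pfun k that) auto
  obtain \<mu> where \<mu>: "near0 m (\<lambda>a. vf_app m v (Dfac k) a = \<mu> a * Dfac k a)"
    using derlog_fac[OF v x] by auto
  have Nk: "near0 m (\<lambda>a. N k a = \<mu> a * Dfac k a)"
    using \<mu> z
  proof (rule near0_mp)
    fix a assume 1: "vf_app m v (Dfac k) a = \<mu> a * Dfac k a" and 2: "\<forall>p\<in>coords m. snd p < k + 2 \<longrightarrow> v a p = 0"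
    show "N k a = \<mu> a * Dfac k a"
      using 1 dfun_Dfac_column[OF k(1), of "v a" a] 2 k(2) unfolding vf_app_dfun N_def by auto
  qed
  have "\<exists>c. holo_germ m c \<and> near0 m (\<lambda>a. N j a = c a * Dfac k a)" if j: "j \<in> {1..k}" for j
  proof -
    have "near0 m (\<lambda>a. fac (Inl k) a = 0 \<longrightarrow> (\<forall>y\<in>facs m - {Inl k}. fac y a \<noteq> 0) \<longrightarrow> N j a = 0)"
      using Nk
    proof (rule near0_mono, intro impI)
      fix a assume Nka: "N k a = \<mu> a * Dfac k a" and D0: "fac (Inl k) a = 0"
        and nz: "\<forall>y\<in>facs m - {Inl k}. fac y a \<noteq> 0"
      \<comment> \<open>Cramer's matrix: column j is replaced by the column of v, and the
        determinant is \<open>N j a\<close> by expansion along that column.\<close>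
      let ?M = "\<lambda>r c. if c = j then v a (r, k + 2) else Ahat a r c"
      have D0': "detk k (Ahat a) = 0" using D0 by (simp add: Dfac_def)
      have "detk k ?M = 0"
      proof (rule detk_eq_0_left_kernel[where i = k and l = "\<lambda>r. cofk k (Ahat a) r k"])
        show "k \<in> {1..k}" using k by auto
        obtain k' where k': "k = Suc k'" using k by (cases k) auto
        have "Inl k' \<in> facs m - {Inl k}" using k k' by (auto simp: facs_def)
        then have "fac (Inl k') a \<noteq> 0" using nz by blast
        then show "cofk k (Ahat a) k k \<noteq> 0" unfolding k' cofk_last by (simp add: Dfac_def)
        fix c assume c: "c \<in> {1..k}"
        show "(\<Sum>r=1..k. cofk k (Ahat a) r k * ?M r c) = 0"
        proof (cases "c = j")
          case True
          then show ?thesis using Nka D0 by (simp add: N_def mult.commute)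
        next
          case False
          then show ?thesis using cofk_col[OF c, of k "Ahat a"] k D0' by (simp add: mult.commute)
        qed
      qed
      moreover have "detk k ?M = detk k (Ahat a) + (\<Sum>r=1..k. (?M r j - Ahat a r j) * cofk k (Ahat a) r j)"
        by (rule detk_change_col[OF j]) auto
      moreover have "(\<Sum>r=1..k. (?M r j - Ahat a r j) * cofk k (Ahat a) r j) = N j a - (\<Sum>r=1..k. Ahat a r j * cofk k (Ahat a) r j)"
        by (simp add: N_def left_diff_distrib sum_subtractf)
      ultimately show "N j a = 0" using cofk_col[OF j j, of "Ahat a"] D0' by simp
    qed
    from fac_division[OF x Nh[OF j] this] show ?thesis by simp
  qed
  then have "\<forall>j\<in>{1..k}. \<exists>c. holo_germ m c \<and> near0 m (\<lambda>a. N j a = c a * Dfac k a)" by blast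
  from bchoice[OF this] obtain c where c: "\<forall>j\<in>{1..k}. holo_germ m (c j)" "\<And>j. j \<in> {1..k} \<Longrightarrow> near0 m (\<lambda>a. N j a = c j a * Dfac k a)"
    by blast
  have cN: "near0 m (\<lambda>a. \<forall>j\<in>{1..k}. N j a = c j a * Dfac k a)"
    by (rule near0_ball_finite) (use c in auto)
  have "near0 m (\<lambda>a. v a (r, k + 2) = (\<Sum>j=1..k. c j a * Ahat a r j))" if r: "r \<in> {1..k}" for r
  proof -
    define g where "g a = v a (r, k + 2) - (\<Sum>j=1..k. c j a * Ahat a r j)" for a
    have Ah: "holo_germ m (\<lambda>a. Ahat a r j)" if "j \<in> {1..k}" for j
      by (intro pfun_holo_germ matA_pfun) (use that r k in auto)
    have gh: "holo_germ m g"
      unfolding g_def[abs_def]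
      by (intro holo_germ_diff vh[OF r] holo_germ_sum holo_germ_mult Ah) (use c(1) in auto)
    \<comment> \<open>The linear system is checked after multiplication by \<open>Dfac k\<close>,
      which is then cancelled as a germ.\<close>
    have "near0 m (\<lambda>a. fac (Inl k) a * g a = 0)"
      using cN
    proof (rule near0_mono)
      fix a assume N: "\<forall>j\<in>{1..k}. N j a = c j a * Dfac k a"
      have "Dfac k a * (\<Sum>j=1..k. c j a * Ahat a r j) = (\<Sum>j=1..k. N j a * Ahat a r j)"
        unfolding sum_distrib_left using N by (intro sum.cong) auto
      also have "\<dots> = (\<Sum>s=1..k. v a (s, k + 2) * (\<Sum>j=1..k. Ahat a r j * cofk k (Ahat a) s j))"
        unfolding N_def sum_distrib_left sum_distrib_right
        by (subst sum.swap) (simp add: mult.assoc mult.left_commute mult.commute)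
      also have "\<dots> = (\<Sum>s=1..k. if s = r then v a (r, k + 2) * Dfac k a else 0)"
        using cofk_row[OF r, of _ "Ahat a"] by (intro sum.cong) (auto simp: Dfac_def)
      also have "\<dots> = v a (r, k + 2) * Dfac k a" using r by simp
      finally have "Dfac k a * (\<Sum>j=1..k. c j a * Ahat a r j) = v a (r, k + 2) * Dfac k a" .
      then show "fac (Inl k) a * g a = 0" unfolding g_def fac_simps right_diff_distrib by (simp only: mult.commute diff_self)
    qed
    from fac_cancel[OF x gh this] show ?thesis by (rule near0_mono) (simp add: g_def)
  qed
  then have "near0 m (\<lambda>a. \<forall>r\<in>{1..k}. v a (r, k + 2) = (\<Sum>j=1..k. c j a * Ahat a r j))"
    by (intro near0_ball_finite) auto
  with c(1) show ?thesis by blast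
qed

text \<open>With everything else up to column k cleared, v applied to \<open>Pfac k\<close> is the
  entry at (k - 1, k) times \<open>Pfac (k - 2)\<close>. That coefficient is nonzero off the other
  factors, so the entry vanishes at the generic zeros of \<open>Pfac k\<close>.\<close>

lemma derlog_pfaffian_solution:
  assumes v: "v \<in> derlog m (hdiv m)" and k: "k \<le> m" "k \<ge> 2"
    and z: "near0 m (\<lambda>a. \<forall>p\<in>coords m. snd p < k \<longrightarrow> v a p = 0)"
    and z': "near0 m (\<lambda>a. \<forall>r\<in>{1..k - 2}. v a (r, k) = 0)"
  shows "\<exists>d. holo_germ m d \<and> near0 m (\<lambda>a. v a (k - 1, k) = d a * Pfac k a)"
proof -
  have x: "Inr k \<in> facs m" using k by (auto simp: facs_def)
  have vh: "holo_germ m (\<lambda>a. v a (k - 1, k))"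
    using v k unfolding derlog_iff holo_field_def by (auto simp: coords_def)
  obtain \<mu> where \<mu>: "near0 m (\<lambda>a. vf_app m v (Pfac k) a = \<mu> a * Pfac k a)"
    using derlog_fac[OF v x] by auto
  have zz: "near0 m (\<lambda>a. (\<forall>p\<in>coords m. snd p < k \<longrightarrow> v a p = 0) \<and> (\<forall>r\<in>{1..k - 2}. v a (r, k) = 0))"
    using z z' by (simp add: near0_conj)
  have "near0 m (\<lambda>a. fac (Inr k) a = 0 \<longrightarrow> (\<forall>y\<in>facs m - {Inr k}. fac y a \<noteq> 0) \<longrightarrow> v a (k - 1, k) = 0)"
    using \<mu> zz
  proof (rule near0_mp, intro impI)
    fix a assume 1: "vf_app m v (Pfac k) a = \<mu> a * Pfac k a"
      and 2: "(\<forall>p\<in>coords m. snd p < k \<longrightarrow> v a p = 0) \<and> (\<forall>r\<in>{1..k - 2}. v a (r, k) = 0)"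
      and 3: "fac (Inr k) a = 0" "\<forall>y\<in>facs m - {Inr k}. fac y a \<noteq> 0"
    have "Pfac (k - 2) a \<noteq> 0"
    proof (cases "k - 2 < 2")
      case False
      then have "Inr (k - 2) \<in> facs m - {Inr k}" using k by (auto simp: facs_def)
      then have "fac (Inr (k - 2)) a \<noteq> 0" using 3(2) by blast
      then show ?thesis by simp
    qed (simp add: Pfac_less_2)
    moreover have "dfun (coords m) (Pfac k) a (v a) = v a (k - 1, k) * Pfac (k - 2) a"
      by (rule dfun_Pfac_column[OF k]) (use 2 in auto)
    ultimately show "v a (k - 1, k) = 0" using 1 3(1) by (simp add: vf_app_dfun)
  qed
  from fac_division[OF x vh this] show ?thesis by simp
qed

lemma basis_field_column:
  assumes "(p, q) \<in> coords m" "i \<in> {3..m}" "n \<in> {3..i}" "q \<le> i"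
  shows "basis_field m (i, n) a (p, q) = (if q = i then matA a p n else 0)"
proof -
  have "n \<in> {1..m}" using assms by auto
  then show ?thesis using assms by (auto simp: basis_field_def xi_elem coords_def)
qed

lemma sum_column:
  fixes f :: "nat \<Rightarrow> complex"
  assumes "i \<ge> 3"
  shows "(\<Sum>b\<in>{i} \<times> {3..i}. f (snd b)) = (\<Sum>j=1..i - 2. f (j + 2))"
proof -
  have "snd b - 2 + 2 = snd b" if "b \<in> {i} \<times> {3..i}" for b using that by auto
  then show ?thesis
    by (intro sum.reindex_bij_witness[where i = "\<lambda>j. (i, j + 2)" and j = "\<lambda>b. snd b - 2"])
       (use assms in \<open>auto simp del: add_2_eq_Suc'\<close>)
qed

text \<open>Up to column k, only the pair (k - 1, k) has both indices above k - 2, and adjoining it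
  to {eps (k - 2)..k - 2} gives the index set of \<open>Pfac k\<close>.\<close>

lemma eta_column:
  assumes "(p, q) \<in> coords m" "q \<le> k" "k \<ge> 4"
  shows "eta m (k - 2) a (p, q) = (if p = k - 1 \<and> q = k then Pfac k a else 0)"
proof -
  interpret skew "matA a" by (rule skew_matA)
  show ?thesis
  proof (cases "p = k - 1 \<and> q = k")
    case True
    then have "eta m (k - 2) a (p, q) = pf (matA a) (p # q # Slist (k - 2))"
      using assms PfS_insert_two[of "k - 2" p q a] by (simp add: eta_def coords_def)
    also have "\<dots> = Pfac k a"
      using True assms Slist_split[of k] pf_append_two[of "Slist (k - 2)" "k - 1" k] by (simp add: Pfac_def)
    finally show ?thesis using True by simp
  next
    case False
    then have "\<not> (k - 2 < p \<and> p < q \<and> q \<le> m)" using assms by auto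
    then show ?thesis using False by (simp only: eta_def prod.case if_False)
  qed
qed

lemma derlog_elimination_step:
  assumes v: "v \<in> derlog m (hdiv m)" and i: "4 \<le> i" "i \<le> m"
    and z: "near0 m (\<lambda>a. \<forall>p\<in>coords m. snd p < i \<longrightarrow> v a p = 0)"
    and IH: "\<And>w. w \<in> derlog m (hdiv m) \<Longrightarrow> near0 m (\<lambda>a. \<forall>p\<in>coords m. snd p < Suc i \<longrightarrow> w a p = 0) \<Longrightarrow> w \<in> basis_span m"
  shows "v \<in> basis_span m"
proof -
  define k where "k = i - 2"
  have k: "k + 2 = i" "k + 2 \<le> m" "k \<ge> 2" using i by (auto simp: k_def)
  \<comment> \<open>Only rows 1 to i - 2 of column i are solved for; the entry in row i - 1 is left
    to the eta field.\<close>
  obtain c where c: "\<forall>j\<in>{1..k}. holo_germ m (c j)"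
    "near0 m (\<lambda>a. \<forall>r\<in>{1..k}. v a (r, i) = (\<Sum>j=1..k. c j a * Ahat a r j))"
    using derlog_column_solution[OF v k(2,3)] z unfolding k(1) by blast
  define J where "J = {i} \<times> {3..i}"
  define c' where "c' b = c (snd b - 2)" for b :: "nat \<times> nat"
  have J: "J \<subseteq> basis_index m" using i by (auto simp: J_def basis_index_def)
  have c'h: "holo_germ m (c' b)" if "b \<in> J" for b
    unfolding c'_def using that k by (intro c(1)[rule_format]) (auto simp: J_def)
  define w where "w = (\<lambda>a q. v a q - (\<Sum>b\<in>J. c' b a * basis_field m b a q))"
  have w: "w \<in> derlog m (hdiv m)" unfolding w_def by (rule derlog_diff[OF v c'h J])
  have sumJ: "(\<Sum>b\<in>J. c' b a * basis_field m b a (p, q)) = (if q = i then \<Sum>j=1..k. c j a * Ahat a p j else 0)"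
    if "(p, q) \<in> coords m" "q \<le> i" for a p q
  proof -
    have "(\<Sum>b\<in>J. c' b a * basis_field m b a (p, q)) = (\<Sum>b\<in>J. (if q = i then c (snd b - 2) a * matA a p (snd b) else 0))"
      by (rule sum.cong) (use that i in \<open>auto simp: J_def c'_def basis_field_column\<close>)
    also have "\<dots> = (\<Sum>j=1..k. (if q = i then c j a * Ahat a p j else 0))"
      unfolding J_def using sum_column[of i "\<lambda>n. if q = i then c (n - 2) a * matA a p n else 0"] i
      unfolding k_def by (simp only: add_diff_cancel_right')
    finally show ?thesis by simp
  qed
  have wz: "near0 m (\<lambda>a. (\<forall>p\<in>coords m. snd p < i \<longrightarrow> w a p = 0) \<and> (\<forall>r\<in>{1..i - 2}. w a (r, i) = 0))"
    using z c(2)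
  proof (rule near0_mp, intro conjI ballI impI)
    fix a p assume 1: "\<forall>p\<in>coords m. snd p < i \<longrightarrow> v a p = 0" and p: "p \<in> coords m" "snd p < i"
    then show "w a p = 0" using sumJ[of "fst p" "snd p" a] by (simp add: w_def)
  next
    fix a r assume 2: "\<forall>r\<in>{1..k}. v a (r, i) = (\<Sum>j=1..k. c j a * Ahat a r j)" and r: "r \<in> {1..i - 2}"
    then have "(r, i) \<in> coords m" using i by (auto simp: coords_def)
    then show "w a (r, i) = 0" using 2 r sumJ[of r i a] by (simp add: w_def k_def)
  qed
  obtain d where d: "holo_germ m d" "near0 m (\<lambda>a. w a (i - 1, i) = d a * Pfac i a)"
    using derlog_pfaffian_solution[OF w i(2)] wz i unfolding near0_conj by auto
  define u where "u = (\<lambda>a q. w a q - (\<Sum>b\<in>{(0, i - 2)}. d a * basis_field m b a q))"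
  have J': "{(0, i - 2)} \<subseteq> basis_index m" using i by (auto simp: basis_index_def)
  have u: "u \<in> derlog m (hdiv m)" unfolding u_def by (rule derlog_diff[OF w d(1) J'])
  have "near0 m (\<lambda>a. \<forall>p\<in>coords m. snd p < Suc i \<longrightarrow> u a p = 0)"
    using wz d(2)
  proof (rule near0_mp, intro ballI impI)
    fix a p assume 1: "(\<forall>p\<in>coords m. snd p < i \<longrightarrow> w a p = 0) \<and> (\<forall>r\<in>{1..i - 2}. w a (r, i) = 0)"
      and 2: "w a (i - 1, i) = d a * Pfac i a" and p: "p \<in> coords m" "snd p < Suc i"
    obtain r q where rq: "p = (r, q)" by (cases p)
    have u_eq: "u a (r, q) = w a (r, q) - d a * (if r = i - 1 \<and> q = i then Pfac i a else 0)"
      using eta_column[of r q m i a] p i unfolding u_def rq by (simp add: basis_field_def)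
    consider "q < i" | "q = i" "r \<in> {1..i - 2}" | "q = i" "r = i - 1"
      using p rq by (fastforce simp: coords_def)
    then show "u a p = 0"
      using 1 2 p unfolding u_eq rq by cases auto
  qed
  from IH[OF u this] have "u \<in> basis_span m" .
  then have "w \<in> basis_span m" unfolding u_def by (rule basis_span_of_diff) (use d J' in auto)
  then show ?thesis unfolding w_def by (rule basis_span_of_diff) (use c'h J in auto)
qed

section \<open>The first three columns\<close>

lemma vf_app_coord: "p \<in> coords m \<Longrightarrow> vf_app m v (\<lambda>a. a p) a = v a p"
  by (simp add: vf_app_def pdiff_coord if_distrib cong: if_cong)

lemma fac_small:
  "fac (Inr 2) = (\<lambda>a. a (1, 2))" "fac (Inl 1) = (\<lambda>a. a (1, 3))" "fac (Inr 3) = (\<lambda>a. a (2, 3))"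
proof -
  have S: "Slist 2 = [1, 2]" "Slist 3 = [2, 3]"
    using Slist_split[of 2] Slist_split[of 3] by (auto simp: Slist_def eps_def numeral_eq_Suc)
  show "fac (Inr 2) = (\<lambda>a. a (1, 2))" "fac (Inr 3) = (\<lambda>a. a (2, 3))"
    by (auto simp: fun_eq_iff Pfac_def S pf_Cons matA_def)
  have "Dfac (Suc 0) a = a (1, 3)" for a
  proof -
    have "(\<Sum>c = 1..1. Ahat a 1 c * cofk 1 (Ahat a) 1 c) = (if 1 = (1::nat) then detk 1 (Ahat a) else 0)"
      by (rule cofk_row) auto
    then show ?thesis using cofk_last[of 0 "Ahat a"] by (simp add: Dfac_def detk_def matA_def numeral_3_eq_3)
  qed
  then show "fac (Inl 1) = (\<lambda>a. a (1, 3))" by auto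
qed

definition small_index :: "(nat \<times> nat) set" where
  "small_index = {(1, 1), (2, 2), (3, 3)}"

lemma sum_small_index: "(\<Sum>b\<in>small_index. f b) = f (1, 1) + f (2, 2) + f (3, 3)" for f :: "nat \<times> nat \<Rightarrow> complex"
  by (simp add: small_index_def add.assoc)

lemma basis_field_small:
  assumes "(p, q) \<in> coords m" "i \<in> {1..m}"
  shows "basis_field m (i, i) a (p, q) = (if p = i \<or> q = i then a (p, q) else 0)"
  using assms by (auto simp: basis_field_def xi_elem coords_def matA_def)

lemma derlog_subset_basis_span:
  assumes m: "m \<ge> 3"
  shows "derlog m (hdiv m) \<subseteq> basis_span m"
proof
  fix v assume v: "v \<in> derlog m (hdiv m)"
  \<comment> \<open>Induction on the number of columns still to be cleared; beyond column m the
    field is zero near the origin.\<close>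
  have cols: "w \<in> basis_span m"
    if w: "w \<in> derlog m (hdiv m)" "near0 m (\<lambda>a. \<forall>p\<in>coords m. snd p < n \<longrightarrow> w a p = 0)" and n: "4 \<le> n" for w n
    using that
  proof (induction "Suc m - n" arbitrary: n w)
    case 0
    then have "near0 m (\<lambda>a. \<forall>p\<in>coords m. w a p = combination m (\<lambda>_ _. 0) a p)"
      by (intro near0_mono[OF \<open>near0 m (\<lambda>a. \<forall>p\<in>coords m. snd p < n \<longrightarrow> w a p = 0)\<close>])
         (auto simp: coords_def combination_def)
    then show ?case unfolding basis_span_def field_eq_def by (intro CollectI exI[of _ "\<lambda>_ _. 0"]) auto
  next
    case (Suc d)
    show ?case
    proof (rule derlog_elimination_step[OF Suc.prems(1,3) _ Suc.prems(2)])
      show "n \<le> m" using Suc.hyps(2) by simp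
      show "w' \<in> basis_span m" if "w' \<in> derlog m (hdiv m)"
        "near0 m (\<lambda>a. \<forall>p\<in>coords m. snd p < Suc n \<longrightarrow> w' a p = 0)" for w'
        by (rule Suc.hyps(1)[OF _ that]) (use Suc in auto)
    qed
  qed
  have co: "(1, 2) \<in> coords m" "(1, 3) \<in> coords m" "(2, 3) \<in> coords m" using m by (auto simp: coords_def)
  have f: "Inr 2 \<in> facs m" "Inl 1 \<in> facs m" "Inr 3 \<in> facs m" using m by (auto simp: facs_def)
  obtain la where l1: "holo_germ m la" "near0 m (\<lambda>a. v a (1, 2) = la a * a (1, 2))"
    using derlog_fac[OF v f(1)] unfolding fac_small vf_app_coord[OF co(1)] by blast
  obtain lb where l2: "holo_germ m lb" "near0 m (\<lambda>a. v a (1, 3) = lb a * a (1, 3))"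
    using derlog_fac[OF v f(2)] unfolding fac_small vf_app_coord[OF co(2)] by blast
  obtain lc where l3: "holo_germ m lc" "near0 m (\<lambda>a. v a (2, 3) = lc a * a (2, 3))"
    using derlog_fac[OF v f(3)] unfolding fac_small vf_app_coord[OF co(3)] by blast
  \<comment> \<open>The diagonal field of i multiplies the coordinates containing i by 1 and the
    others by 0. The coefficients solve c1 + c2 = \<open>la\<close>, c1 + c3 = \<open>lb\<close>, c2
    + c3 = \<open>lc\<close>.\<close>
  define c where "c b = (if b = (1::nat, 1::nat) then (\<lambda>a. 1/2 * (la a + lb a - lc a))
     else if b = (2, 2) then (\<lambda>a. 1/2 * (la a + lc a - lb a)) else (\<lambda>a. 1/2 * (lb a + lc a - la a)))" for b
  have ch: "holo_germ m (c b)" for b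
  proof -
    have "holo_germ m (\<lambda>a. 1/2 * (la a + lb a - lc a))" "holo_germ m (\<lambda>a. 1/2 * (la a + lc a - lb a))"
      "holo_germ m (\<lambda>a. 1/2 * (lb a + lc a - la a))"
      by (intro holo_germ_mult holo_germ_add holo_germ_diff holo_germ_const l1(1) l2(1) l3(1))+
    then show ?thesis by (auto simp: c_def)
  qed
  have J: "small_index \<subseteq> basis_index m" using m by (auto simp: small_index_def basis_index_def)
  define w where "w = (\<lambda>a q. v a q - (\<Sum>b\<in>small_index. c b a * basis_field m b a q))"
  have w: "w \<in> derlog m (hdiv m)" unfolding w_def by (rule derlog_diff[OF v ch J])
  have "near0 m (\<lambda>a. v a (1, 2) = la a * a (1, 2) \<and> v a (1, 3) = lb a * a (1, 3) \<and> v a (2, 3) = lc a * a (2, 3))"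
    using l1(2) l2(2) l3(2) by (simp add: near0_conj)
  then have "near0 m (\<lambda>a. \<forall>p\<in>coords m. snd p < 4 \<longrightarrow> w a p = 0)"
  proof (rule near0_mono, intro ballI impI)
    fix a p assume v: "v a (1, 2) = la a * a (1, 2) \<and> v a (1, 3) = lb a * a (1, 3) \<and> v a (2, 3) = lc a * a (2, 3)"
      and p: "p \<in> coords m" "snd p < 4"
    have "p = (1, 2) \<or> p = (1, 3) \<or> p = (2, 3)" using p by (cases p) (auto simp: coords_def)
    then show "w a p = 0"
      using v co m unfolding w_def sum_small_index
      by (elim disjE) (simp_all add: basis_field_small c_def field_simps)
  qed
  from cols[OF w this] have "w \<in> basis_span m" by simp
  then show "v \<in> basis_span m" unfolding w_def by (rule basis_span_of_diff) (use ch J in auto)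
qed

subsection \<open>Linear independence of the generators\<close>

text \<open>From 4 on, the first column in which the field can be nonzero. The diagonal fields of 1,
  2 and 3 share block 3, as the first two nonempty columns determine their coefficients only
  jointly.\<close>

definition block :: "nat \<times> nat \<Rightarrow> nat" where
  "block b = (if fst b = 0 then snd b + 2 else max (fst b) 3)"

lemma basis_field_below_block:
  assumes "(p, q) \<in> coords m" "b \<in> basis_index m" "q < block b" "block b \<ge> 4"
  shows "basis_field m b a (p, q) = 0"
  using assms
  by (cases b) (auto simp: basis_index_def block_def basis_field_def eta_def xi_elem coords_def split: if_splits)

text \<open>Induction on the block. Once the coefficients of smaller blocks vanish, column i
  involves only the fields of block i. Rows 1 to i - 2 do not meet the eta field, so pairing with
  cofactors gives \<open>Dfac (i - 2)\<close> times each matrix coefficient; row i - 1 then gives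
  \<open>Pfac i\<close> times the eta coefficient.\<close>

lemma basis_independent:
  assumes m: "m \<ge> 3" and c: "\<And>b. b \<in> basis_index m \<Longrightarrow> holo_germ m (c b)"
    and z: "field_eq m (combination m c) (\<lambda>a q. 0)"
  shows "b \<in> basis_index m \<Longrightarrow> near0 m (\<lambda>a. c b a = 0)"
proof (induction "block b" arbitrary: b rule: less_induct)
  case less
  define i where "i = block b"
  have "near0 m (\<lambda>a. \<forall>b'\<in>{b'\<in>basis_index m. block b' < i}. c b' a = 0)"
    by (rule near0_ball_finite) (use less.hyps i_def in auto)
  then have "near0 m (\<lambda>a. \<forall>b'\<in>basis_index m. block b' < i \<longrightarrow> c b' a = 0)"
    by (rule near0_mono) blast
  with z have zz: "near0 m (\<lambda>a. (\<forall>q\<in>coords m. combination m c a q = 0) \<and> (\<forall>b'\<in>basis_index m. block b' < i \<longrightarrow> c b' a = 0))"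
    by (simp add: near0_conj field_eq_def)
  have b: "b \<in> basis_index m" by (rule less.prems)
  show ?case
  proof (cases "i = 3")
    case True
    have J: "small_index \<subseteq> basis_index m" using m by (auto simp: small_index_def basis_index_def)
    have bs: "b \<in> small_index" using b True unfolding i_def
      by (cases b) (auto simp: block_def small_index_def basis_index_def split: if_splits)
    have comb: "combination m c a (p, q) = (\<Sum>b'\<in>small_index. c b' a * basis_field m b' a (p, q))"
      if "(p, q) \<in> coords m" "q \<le> 3" for a p q
      unfolding combination_def
    proof (rule sum.mono_neutral_right[OF finite_basis_index J])
      show "\<forall>b'\<in>basis_index m - small_index. c b' a * basis_field m b' a (p, q) = 0"
      proof
        fix b' assume b': "b' \<in> basis_index m - small_index"
        then have "block b' \<ge> 4"
          by (cases b') (auto simp: block_def small_index_def basis_index_def)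
        then have "basis_field m b' a (p, q) = 0" using b' that by (intro basis_field_below_block) auto
        then show "c b' a * basis_field m b' a (p, q) = 0" by simp
      qed
    qed
    have co: "(1, 2) \<in> coords m" "(1, 3) \<in> coords m" "(2, 3) \<in> coords m" using m by (auto simp: coords_def)
    have f: "Inr 2 \<in> facs m" "Inl 1 \<in> facs m" "Inr 3 \<in> facs m" using m by (auto simp: facs_def)
    have ch: "holo_germ m (c (1,1))" "holo_germ m (c (2,2))" "holo_germ m (c (3,3))"
      using c J by (auto simp: small_index_def)
    have "near0 m (\<lambda>a. c (1,1) a + c (2,2) a = 0)"
    proof (rule fac_cancel[OF f(1) holo_germ_add[OF ch(1,2)]])
      show "near0 m (\<lambda>a. fac (Inr 2) a * (c (1,1) a + c (2,2) a) = 0)"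
        using zz by (rule near0_mono)
          (use comb[OF co(1)] co m in \<open>auto simp: fac_small sum_small_index basis_field_small algebra_simps simp del: fac_simps\<close>)
    qed
    moreover have "near0 m (\<lambda>a. c (1,1) a + c (3,3) a = 0)"
    proof (rule fac_cancel[OF f(2) holo_germ_add[OF ch(1,3)]])
      show "near0 m (\<lambda>a. fac (Inl 1) a * (c (1,1) a + c (3,3) a) = 0)"
        using zz by (rule near0_mono)
          (use comb[OF co(2)] co m in \<open>auto simp: fac_small[unfolded One_nat_def] sum_small_index basis_field_small algebra_simps simp del: fac_simps\<close>)
    qed
    moreover have "near0 m (\<lambda>a. c (2,2) a + c (3,3) a = 0)"
    proof (rule fac_cancel[OF f(3) holo_germ_add[OF ch(2,3)]])
      show "near0 m (\<lambda>a. fac (Inr 3) a * (c (2,2) a + c (3,3) a) = 0)"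
        using zz by (rule near0_mono)
          (use comb[OF co(3)] co m in \<open>auto simp: fac_small sum_small_index basis_field_small algebra_simps simp del: fac_simps\<close>)
    qed
    ultimately have "near0 m (\<lambda>a. c (1,1) a + c (2,2) a = 0 \<and> c (1,1) a + c (3,3) a = 0 \<and> c (2,2) a + c (3,3) a = 0)"
      by (simp add: near0_conj)
    then show ?thesis
    proof (rule near0_mono)
      fix a assume *: "c (1,1) a + c (2,2) a = 0 \<and> c (1,1) a + c (3,3) a = 0 \<and> c (2,2) a + c (3,3) a = 0"
      moreover have "2 * c (1,1) a = (c (1,1) a + c (2,2) a) + (c (1,1) a + c (3,3) a) - (c (2,2) a + c (3,3) a)" by simp
      ultimately have "c (1,1) a = 0" by simp
      then show "c b a = 0" using * bs by (auto simp: small_index_def)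
    qed
  next
    case False
    then have i4: "i \<ge> 4" and im: "i \<le> m" using b m unfolding i_def
      by (cases b; auto simp: block_def basis_index_def split: if_splits)+
    define k where "k = i - 2"
    have k: "k + 2 = i" "k + 2 \<le> m" "k \<ge> 2" using i4 im by (auto simp: k_def)
    define J where "J = {i} \<times> {3..i}"
    have J: "insert (0, k) J \<subseteq> basis_index m" using i4 im by (auto simp: J_def k_def basis_index_def)
    have notin: "(0, k) \<notin> J" "finite J" using i4 by (auto simp: J_def)
    have bJ: "b \<in> insert (0, k) J" using b i4 unfolding i_def J_def k_def
      by (cases b) (auto simp: block_def basis_index_def split: if_splits)
    have comb: "combination m c a (p, i) = c (0, k) a * basis_field m (0, k) a (p, i) + (\<Sum>b'\<in>J. c b' a * basis_field m b' a (p, i))"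
      if "(p, i) \<in> coords m" "\<forall>b'\<in>basis_index m. block b' < i \<longrightarrow> c b' a = 0" for a p
    proof -
      have "combination m c a (p, i) = (\<Sum>b'\<in>insert (0, k) J. c b' a * basis_field m b' a (p, i))"
        unfolding combination_def
      proof (rule sum.mono_neutral_right[OF finite_basis_index J])
        show "\<forall>b'\<in>basis_index m - insert (0, k) J. c b' a * basis_field m b' a (p, i) = 0"
        proof
          fix b' assume b': "b' \<in> basis_index m - insert (0, k) J"
          then have "block b' \<noteq> i" using i4
            by (cases b') (auto simp: block_def J_def k_def basis_index_def)
          then consider "block b' < i" | "i < block b'" by linarith
          then show "c b' a * basis_field m b' a (p, i) = 0"
          proof cases
            case 1
            then show ?thesis using that b' by auto
          next
            case 2
            then show ?thesis using b' that i4 by (simp add: basis_field_below_block)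
          qed
        qed
      qed
      then show ?thesis using notin by simp
    qed
    have sumJ: "(\<Sum>b'\<in>J. c b' a * basis_field m b' a (p, i)) = (\<Sum>j=1..k. c (i, j + 2) a * Ahat a p j)"
      if "(p, i) \<in> coords m" for a p
    proof -
      have "(\<Sum>b'\<in>J. c b' a * basis_field m b' a (p, i)) = (\<Sum>b'\<in>J. c (i, snd b') a * matA a p (snd b'))"
        by (rule sum.cong) (use that i4 im in \<open>auto simp: J_def basis_field_column\<close>)
      also have "\<dots> = (\<Sum>j=1..k. c (i, j + 2) a * Ahat a p j)"
        unfolding J_def using sum_column[of i "\<lambda>n. c (i, n) a * matA a p n"] i4 by (simp add: k_def)
      finally show ?thesis .
    qed
    have et: "basis_field m (0, k) a (p, i) = (if p = i - 1 then Pfac i a else 0)" if "(p, i) \<in> coords m" for a p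
      using eta_column[OF that _ i4] by (simp add: basis_field_def k_def)
    have col: "near0 m (\<lambda>a. c (i, j + 2) a = 0)" if j: "j \<in> {1..k}" for j
    proof (rule fac_cancel[of "Inl k"])
      show "Inl k \<in> facs m" using k by (auto simp: facs_def)
      have "(i, j + 2) \<in> insert (0, k) J" using j k by (auto simp: J_def)
      then show "holo_germ m (c (i, j + 2))" using c J by blast
      show "near0 m (\<lambda>a. fac (Inl k) a * c (i, j + 2) a = 0)"
        using zz
      proof (rule near0_mono)
        fix a assume a: "(\<forall>q\<in>coords m. combination m c a q = 0) \<and> (\<forall>b'\<in>basis_index m. block b' < i \<longrightarrow> c b' a = 0)"
        have row: "(\<Sum>j=1..k. c (i, j + 2) a * Ahat a r j) = 0" if r: "r \<in> {1..k}" for r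
        proof -
          have ri: "(r, i) \<in> coords m" "r \<noteq> i - 1" using r k im by (auto simp: coords_def)
          then show ?thesis using a comb[OF ri(1), of a] sumJ[OF ri(1), of a] et[OF ri(1), of a] by simp
        qed
        have "0 = (\<Sum>r=1..k. (\<Sum>j'=1..k. c (i, j' + 2) a * Ahat a r j') * cofk k (Ahat a) r j)"
          using row by simp
        also have "\<dots> = (\<Sum>j'=1..k. c (i, j' + 2) a * (\<Sum>r=1..k. Ahat a r j' * cofk k (Ahat a) r j))"
          unfolding sum_distrib_left sum_distrib_right by (subst sum.swap) (simp add: mult.assoc)
        also have "\<dots> = (\<Sum>j'=1..k. if j' = j then c (i, j + 2) a * Dfac k a else 0)"
          using cofk_col[OF _ j, of _ "Ahat a"] by (intro sum.cong) (auto simp: Dfac_def)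
        also have "\<dots> = c (i, j + 2) a * Dfac k a" using j by simp
        finally show "fac (Inl k) a * c (i, j + 2) a = 0" by (simp add: mult.commute)
      qed
    qed
    have eta0: "near0 m (\<lambda>a. c (0, k) a = 0)"
    proof (rule fac_cancel[of "Inr i"])
      show "Inr i \<in> facs m" using i4 im by (auto simp: facs_def)
      show "holo_germ m (c (0, k))" using c J by blast
      have "near0 m (\<lambda>a. \<forall>j\<in>{1..k}. c (i, j + 2) a = 0)" by (rule near0_ball_finite) (use col in auto)
      with zz show "near0 m (\<lambda>a. fac (Inr i) a * c (0, k) a = 0)"
      proof (rule near0_mp)
        fix a assume a: "(\<forall>q\<in>coords m. combination m c a q = 0) \<and> (\<forall>b'\<in>basis_index m. block b' < i \<longrightarrow> c b' a = 0)"
          and c0: "\<forall>j\<in>{1..k}. c (i, j + 2) a = 0"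
        have ii: "(i - 1, i) \<in> coords m" using i4 im by (auto simp: coords_def)
        have "(\<Sum>j=1..k. c (i, j + 2) a * Ahat a (i - 1) j) = 0" using c0 by (intro sum.neutral) auto
        then show "fac (Inr i) a * c (0, k) a = 0"
          using a ii comb[OF ii, of a] sumJ[OF ii, of a] et[OF ii, of a] by (simp add: disj_commute)
      qed
    qed
    show ?thesis
    proof (cases "b = (0, k)")
      case True
      then show ?thesis using eta0 by simp
    next
      case False
      then obtain n where n: "b = (i, n)" "n \<in> {3..i}" using bJ by (auto simp: J_def)
      then have "n - 2 \<in> {1..k}" "n - 2 + 2 = n" using k by auto
      then show ?thesis using col[of "n - 2"] n by simp
    qed
  qed
qed

subsection \<open>Freeness and the free divisor\<close>

lemma Lm_eq_derlog: "m \<ge> 3 \<Longrightarrow> Lm m = derlog m (hdiv m)"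
  unfolding Lm_eq_basis_span using basis_span_subset_derlog derlog_subset_basis_span by blast

lemma derlog_lie_bracket:
  assumes v: "v \<in> derlog m h" and w: "w \<in> derlog m h"
  shows "lie_bracket m v w \<in> derlog m h"
proof -
  have hv: "holo_field m v" "holo_field m w" using v w by (auto simp: derlog_def)
  have hb: "holo_field m (lie_bracket m v w)" by (rule holo_field_bracket[OF hv])
  have "vf_app m (lie_bracket m v w) g \<in> vanish_ideal m h" if g: "g \<in> vanish_ideal m h" for g
  proof -
    have gh: "holo_germ m g" using g by (simp add: vanish_ideal_def)
    have "vf_app m v (vf_app m w g) \<in> vanish_ideal m h" "vf_app m w (vf_app m v g) \<in> vanish_ideal m h"
      using v w g by (auto simp: derlog_def)
    then have "near0 m (\<lambda>a. h a = 0 \<longrightarrow> vf_app m v (vf_app m w g) a = 0)"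
      "near0 m (\<lambda>a. h a = 0 \<longrightarrow> vf_app m w (vf_app m v g) a = 0)"
      by (auto simp: vanish_ideal_def)
    then have "near0 m (\<lambda>a. h a = 0 \<longrightarrow> vf_app m v (vf_app m w g) a - vf_app m w (vf_app m v g) a = 0)"
      by (rule near0_mp) simp
    then have "near0 m (\<lambda>a. h a = 0 \<longrightarrow> vf_app m (lie_bracket m v w) g a = 0)"
      using vf_app_bracket[OF hv gh] by (rule near0_mp) simp
    then show ?thesis using holo_germ_vf_app[OF hb gh] by (simp add: vanish_ideal_def)
  qed
  with hb show ?thesis by (simp add: derlog_def)
qed

text \<open>Closure is inherited from the logarithmic fields, so no bracket of two generators is
  computed.\<close>

lemma Lm_holo_lie_alg:
  assumes "m \<ge> 3"
  shows "holo_lie_alg m (Lm m)"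
  unfolding holo_lie_alg_def
proof (intro conjI exI ballI)
  show "finite (basis_field m ` basis_index m)" by simp
  show "holo_field m v" if "v \<in> basis_field m ` basis_index m" for v using that basis_field_holo by auto
  show "Lm m = gen_by m (basis_field m ` basis_index m)" by (simp only: Lm_eq_basis_span gen_by_basis)
  show "lie_bracket m v w \<in> Lm m" if "v \<in> Lm m" "w \<in> Lm m" for v w
    using that derlog_lie_bracket unfolding Lm_eq_derlog[OF assms] by blast
qed

text \<open>Passing from m to m + 1 adds the m - 1 fields of row m + 1 and the field eta_{m-1},
  hence m fields, as in the recursion of binomial coefficients.\<close>

lemma card_basis_index:
  assumes "m \<ge> 3"
  shows "card (basis_index m) = m choose 2"
  using assms
proof (induction m rule: nat_induct_at_least)
  case base
  have "basis_index 3 = {(1, 1), (2, 2), (3, 3)}" by (auto simp: basis_index_def)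
  then show ?case by (simp add: choose_two)
next
  case (Suc m)
  have "(i, j) \<in> basis_index (Suc m) \<longleftrightarrow> (i, j) \<in> basis_index m \<union> insert (0, m - 1) ({Suc m} \<times> {3..Suc m})" for i j
    using Suc.hyps unfolding basis_index_def by (cases "i = 0"; cases "i = Suc m") auto
  then have eq: "basis_index (Suc m) = basis_index m \<union> insert (0, m - 1) ({Suc m} \<times> {3..Suc m})" by auto
  have disj: "basis_index m \<inter> insert (0, m - 1) ({Suc m} \<times> {3..Suc m}) = {}"
    using Suc by (auto simp: basis_index_def)
  have "card (insert (0, m - 1) ({Suc m} \<times> {3..Suc m})) = m"
    using Suc.hyps by (subst card_insert_disjoint) auto
  then have "card (basis_index (Suc m)) = (m choose 2) + m"
    unfolding eq by (subst card_Un_disjoint[OF _ _ disj]) (auto simp: Suc.IH)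
  then show ?case by (simp add: numeral_2_eq_2)
qed

lemma Lm_free:
  assumes m: "m \<ge> 3"
  shows "free_of_rank m (Lm m) (m choose 2)"
proof -
  obtain \<beta> where "bij_betw \<beta> {0..<m choose 2} (basis_index m)"
    using ex_bij_betw_nat_finite[OF finite_basis_index, of m] card_basis_index[OF m] by auto
  then have \<beta>: "bij_betw \<beta> {..<m choose 2} (basis_index m)" by (simp add: atLeast0LessThan)
  then have im: "\<beta> ` {..<m choose 2} = basis_index m" by (simp add: bij_betw_def)
  have "\<forall>i<m choose 2. near0 m (\<lambda>a. h i a = 0)"
    if h: "\<forall>i<m choose 2. holo_germ m (h i)"
      and z: "field_eq m (\<lambda>a q. \<Sum>i<m choose 2. h i a * basis_field m (\<beta> i) a q) (\<lambda>a q. 0)" for h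
  proof (intro allI impI)
    define c where "c = (\<lambda>b. h (inv_into {..<m choose 2} \<beta> b))"
    have c\<beta>: "c (\<beta> i) = h i" if "i < m choose 2" for i
      using that bij_betw_inv_into_left[OF \<beta>] by (simp add: c_def)
    have ch: "holo_germ m (c b)" if "b \<in> basis_index m" for b
      using that h c\<beta> unfolding im[symmetric] by auto
    have "combination m c = (\<lambda>a q. \<Sum>i<m choose 2. h i a * basis_field m (\<beta> i) a q)"
      unfolding combination_def sum.reindex_bij_betw[OF \<beta>, symmetric] using c\<beta> by (intro ext sum.cong) auto
    then have z': "field_eq m (combination m c) (\<lambda>a q. 0)" using z by simp
    fix i assume i: "i < m choose 2"
    then have "\<beta> i \<in> basis_index m" using im by auto
    from basis_independent[OF m ch z' this] show "near0 m (\<lambda>a. h i a = 0)" using c\<beta>[OF i] by simp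
  qed
  moreover have "Lm m = gen_by m ((\<lambda>i. basis_field m (\<beta> i)) ` {..<m choose 2})"
    unfolding Lm_eq_basis_span gen_by_basis[symmetric] im[symmetric] image_image ..
  ultimately show ?thesis
    unfolding free_of_rank_def by (intro exI[of _ "\<lambda>i. basis_field m (\<beta> i)"]) (simp add: basis_field_holo)
qed

lemma hdiv_not_zero: "\<not> near0 m (\<lambda>a. hdiv m a = 0)"
proof -
  have "\<not> near0 m (\<lambda>a. (\<Prod>x\<in>I. fac x a) = 0)" if "finite I" "I \<subseteq> facs m" for I
    using that
  proof (induction rule: finite_induct)
    case empty
    then show ?case using near0_at_0 by fastforce
  next
    case (insert x I)
    have "holo_germ m (\<lambda>a. \<Prod>x\<in>I. fac x a)"
      using insert.prems by (intro pfun_holo_germ pfun_prod fac_pfun) auto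
    then have "near0 m (\<lambda>a. (\<Prod>x\<in>I. fac x a) = 0)" if "near0 m (\<lambda>a. fac x a * (\<Prod>x\<in>I. fac x a) = 0)"
      using fac_cancel[of x m "\<lambda>a. \<Prod>x\<in>I. fac x a"] that insert.prems by blast
    then show ?case using insert by auto
  qed
  from this[OF finite_facs subset_refl] show ?thesis unfolding hdiv_eq .
qed

lemma Lm_defines_free_divisor:
  assumes m: "m \<ge> 3"
  shows "defines_free_divisor m (Lm m) (hdiv m)"
proof -
  have "Inl 1 \<in> facs m" using m by (auto simp: facs_def)
  moreover have "fac (Inl 1) (\<lambda>_. 0) = 0" unfolding fac_small by simp
  ultimately have "hdiv m (\<lambda>_. 0) = 0" unfolding hdiv_zero_iff by blast
  then show ?thesis
    unfolding defines_free_divisor_def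
    using hdiv_holo hdiv_not_zero vanish_ideal_eq Lm_eq_derlog[OF m] Lm_free[OF m] by blast
qed

subsection \<open>The weight filtration and solvability\<close>

text \<open>Rescaling \<open>a\<^bsub>pq\<^esub>\<close> by \<open>(1/2) ^ ((m + 1 - p) + (m + 1 - q))\<close> multiplies each generator by \<open>1/2\<close> to the power
  of its weight, up to the rescaling of the components. So structure constants respect weights, which
  drives the derived series into the maximal ideal.\<close>

definition dil :: "nat \<Rightarrow> nat \<Rightarrow> complex" where
  "dil m i = (1/2) ^ (Suc m - i)"

definition dil_at :: "nat \<Rightarrow> nat \<times> nat \<Rightarrow> complex" where
  "dil_at m p = dil m (fst p) * dil m (snd p)"

definition dilate :: "nat \<Rightarrow> pt \<Rightarrow> pt" where
  "dilate m a = (\<lambda>p. dil_at m p * a p)"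

definition weight :: "nat \<Rightarrow> nat \<times> nat \<Rightarrow> nat" where
  "weight m b = (if fst b = 0 then \<Sum>x\<in>{eps (snd b)..snd b}. Suc m - x else fst b - snd b)"

lemma dil_at_nonzero [simp]: "dil_at m p \<noteq> 0"
  by (simp add: dil_at_def dil_def)

lemma norm_dil_at: "norm (dil_at m p) \<le> 1"
  by (simp add: dil_at_def dil_def norm_mult norm_power norm_divide mult_le_one power_le_one)

lemma dilate_0 [simp]: "dilate m (\<lambda>_. 0) = (\<lambda>_. 0)"
  by (simp add: dilate_def)

lemma matA_dilate: "matA (dilate m a) i j = dil m i * dil m j * matA a i j"
  by (simp add: matA_def dilate_def dil_at_def)

lemma near0_dilate:
  assumes "near0 m P"
  shows "near0 m (\<lambda>a. P (dilate m a))"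
proof -
  obtain r where r: "r > 0" "\<And>a. a \<in> polydisc (coords m) r \<Longrightarrow> P a" using assms unfolding near0_iff by blast
  show ?thesis
  proof (rule near0I[OF r(1)], rule r(2))
    fix a assume a: "a \<in> polydisc (coords m) r"
    have "norm (dilate m a p) \<le> norm (a p)" for p
      unfolding dilate_def norm_mult using norm_dil_at by (intro mult_left_le_one_le) auto
    then show "dilate m a \<in> polydisc (coords m) r"
      using a unfolding polydisc_def by (auto intro: le_less_trans)
  qed
qed

text \<open>For an elementary matrix an index i is replaced by j, which costs dil j / dil i. For eta
  the Pfaffian scales by the product over all its indices: p and q account for the component, the
  set S for the weight.\<close>

lemma basis_field_dilate:
  assumes b: "b \<in> basis_index m" and p: "p \<in> coords m"
  shows "basis_field m b (dilate m a) p = (1/2) ^ weight m b * dil_at m p * basis_field m b a p"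
proof -
  obtain i j u v where bij: "b = (i, j)" "p = (u, v)" by (cases b, cases p)
  show ?thesis
  proof (cases "i = 0")
    case True
    show ?thesis
    proof (cases "j < u")
      case F: False
      then show ?thesis using True unfolding bij by (simp add: basis_field_def eta_def)
    next
      case J: True
      have uv: "u < v" "v \<le> m" using p unfolding bij by (auto simp: coords_def)
      have "pf (matA (dilate m a)) (u # v # Slist j) = (\<Prod>x\<in>set (u # v # Slist j). dil m x) * pf (matA a) (u # v # Slist j)"
        unfolding matA_dilate[abs_def] by (rule pf_scale) (use J uv in auto)
      also have "(\<Prod>x\<in>set (u # v # Slist j). dil m x) = dil m u * (dil m v * (\<Prod>x\<in>{eps j..j}. dil m x))"
        using J uv by simp
      also have "(\<Prod>x\<in>{eps j..j}. dil m x) = (1/2) ^ weight m b"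
        using True unfolding bij weight_def dil_def by (simp add: power_sum)
      finally show ?thesis
        using True J uv PfS_insert_two[OF J uv(1)] unfolding bij
        by (simp add: basis_field_def eta_def dil_at_def)
    qed
  next
    case False
    then have ij: "1 \<le> j" "j \<le> i" "i \<le> m" using b unfolding bij by (auto simp: basis_index_def)
    have "dil m j = (1/2) ^ (i - j) * dil m i"
      unfolding dil_def power_add[symmetric] using ij by simp
    moreover have "j \<in> {1..m}" using ij by auto
    ultimately show ?thesis
      using False unfolding bij
      by (simp add: basis_field_def xi_elem matA_dilate weight_def dil_at_def algebra_simps)
  qed
qed

text \<open>The dilation fixes the origin, so the value there equals itself times a number of norm
  below 1.\<close>

lemma basis_field_at_0:
  assumes b: "b \<in> basis_index m" and p: "p \<in> coords m"
  shows "basis_field m b (\<lambda>_. 0) p = 0"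
proof -
  let ?k = "weight m b + ((Suc m - fst p) + (Suc m - snd p))"
  have "basis_field m b (\<lambda>_. 0) p = (1/2) ^ ?k * basis_field m b (\<lambda>_. 0) p"
    using basis_field_dilate[OF assms, of "\<lambda>_. 0"] by (simp add: dil_at_def dil_def power_add mult.assoc)
  moreover have "norm ((1/2 :: complex) ^ ?k) < 1"
    unfolding norm_power using p by (intro power_less_one_iff[THEN iffD2]) (auto simp: coords_def norm_divide)
  then have "(1/2 :: complex) ^ ?k \<noteq> 1" by force
  ultimately show ?thesis by simp
qed

lemma vf_app_dilate:
  assumes b: "b \<in> basis_index m" and f: "pfun (coords m) f" and h: "\<And>a. f (dilate m a) = \<kappa> * f a"
  shows "vf_app m (basis_field m b) f (dilate m a) = (1/2) ^ weight m b * \<kappa> * vf_app m (basis_field m b) f a"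
proof -
  have d: "dil_at m p * pdiff p f (dilate m a) = \<kappa> * pdiff p f a" if p: "p \<in> coords m" for p
  proof -
    have upd: "dilate m (a(p := t)) = (dilate m a)(p := dil_at m p * t)" for t
      by (auto simp: dilate_def)
    have 1: "((\<lambda>t. f ((dilate m a)(p := t))) has_field_derivative pdiff p f (dilate m a)) (at (dil_at m p * a p))"
      using pfun_has_derivative[OF f p, of "dilate m a"] by (simp add: dilate_def)
    have 2: "((\<lambda>t. dil_at m p * t) has_field_derivative dil_at m p) (at (a p))"
      by (auto intro!: derivative_eq_intros)
    have "((\<lambda>t. f ((dilate m a)(p := dil_at m p * t))) has_field_derivative pdiff p f (dilate m a) * dil_at m p) (at (a p))"
      using DERIV_chain2[OF 1 2] .
    then have "((\<lambda>t. \<kappa> * f (a(p := t))) has_field_derivative pdiff p f (dilate m a) * dil_at m p) (at (a p))"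
      unfolding upd[symmetric] h .
    moreover have "((\<lambda>t. \<kappa> * f (a(p := t))) has_field_derivative \<kappa> * pdiff p f a) (at (a p))"
      by (rule DERIV_cmult[OF pfun_has_derivative[OF f p]])
    ultimately show ?thesis using DERIV_unique by (metis mult.commute)
  qed
  have "basis_field m b (dilate m a) p * pdiff p f (dilate m a) =
    (1/2) ^ weight m b * \<kappa> * (basis_field m b a p * pdiff p f a)" if p: "p \<in> coords m" for p
  proof -
    have "basis_field m b (dilate m a) p * pdiff p f (dilate m a)
        = (1/2) ^ weight m b * basis_field m b a p * (dil_at m p * pdiff p f (dilate m a))"
      unfolding basis_field_dilate[OF b p] by (simp only: mult_ac)
    then show ?thesis unfolding d[OF p] by (simp only: mult_ac)
  qed
  then show ?thesis unfolding vf_app_def sum_distrib_left by (intro sum.cong) auto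
qed

lemma lie_bracket_dilate:
  assumes b: "b \<in> basis_index m" "b' \<in> basis_index m" and q: "q \<in> coords m"
  shows "lie_bracket m (basis_field m b) (basis_field m b') (dilate m a) q =
    (1/2) ^ (weight m b + weight m b') * dil_at m q * lie_bracket m (basis_field m b) (basis_field m b') a q"
proof -
  have *: "vf_app m (basis_field m x) (\<lambda>c. basis_field m y c q) (dilate m a) =
     (1/2) ^ weight m x * ((1/2) ^ weight m y * dil_at m q) * vf_app m (basis_field m x) (\<lambda>c. basis_field m y c q) a"
    if "x \<in> basis_index m" "y \<in> basis_index m" for x y
    by (rule vf_app_dilate[OF that(1) basis_field_pfun[OF q] basis_field_dilate[OF that(2) q]])
  show ?thesis
    unfolding lie_bracket_def *[OF b] *[OF b(2,1)] by (simp add: power_add algebra_simps)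
qed

lemma weight_0_iff:
  assumes b: "b \<in> basis_index m"
  shows "weight m b = 0 \<longleftrightarrow> fst b = snd b"
proof (cases "fst b = 0")
  case True
  then have "snd b \<in> {2..m-2}" using b by (auto simp: basis_index_def)
  then have "\<exists>x\<in>{eps (snd b)..snd b}. Suc m - x \<noteq> 0"
    using eps_bounds[of "snd b"] by (intro bexI[of _ "snd b"]) auto
  then have "weight m b \<noteq> 0" using True by (simp add: weight_def)
  then show ?thesis using True \<open>snd b \<in> {2..m-2}\<close> by auto
next
  case False
  then show ?thesis using b by (auto simp: basis_index_def weight_def)
qed

text \<open>Generators of weight 0 are diagonal: they multiply each coordinate by a constant, so
  they commute.\<close>

lemma lie_bracket_weight_0:
  assumes b: "b \<in> basis_index m" "b' \<in> basis_index m" and w: "weight m b = 0" "weight m b' = 0" and q: "q \<in> coords m"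
  shows "lie_bracket m (basis_field m b) (basis_field m b') a q = 0"
proof -
  have d: "\<exists>i\<in>{1..m}. x = (i, i)" if "x \<in> basis_index m" "weight m x = 0" for x
    using that weight_0_iff[OF that(1)] by (cases x) (auto simp: basis_index_def)
  have bf: "basis_field m (i, i) a q = (if fst q = i \<or> snd q = i then a q else 0)" if "i \<in> {1..m}" for i a
    using basis_field_small[of "fst q" "snd q" m i a] q that by simp
  have app: "vf_app m v (\<lambda>c. basis_field m (i, i) c q) a = (if fst q = i \<or> snd q = i then v a q else 0)"
    if "i \<in> {1..m}" for v i
    unfolding bf[OF that] by (simp add: vf_app_coord[OF q] vf_app_def[of m v "\<lambda>_. 0"] pdiff_const)
  obtain i j where ij: "i \<in> {1..m}" "b = (i, i)" "j \<in> {1..m}" "b' = (j, j)" using d b w by meson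
  show ?thesis
    unfolding lie_bracket_def ij(2,4) unfolding app[OF ij(1)] app[OF ij(3)] unfolding bf[OF ij(1)] bf[OF ij(3)] by simp
qed

text \<open>Comparing the expansion of the bracket at a and at its dilation, independence forces
  each coefficient to transform by the difference of weights. At the fixed point 0 a nonzero
  coefficient is possible only when the weights agree. Weight 0 is excluded because then the
  bracket, and with it every coefficient, vanishes.\<close>

lemma lie_bracket_basis:
  assumes m: "m \<ge> 3" and b: "b \<in> basis_index m" "b' \<in> basis_index m"
  shows "\<exists>c. (\<forall>l\<in>basis_index m. holo_germ m (c l) \<and>
      (c l (\<lambda>_. 0) \<noteq> 0 \<longrightarrow> weight m l = weight m b + weight m b' \<and> weight m l > 0)) \<and>
    field_eq m (lie_bracket m (basis_field m b) (basis_field m b')) (combination m c)"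
proof -
  let ?B = "lie_bracket m (basis_field m b) (basis_field m b')"
  have "?B \<in> Lm m"
    using Lm_holo_lie_alg[OF m] b basis_span_basis unfolding holo_lie_alg_def Lm_eq_basis_span by blast
  then obtain c where c: "\<And>l. l \<in> basis_index m \<Longrightarrow> holo_germ m (c l)" and e: "field_eq m ?B (combination m c)"
    unfolding Lm_eq_basis_span basis_span_def by blast
  have "weight m l = weight m b + weight m b' \<and> weight m l > 0"
    if l: "l \<in> basis_index m" and nz: "c l (\<lambda>_. 0) \<noteq> 0" for l
  proof
    define c' where "c' = (\<lambda>l a. c l (dilate m a) * (1/2) ^ weight m l - (1/2) ^ (weight m b + weight m b') * c l a)"
    have c'h: "holo_germ m (c' l)" if "l \<in> basis_index m" for l
      unfolding c'_def
      by (intro holo_germ_diff holo_germ_mult holo_germ_const c that)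
         (use holo_germ_scale[OF c[OF that], of "dil_at m"] norm_dil_at in \<open>simp add: dilate_def\<close>)
    have "field_eq m (combination m c') (\<lambda>a q. 0)"
      unfolding field_eq_def using e[unfolded field_eq_def] near0_dilate[OF e[unfolded field_eq_def]]
    proof (rule near0_mp, intro ballI)
      fix a q assume 1: "\<forall>p\<in>coords m. ?B a p = combination m c a p"
        and 2: "\<forall>p\<in>coords m. ?B (dilate m a) p = combination m c (dilate m a) p" and q: "q \<in> coords m"
      have "dil_at m q * combination m c' a q = combination m c (dilate m a) q
          - (1/2) ^ (weight m b + weight m b') * dil_at m q * combination m c a q"
        unfolding combination_def c'_def sum_distrib_left sum_subtractf[symmetric]
        by (intro sum.cong) (auto simp: basis_field_dilate[OF _ q] algebra_simps)
      also have "\<dots> = 0" using bspec[OF 1 q] bspec[OF 2 q] lie_bracket_dilate[OF b q, of a] by simp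
      finally show "combination m c' a q = 0" by simp
    qed
    from basis_independent[OF m c'h this l] have "near0 m (\<lambda>a. c' l a = 0)" .
    from near0_at_0[OF this] have "(1/2 :: complex) ^ weight m l = (1/2) ^ (weight m b + weight m b')"
      using nz by (simp add: c'_def mult.commute)
    then have "(2 :: complex) ^ weight m l = 2 ^ (weight m b + weight m b')" by (simp add: power_divide)
    then have "of_nat (2 ^ weight m l) = (of_nat (2 ^ (weight m b + weight m b')) :: complex)" by simp
    then have "(2::nat) ^ weight m l = 2 ^ (weight m b + weight m b')" using of_nat_eq_iff by blast
    then show eq: "weight m l = weight m b + weight m b'" by simp
    show "weight m l > 0"
    proof (rule ccontr)
      assume "\<not> weight m l > 0"
      then have "weight m b = 0" "weight m b' = 0" using eq by auto
      then have "field_eq m (combination m c) (\<lambda>a q. 0)"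
        using e lie_bracket_weight_0[OF b] unfolding field_eq_def by (auto elim!: near0_mono)
      from near0_at_0[OF basis_independent[OF m c this l]] nz show False by simp
    qed
  qed
  with c e show ?thesis by blast
qed

text \<open>Coefficients that are units may occur only at generators of weight at least k.\<close>

definition weight_filtration :: "nat \<Rightarrow> nat \<Rightarrow> vfield set" where
  "weight_filtration m k = basis_span_vanishing m {b. weight m b < k}"

lemma lie_bracket_combination:
  assumes f: "\<forall>b\<in>basis_index m. holo_germ m (f b)" and g: "\<forall>b\<in>basis_index m. holo_germ m (g b)"
    and v: "field_eq m v (combination m f)" and w: "field_eq m w (combination m g)"
  shows "near0 m (\<lambda>a. \<forall>q\<in>coords m. vf_app m v (\<lambda>c. w c q) a =
     (\<Sum>b\<in>basis_index m. vf_app m v (g b) a * basis_field m b a q) +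
     (\<Sum>b\<in>basis_index m. \<Sum>b'\<in>basis_index m. f b a * g b' a * vf_app m (basis_field m b) (\<lambda>c. basis_field m b' c q) a))"
proof (rule near0_ball_finite)
  fix q assume q: "q \<in> coords m"
  have Bh: "holo_germ m (\<lambda>a. basis_field m b a q)" for b
    using basis_field_holo q unfolding holo_field_def by blast
  have 0: "near0 m (\<lambda>a. vf_app m v (\<lambda>c. w c q) a = vf_app m v (\<lambda>c. combination m g c q) a)"
    by (rule vf_app_cong) (use w q in \<open>auto simp: field_eq_def elim: near0_mono\<close>)
  have 1: "near0 m (\<lambda>a. vf_app m v (\<lambda>c. combination m g c q) a =
      (\<Sum>b\<in>basis_index m. vf_app m v (\<lambda>a. g b a * basis_field m b a q) a))"
    unfolding combination_def by (rule vf_app_sum) (auto intro!: holo_germ_mult g[rule_format] Bh)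
  have 2: "near0 m (\<lambda>a. \<forall>b\<in>basis_index m. vf_app m v (\<lambda>a. g b a * basis_field m b a q) a =
      g b a * vf_app m v (\<lambda>a. basis_field m b a q) a + basis_field m b a q * vf_app m v (g b) a)"
    by (rule near0_ball_finite) (auto intro!: vf_app_mult g[rule_format] Bh)
  have 3: "near0 m (\<lambda>a. \<forall>F. vf_app m v F a = (\<Sum>b\<in>basis_index m. f b a * vf_app m (basis_field m b) F a))"
    using vf_app_field_cong[OF v] unfolding combination_def vf_app_comb .
  have "near0 m (\<lambda>a. vf_app m v (\<lambda>c. w c q) a = (\<Sum>b\<in>basis_index m. g b a * vf_app m v (\<lambda>a. basis_field m b a q) a + basis_field m b a q * vf_app m v (g b) a))"
    using near0_conj[THEN iffD2, OF conjI[OF 0 1]] 2 by (rule near0_mp) simp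
  then show "near0 m (\<lambda>a. vf_app m v (\<lambda>c. w c q) a =
     (\<Sum>b\<in>basis_index m. vf_app m v (g b) a * basis_field m b a q) +
     (\<Sum>b\<in>basis_index m. \<Sum>b'\<in>basis_index m. f b a * g b' a * vf_app m (basis_field m b) (\<lambda>c. basis_field m b' c q) a))"
    using 3
  proof (rule near0_mp)
    fix a
    assume A: "vf_app m v (\<lambda>c. w c q) a = (\<Sum>b\<in>basis_index m. g b a * vf_app m v (\<lambda>a. basis_field m b a q) a + basis_field m b a q * vf_app m v (g b) a)"
      and B: "\<forall>F. vf_app m v F a = (\<Sum>b\<in>basis_index m. f b a * vf_app m (basis_field m b) F a)"
    have "(\<Sum>b'\<in>basis_index m. g b' a * vf_app m v (\<lambda>a. basis_field m b' a q) a) =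
       (\<Sum>b'\<in>basis_index m. \<Sum>b\<in>basis_index m. f b a * g b' a * vf_app m (basis_field m b) (\<lambda>c. basis_field m b' c q) a)"
      unfolding B[THEN spec[of _ "\<lambda>c. basis_field m _ c q"]] sum_distrib_left by (intro sum.cong) (auto simp: mult_ac)
    also have "\<dots> = (\<Sum>b\<in>basis_index m. \<Sum>b'\<in>basis_index m. f b a * g b' a * vf_app m (basis_field m b) (\<lambda>c. basis_field m b' c q) a)"
      by (rule sum.swap)
    finally show "vf_app m v (\<lambda>c. w c q) a =
     (\<Sum>b\<in>basis_index m. vf_app m v (g b) a * basis_field m b a q) +
     (\<Sum>b\<in>basis_index m. \<Sum>b'\<in>basis_index m. f b a * g b' a * vf_app m (basis_field m b) (\<lambda>c. basis_field m b' c q) a)"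
      unfolding A sum.distrib by (simp add: mult.commute)
  qed
qed simp

text \<open>Terms in which a field differentiates a coefficient vanish at 0, since the field does.
  In the other terms a nonzero value at 0 requires both generators to have weight at least k and the
  result to have their sum, which is positive. This is at least 2 k and at least 1, hence at least k
  + 1.\<close>

lemma lie_bracket_filtration:
  assumes m: "m \<ge> 3" and v: "v \<in> weight_filtration m k" and w: "w \<in> weight_filtration m k"
  shows "lie_bracket m v w \<in> weight_filtration m (Suc k)"
proof -
  let ?I = "basis_index m"
  obtain f where f: "\<And>b. b \<in> ?I \<Longrightarrow> holo_germ m (f b)" "\<And>b. b \<in> ?I \<Longrightarrow> f b (\<lambda>_. 0) \<noteq> 0 \<Longrightarrow> weight m b \<ge> k"
    "field_eq m v (combination m f)"
    using v unfolding weight_filtration_def basis_span_vanishing_def by (auto simp: not_less[symmetric])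
  obtain g where g: "\<And>b. b \<in> ?I \<Longrightarrow> holo_germ m (g b)" "\<And>b. b \<in> ?I \<Longrightarrow> g b (\<lambda>_. 0) \<noteq> 0 \<Longrightarrow> weight m b \<ge> k"
    "field_eq m w (combination m g)"
    using w unfolding weight_filtration_def basis_span_vanishing_def by (auto simp: not_less[symmetric])
  have "\<forall>x\<in>?I \<times> ?I. \<exists>c. (\<forall>l\<in>?I. holo_germ m (c l) \<and>
      (c l (\<lambda>_. 0) \<noteq> 0 \<longrightarrow> weight m l = weight m (fst x) + weight m (snd x) \<and> weight m l > 0)) \<and>
    field_eq m (lie_bracket m (basis_field m (fst x)) (basis_field m (snd x))) (combination m c)"
    using lie_bracket_basis[OF m] by auto
  from bchoice[OF this] obtain C where C: "\<And>b b' l. b \<in> ?I \<Longrightarrow> b' \<in> ?I \<Longrightarrow> l \<in> ?I \<Longrightarrow> holo_germ m (C (b, b') l)"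
    "\<And>b b' l. b \<in> ?I \<Longrightarrow> b' \<in> ?I \<Longrightarrow> l \<in> ?I \<Longrightarrow> C (b, b') l (\<lambda>_. 0) \<noteq> 0 \<Longrightarrow> weight m l = weight m b + weight m b' \<and> weight m l > 0"
    "\<And>b b'. b \<in> ?I \<Longrightarrow> b' \<in> ?I \<Longrightarrow> field_eq m (lie_bracket m (basis_field m b) (basis_field m b')) (combination m (C (b, b')))"
    by (simp add: mem_Times_iff) blast
  define c where "c = (\<lambda>l a. vf_app m v (g l) a - vf_app m w (f l) a + (\<Sum>b\<in>?I. \<Sum>b'\<in>?I. f b a * g b' a * C (b, b') l a))"
  have hol: "holo_field m u" if "u \<in> weight_filtration m k" for u
    using that basis_span_vanishing_subset basis_span_subset_derlog
    unfolding weight_filtration_def derlog_def by blast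
  have ch: "holo_germ m (c l)" if "l \<in> ?I" for l
    unfolding c_def
    by (intro holo_germ_add holo_germ_diff holo_germ_vf_app hol v w f(1) g(1) that holo_germ_sum holo_germ_mult C(1))
  have at0: "u (\<lambda>_. 0) p = 0" if "field_eq m u (combination m h)" "p \<in> coords m" for u h p
    using near0_at_0[OF that(1)[unfolded field_eq_def]] that(2) by (simp add: combination_def basis_field_at_0)
  have c0: "c l (\<lambda>_. 0) = 0" if l: "l \<in> ?I" "weight m l < Suc k" for l
  proof -
    have "vf_app m v (g l) (\<lambda>_. 0) = 0" "vf_app m w (f l) (\<lambda>_. 0) = 0"
      using at0[OF f(3)] at0[OF g(3)] by (simp_all add: vf_app_def)
    moreover have "f b (\<lambda>_. 0) * g b' (\<lambda>_. 0) * C (b, b') l (\<lambda>_. 0) = 0" if "b \<in> ?I" "b' \<in> ?I" for b b'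
      using f(2)[OF that(1)] g(2)[OF that(2)] C(2)[OF that l(1)] l(2) by force
    then have "(\<Sum>b\<in>?I. \<Sum>b'\<in>?I. f b (\<lambda>_. 0) * g b' (\<lambda>_. 0) * C (b, b') l (\<lambda>_. 0)) = 0"
      by (intro sum.neutral ballI)
    ultimately show ?thesis by (simp add: c_def)
  qed
  have near_C: "near0 m (\<lambda>a. \<forall>x\<in>?I \<times> ?I. \<forall>q\<in>coords m. lie_bracket m (basis_field m (fst x)) (basis_field m (snd x)) a q = combination m (C x) a q)"
  proof (rule near0_ball_finite)
    fix x assume "x \<in> ?I \<times> ?I"
    then show "near0 m (\<lambda>a. \<forall>q\<in>coords m. lie_bracket m (basis_field m (fst x)) (basis_field m (snd x)) a q = combination m (C x) a q)"
      using C(3)[of "fst x" "snd x"] unfolding field_eq_def by (simp add: mem_Times_iff)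
  qed simp
  have f': "\<forall>b\<in>?I. holo_germ m (f b)" and g': "\<forall>b\<in>?I. holo_germ m (g b)" using f(1) g(1) by blast+
  have "near0 m (\<lambda>a. \<forall>q\<in>coords m. lie_bracket m v w a q = combination m c a q)"
    using near0_conj[THEN iffD2, OF conjI[OF lie_bracket_combination[OF f' g' f(3) g(3)]
      lie_bracket_combination[OF g' f' g(3) f(3)]]] near_C
  proof (rule near0_mp, intro ballI)
    fix a q
    let ?V = "\<lambda>b b'. vf_app m (basis_field m b) (\<lambda>c. basis_field m b' c q) a"
    assume A: "(\<forall>q\<in>coords m. vf_app m v (\<lambda>c. w c q) a =
        (\<Sum>b\<in>?I. vf_app m v (g b) a * basis_field m b a q) +
        (\<Sum>b\<in>?I. \<Sum>b'\<in>?I. f b a * g b' a * vf_app m (basis_field m b) (\<lambda>c. basis_field m b' c q) a)) \<and>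
      (\<forall>q\<in>coords m. vf_app m w (\<lambda>c. v c q) a =
        (\<Sum>b\<in>?I. vf_app m w (f b) a * basis_field m b a q) +
        (\<Sum>b\<in>?I. \<Sum>b'\<in>?I. g b a * f b' a * vf_app m (basis_field m b) (\<lambda>c. basis_field m b' c q) a))"
      and B: "\<forall>x\<in>?I \<times> ?I. \<forall>q\<in>coords m. lie_bracket m (basis_field m (fst x)) (basis_field m (snd x)) a q = combination m (C x) a q"
      and q: "q \<in> coords m"
    have swap3: "(\<Sum>b\<in>?I. \<Sum>b'\<in>?I. \<Sum>l\<in>?I. F b b' l) = (\<Sum>l\<in>?I. \<Sum>b\<in>?I. \<Sum>b'\<in>?I. F b b' l)"
      for F :: "nat \<times> nat \<Rightarrow> nat \<times> nat \<Rightarrow> nat \<times> nat \<Rightarrow> complex"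
    proof -
      have "(\<Sum>b\<in>?I. \<Sum>b'\<in>?I. \<Sum>l\<in>?I. F b b' l) = (\<Sum>b\<in>?I. \<Sum>l\<in>?I. \<Sum>b'\<in>?I. F b b' l)"
        by (intro sum.cong refl sum.swap)
      also have "\<dots> = (\<Sum>l\<in>?I. \<Sum>b\<in>?I. \<Sum>b'\<in>?I. F b b' l)" by (rule sum.swap)
      finally show ?thesis .
    qed
    have "(\<Sum>b\<in>?I. \<Sum>b'\<in>?I. g b a * f b' a * ?V b b') = (\<Sum>b\<in>?I. \<Sum>b'\<in>?I. f b a * g b' a * ?V b' b)"
      by (subst sum.swap) (simp add: mult_ac)
    then have "(\<Sum>b\<in>?I. \<Sum>b'\<in>?I. f b a * g b' a * ?V b b') - (\<Sum>b\<in>?I. \<Sum>b'\<in>?I. g b a * f b' a * ?V b b')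
      = (\<Sum>b\<in>?I. \<Sum>b'\<in>?I. f b a * g b' a * (?V b b' - ?V b' b))"
      by (simp add: sum_subtractf right_diff_distrib)
    also have "\<dots> = (\<Sum>b\<in>?I. \<Sum>b'\<in>?I. f b a * g b' a * combination m (C (b, b')) a q)"
      using B q by (intro sum.cong) (auto simp: lie_bracket_def)
    also have "\<dots> = (\<Sum>l\<in>?I. (\<Sum>b\<in>?I. \<Sum>b'\<in>?I. f b a * g b' a * C (b, b') l a) * basis_field m l a q)"
      unfolding combination_def sum_distrib_left sum_distrib_right
      by (rule trans[OF swap3]) (simp only: mult.assoc)
    finally show "lie_bracket m v w a q = combination m c a q"
      using A q by (simp add: lie_bracket_def combination_def c_def distrib_right left_diff_distrib sum.distrib sum_subtractf)
  qed
  then have "field_eq m (lie_bracket m v w) (combination m c)" by (simp add: field_eq_def)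
  then show ?thesis
    unfolding weight_filtration_def basis_span_vanishing_def using ch c0 by blast
qed

lemma derived_subset_filtration:
  assumes m: "m \<ge> 3"
  shows "derived m (Lm m) k \<subseteq> weight_filtration m k"
proof (induction k)
  case 0
  then show ?case by (simp add: weight_filtration_def basis_span_vanishing_empty Lm_eq_basis_span)
next
  case (Suc k)
  have "{lie_bracket m v w |v w. v \<in> derived m (Lm m) k \<and> w \<in> derived m (Lm m) k} \<subseteq> weight_filtration m (Suc k)"
    using lie_bracket_filtration[OF m] Suc.IH by blast
  then show ?case unfolding weight_filtration_def derived.simps by (rule gen_by_subset_span_vanishing)
qed

lemma basis_span_vanishing_all: "basis_span_vanishing m (basis_index m) \<subseteq> max_ideal_mult m (basis_span m)"
proof
  fix v assume "v \<in> basis_span_vanishing m (basis_index m)"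
  then obtain c where c: "\<And>b. b \<in> basis_index m \<Longrightarrow> holo_germ m (c b)" "\<And>b. b \<in> basis_index m \<Longrightarrow> c b (\<lambda>_. 0) = 0"
    and v: "field_eq m v (combination m c)"
    unfolding basis_span_vanishing_def by blast
  define h where "h \<zeta> a = (\<Sum>b | b \<in> basis_index m \<and> basis_field m b = \<zeta>. c b a)" for \<zeta> a
  have "combination m c = (\<lambda>a q. \<Sum>\<zeta>\<in>basis_field m ` basis_index m. h \<zeta> a * \<zeta> a q)"
    unfolding combination_def h_def by (intro ext sum_image_fibers[symmetric]) simp
  moreover have "holo_germ m (h \<zeta>) \<and> h \<zeta> (\<lambda>_. 0) = 0" for \<zeta>
    unfolding h_def[abs_def] using c by (auto intro!: holo_germ_sum)
  ultimately show "v \<in> max_ideal_mult m (basis_span m)"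
    unfolding max_ideal_mult_def using v basis_span_basis
    by (intro CollectI exI[of _ "basis_field m ` basis_index m"] exI[of _ h]) auto
qed

lemma Lm_solvable:
  assumes m: "m \<ge> 3"
  shows "solvable_hla m (Lm m)"
proof -
  \<comment> \<open>Chosen to exceed every weight, so that in step N of the filtration all
    coefficients vanish at the origin.\<close>
  define N where "N = Suc (\<Sum>b\<in>basis_index m. weight m b)"
  have "weight m b < N" if "b \<in> basis_index m" for b
    unfolding N_def using that by (intro le_imp_less_Suc member_le_sum) auto
  then have "weight_filtration m N \<subseteq> basis_span_vanishing m (basis_index m)"
    unfolding weight_filtration_def basis_span_vanishing_def by blast
  then have "derived m (Lm m) N \<subseteq> max_ideal_mult m (Lm m)"
    using derived_subset_filtration[OF m, of N] basis_span_vanishing_all[of m] unfolding Lm_eq_basis_span by blast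
  then show ?thesis using Lm_holo_lie_alg[OF m] unfolding solvable_hla_def by blast
qed

theorem theorem8p1:
  fixes m :: nat
  assumes "m \<ge> 3"
  shows "solvable_hla m (Lm m) \<and> free_of_rank m (Lm m) (m choose 2) \<and>
         defines_free_divisor m (Lm m) (hdiv m)"
  using Lm_solvable[OF assms] Lm_free[OF assms] Lm_defines_free_divisor[OF assms] by blast

end
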